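(* Let $F$ be one of the following potentials: (i) $F_{1,n}(s)=(1-e^{-s})^{2n}$ with $n\ge2$ an integer; (ii) $F_{2,n}(s)=\tanh^{2n}(s)$ with $n\ge2$ an integer; (iii) $F_{3,-}(s)=1-\cos s$; (iv) $F_{5,2}(s)=-s^4$; and let $f=F'$. Then, provided $\varepsilon>0$ is small enough, any global solution $(\phi,\partial_t\phi)\in C([0,\infty);H^1(\mathbb{R}^3)\times L^2(\mathbb{R}^3))$ with radially symmetric initial data of $$\partial_t^2\phi-\Delta\phi+f(\phi)=0$$ such that $\sup_{t\ge0}\|\phi(t)\|_{H^1\cap L^\infty}\le\varepsilon$ satisfies, for any $R>0$, $$\lim_{t\to\infty}\|(\phi,\partial_t\phi)(t)\|_{H^1\times L^2(B(0,R))}=0 .$$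
   Context: Here $\phi=\phi(t,x)$ is real valued, $x\in\mathbb{R}^3$, $\Delta$ is the Laplacian in $x$, and $B(0,R)\subset\mathbb{R}^3$ is the ball of radius $R$ centered at the origin. Radial data give radial solutions. *)

theory Defs
  imports "HOL-Analysis.Analysis" "HOL-Probability.Essential_Supremum"
begin

section \<open>Test functions\<close>

definition partial :: "'a::euclidean_space \<Rightarrow> ('a \<Rightarrow> real) \<Rightarrow> 'a \<Rightarrow> real" where
  "partial b u = (\<lambda>x. frechet_derivative u (at x) b)"

primrec Ck :: "nat \<Rightarrow> ('a::euclidean_space \<Rightarrow> real) \<Rightarrow> bool" where
  "Ck 0 u \<longleftrightarrow> continuous_on UNIV u"
| "Ck (Suc k) u \<longleftrightarrow> (\<forall>x. u differentiable (at x)) \<and> (\<forall>b\<in>Basis. Ck k (partial b u))"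

definition test_functions :: "'a::euclidean_space set \<Rightarrow> ('a \<Rightarrow> real) set" where
  "test_functions \<Omega> =
     {\<eta>. (\<forall>k. Ck k \<eta>) \<and> compact (closure {x. \<eta> x \<noteq> 0}) \<and> closure {x. \<eta> x \<noteq> 0} \<subseteq> \<Omega>}"

definition laplacian :: "('a::euclidean_space \<Rightarrow> real) \<Rightarrow> 'a \<Rightarrow> real" where
  "laplacian u = (\<lambda>x. \<Sum>b\<in>Basis. partial b (partial b u) x)"

section \<open>Function spaces on an open set\<close>

text \<open>
  Elements of the function spaces are represented by Borel functions; no identification of
  functions that agree almost everywhere is made, and all notions below except the pointwise
  values of \<open>weak_partial\<close> are invariant under changes on null sets.
\<close>

definition L2 :: "'a::euclidean_space set \<Rightarrow> ('a \<Rightarrow> real) set" where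
  "L2 \<Omega> = {u. set_borel_measurable lborel \<Omega> u \<and> set_integrable lborel \<Omega> (\<lambda>x. (u x)\<^sup>2)}"

definition L2_norm :: "'a::euclidean_space set \<Rightarrow> ('a \<Rightarrow> real) \<Rightarrow> real" where
  "L2_norm \<Omega> u = sqrt (LINT x:\<Omega>|lborel. (u x)\<^sup>2)"

definition has_weak_partial ::
  "'a::euclidean_space set \<Rightarrow> 'a \<Rightarrow> ('a \<Rightarrow> real) \<Rightarrow> ('a \<Rightarrow> real) \<Rightarrow> bool" where
  "has_weak_partial \<Omega> b u g \<longleftrightarrow>
     (\<forall>\<eta>\<in>test_functions \<Omega>.
        (LINT x:\<Omega>|lborel. u x * partial b \<eta> x) = - (LINT x:\<Omega>|lborel. g x * \<eta> x))"

definition weak_partial ::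
  "'a::euclidean_space set \<Rightarrow> 'a \<Rightarrow> ('a \<Rightarrow> real) \<Rightarrow> 'a \<Rightarrow> real" where
  "weak_partial \<Omega> b u = (SOME g. g \<in> L2 \<Omega> \<and> has_weak_partial \<Omega> b u g)"

definition H1 :: "'a::euclidean_space set \<Rightarrow> ('a \<Rightarrow> real) set" where
  "H1 \<Omega> = {u \<in> L2 \<Omega>. \<forall>b\<in>Basis. \<exists>g\<in>L2 \<Omega>. has_weak_partial \<Omega> b u g}"

definition H1_norm :: "'a::euclidean_space set \<Rightarrow> ('a \<Rightarrow> real) \<Rightarrow> real" where
  "H1_norm \<Omega> u =
     sqrt ((L2_norm \<Omega> u)\<^sup>2 + (\<Sum>b\<in>Basis. (L2_norm \<Omega> (weak_partial \<Omega> b u))\<^sup>2))"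

definition H1L2_norm ::
  "'a::euclidean_space set \<Rightarrow> ('a \<Rightarrow> real) \<Rightarrow> ('a \<Rightarrow> real) \<Rightarrow> real" where
  "H1L2_norm \<Omega> u v = sqrt ((H1_norm \<Omega> u)\<^sup>2 + (L2_norm \<Omega> v)\<^sup>2)"

text \<open>The value is infinite if \<open>u\<close> is not essentially bounded.\<close>

definition H1_Linf_norm :: "('a::euclidean_space \<Rightarrow> real) \<Rightarrow> ereal" where
  "H1_Linf_norm u = ereal (H1_norm UNIV u) + esssup lborel (\<lambda>x. ereal \<bar>u x\<bar>)"

definition radially_symmetric :: "('a::euclidean_space \<Rightarrow> real) \<Rightarrow> bool" where
  "radially_symmetric u \<longleftrightarrow> (\<exists>g. AE x in lborel. u x = g (norm x))"

section \<open>The nonlinear wave equation\<close>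

text \<open>
  \<open>(\<phi>, \<psi>)\<close> is a continuous curve in $H^1 \times L^2$ on $[0,\infty)$ with
  $\psi = \partial_t \phi$ and $\partial_t \psi = \Delta \phi - f(\phi)$, where for every
  $t \ge 0$ both identities are between distributions on the whole space and the time
  derivatives are those of the pairings with test functions. Values at negative times
  play no role.
\<close>

definition global_solution ::
  "(real \<Rightarrow> real) \<Rightarrow> (real \<Rightarrow> 'a::euclidean_space \<Rightarrow> real) \<Rightarrow> (real \<Rightarrow> 'a \<Rightarrow> real) \<Rightarrow> bool" where
  "global_solution f \<phi> \<psi> \<longleftrightarrow>
     (\<forall>t\<ge>0. \<phi> t \<in> H1 UNIV \<and> \<psi> t \<in> L2 UNIV) \<and>
     (\<forall>t\<ge>0. ((\<lambda>s. H1L2_norm UNIV (\<lambda>x. \<phi> s x - \<phi> t x) (\<lambda>x. \<psi> s x - \<psi> t x))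
               \<longlongrightarrow> 0) (at t within {0..})) \<and>
     (\<forall>\<eta>\<in>test_functions UNIV. \<forall>t\<ge>0.
        ((\<lambda>s. LINT x|lborel. \<phi> s x * \<eta> x) has_real_derivative
           (LINT x|lborel. \<psi> t x * \<eta> x)) (at t within {0..}) \<and>
        integrable lborel (\<lambda>x. f (\<phi> t x) * \<eta> x) \<and>
        ((\<lambda>s. LINT x|lborel. \<psi> s x * \<eta> x) has_real_derivative
           (LINT x|lborel. \<phi> t x * laplacian \<eta> x) - (LINT x|lborel. f (\<phi> t x) * \<eta> x))
          (at t within {0..}))"

section \<open>The potentials\<close>

definition F1 :: "nat \<Rightarrow> real \<Rightarrow> real" where
  "F1 n s = (1 - exp (- s)) ^ (2 * n)"

definition F2 :: "nat \<Rightarrow> real \<Rightarrow> real" where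
  "F2 n s = tanh s ^ (2 * n)"

definition F3_minus :: "real \<Rightarrow> real" where
  "F3_minus s = 1 - cos s"

definition F5_2 :: "real \<Rightarrow> real" where
  "F5_2 s = - (s ^ 4)"

definition potentials :: "(real \<Rightarrow> real) set" where
  "potentials = {F1 n | n. n \<ge> 2} \<union> {F2 n | n. n \<ge> 2} \<union> {F3_minus, F5_2}"

end

theory Submission
  imports Defs
begin

text \<open>
  All four nonlinearities have the form \<open>f(s) = m s + N(s)\<close> with \<open>m \<ge> 0\<close> and \<open>N(s) = O(s\<^sup>3)\<close>. The proof is
  the Morawetz multiplier argument. Radial symmetry propagates, because the difference of a solution and its
  reflection in a hyperplane solves a wave equation with zero data and a source bounded in \<open>L\<^sup>2\<close> by the difference.
  For radial \<open>\<phi>\<close> put \<open>v = r \<phi>\<close> and test the equation with the multiplier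
  \<open>M = h \<partial>\<^sub>r + h/r + h'/2\<close>, \<open>h(r) = r/(1+r)\<close>, which acts on \<open>v\<close> as \<open>h \<partial>\<^sub>r + h'/2\<close> and is skew, so the mass
  term and \<open>\<partial>\<^sub>t\<phi>\<close> do not contribute. The Laplacian contributes
  \<open>- \<integral> v\<^sub>r\<^sup>2/(1+r)\<^sup>2 + (3/2) \<integral> v\<^sup>2/(1+r)\<^sup>4\<close>, which is negative by Hardy's inequality with constant \<open>9/4\<close>, and the
  cubic remainder is absorbed by smallness of \<open>\<phi>\<close> in \<open>L\<^sup>\<infinity>\<close> and \<open>L\<^sup>2\<close>. Since \<open>\<langle>\<partial>\<^sub>t\<phi>, M \<phi>\<rangle>\<close> stays bounded, the local
  \<open>H\<^sup>1\<close> density is integrable in time; the virial identity adds the density of \<open>\<partial>\<^sub>t\<phi>\<close>. The local energy is thus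
  integrable in time and grows at most at a rate bounded by itself, so it tends to zero. Every identity is
  first derived for the mollified solution, where all integrations by parts are classical.
\<close>

section \<open>Square integrable curves\<close>

text \<open>The smallness hypothesis controls \<open>\<phi>\<close> alone, so a bound on the
  velocity, uniform in time, has to be produced: on each unit interval the virial identity bounds
  the mean of its squared norm, and the energy identity turns the mean into a pointwise bound. The
  energy is the free one with unit mass, and \<open>f(\<phi>)\<close> is a source; positivity thus
  does not depend on the sign of \<open>F\<close>, which is negative for -s^4. The function h is
  bounded, so the multiplier maps H^1 to L^2. From h' = (1+r)^-2 and h''' = 6 (1+r)^-4 comes the
  coefficient 3/2 = 6/4, which stays below the Hardy constant 9/4; the gap pays for the cubic term.
  Smallness in L^2 enters through a weighted sup bound on v, since |\<open>\<phi>\<close>| = |v|/r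
  then supplies decay at infinity. Mollification does not commute with the nonlinearity. The
  commutator tends to zero in L^2 at each time and is bounded uniformly, so it disappears after
  integration over a bounded time interval. Reflections replace rotations because a single
  reflection carries a point to any other point of the same norm.\<close>

definition l2 :: "('a::euclidean_space \<Rightarrow> real) \<Rightarrow> bool" where
  "l2 u \<longleftrightarrow> u \<in> borel_measurable borel \<and> integrable lborel (\<lambda>x. (u x)\<^sup>2)"

text \<open>The square of the norm, not the norm: sums and differences are therefore estimated with
  a factor 2.\<close>

definition n2 :: "('a::euclidean_space \<Rightarrow> real) \<Rightarrow> real" where
  "n2 u = (LINT x|lborel. (u x)\<^sup>2)"

lemma l2_meas[measurable_dest]: "l2 u \<Longrightarrow> u \<in> borel_measurable borel"
  and l2_integrable: "l2 u \<Longrightarrow> integrable lborel (\<lambda>x. (u x)\<^sup>2)"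
  by (auto simp: l2_def)

lemma n2_nonneg[simp]: "0 \<le> n2 u"
  by (simp add: n2_def)

lemma l2_bound:
  assumes "u \<in> borel_measurable borel" "l2 v" "AE x in lborel. \<bar>u x\<bar> \<le> C * \<bar>v x\<bar>"
  shows "l2 u" "n2 u \<le> C\<^sup>2 * n2 v"
proof -
  have i: "integrable lborel (\<lambda>x. C\<^sup>2 * (v x)\<^sup>2)"
    using assms(2) by (simp add: l2_def)
  have b: "AE x in lborel. (u x)\<^sup>2 \<le> C\<^sup>2 * (v x)\<^sup>2"
    using assms(3)
  proof eventually_elim
    case (elim x)
    have "\<bar>u x\<bar>\<^sup>2 \<le> (C * \<bar>v x\<bar>)\<^sup>2" using elim by (intro power_mono) auto
    thus ?case by (simp add: power_mult_distrib)
  qed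
  have j: "integrable lborel (\<lambda>x. (u x)\<^sup>2)"
    by (rule Bochner_Integration.integrable_bound[OF i]) (use assms b in auto)
  thus "l2 u" using assms by (simp add: l2_def)
  have "n2 u \<le> (LINT x|lborel. C\<^sup>2 * (v x)\<^sup>2)"
    unfolding n2_def by (rule integral_mono_AE[OF j i b])
  thus "n2 u \<le> C\<^sup>2 * n2 v" by (simp add: n2_def)
qed

lemma l2_zero[simp]: "l2 (\<lambda>x. 0)" by (simp add: l2_def)
lemma n2_zero[simp]: "n2 (\<lambda>x. 0) = 0" by (simp add: n2_def)

lemma l2_add: assumes "l2 u" "l2 v"
  shows "l2 (\<lambda>x. u x + v x)" "n2 (\<lambda>x. u x + v x) \<le> 2 * n2 u + 2 * n2 v"
proof -
  have i: "integrable lborel (\<lambda>x. 2 * (u x)\<^sup>2 + 2 * (v x)\<^sup>2)"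
    using assms by (simp add: l2_def)
  have b: "(u x + v x)\<^sup>2 \<le> 2 * (u x)\<^sup>2 + 2 * (v x)\<^sup>2" for x
    using sum_squares_bound[of "u x" "v x"] by (simp add: power2_sum)
  have [measurable]: "u \<in> borel_measurable borel" "v \<in> borel_measurable borel"
    using assms by (auto simp: l2_def)
  have j: "integrable lborel (\<lambda>x. (u x + v x)\<^sup>2)"
    by (rule Bochner_Integration.integrable_bound[OF i]) (use b in \<open>auto intro: order_trans[OF b]\<close>)
  show "l2 (\<lambda>x. u x + v x)" using j by (simp add: l2_def)
  have "n2 (\<lambda>x. u x + v x) \<le> (LINT x|lborel. 2 * (u x)\<^sup>2 + 2 * (v x)\<^sup>2)"
    unfolding n2_def by (rule integral_mono[OF j i b])
  also have "\<dots> = 2 * n2 u + 2 * n2 v" using assms by (simp add: n2_def l2_def)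
  finally show "n2 (\<lambda>x. u x + v x) \<le> 2 * n2 u + 2 * n2 v" .
qed

lemma l2_cmult: "l2 u \<Longrightarrow> l2 (\<lambda>x. c * u x)"
  by (auto simp: l2_def power_mult_distrib)
lemma n2_cmult: "n2 (\<lambda>x. c * u x) = c\<^sup>2 * n2 u"
  by (simp add: n2_def power_mult_distrib)

lemma l2_uminus: "l2 u \<Longrightarrow> l2 (\<lambda>x. - u x)"
  by (simp add: l2_def)
lemma n2_uminus: "n2 (\<lambda>x. - u x) = n2 u"
  by (simp add: n2_def)
lemma l2_diff: assumes "l2 u" "l2 v"
  shows "l2 (\<lambda>x. u x - v x)" "n2 (\<lambda>x. u x - v x) \<le> 2 * n2 u + 2 * n2 v"
  using l2_add[OF assms(1) l2_uminus[OF assms(2)]] by (simp_all add: n2_uminus)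

lemma l2_sum: "finite I \<Longrightarrow> (\<And>i. i \<in> I \<Longrightarrow> l2 (u i)) \<Longrightarrow> l2 (\<lambda>x. \<Sum>i\<in>I. u i x)"
  by (induction I rule: finite_induct) (auto intro: l2_add)

lemma l2_weight:
  assumes "l2 u" "w \<in> borel_measurable borel" "\<And>x. \<bar>w x\<bar> \<le> B"
  shows "l2 (\<lambda>x. w x * u x)" "n2 (\<lambda>x. w x * u x) \<le> B\<^sup>2 * n2 u"
proof -
  have m: "(\<lambda>x. w x * u x) \<in> borel_measurable borel" using assms by (auto simp: l2_def)
  have b: "AE x in lborel. \<bar>w x * u x\<bar> \<le> B * \<bar>u x\<bar>"
    by (auto simp: abs_mult intro!: mult_right_mono assms(3))
  show "l2 (\<lambda>x. w x * u x)" "n2 (\<lambda>x. w x * u x) \<le> B\<^sup>2 * n2 u"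
    using l2_bound[OF m assms(1) b] by auto
qed

lemma l2_mult_integrable: assumes "l2 u" "l2 v" shows "integrable lborel (\<lambda>x. u x * v x)"
proof -
  have i: "integrable lborel (\<lambda>x. (u x)\<^sup>2 + (v x)\<^sup>2)"
    using assms by (simp add: l2_def)
  have b: "\<bar>u x * v x\<bar> \<le> (u x)\<^sup>2 + (v x)\<^sup>2" for x
  proof -
    have "2 * (\<bar>u x\<bar> * \<bar>v x\<bar>) \<le> (u x)\<^sup>2 + (v x)\<^sup>2" using sum_squares_bound[of "\<bar>u x\<bar>" "\<bar>v x\<bar>"] by simp
    moreover have "0 \<le> \<bar>u x\<bar> * \<bar>v x\<bar>" by simp
    ultimately show ?thesis unfolding abs_mult by linarith
  qed
  show ?thesis
    by (rule Bochner_Integration.integrable_bound[OF i]) (use b assms in \<open>auto simp: l2_def\<close>)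
qed

lemma n2_eq_0_iff: assumes "l2 u" shows "n2 u = 0 \<longleftrightarrow> (AE x in lborel. u x = 0)"
  unfolding n2_def using integral_nonneg_eq_0_iff_AE[OF l2_integrable[OF assms]] by simp

text \<open>The quadratic polynomial c -> \<open>n2\<close> (u + c v) is nonnegative; its minimum is
  at c = - P / \<open>n2 v\<close>.\<close>

lemma cauchy_schwarz_sq: assumes "l2 u" "l2 v"
  shows "(LINT x|lborel. u x * v x)\<^sup>2 \<le> n2 u * n2 v"
proof -
  define P where "P = (LINT x|lborel. u x * v x)"
  have q: "0 \<le> n2 u + 2 * c * P + c\<^sup>2 * n2 v" for c
  proof -
    have "0 \<le> n2 (\<lambda>x. u x + c * v x)" by simp
    also have "\<dots> = (LINT x|lborel. (u x)\<^sup>2 + 2 * c * (u x * v x) + c\<^sup>2 * (v x)\<^sup>2)"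
      unfolding n2_def by (intro Bochner_Integration.integral_cong) (auto simp: power2_eq_square algebra_simps)
    also have "\<dots> = n2 u + 2 * c * P + c\<^sup>2 * n2 v"
      using assms l2_mult_integrable[OF assms] by (simp add: n2_def P_def l2_def)
    finally show ?thesis .
  qed
  show ?thesis
  proof (cases "n2 v = 0")
    case True
    have "P = 0"
    proof (rule ccontr)
      assume "P \<noteq> 0"
      \<comment> \<open>With \<open>n2 v = 0\<close> the polynomial is affine in c, and this c would
        give it the value -1.\<close>
      hence "2 * (- (n2 u + 1) / (2 * P)) * P = - (n2 u + 1)" by simp
      with q[of "- (n2 u + 1) / (2 * P)"] True show False by simp
    qed
    thus ?thesis using True by (simp add: P_def)
  next
    case False
    hence v: "n2 v > 0" using n2_nonneg[of v] by linarith
    have "0 \<le> n2 u - P\<^sup>2 / n2 v" using q[of "- P / n2 v"] v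
      by (simp add: field_simps power2_eq_square)
    thus ?thesis using v by (simp add: field_simps P_def)
  qed
qed

lemma cauchy_schwarz: assumes "l2 u" "l2 v"
  shows "\<bar>LINT x|lborel. u x * v x\<bar> \<le> sqrt (n2 u) * sqrt (n2 v)"
  using real_le_rsqrt[of "\<bar>LINT x|lborel. u x * v x\<bar>" "n2 u * n2 v"] cauchy_schwarz_sq[OF assms]
  by (simp add: real_sqrt_mult)

text \<open>The weight \<open>c\<close> decides which factor bears the cost;
  \<open>velocity_bounded\<close> takes 12 so that a term can be absorbed on the left.\<close>

lemma young_pair: assumes "l2 u" "l2 v" "c > 0"
  shows "2 * \<bar>LINT x|lborel. u x * v x\<bar> \<le> c * n2 u + n2 v / c"
proof -
  have "\<bar>LINT x|lborel. u x * v x\<bar>\<^sup>2 \<le> n2 u * n2 v" using cauchy_schwarz_sq[OF assms(1,2)] by simp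
  also have "4 * (n2 u * n2 v) \<le> (c * n2 u + n2 v / c)\<^sup>2"
  proof -
    have "(c * n2 u + n2 v / c)\<^sup>2 = (c * n2 u - n2 v / c)\<^sup>2 + 4 * (c * n2 u) * (n2 v / c)"
      by (simp add: power2_eq_square algebra_simps)
    also have "4 * (c * n2 u) * (n2 v / c) = 4 * (n2 u * n2 v)" using assms(3) by simp
    finally show ?thesis by simp
  qed
  finally have "(2 * \<bar>LINT x|lborel. u x * v x\<bar>)\<^sup>2 \<le> (c * n2 u + n2 v / c)\<^sup>2"
    by (simp add: power_mult_distrib)
  thus ?thesis by (rule power2_le_imp_le) (use assms in auto)
qed

section \<open>Limits in L^2 along a filter; continuous and differentiable curves in L^2\<close>

definition l2lim :: "('i \<Rightarrow> 'a::euclidean_space \<Rightarrow> real) \<Rightarrow> ('a \<Rightarrow> real) \<Rightarrow> 'i filter \<Rightarrow> bool" where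
  "l2lim f u F \<longleftrightarrow> (\<forall>\<^sub>F i in F. l2 (f i)) \<and> l2 u \<and> ((\<lambda>i. n2 (\<lambda>x. f i x - u x)) \<longlongrightarrow> 0) F"

lemma l2limI: "(\<forall>\<^sub>F i in F. l2 (f i)) \<Longrightarrow> l2 u \<Longrightarrow> ((\<lambda>i. n2 (\<lambda>x. f i x - u x)) \<longlongrightarrow> 0) F \<Longrightarrow> l2lim f u F"
  by (simp add: l2lim_def)

lemma l2lim_bound:
  assumes "\<forall>\<^sub>F i in F. l2 (f i)" "l2 u" "\<forall>\<^sub>F i in F. n2 (\<lambda>x. f i x - u x) \<le> h i" "(h \<longlongrightarrow> 0) F"
  shows "l2lim f u F"
  by (intro l2limI tendsto_sandwich[OF _ assms(3) tendsto_const assms(4)] assms) auto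

lemma l2lim_const: "l2 u \<Longrightarrow> l2lim (\<lambda>_. u) u F"
  by (simp add: l2lim_def)

lemma l2lim_add: assumes "l2lim f u F" "l2lim g v F"
  shows "l2lim (\<lambda>i x. f i x + g i x) (\<lambda>x. u x + v x) F"
proof (rule l2lim_bound)
  show "\<forall>\<^sub>F i in F. l2 (\<lambda>x. f i x + g i x)"
    using assms unfolding l2lim_def by (auto elim: eventually_elim2 intro: l2_add)
  show "l2 (\<lambda>x. u x + v x)" using assms by (auto simp: l2lim_def intro: l2_add)
  show "\<forall>\<^sub>F i in F. n2 (\<lambda>x. f i x + g i x - (u x + v x)) \<le>
      2 * n2 (\<lambda>x. f i x - u x) + 2 * n2 (\<lambda>x. g i x - v x)"
  proof -
    have "\<forall>\<^sub>F i in F. l2 (f i)" "\<forall>\<^sub>F i in F. l2 (g i)" using assms by (auto simp: l2lim_def)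
    thus ?thesis
    proof eventually_elim
      case (elim i)
      have "n2 (\<lambda>x. (f i x - u x) + (g i x - v x)) \<le> 2 * n2 (\<lambda>x. f i x - u x) + 2 * n2 (\<lambda>x. g i x - v x)"
        using assms elim by (intro l2_add l2_diff) (auto simp: l2lim_def)
      thus ?case by (simp add: algebra_simps)
    qed
  qed
  show "((\<lambda>i. 2 * n2 (\<lambda>x. f i x - u x) + 2 * n2 (\<lambda>x. g i x - v x)) \<longlongrightarrow> 0) F"
    using assms unfolding l2lim_def by (auto intro!: tendsto_eq_intros)
qed

lemma l2lim_weight:
  assumes "l2lim f u F" "w \<in> borel_measurable borel" "\<And>x. \<bar>w x\<bar> \<le> B"
  shows "l2lim (\<lambda>i x. w x * f i x) (\<lambda>x. w x * u x) F"
proof (rule l2lim_bound)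
  have e: "\<forall>\<^sub>F i in F. l2 (f i)" "l2 u" using assms by (auto simp: l2lim_def)
  show "\<forall>\<^sub>F i in F. l2 (\<lambda>x. w x * f i x)"
    using e(1) by eventually_elim (rule l2_weight, use assms in auto)
  show "l2 (\<lambda>x. w x * u x)" using e(2) assms by (auto intro: l2_weight)
  show "\<forall>\<^sub>F i in F. n2 (\<lambda>x. w x * f i x - w x * u x) \<le> B\<^sup>2 * n2 (\<lambda>x. f i x - u x)"
    using e(1)
  proof eventually_elim
    case (elim i)
    have "n2 (\<lambda>x. w x * (f i x - u x)) \<le> B\<^sup>2 * n2 (\<lambda>x. f i x - u x)"
      using elim e assms by (intro l2_weight l2_diff) auto
    thus ?case by (simp add: algebra_simps)
  qed
  show "((\<lambda>i. B\<^sup>2 * n2 (\<lambda>x. f i x - u x)) \<longlongrightarrow> 0) F"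
    using assms unfolding l2lim_def by (auto intro!: tendsto_eq_intros)
qed

lemma l2lim_cmult: "l2lim f u F \<Longrightarrow> l2lim (\<lambda>i x. c * f i x) (\<lambda>x. c * u x) F"
  by (rule l2lim_weight[where w="\<lambda>_. c" and B="\<bar>c\<bar>"]) auto

lemma l2lim_diff: assumes "l2lim f u F" "l2lim g v F"
  shows "l2lim (\<lambda>i x. f i x - g i x) (\<lambda>x. u x - v x) F"
  using l2lim_add[OF assms(1) l2lim_cmult[OF assms(2), of "-1"]] by simp

lemma l2lim_sum: "finite I \<Longrightarrow> (\<And>j. j \<in> I \<Longrightarrow> l2lim (f j) (u j) F) \<Longrightarrow>
    l2lim (\<lambda>i x. \<Sum>j\<in>I. f j i x) (\<lambda>x. \<Sum>j\<in>I. u j x) F"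
  by (induction I rule: finite_induct) (auto intro: l2lim_add l2lim_const)

lemma l2lim_pair: assumes "l2lim f u F" "l2lim g v F"
  shows "((\<lambda>i. LINT x|lborel. f i x * g i x) \<longlongrightarrow> (LINT x|lborel. u x * v x)) F"
proof -
  have e: "\<forall>\<^sub>F i in F. l2 (f i)" "\<forall>\<^sub>F i in F. l2 (g i)" "l2 u" "l2 v"
    and t: "((\<lambda>i. n2 (\<lambda>x. f i x - u x)) \<longlongrightarrow> 0) F" "((\<lambda>i. n2 (\<lambda>x. g i x - v x)) \<longlongrightarrow> 0) F"
    using assms by (auto simp: l2lim_def)
  define h where "h i = sqrt (n2 (\<lambda>x. f i x - u x)) * sqrt (n2 (\<lambda>x. g i x - v x))
     + sqrt (n2 (\<lambda>x. f i x - u x)) * sqrt (n2 v) + sqrt (n2 u) * sqrt (n2 (\<lambda>x. g i x - v x))" for i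
  have h0: "(h \<longlongrightarrow> 0) F"
    unfolding h_def using tendsto_real_sqrt[OF t(1)] tendsto_real_sqrt[OF t(2)]
    by (intro tendsto_add_zero tendsto_mult_zero tendsto_mult_left_zero tendsto_mult_right_zero) simp_all
  have "((\<lambda>i. (LINT x|lborel. f i x * g i x) - (LINT x|lborel. u x * v x)) \<longlongrightarrow> 0) F"
  proof (rule Lim_null_comparison[OF _ h0])
    show "\<forall>\<^sub>F i in F. norm ((LINT x|lborel. f i x * g i x) - (LINT x|lborel. u x * v x)) \<le> h i"
      using e(1,2)
    proof eventually_elim
      case (elim i)
      let ?a = "\<lambda>x. f i x - u x" and ?b = "\<lambda>x. g i x - v x"
      have ab: "l2 ?a" "l2 ?b" using elim e by (auto intro: l2_diff)
      have "(LINT x|lborel. f i x * g i x) = (LINT x|lborel. ?a x * ?b x + ?a x * v x + u x * ?b x + u x * v x)"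
        by (intro Bochner_Integration.integral_cong) (auto simp: algebra_simps)
      also have "\<dots> = (LINT x|lborel. ?a x * ?b x) + (LINT x|lborel. ?a x * v x) + (LINT x|lborel. u x * ?b x)
          + (LINT x|lborel. u x * v x)"
        using l2_mult_integrable[OF ab] l2_mult_integrable[OF ab(1) e(4)] l2_mult_integrable[OF e(3) ab(2)]
          l2_mult_integrable[OF e(3,4)] by (simp add: Bochner_Integration.integral_add)
      finally show ?case
        using cauchy_schwarz[OF ab] cauchy_schwarz[OF ab(1) e(4)] cauchy_schwarz[OF e(3) ab(2)]
        unfolding h_def by (simp add: real_norm_def)
    qed
  qed
  thus ?thesis by (simp add: LIM_zero_cancel)
qed

lemma l2lim_n2: assumes "l2lim f u F" shows "((\<lambda>i. n2 (f i)) \<longlongrightarrow> n2 u) F"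
  using l2lim_pair[OF assms assms] by (simp add: n2_def power2_eq_square)

text \<open>Limits are taken along \<open>at t within {0..}\<close>: curves are constrained at
  nonnegative times only, and derivatives at 0 are one-sided.\<close>

definition l2cont :: "(real \<Rightarrow> 'a::euclidean_space \<Rightarrow> real) \<Rightarrow> bool" where
  "l2cont u \<longleftrightarrow> (\<forall>t\<ge>0. l2 (u t)) \<and> (\<forall>t\<ge>0. l2lim u (u t) (at t within {0..}))"

definition l2deriv :: "(real \<Rightarrow> 'a::euclidean_space \<Rightarrow> real) \<Rightarrow> (real \<Rightarrow> 'a \<Rightarrow> real) \<Rightarrow> bool" where
  "l2deriv u u' \<longleftrightarrow> (\<forall>t\<ge>0. l2lim (\<lambda>s x. (u s x - u t x) / (s - t)) (u' t) (at t within {0..}))"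

lemma l2cont_l2: "l2cont u \<Longrightarrow> 0 \<le> t \<Longrightarrow> l2 (u t)" by (simp add: l2cont_def)
lemma l2cont_lim: "l2cont u \<Longrightarrow> 0 \<le> t \<Longrightarrow> l2lim u (u t) (at t within {0..})" by (simp add: l2cont_def)

lemma l2contI: "(\<And>t. 0 \<le> t \<Longrightarrow> l2 (u t)) \<Longrightarrow> (\<And>t. 0 \<le> t \<Longrightarrow> l2lim u (u t) (at t within {0..})) \<Longrightarrow> l2cont u"
  by (simp add: l2cont_def)

lemma eventually_nonneg_within: "\<forall>\<^sub>F s in at t within {0..}. (0::real) \<le> s"
  by (simp add: eventually_at_filter)

lemma l2cont_diff: "l2cont u \<Longrightarrow> l2cont v \<Longrightarrow> l2cont (\<lambda>t x. u t x - v t x)"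
  by (auto simp: l2cont_def intro: l2_diff l2lim_diff)
lemma l2cont_cmult: "l2cont u \<Longrightarrow> l2cont (\<lambda>t x. c * u t x)"
  by (auto simp: l2cont_def intro: l2_cmult l2lim_cmult)
lemma l2cont_weight:
  "l2cont u \<Longrightarrow> w \<in> borel_measurable borel \<Longrightarrow> (\<And>x. \<bar>w x\<bar> \<le> B) \<Longrightarrow> l2cont (\<lambda>t x. w x * u t x)"
  by (intro l2contI l2_weight(1)[where B=B] l2lim_weight[where B=B]) (simp_all add: l2cont_l2 l2cont_lim)
lemma l2cont_sum: "finite I \<Longrightarrow> (\<And>j. j \<in> I \<Longrightarrow> l2cont (u j)) \<Longrightarrow> l2cont (\<lambda>t x. \<Sum>j\<in>I. u j t x)"
  unfolding l2cont_def by (auto intro!: l2_sum l2lim_sum)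

lemma l2cont_pair: "l2cont u \<Longrightarrow> l2cont v \<Longrightarrow> continuous_on {0..} (\<lambda>t. LINT x|lborel. u t x * v t x)"
  unfolding continuous_on_def l2cont_def by (auto intro: l2lim_pair)

lemma l2cont_n2: "l2cont u \<Longrightarrow> continuous_on {0..} (\<lambda>t. n2 (u t))"
  using l2cont_pair[of u u] by (simp add: n2_def power2_eq_square)

lemma l2deriv_add: "l2deriv u u' \<Longrightarrow> l2deriv v v' \<Longrightarrow> l2deriv (\<lambda>t x. u t x + v t x) (\<lambda>t x. u' t x + v' t x)"
  unfolding l2deriv_def
proof (intro allI impI)
  fix t :: real assume a: "\<forall>t\<ge>0. l2lim (\<lambda>s x. (u s x - u t x) / (s - t)) (u' t) (at t within {0..})"
    "\<forall>t\<ge>0. l2lim (\<lambda>s x. (v s x - v t x) / (s - t)) (v' t) (at t within {0..})" "0 \<le> t"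
  have e: "(u s x - u t x) / (s - t) + (v s x - v t x) / (s - t) = (u s x + v s x - (u t x + v t x)) / (s - t)" for s x
    by (simp add: add_divide_distrib[symmetric] algebra_simps)
  show "l2lim (\<lambda>s x. (u s x + v s x - (u t x + v t x)) / (s - t)) (\<lambda>x. u' t x + v' t x) (at t within {0..})"
    using l2lim_add[of "\<lambda>s x. (u s x - u t x) / (s - t)" "u' t" "at t within {0..}" "\<lambda>s x. (v s x - v t x) / (s - t)" "v' t"] a
    unfolding e by blast
qed

lemma l2deriv_weight:
  assumes "l2deriv u u'" "w \<in> borel_measurable borel" "\<And>x. \<bar>w x\<bar> \<le> B"
  shows "l2deriv (\<lambda>t x. w x * u t x) (\<lambda>t x. w x * u' t x)"
  unfolding l2deriv_def
proof (intro allI impI)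
  fix t :: real assume "0 \<le> t"
  hence "l2lim (\<lambda>s x. w x * ((u s x - u t x) / (s - t))) (\<lambda>x. w x * u' t x) (at t within {0..})"
    using assms by (intro l2lim_weight[where B=B]) (auto simp: l2deriv_def)
  thus "l2lim (\<lambda>s x. (w x * u s x - w x * u t x) / (s - t)) (\<lambda>x. w x * u' t x) (at t within {0..})"
    by (simp add: algebra_simps diff_divide_distrib)
qed

lemma l2deriv_zero: "l2deriv (\<lambda>t x. 0) (\<lambda>t x. 0)"
  by (simp add: l2deriv_def l2lim_const)

lemma l2deriv_sum: "finite I \<Longrightarrow> (\<And>j. j \<in> I \<Longrightarrow> l2deriv (u j) (u' j)) \<Longrightarrow>
    l2deriv (\<lambda>t x. \<Sum>j\<in>I. u j t x) (\<lambda>t x. \<Sum>j\<in>I. u' j t x)"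
  by (induction I rule: finite_induct) (auto intro: l2deriv_add l2deriv_zero)

text \<open>The quotient of the pairing splits into (u_s - u_t)/(s - t) against v_s and u_t against
  (v_s - v_t)/(s - t); in each pairing both factors converge in L^2.\<close>

lemma l2deriv_pair:
  assumes "l2cont u" "l2cont v" "l2deriv u u'" "l2deriv v v'" "0 \<le> t"
  shows "((\<lambda>s. LINT x|lborel. u s x * v s x) has_real_derivative
     ((LINT x|lborel. u' t x * v t x) + (LINT x|lborel. u t x * v' t x))) (at t within {0..})"
  unfolding has_field_derivative_iff
proof (rule Lim_transform_eventually)
  show "((\<lambda>s. (LINT x|lborel. (u s x - u t x) / (s - t) * v s x) + (LINT x|lborel. u t x * ((v s x - v t x) / (s - t))))
     \<longlongrightarrow> (LINT x|lborel. u' t x * v t x) + (LINT x|lborel. u t x * v' t x)) (at t within {0..})"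
    using assms by (intro tendsto_add l2lim_pair l2lim_const) (auto simp: l2cont_def l2deriv_def)
  show "\<forall>\<^sub>F s in at t within {0..}.
     (LINT x|lborel. (u s x - u t x) / (s - t) * v s x) + (LINT x|lborel. u t x * ((v s x - v t x) / (s - t)))
     = ((LINT x|lborel. u s x * v s x) - (LINT x|lborel. u t x * v t x)) / (s - t)"
    using eventually_nonneg_within
  proof eventually_elim
    case (elim s)
    have l: "l2 (u s)" "l2 (v s)" "l2 (u t)" "l2 (v t)" using assms elim by (auto simp: l2cont_def)
    have "(LINT x|lborel. (u s x - u t x) / (s - t) * v s x) + (LINT x|lborel. u t x * ((v s x - v t x) / (s - t)))
       = ((LINT x|lborel. (u s x - u t x) * v s x) + (LINT x|lborel. u t x * (v s x - v t x))) / (s - t)"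
      by (simp add: add_divide_distrib)
    also have "(LINT x|lborel. (u s x - u t x) * v s x) = (LINT x|lborel. u s x * v s x) - (LINT x|lborel. u t x * v s x)"
      using l by (simp add: algebra_simps l2_mult_integrable)
    also have "(LINT x|lborel. u t x * (v s x - v t x)) = (LINT x|lborel. u t x * v s x) - (LINT x|lborel. u t x * v t x)"
      using l by (simp add: algebra_simps l2_mult_integrable)
    finally show ?case by simp
  qed
qed

text \<open>The time integral is the gauge integral, for which differentiability at every point of
  the interval suffices; no continuity of the derivative has to be carried along.\<close>

lemma l2cont_ftc:
  assumes "l2cont u" "l2cont v" "l2deriv u u'" "l2deriv v v'" "0 \<le> s" "s \<le> t"
  shows "((\<lambda>\<tau>. (LINT x|lborel. u' \<tau> x * v \<tau> x) + (LINT x|lborel. u \<tau> x * v' \<tau> x)) has_integral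
     (LINT x|lborel. u t x * v t x) - (LINT x|lborel. u s x * v s x)) {s..t}"
proof (rule fundamental_theorem_of_calculus[OF assms(6)])
  fix \<tau> assume "\<tau> \<in> {s..t}"
  hence "((\<lambda>s. LINT x|lborel. u s x * v s x) has_real_derivative
     ((LINT x|lborel. u' \<tau> x * v \<tau> x) + (LINT x|lborel. u \<tau> x * v' \<tau> x))) (at \<tau> within {0..})"
    using assms by (intro l2deriv_pair) auto
  thus "((\<lambda>s. LINT x|lborel. u s x * v s x) has_vector_derivative
     ((LINT x|lborel. u' \<tau> x * v \<tau> x) + (LINT x|lborel. u \<tau> x * v' \<tau> x))) (at \<tau> within {s..t})"
    unfolding has_real_derivative_iff_has_vector_derivative
    by (rule has_vector_derivative_within_subset) (use assms in auto)
qed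

section \<open>Convolution in $L^2$\<close>

lemma l2I_nn:
  assumes [measurable]: "u \<in> borel_measurable borel" and "(\<integral>\<^sup>+x. ennreal ((u x)\<^sup>2) \<partial>lborel) \<le> ennreal C" "0 \<le> C"
  shows "l2 u" "n2 u \<le> C"
proof -
  have f: "(\<integral>\<^sup>+x. ennreal ((u x)\<^sup>2) \<partial>lborel) < \<infinity>"
    using assms(2) by (rule le_less_trans) simp
  have "integrable lborel (\<lambda>x. (u x)\<^sup>2)"
    using f by (intro integrableI_nonneg) auto
  thus l: "l2 u" by (simp add: l2_def)
  hence "ennreal (n2 u) \<le> ennreal C"
    using assms(2) by (simp add: n2_def l2_def nn_integral_eq_integral)
  thus "n2 u \<le> C" using assms(3) by simp
qed

lemma nn_n2: "l2 u \<Longrightarrow> (\<integral>\<^sup>+x. ennreal ((u x)\<^sup>2) \<partial>lborel) = ennreal (n2 u)"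
  by (simp add: n2_def l2_def nn_integral_eq_integral)

section \<open>Maps that preserve Lebesgue measure\<close>

definition lpres :: "('a::euclidean_space \<Rightarrow> 'a) \<Rightarrow> bool" where
  "lpres T \<longleftrightarrow> T \<in> borel_measurable borel \<and> distr lborel borel T = lborel"

lemma lpres_meas: "lpres T \<Longrightarrow> T \<in> borel_measurable borel"
  by (simp add: lpres_def)

lemma lpres_translate: "lpres (\<lambda>x. a + x)"
  by (simp add: lpres_def lborel_distr_plus)

lemma lpres_reflect: "lpres (\<lambda>x. a - x :: 'a::euclidean_space)"
proof -
  have "lborel = density (distr lborel borel (\<lambda>x::'a. a + (-1) *\<^sub>R x)) (\<lambda>_. \<bar>-1::real\<bar>^DIM('a))"
    by (rule lborel_affine) simp
  hence "distr lborel borel (\<lambda>x::'a. a - x) = lborel" by (simp add: density_1)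
  thus ?thesis by (simp add: lpres_def)
qed

lemma lpres_integrable:
  fixes f :: "'a::euclidean_space \<Rightarrow> real"
  assumes "lpres T" "integrable lborel f"
  shows "integrable lborel (\<lambda>x. f (T x))"
proof -
  have "integrable (distr lborel borel T) f" using assms by (simp add: lpres_def)
  thus ?thesis
    using assms by (subst (asm) integrable_distr_eq) (auto simp: lpres_def)
qed

lemma lpres_integral:
  fixes f :: "'a::euclidean_space \<Rightarrow> real"
  assumes "lpres T" "f \<in> borel_measurable borel"
  shows "(LINT x|lborel. f (T x)) = (LINT x|lborel. f x)"
proof -
  have "integral\<^sup>L (distr lborel borel T) f = (LINT x|lborel. f (T x))"
    using assms by (intro integral_distr) (auto simp: lpres_def)
  thus ?thesis using assms by (simp add: lpres_def)
qed

lemma lpres_nn_integral: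
  assumes "lpres T" "f \<in> borel_measurable borel"
  shows "(\<integral>\<^sup>+x. f (T x) \<partial>lborel) = (\<integral>\<^sup>+x. f x \<partial>lborel)"
proof -
  have "integral\<^sup>N (distr lborel borel T) f = (\<integral>\<^sup>+x. f (T x) \<partial>lborel)"
    using assms by (intro nn_integral_distr) (auto simp: lpres_def)
  thus ?thesis using assms by (simp add: lpres_def)
qed

lemma lpres_AE:
  assumes "lpres T" "AE x in lborel. P x"
  shows "AE x in lborel. P (T x)"
proof -
  have "AE x in distr lborel borel T. P x" using assms(2) assms(1)[unfolded lpres_def] by metis
  thus ?thesis using AE_distrD[of T lborel borel P] assms by (simp add: lpres_def)
qed

lemma lpres_l2: assumes "lpres T" "l2 u" shows "l2 (\<lambda>x. u (T x))" "n2 (\<lambda>x. u (T x)) = n2 u"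
proof -
  have [measurable]: "T \<in> borel_measurable borel" "u \<in> borel_measurable borel"
    using assms by (auto simp: l2_def lpres_def)
  show "l2 (\<lambda>x. u (T x))" using lpres_integrable[OF assms(1) l2_integrable[OF assms(2)]] by (simp add: l2_def)
  show "n2 (\<lambda>x. u (T x)) = n2 u" unfolding n2_def by (rule lpres_integral[OF assms(1)]) simp
qed

section \<open>Continuity of translations in L^1 and L^2\<close>

lemma l1_translation_approx:
  fixes f :: "'a::euclidean_space \<Rightarrow> real" and h :: "nat \<Rightarrow> 'a"
  assumes f: "integrable lborel f"
    and g: "\<And>e. 0 < e \<Longrightarrow> \<exists>g. integrable lborel g \<and> (LINT x|lborel. \<bar>f x - g x\<bar>) < e \<and>
      (\<lambda>n. LINT x|lborel. \<bar>g (h n + x) - g x\<bar>) \<longlonglongrightarrow> 0"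
  shows "(\<lambda>n. LINT x|lborel. \<bar>f (h n + x) - f x\<bar>) \<longlonglongrightarrow> 0"
proof (rule LIMSEQ_I)
  fix e :: real assume e: "0 < e"
  hence "0 < e / 3" by simp
  from g[OF this] obtain g where g: "integrable lborel g" "(LINT x|lborel. \<bar>f x - g x\<bar>) < e / 3"
    "(\<lambda>n. LINT x|lborel. \<bar>g (h n + x) - g x\<bar>) \<longlonglongrightarrow> 0" by blast
  from LIMSEQ_D[OF g(3), of "e/3"] e obtain N where
    N: "\<And>n. n \<ge> N \<Longrightarrow> norm ((LINT x|lborel. \<bar>g (h n + x) - g x\<bar>) - 0) < e / 3" by auto
  show "\<exists>N. \<forall>n\<ge>N. norm ((LINT x|lborel. \<bar>f (h n + x) - f x\<bar>) - 0) < e"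
  proof (intro exI allI impI)
    fix n assume n: "n \<ge> N"
    note T = lpres_translate[of "h n"]
    have i: "integrable lborel (\<lambda>x. f (h n + x))" "integrable lborel (\<lambda>x. g (h n + x))"
      using lpres_integrable[OF T] f g by auto
    have m[measurable]: "f \<in> borel_measurable borel" "g \<in> borel_measurable borel" using f g by auto
    have "(LINT x|lborel. \<bar>f (h n + x) - f x\<bar>) \<le>
       (LINT x|lborel. \<bar>f (h n + x) - g (h n + x)\<bar> + \<bar>g (h n + x) - g x\<bar> + \<bar>f x - g x\<bar>)"
      using i f g by (intro integral_mono) (auto intro!: integrable_add integrable_abs integrable_diff)
    also have "\<dots> = (LINT x|lborel. \<bar>f (h n + x) - g (h n + x)\<bar>) + (LINT x|lborel. \<bar>g (h n + x) - g x\<bar>)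
        + (LINT x|lborel. \<bar>f x - g x\<bar>)"
      using i f g by (simp add: integrable_abs)
    also have "(LINT x|lborel. \<bar>f (h n + x) - g (h n + x)\<bar>) = (LINT x|lborel. \<bar>f x - g x\<bar>)"
      using lpres_integral[OF T, of "\<lambda>x. \<bar>f x - g x\<bar>"] by simp
    finally have "(LINT x|lborel. \<bar>f (h n + x) - f x\<bar>) < e"
      using g(2) N[OF n] by simp
    moreover have "0 \<le> (LINT x|lborel. \<bar>f (h n + x) - f x\<bar>)" by simp
    ultimately show "norm ((LINT x|lborel. \<bar>f (h n + x) - f x\<bar>) - 0) < e" by simp
  qed
qed

text \<open>\<open>U\<close> and its translate have the same measure, so the symmetric difference is
  twice the part of \<open>U\<close> that is lost. Each point of the open set \<open>U\<close> is
  eventually not lost, and the indicator of \<open>U\<close> dominates; nothing has to be known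
  about the boundary of \<open>U\<close>.\<close>

lemma l1_translation_open:
  fixes h :: "nat \<Rightarrow> 'a::euclidean_space"
  assumes U: "open U" "emeasure lborel U < \<infinity>" and h: "h \<longlonglongrightarrow> 0"
  shows "(\<lambda>n. LINT x|lborel. \<bar>indicator U (h n + x) - indicator U x :: real\<bar>) \<longlonglongrightarrow> 0"
proof -
  let ?I = "indicator U :: 'a \<Rightarrow> real"
  have [measurable]: "U \<in> sets borel" using U by simp
  have iU: "integrable lborel ?I" using U by simp
  have eq: "(LINT x|lborel. \<bar>?I (h n + x) - ?I x\<bar>) = 2 * (LINT x|lborel. max 0 (?I x - ?I (h n + x)))" for n
  proof -
    have i: "integrable lborel (\<lambda>x. ?I (h n + x))"
      by (rule lpres_integrable[OF lpres_translate iU])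
    have j: "integrable lborel (\<lambda>x. max 0 (?I x - ?I (h n + x)))"
      by (rule Bochner_Integration.integrable_bound[OF iU]) (auto simp: indicator_def)
    have "(LINT x|lborel. \<bar>?I (h n + x) - ?I x\<bar>) =
        (LINT x|lborel. (?I (h n + x) - ?I x) + 2 * max 0 (?I x - ?I (h n + x)))"
      by (intro Bochner_Integration.integral_cong) (auto simp: indicator_def)
    also have "\<dots> = (LINT x|lborel. ?I (h n + x)) - (LINT x|lborel. ?I x) + 2 * (LINT x|lborel. max 0 (?I x - ?I (h n + x)))"
      using i iU j by simp
    also have "(LINT x|lborel. ?I (h n + x)) = (LINT x|lborel. ?I x)"
      by (rule lpres_integral[OF lpres_translate]) simp
    finally show ?thesis by simp
  qed
  have "(\<lambda>n. LINT x|lborel. max 0 (?I x - ?I (h n + x))) \<longlonglongrightarrow> (LINT (x::'a)|lborel. (0::real))"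
  proof (rule integral_dominated_convergence[where w="?I"])
    show "AE x in lborel. (\<lambda>n. max 0 (?I x - ?I (h n + x))) \<longlonglongrightarrow> 0"
    proof (rule AE_I2)
      fix x
      show "(\<lambda>n. max 0 (?I x - ?I (h n + x))) \<longlonglongrightarrow> 0"
      proof (cases "x \<in> U")
        case True
        have "(\<lambda>n. h n + x) \<longlonglongrightarrow> x" using tendsto_add[OF h tendsto_const[of x]] by simp
        hence "\<forall>\<^sub>F n in sequentially. h n + x \<in> U" using U(1) True by (rule topological_tendstoD)
        hence "\<forall>\<^sub>F n in sequentially. max 0 (?I x - ?I (h n + x)) = 0"
          by eventually_elim (simp add: True)
        thus ?thesis by (rule tendsto_eventually)
      qed simp
    qed
    show "AE x in lborel. norm (max 0 (?I x - ?I (h n + x))) \<le> ?I x" for n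
      by (auto simp: indicator_def)
  qed (use iU in auto)
  hence "(\<lambda>n. LINT x|lborel. max 0 (?I x - ?I (h n + x))) \<longlonglongrightarrow> 0" by simp
  from tendsto_mult_left[OF this, of 2] show ?thesis unfolding eq by simp
qed

text \<open>Induction over integrable functions. By \<open>l1_translation_approx\<close>, the
  indicator of a Borel set is replaced by that of an open superset of nearly the same measure, and a
  limit by a member of the approximating sequence.\<close>

lemma l1_translation:
  fixes f :: "'a::euclidean_space \<Rightarrow> real" and h :: "nat \<Rightarrow> 'a"
  assumes f: "integrable lborel f" and h: "h \<longlonglongrightarrow> 0"
  shows "(\<lambda>n. LINT x|lborel. \<bar>f (h n + x) - f x\<bar>) \<longlonglongrightarrow> 0"
  using f
proof (induction rule: integrable_induct)
  case (base A c)
  hence A: "A \<in> sets borel" and fin: "emeasure lborel A < \<infinity>" by auto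
  have "(\<lambda>n. LINT x|lborel. \<bar>indicator A (h n + x) - indicator A x :: real\<bar>) \<longlonglongrightarrow> 0"
  proof (rule l1_translation_approx)
    show "integrable lborel (indicator A :: 'a \<Rightarrow> real)" using A fin by simp
    fix e :: real assume e: "0 < e"
    from outer_regular_lborel[OF A e] obtain U where
      U: "open U" "A \<subseteq> U" "emeasure lborel (U - A) < ennreal e" by blast
    have "emeasure lborel U \<le> emeasure lborel (U - A) + emeasure lborel A"
      using U A emeasure_subadditive[of "U - A" lborel A] by (auto simp: Un_absorb2)
    also have "\<dots> < \<infinity>" using U(3) fin by (auto simp: less_top[symmetric])
    finally have Uf: "emeasure lborel U < \<infinity>" .
    have "(LINT x|lborel. \<bar>indicator A x - indicator U x :: real\<bar>) = (LINT x|lborel. indicator (U - A) x)"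
      using U by (intro Bochner_Integration.integral_cong) (auto simp: indicator_def)
    also have "\<dots> = measure lborel (U - A)" by simp
    also have "\<dots> < e" using U(3) e unfolding measure_def
      by (metis enn2real_less_iff order.strict_implies_order ennreal_less_top less_trans)
    finally show "\<exists>g. integrable lborel g \<and> (LINT x|lborel. \<bar>indicator A x - g x\<bar>) < e \<and>
      (\<lambda>n. LINT x|lborel. \<bar>g (h n + x) - g x\<bar>) \<longlonglongrightarrow> 0"
      using l1_translation_open[OF U(1) Uf h] U(1) Uf by (intro exI[of _ "indicator U"]) auto
  qed
  from tendsto_mult_right[OF this, of "\<bar>c\<bar>"] show ?case
    by (simp add: left_diff_distrib[symmetric] abs_mult)
next
  case (add f g)
  show ?case
  proof (rule Lim_null_comparison)
    show "(\<lambda>n. (LINT x|lborel. \<bar>f (h n + x) - f x\<bar>) + (LINT x|lborel. \<bar>g (h n + x) - g x\<bar>)) \<longlonglongrightarrow> 0"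
      using tendsto_add[OF add.IH] by simp
    show "\<forall>\<^sub>F n in sequentially. norm (LINT x|lborel. \<bar>f (h n + x) + g (h n + x) - (f x + g x)\<bar>)
       \<le> (LINT x|lborel. \<bar>f (h n + x) - f x\<bar>) + (LINT x|lborel. \<bar>g (h n + x) - g x\<bar>)"
    proof (intro always_eventually allI)
      fix n
      have i: "integrable lborel (\<lambda>x. f (h n + x))" "integrable lborel (\<lambda>x. g (h n + x))"
        using lpres_integrable[OF lpres_translate] add by auto
      have "(LINT x|lborel. \<bar>f (h n + x) + g (h n + x) - (f x + g x)\<bar>) \<le>
        (LINT x|lborel. \<bar>f (h n + x) - f x\<bar> + \<bar>g (h n + x) - g x\<bar>)"
        using i add by (intro integral_mono) auto
      also have "\<dots> = (LINT x|lborel. \<bar>f (h n + x) - f x\<bar>) + (LINT x|lborel. \<bar>g (h n + x) - g x\<bar>)"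
        using i add by simp
      finally show "norm (LINT x|lborel. \<bar>f (h n + x) + g (h n + x) - (f x + g x)\<bar>) \<le> \<dots>" by simp
    qed
  qed
next
  case (lim f s)
  show ?case
  proof (rule l1_translation_approx[OF lim(4)])
    fix e :: real assume e: "0 < e"
    have "(\<lambda>i. LINT x|lborel. \<bar>f x - s i x\<bar>) \<longlonglongrightarrow> (LINT (x::'a)|lborel. (0::real))"
    proof (rule integral_dominated_convergence[where w="\<lambda>x. 3 * \<bar>f x\<bar>"])
      show "AE x in lborel. (\<lambda>i. \<bar>f x - s i x\<bar>) \<longlonglongrightarrow> 0"
      proof (rule AE_I2)
        fix x
        have "(\<lambda>i. s i x) \<longlonglongrightarrow> f x" using lim(2) by simp
        from tendsto_rabs[OF tendsto_diff[OF tendsto_const[of "f x"] this]] show "(\<lambda>i. \<bar>f x - s i x\<bar>) \<longlonglongrightarrow> 0" by simp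
      qed
      show "AE x in lborel. norm \<bar>f x - s i x\<bar> \<le> 3 * \<bar>f x\<bar>" for i
        using lim(3)[of _ i] by (auto intro!: AE_I2 order_trans[OF abs_triangle_ineq4])
    qed (use lim in \<open>auto intro: borel_measurable_integrable\<close>)
    from LIMSEQ_D[OF this e] obtain i where "norm ((LINT x|lborel. \<bar>f x - s i x\<bar>) - (LINT (x::'a)|lborel. (0::real))) < e" by blast
    thus "\<exists>g. integrable lborel g \<and> (LINT x|lborel. \<bar>f x - g x\<bar>) < e \<and>
      (\<lambda>n. LINT x|lborel. \<bar>g (h n + x) - g x\<bar>) \<longlonglongrightarrow> 0"
      using lim by (intro exI[of _ "s i"]) auto
  qed
qed

text \<open>For a, b \<ge> 0 one has (a - b)^2 \<le> |a^2 - b^2|, so the claim reduces to the L^1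
  case applied to the square of \<open>u\<close>. Functions of any sign are then split into positive
  and negative parts.\<close>

lemma l2_translation_nonneg:
  fixes h :: "nat \<Rightarrow> 'a::euclidean_space"
  assumes u: "l2 u" and pos: "\<And>x. 0 \<le> u x" and h: "h \<longlonglongrightarrow> 0"
  shows "l2lim (\<lambda>n x. u (h n + x)) u sequentially"
proof (rule l2lim_bound)
  have t: "l2 (\<lambda>x. u (h n + x))" for n
    using lpres_l2[OF lpres_translate u] by simp
  show "\<forall>\<^sub>F n in sequentially. l2 (\<lambda>x. u (h n + x))" using t by simp
  show "(\<lambda>n. LINT x|lborel. \<bar>(u (h n + x))\<^sup>2 - (u x)\<^sup>2\<bar>) \<longlonglongrightarrow> 0"
    by (rule l1_translation[OF l2_integrable[OF u] h])
  show "\<forall>\<^sub>F n in sequentially. n2 (\<lambda>x. u (h n + x) - u x) \<le> (LINT x|lborel. \<bar>(u (h n + x))\<^sup>2 - (u x)\<^sup>2\<bar>)"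
  proof (intro always_eventually allI)
    fix n
    show "n2 (\<lambda>x. u (h n + x) - u x) \<le> (LINT x|lborel. \<bar>(u (h n + x))\<^sup>2 - (u x)\<^sup>2\<bar>)"
      unfolding n2_def
    proof (rule integral_mono)
      show "integrable lborel (\<lambda>x. (u (h n + x) - u x)\<^sup>2)" using l2_diff[OF t u] by (simp add: l2_def)
      show "integrable lborel (\<lambda>x. \<bar>(u (h n + x))\<^sup>2 - (u x)\<^sup>2\<bar>)"
        using t u by (intro integrable_abs Bochner_Integration.integrable_diff) (auto simp: l2_def)
      fix x
      have "(u (h n + x) - u x)\<^sup>2 = \<bar>u (h n + x) - u x\<bar> * \<bar>u (h n + x) - u x\<bar>"
        by (simp add: power2_eq_square)
      also have "\<dots> \<le> \<bar>u (h n + x) - u x\<bar> * \<bar>u (h n + x) + u x\<bar>"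
        using pos[of "h n + x"] pos[of x] by (intro mult_left_mono) auto
      also have "\<dots> = \<bar>(u (h n + x))\<^sup>2 - (u x)\<^sup>2\<bar>"
        by (simp add: abs_mult[symmetric] power2_eq_square algebra_simps)
      finally show "(u (h n + x) - u x)\<^sup>2 \<le> \<bar>(u (h n + x))\<^sup>2 - (u x)\<^sup>2\<bar>" .
    qed
  qed
qed (use u in auto)

lemma l2_translation:
  fixes h :: "nat \<Rightarrow> 'a::euclidean_space"
  assumes u: "l2 u" and h: "h \<longlonglongrightarrow> 0"
  shows "l2lim (\<lambda>n x. u (h n + x)) u sequentially"
proof -
  have [measurable]: "u \<in> borel_measurable borel" using u by (simp add: l2_def)
  have "l2 (\<lambda>x. max 0 (u x))" "l2 (\<lambda>x. max 0 (- u x))"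
    by (rule l2_bound(1)[where v=u and C=1]; use u in \<open>auto\<close>)+
  hence "l2lim (\<lambda>n x. max 0 (u (h n + x)) - max 0 (- u (h n + x))) (\<lambda>x. max 0 (u x) - max 0 (- u x)) sequentially"
    by (intro l2lim_diff l2_translation_nonneg[OF _ _ h]) auto
  moreover have "max 0 a - max 0 (- a) = a" for a :: real by auto
  ultimately show ?thesis by simp
qed

lemma l2_translation_at:
  fixes u :: "'a::euclidean_space \<Rightarrow> real"
  assumes u: "l2 u"
  shows "((\<lambda>h. n2 (\<lambda>x. u (h + x) - u x)) \<longlongrightarrow> 0) (at 0)"
  unfolding tendsto_at_iff_sequentially comp_def
  using l2_translation[OF u] by (auto simp: l2lim_def)

section \<open>Convolution of square integrable functions with continuous kernels of compact
  support\<close>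

definition ckernel :: "('a::euclidean_space \<Rightarrow> real) \<Rightarrow> bool" where
  "ckernel k \<longleftrightarrow> continuous_on UNIV k \<and> (\<exists>r. \<forall>x. r < norm x \<longrightarrow> k x = 0)"

definition conv :: "('a::euclidean_space \<Rightarrow> real) \<Rightarrow> ('a \<Rightarrow> real) \<Rightarrow> 'a \<Rightarrow> real" where
  "conv u k x = (LINT y|lborel. u y * k (x - y))"

lemma kernel_meas: "ckernel k \<Longrightarrow> k \<in> borel_measurable borel"
  by (simp add: ckernel_def borel_measurable_continuous_onI)

lemma kernel_integrable: assumes "ckernel k" shows "integrable lborel k"
proof -
  obtain r where r: "\<And>x. r < norm x \<Longrightarrow> k x = 0" using assms by (auto simp: ckernel_def)
  have "integrable lborel (\<lambda>x. indicator (cball 0 r) x *\<^sub>R k x)"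
    using assms by (intro borel_integrable_compact) (auto simp: ckernel_def intro: continuous_on_subset)
  moreover have "(\<lambda>x. indicator (cball 0 r) x *\<^sub>R k x) = k"
  proof
    fix x show "indicator (cball 0 r) x *\<^sub>R k x = k x" using r[of x] by (cases "norm x \<le> r") auto
  qed
  ultimately show ?thesis by simp
qed

lemma kernel_l2: assumes "ckernel k" shows "l2 k"
proof -
  have "ckernel (\<lambda>x. (k x)\<^sup>2)" using assms by (auto simp: ckernel_def intro!: continuous_intros)
  from kernel_integrable[OF this] kernel_meas[OF assms] show ?thesis by (simp add: l2_def)
qed

lemma kernel_bound: assumes "ckernel k" obtains B where "\<And>x. \<bar>k x\<bar> \<le> B"
proof -
  obtain r where r: "\<And>x. r < norm x \<Longrightarrow> k x = 0" using assms by (auto simp: ckernel_def)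
  have "compact (k ` cball 0 r)"
    using assms by (intro compact_continuous_image) (auto simp: ckernel_def intro: continuous_on_subset)
  then obtain B where B: "\<And>y. y \<in> k ` cball 0 r \<Longrightarrow> norm y \<le> B"
    using compact_imp_bounded bounded_iff by metis
  have "\<bar>k x\<bar> \<le> max B 0" for x
    using B[of "k x"] r[of x] by (cases "norm x \<le> r") auto
  thus thesis by (rule that)
qed

lemma l2_kernel_shift: assumes "ckernel k" shows "l2 (\<lambda>y. k (x - y))" "n2 (\<lambda>y. k (x - y)) = n2 k"
  using lpres_l2[OF lpres_reflect kernel_l2[OF assms]] by auto

lemma conv_integrable: "l2 u \<Longrightarrow> ckernel k \<Longrightarrow> integrable lborel (\<lambda>y. u y * k (x - y))"
  by (intro l2_mult_integrable l2_kernel_shift)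

lemma conv_bound: "l2 u \<Longrightarrow> ckernel k \<Longrightarrow> \<bar>conv u k x\<bar> \<le> sqrt (n2 u) * sqrt (n2 k)"
  unfolding conv_def using cauchy_schwarz[of u "\<lambda>y. k (x - y)"] l2_kernel_shift[of k x] by simp

lemma conv_add: "l2 u \<Longrightarrow> l2 v \<Longrightarrow> ckernel k \<Longrightarrow> conv (\<lambda>x. u x + v x) k x = conv u k x + conv v k x"
  unfolding conv_def by (simp add: distrib_right conv_integrable)
lemma conv_diff: "l2 u \<Longrightarrow> l2 v \<Longrightarrow> ckernel k \<Longrightarrow> conv (\<lambda>x. u x - v x) k x = conv u k x - conv v k x"
  unfolding conv_def by (simp add: left_diff_distrib conv_integrable)
lemma conv_cmult: "conv (\<lambda>x. c * u x) k x = c * conv u k x"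
  unfolding conv_def by (simp add: mult.assoc)
lemma conv_divide: "conv (\<lambda>x. u x / c) k x = conv u k x / c"
  using conv_cmult[of "1/c" u k x] by simp

lemma conv_sum: "finite I \<Longrightarrow> (\<And>i. i \<in> I \<Longrightarrow> l2 (u i)) \<Longrightarrow> ckernel k \<Longrightarrow>
    conv (\<lambda>x. \<Sum>i\<in>I. u i x) k x = (\<Sum>i\<in>I. conv (u i) k x)"
proof (induction I rule: finite_induct)
  case empty thus ?case by (simp add: conv_def)
next
  case (insert a I) thus ?case by (simp add: conv_add l2_sum)
qed

lemma conv_sum_kernel: "finite I \<Longrightarrow> (\<And>i. i \<in> I \<Longrightarrow> ckernel (k i)) \<Longrightarrow> l2 u \<Longrightarrow>
    conv u (\<lambda>x. \<Sum>i\<in>I. k i x) x = (\<Sum>i\<in>I. conv u (k i) x)"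
  unfolding conv_def by (simp add: sum_distrib_left conv_integrable)

lemma conv_cong_AE: 
  assumes "u \<in> borel_measurable borel" "v \<in> borel_measurable borel" "ckernel k" "AE x in lborel. u x = v x" 
  shows "conv u k x = conv v k x"
proof -
  have [measurable]: "(\<lambda>y. k (x - y)) \<in> borel_measurable borel"
    using l2_kernel_shift[OF assms(3)] by (simp add: l2_def)
  show ?thesis unfolding conv_def using assms by (intro integral_cong_AE) (auto)
qed

lemma conv_continuous: assumes "l2 u" "ckernel k" shows "continuous_on UNIV (conv u k)"
  unfolding continuous_on_sequentially comp_def
proof (intro allI ballI impI)
  fix X x assume "(\<forall>n::nat. X n \<in> UNIV) \<and> X \<longlonglongrightarrow> (x::'a)"
  hence "(\<lambda>n. X n - x) \<longlonglongrightarrow> x - x" by (intro tendsto_diff) auto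
  hence l: "l2lim (\<lambda>n z. k ((X n - x) + z)) k sequentially"
    by (intro l2_translation kernel_l2 assms) simp
  have "l2lim (\<lambda>n y. k (X n - y)) (\<lambda>y. k (x - y)) sequentially"
  proof (rule l2limI)
    have "n2 (\<lambda>y. k (X n - y) - k (x - y)) = n2 (\<lambda>z. k ((X n - x) + z) - k z)" for n
    proof -
      have "l2 (\<lambda>z. k ((X n - x) + z) - k z)"
        by (intro l2_diff kernel_l2 lpres_l2[OF lpres_translate] assms)
      from lpres_l2(2)[OF lpres_reflect[of x] this] show ?thesis by simp
    qed
    thus "(\<lambda>n. n2 (\<lambda>y. k (X n - y) - k (x - y))) \<longlonglongrightarrow> 0"
      using l by (simp add: l2lim_def)
  qed (use l2_kernel_shift(1)[OF assms(2)] assms in auto)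
  from l2lim_pair[OF l2lim_const[OF assms(1)] this] show "(\<lambda>n. conv u k (X n)) \<longlonglongrightarrow> conv u k x"
    unfolding conv_def .
qed

lemma conv_meas: "l2 u \<Longrightarrow> ckernel k \<Longrightarrow> conv u k \<in> borel_measurable borel"
  by (intro borel_measurable_continuous_onI conv_continuous)

text \<open>Young's inequality. The kernel is written as sqrt|k| times sgn(k) sqrt|k|;
  Cauchy-Schwarz leaves one factor of the L^1 norm of \<open>k\<close>, and exchanging the integrals
  produces the second.\<close>

lemma conv_l2: assumes u: "l2 u" and k: "ckernel k"
  shows "l2 (conv u k)" "n2 (conv u k) \<le> (LINT x|lborel. \<bar>k x\<bar>)\<^sup>2 * n2 u"
proof -
  define K where "K = (LINT x|lborel. \<bar>k x\<bar>)"
  have K0: "0 \<le> K" unfolding K_def by simp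
  obtain B where B: "\<And>x. \<bar>k x\<bar> \<le> B" using kernel_bound[OF k] by blast
  have [measurable]: "k \<in> borel_measurable borel" "u \<in> borel_measurable borel"
    using kernel_meas[OF k] u by (auto simp: l2_def)
  have int_abs: "integrable lborel (\<lambda>y. \<bar>k (x - y)\<bar>)" for x
    using lpres_integrable[OF lpres_reflect kernel_integrable[OF k]] by simp
  have inv1p: "integrable lborel (\<lambda>y. (u y)\<^sup>2 * \<bar>k (x - y)\<bar>)" for x
  proof (rule Bochner_Integration.integrable_bound)
    show "integrable lborel (\<lambda>y. B * (u y)\<^sup>2)" using u by (simp add: l2_def)
    show "AE y in lborel. norm ((u y)\<^sup>2 * \<bar>k (x - y)\<bar>) \<le> norm (B * (u y)\<^sup>2)"
      using B by (auto intro!: AE_I2 mult_right_mono simp: abs_mult mult.commute[of "(u _)\<^sup>2"] intro: order_trans[OF B])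
  qed simp
  have pt: "(conv u k x)\<^sup>2 \<le> K * (LINT y|lborel. (u y)\<^sup>2 * \<bar>k (x - y)\<bar>)" for x
  proof -
    have a: "l2 (\<lambda>y. u y * sqrt \<bar>k (x - y)\<bar>)" "n2 (\<lambda>y. u y * sqrt \<bar>k (x - y)\<bar>) = (LINT y|lborel. (u y)\<^sup>2 * \<bar>k (x - y)\<bar>)"
      using inv1p[of x] by (auto simp: l2_def n2_def power_mult_distrib)
    have s: "(sgn a)\<^sup>2 * \<bar>a\<bar> = \<bar>a\<bar>" for a :: real by (auto simp: sgn_if)
    have b: "l2 (\<lambda>y. sgn (k (x - y)) * sqrt \<bar>k (x - y)\<bar>)" "n2 (\<lambda>y. sgn (k (x - y)) * sqrt \<bar>k (x - y)\<bar>) = K"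
      using int_abs[of x] lpres_integral[OF lpres_reflect[of x], of "\<lambda>y. \<bar>k y\<bar>"]
      by (auto simp: l2_def n2_def power_mult_distrib s K_def)
    have c: "sqrt \<bar>a\<bar> * (sgn a * sqrt \<bar>a\<bar>) = a" for a :: real
      by (simp add: mult.left_commute sgn_mult_abs)
    have "conv u k x = (LINT y|lborel. (u y * sqrt \<bar>k (x - y)\<bar>) * (sgn (k (x - y)) * sqrt \<bar>k (x - y)\<bar>))"
      unfolding conv_def mult.assoc c ..
    thus ?thesis using cauchy_schwarz_sq[OF a(1) b(1)] unfolding a(2) b(2) by (simp add: mult.commute)
  qed
  have "(\<integral>\<^sup>+x. ennreal ((conv u k x)\<^sup>2) \<partial>lborel) \<le> (\<integral>\<^sup>+x. ennreal K * (\<integral>\<^sup>+y. ennreal ((u y)\<^sup>2 * \<bar>k (x - y)\<bar>) \<partial>lborel) \<partial>lborel)"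
  proof (rule nn_integral_mono)
    fix x
    have "ennreal ((conv u k x)\<^sup>2) \<le> ennreal (K * (LINT y|lborel. (u y)\<^sup>2 * \<bar>k (x - y)\<bar>))"
      by (rule ennreal_leI[OF pt])
    also have "\<dots> = ennreal K * (\<integral>\<^sup>+y. ennreal ((u y)\<^sup>2 * \<bar>k (x - y)\<bar>) \<partial>lborel)"
      using K0 by (subst nn_integral_eq_integral[OF inv1p]) (auto simp: ennreal_mult)
    finally show "ennreal ((conv u k x)\<^sup>2) \<le> \<dots>" .
  qed
  also have "\<dots> = ennreal K * (\<integral>\<^sup>+x. (\<integral>\<^sup>+y. ennreal ((u y)\<^sup>2 * \<bar>k (x - y)\<bar>) \<partial>lborel) \<partial>lborel)"
    by (rule nn_integral_cmult) measurable
  also have "(\<integral>\<^sup>+x. (\<integral>\<^sup>+y. ennreal ((u y)\<^sup>2 * \<bar>k (x - y)\<bar>) \<partial>lborel) \<partial>lborel)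
      = (\<integral>\<^sup>+y. (\<integral>\<^sup>+x. ennreal ((u y)\<^sup>2 * \<bar>k (x - y)\<bar>) \<partial>lborel) \<partial>lborel)"
    by (rule lborel_pair.Fubini') measurable
  also have "\<dots> = (\<integral>\<^sup>+y. ennreal ((u y)\<^sup>2) * ennreal K \<partial>lborel)"
  proof (rule nn_integral_cong)
    fix y
    have "(\<integral>\<^sup>+x. ennreal ((u y)\<^sup>2 * \<bar>k (x - y)\<bar>) \<partial>lborel) = ennreal ((u y)\<^sup>2) * (\<integral>\<^sup>+x. ennreal \<bar>k (x - y)\<bar> \<partial>lborel)"
      by (simp add: ennreal_mult nn_integral_cmult)
    also have "(\<integral>\<^sup>+x. ennreal \<bar>k (x - y)\<bar> \<partial>lborel) = (\<integral>\<^sup>+x. ennreal \<bar>k x\<bar> \<partial>lborel)"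
      using lpres_nn_integral[OF lpres_translate[of "-y"], of "\<lambda>x. ennreal \<bar>k x\<bar>"] by simp
    also have "\<dots> = ennreal K"
      unfolding K_def using kernel_integrable[OF k] by (intro nn_integral_eq_integral) auto
    finally show "(\<integral>\<^sup>+x. ennreal ((u y)\<^sup>2 * \<bar>k (x - y)\<bar>) \<partial>lborel) = ennreal ((u y)\<^sup>2) * ennreal K" .
  qed
  also have "\<dots> = ennreal (n2 u) * ennreal K"
    by (subst nn_integral_multc) (auto simp: nn_n2[OF u])
  also have "ennreal K * (ennreal (n2 u) * ennreal K) = ennreal (K\<^sup>2 * n2 u)"
    using K0 by (simp add: ennreal_mult[symmetric] power2_eq_square mult_ac)
  finally have f: "(\<integral>\<^sup>+x. ennreal ((conv u k x)\<^sup>2) \<partial>lborel) \<le> ennreal (K\<^sup>2 * n2 u)" .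
  show "l2 (conv u k)" "n2 (conv u k) \<le> (LINT x|lborel. \<bar>k x\<bar>)\<^sup>2 * n2 u"
    using l2I_nn[OF conv_meas[OF u k] f] by (auto simp: K_def)
qed

lemma l2lim_conv: assumes "l2lim f u F" "ckernel k"
  shows "l2lim (\<lambda>i. conv (f i) k) (conv u k) F"
proof (rule l2lim_bound)
  have e: "\<forall>\<^sub>F i in F. l2 (f i)" "l2 u" using assms by (auto simp: l2lim_def)
  show "\<forall>\<^sub>F i in F. l2 (conv (f i) k)" using e(1) by eventually_elim (intro conv_l2 assms)
  show "l2 (conv u k)" by (intro conv_l2 e assms)
  show "\<forall>\<^sub>F i in F. n2 (\<lambda>x. conv (f i) k x - conv u k x) \<le> (LINT x|lborel. \<bar>k x\<bar>)\<^sup>2 * n2 (\<lambda>x. f i x - u x)"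
    using e(1)
  proof eventually_elim
    case (elim i)
    have "(\<lambda>x. conv (f i) k x - conv u k x) = conv (\<lambda>x. f i x - u x) k"
      using conv_diff[OF elim e(2) assms(2)] by auto
    thus ?case using conv_l2(2)[OF l2_diff(1)[OF elim e(2)] assms(2)] by simp
  qed
  show "((\<lambda>i. (LINT x|lborel. \<bar>k x\<bar>)\<^sup>2 * n2 (\<lambda>x. f i x - u x)) \<longlongrightarrow> 0) F"
    using assms(1) unfolding l2lim_def by (auto intro!: tendsto_mult_right_zero)
qed

lemma l2cont_conv: "l2cont u \<Longrightarrow> ckernel k \<Longrightarrow> l2cont (\<lambda>t. conv (u t) k)"
  by (intro l2contI conv_l2 l2lim_conv) (auto simp: l2cont_def)

lemma l2deriv_conv: assumes "l2cont u" "l2deriv u u'" "ckernel k"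
  shows "l2deriv (\<lambda>t. conv (u t) k) (\<lambda>t. conv (u' t) k)"
  unfolding l2deriv_def
proof (intro allI impI)
  fix t :: real assume t: "0 \<le> t"
  let ?F = "at t within {0..}"
  have l: "l2lim (\<lambda>s. conv (\<lambda>x. (u s x - u t x) / (s - t)) k) (conv (u' t) k) ?F"
    using assms t by (intro l2lim_conv) (auto simp: l2deriv_def)
  have eq: "\<forall>\<^sub>F s in ?F. conv (\<lambda>x. (u s x - u t x) / (s - t)) k = (\<lambda>x. (conv (u s) k x - conv (u t) k x) / (s - t))"
    using eventually_nonneg_within
    by eventually_elim (use assms t in \<open>auto simp: conv_divide conv_diff l2cont_l2\<close>)
  show "l2lim (\<lambda>s x. (conv (u s) k x - conv (u t) k x) / (s - t)) (conv (u' t) k) ?F"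
  proof (rule l2limI)
    show "\<forall>\<^sub>F s in ?F. l2 (\<lambda>x. (conv (u s) k x - conv (u t) k x) / (s - t))"
      using eq conjunct1[OF l[unfolded l2lim_def]] by eventually_elim simp
    show "l2 (conv (u' t) k)" using l by (simp add: l2lim_def)
    show "((\<lambda>s. n2 (\<lambda>x. (conv (u s) k x - conv (u t) k x) / (s - t) - conv (u' t) k x)) \<longlongrightarrow> 0) ?F"
    proof (rule Lim_transform_eventually)
      show "((\<lambda>s. n2 (\<lambda>x. conv (\<lambda>x. (u s x - u t x) / (s - t)) k x - conv (u' t) k x)) \<longlongrightarrow> 0) ?F"
        using l by (simp add: l2lim_def)
      show "\<forall>\<^sub>F s in ?F. n2 (\<lambda>x. conv (\<lambda>x. (u s x - u t x) / (s - t)) k x - conv (u' t) k x) =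
         n2 (\<lambda>x. (conv (u s) k x - conv (u t) k x) / (s - t) - conv (u' t) k x)"
        using eq by eventually_elim simp
    qed
  qed
qed

section \<open>Directional derivatives\<close>

text \<open>Integrating \<open>g'\<close> along the segment from x to x + b gives g(x+b) - g(x),
  whose integral over x is 0 by translation invariance; the order of integration can be exchanged,
  and every translate of \<open>g'\<close> has the same integral. Integrability of \<open>g\<close>
  and \<open>g'\<close> replaces compact support and cutoffs.\<close>

lemma integral_directional_derivative_zero:
  fixes g g' :: "'a::euclidean_space \<Rightarrow> real"
  assumes d: "\<And>x s. ((\<lambda>s. g (x + s *\<^sub>R b)) has_real_derivative g' (x + s *\<^sub>R b)) (at s)"
    and c: "continuous_on UNIV g'" and i: "integrable lborel g" "integrable lborel g'"
  shows "(LINT x|lborel. g' x) = 0"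
proof -
  have [measurable]: "g' \<in> borel_measurable borel" using c by (rule borel_measurable_continuous_onI)
  have ftc: "(LINT s|lborel. indicator {0..1} s * g' (x + s *\<^sub>R b)) = g (x + b) - g x" for x
  proof -
    have "continuous_on UNIV (\<lambda>s. g' (x + s *\<^sub>R b))"
      by (intro continuous_on_compose2[OF c] continuous_intros) auto
    hence "(LINT s|lborel. g' (x + s *\<^sub>R b) * indicator {0..1} s) = g (x + 1 *\<^sub>R b) - g (x + 0 *\<^sub>R b)"
      using d by (intro integral_FTC_Icc_real) (auto simp: continuous_on_eq_continuous_at)
    thus ?thesis by (simp add: mult.commute)
  qed
  have tr: "integrable lborel (\<lambda>x. g' (x + s *\<^sub>R b))" "(LINT x|lborel. g' (x + s *\<^sub>R b)) = (LINT x|lborel. g' x)"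
    "(LINT x|lborel. \<bar>g' (x + s *\<^sub>R b)\<bar>) = (LINT x|lborel. \<bar>g' x\<bar>)" for s
    using lpres_integrable[OF lpres_translate[of "s *\<^sub>R b"] i(2)] lpres_integral[OF lpres_translate[of "s *\<^sub>R b"], of g']
      lpres_integral[OF lpres_translate[of "s *\<^sub>R b"], of "\<lambda>x. \<bar>g' x\<bar>"]
    by (auto simp: add.commute)
  have "integrable (lborel \<Otimes>\<^sub>M lborel) (\<lambda>(s::real, x). indicator {0..1} s * g' (x + s *\<^sub>R b))"
  proof (rule lborel_pair.Fubini_integrable)
    show "integrable lborel (\<lambda>s. LINT x|lborel. norm (case (s, x) of (s::real, x) \<Rightarrow> indicator {0..1} s * g' (x + s *\<^sub>R b)))"
      by (simp add: abs_mult tr)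
    show "AE s in lborel. integrable lborel (\<lambda>x. case (s, x) of (s::real, x) \<Rightarrow> indicator {0..1} s * g' (x + s *\<^sub>R b))"
      using tr by simp
  qed measurable
  from lborel_pair.Fubini_integral[OF this]
  have "(LINT x|lborel. LINT s|lborel. indicator {0..1} s * g' (x + s *\<^sub>R b)) = 
      (LINT s|lborel. LINT x|lborel. indicator {0..(1::real)} s * g' (x + s *\<^sub>R b))" .
  also have "\<dots> = (LINT x|lborel. g' x)" by (simp add: tr)
  also have "(LINT x|lborel. LINT s|lborel. indicator {0..1} s * g' (x + s *\<^sub>R b)) = (LINT x|lborel. g (x + b) - g x)"
    by (simp only: ftc)
  also have "\<dots> = (LINT x|lborel. g (b + x)) - (LINT x|lborel. g x)"
    using i lpres_integrable[OF lpres_translate[of b] i(1)] by (simp add: add.commute)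
  also have "\<dots> = 0" using lpres_integral[OF lpres_translate[of b], of g] i(1) by simp
  finally show ?thesis by simp
qed

text \<open>Minkowski's inequality for integrals in squared form: Cauchy-Schwarz in the parameter
  gives one factor b - a, and integrating the bound \<open>B\<close> over the parameter interval
  gives the other.\<close>

lemma average_l2:
  fixes G :: "real \<Rightarrow> 'a::euclidean_space \<Rightarrow> real"
  assumes ab: "a \<le> b"
    and m: "(\<lambda>(\<tau>, x). indicator {a..b} \<tau> * G \<tau> x) \<in> borel_measurable (lborel \<Otimes>\<^sub>M lborel)"
    and c: "\<And>x. continuous_on {a..b} (\<lambda>\<tau>. G \<tau> x)"
    and l: "\<And>\<tau>. \<tau> \<in> {a..b} \<Longrightarrow> l2 (G \<tau>)" "\<And>\<tau>. \<tau> \<in> {a..b} \<Longrightarrow> n2 (G \<tau>) \<le> B"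
    and w: "w \<in> borel_measurable borel" "\<And>x. w x = (LINT \<tau>|lborel. indicator {a..b} \<tau> * G \<tau> x)"
  shows "l2 w" "n2 w \<le> (b - a)\<^sup>2 * B"
proof -
  let ?I = "indicator {a..b} :: real \<Rightarrow> real"
  have B: "0 \<le> B" using order_trans[OF n2_nonneg l(2)[of a]] ab by simp
  have lx: "l2 (\<lambda>\<tau>. ?I \<tau> * G \<tau> x)" for x
  proof -
    have "continuous_on {a..b} (\<lambda>\<tau>. (G \<tau> x)\<^sup>2)" by (intro continuous_intros c)
    from borel_integrable_compact[OF compact_Icc this]
    have "integrable lborel (\<lambda>\<tau>. (?I \<tau> * G \<tau> x)\<^sup>2)"
      by (rule back_subst[where P="integrable lborel"]) (auto simp: indicator_def)
    moreover have "(\<lambda>\<tau>. ?I \<tau> * G \<tau> x) \<in> borel_measurable borel"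
      using borel_measurable_continuous_on_indicator[OF _ c[of x]] by simp
    ultimately show ?thesis by (simp add: l2_def)
  qed
  have li: "l2 ?I" "n2 ?I = b - a"
    using ab by (auto simp: l2_def n2_def power2_eq_square indicator_inter_arith[symmetric])
  have pt: "(w x)\<^sup>2 \<le> (b - a) * n2 (\<lambda>\<tau>. ?I \<tau> * G \<tau> x)" for x
  proof -
    have "w x = (LINT \<tau>|lborel. ?I \<tau> * (?I \<tau> * G \<tau> x))"
      unfolding w(2) by (intro Bochner_Integration.integral_cong) (auto simp: indicator_def)
    thus ?thesis using cauchy_schwarz_sq[OF li(1) lx[of x]] li(2) by simp
  qed
  have m2[measurable]: "(\<lambda>(\<tau>, x). ?I \<tau> * G \<tau> x) \<in> borel_measurable (lborel \<Otimes>\<^sub>M lborel)" by (rule m)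
  have "(\<integral>\<^sup>+x. ennreal ((w x)\<^sup>2) \<partial>lborel) \<le> (\<integral>\<^sup>+x. ennreal (b - a) * (\<integral>\<^sup>+\<tau>. ennreal ((?I \<tau> * G \<tau> x)\<^sup>2) \<partial>lborel) \<partial>lborel)"
  proof (rule nn_integral_mono)
    fix x
    have "ennreal ((w x)\<^sup>2) \<le> ennreal ((b - a) * n2 (\<lambda>\<tau>. ?I \<tau> * G \<tau> x))" by (rule ennreal_leI[OF pt])
    also have "\<dots> = ennreal (b - a) * (\<integral>\<^sup>+\<tau>. ennreal ((?I \<tau> * G \<tau> x)\<^sup>2) \<partial>lborel)"
      using ab by (simp add: nn_n2[OF lx] ennreal_mult)
    finally show "ennreal ((w x)\<^sup>2) \<le> \<dots>" .
  qed
  also have "\<dots> = ennreal (b - a) * (\<integral>\<^sup>+x. (\<integral>\<^sup>+\<tau>. ennreal ((?I \<tau> * G \<tau> x)\<^sup>2) \<partial>lborel) \<partial>lborel)"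
    by (rule nn_integral_cmult) measurable
  also have "(\<integral>\<^sup>+x. (\<integral>\<^sup>+\<tau>. ennreal ((?I \<tau> * G \<tau> x)\<^sup>2) \<partial>lborel) \<partial>lborel)
      = (\<integral>\<^sup>+\<tau>. (\<integral>\<^sup>+x. ennreal ((?I \<tau> * G \<tau> x)\<^sup>2) \<partial>lborel) \<partial>lborel)"
    by (rule lborel_pair.Fubini') measurable
  also have "\<dots> \<le> (\<integral>\<^sup>+\<tau>. ennreal B * indicator {a..b} \<tau> \<partial>lborel)"
  proof (rule nn_integral_mono)
    fix \<tau>
    show "(\<integral>\<^sup>+x. ennreal ((?I \<tau> * G \<tau> x)\<^sup>2) \<partial>lborel) \<le> ennreal B * indicator {a..b} \<tau>"
      using nn_n2[OF l(1), of \<tau>] l(2)[of \<tau>] by (cases "\<tau> \<in> {a..b}") (auto simp: ennreal_leI)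
  qed
  also have "\<dots> = ennreal B * ennreal (b - a)"
    using ab by (simp add: nn_integral_cmult_indicator)
  also have "ennreal (b - a) * (ennreal B * ennreal (b - a)) = ennreal ((b - a)\<^sup>2 * B)"
    using ab B by (simp add: ennreal_mult[symmetric] power2_eq_square mult_ac)
  finally have "(\<integral>\<^sup>+x. ennreal ((w x)\<^sup>2) \<partial>lborel) \<le> ennreal ((b - a)\<^sup>2 * B)"
    by (simp add: mult_left_mono)
  from l2I_nn[OF w(1) this] B show "l2 w" "n2 w \<le> (b - a)\<^sup>2 * B" by auto
qed

text \<open>Differentiability along lines is all that integration by parts needs, and for a
  convolution it follows from a single L^2 limit of difference quotients of the kernel.\<close>

definition dir_deriv :: "'a::euclidean_space \<Rightarrow> ('a \<Rightarrow> real) \<Rightarrow> ('a \<Rightarrow> real) \<Rightarrow> bool" where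
  "dir_deriv b g g' \<longleftrightarrow> (\<forall>x s. ((\<lambda>s. g (x + s *\<^sub>R b)) has_real_derivative g' (x + s *\<^sub>R b)) (at s))"

lemma dir_derivD: "dir_deriv b g g' \<Longrightarrow> ((\<lambda>s. g (x + s *\<^sub>R b)) has_real_derivative g' (x + s *\<^sub>R b)) (at s)"
  by (simp add: dir_deriv_def)

lemma dir_derivI: assumes "\<And>x. ((\<lambda>s. g (x + s *\<^sub>R b)) has_real_derivative g' x) (at 0)" shows "dir_deriv b g g'"
  unfolding dir_deriv_def
proof (intro allI)
  fix x s
  have "((\<lambda>r. g ((x + s *\<^sub>R b) + r *\<^sub>R b)) has_real_derivative g' (x + s *\<^sub>R b)) (at 0)" by (rule assms)
  hence "((\<lambda>r. g (x + (s + r) *\<^sub>R b)) has_real_derivative g' (x + s *\<^sub>R b)) (at 0)"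
    by (simp add: algebra_simps)
  thus "((\<lambda>s. g (x + s *\<^sub>R b)) has_real_derivative g' (x + s *\<^sub>R b)) (at s)"
    using DERIV_shift[of "\<lambda>r. g (x + r *\<^sub>R b)" "g' (x + s *\<^sub>R b)" 0 s] by (simp add: add.commute)
qed

lemma dir_deriv_mult: "dir_deriv b f f' \<Longrightarrow> dir_deriv b g g' \<Longrightarrow> dir_deriv b (\<lambda>x. f x * g x) (\<lambda>x. f' x * g x + f x * g' x)"
  unfolding dir_deriv_def by (auto intro!: derivative_eq_intros)

text \<open>The difference quotient minus \<open>k'\<close> is the mean over \<tau> in [0,1] of k'(z
  + \<tau> h b) - k'(z). By \<open>average_l2\<close> its norm is controlled by that of small
  translations of \<open>k'\<close>.\<close>

lemma kernel_quotient:
  assumes k: "ckernel k" "ckernel k'" "dir_deriv b k k'"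
  shows "l2lim (\<lambda>h z. (k (z + h *\<^sub>R b) - k z) / h) k' (at 0)"
proof (rule l2limI)
  have lt: "l2 (\<lambda>z. k (z + h *\<^sub>R b))" "l2 (\<lambda>z. k' (z + h *\<^sub>R b))" for h
    using lpres_l2(1)[OF lpres_translate[of "h *\<^sub>R b"]] kernel_l2 k by (auto simp: add.commute)
  have lq: "l2 (\<lambda>z. (k (z + h *\<^sub>R b) - k z) / h)" for h
    using l2_cmult[OF l2_diff(1)[OF lt(1) kernel_l2[OF k(1)]], of "1/h"] by simp
  show "\<forall>\<^sub>F h in at 0. l2 (\<lambda>z. (k (z + h *\<^sub>R b) - k z) / h)" using lq by simp
  show lk': "l2 k'" by (rule kernel_l2[OF k(2)])
  have [measurable]: "k \<in> borel_measurable borel" "k' \<in> borel_measurable borel" using k kernel_meas by auto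
  have ck': "continuous_on UNIV k'" using k by (simp add: ckernel_def)
  show "((\<lambda>h. n2 (\<lambda>z. (k (z + h *\<^sub>R b) - k z) / h - k' z)) \<longlongrightarrow> 0) (at 0)"
  proof (rule tendstoI)
    fix e :: real assume e: "0 < e"
    have "((\<lambda>y. n2 (\<lambda>x. k' (y + x) - k' x)) \<longlongrightarrow> 0) (at 0)" by (rule l2_translation_at[OF lk'])
    from tendstoD[OF this, of "e/2"] e obtain d where d: "0 < d"
      "\<And>y. y \<noteq> 0 \<Longrightarrow> norm y < d \<Longrightarrow> n2 (\<lambda>x. k' (y + x) - k' x) < e / 2"
      by (auto simp: eventually_at)
    have d2: "n2 (\<lambda>x. k' (y + x) - k' x) \<le> e / 2" if "norm y < d" for y
      using d(2)[OF _ that] e by (cases "y = 0") auto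
    have "\<forall>\<^sub>F h in at 0. \<bar>h\<bar> * norm b < d"
    proof -
      have "((\<lambda>h. \<bar>h\<bar> * norm b) \<longlongrightarrow> \<bar>0\<bar> * norm b) (at (0::real))" by (intro tendsto_intros)
      thus ?thesis using d(1) by (intro order_tendstoD(2)) auto
    qed
    moreover have "\<forall>\<^sub>F h in at 0. h \<noteq> (0::real)" by (simp add: eventually_at_filter)
    ultimately show "\<forall>\<^sub>F h in at 0. dist (n2 (\<lambda>z. (k (z + h *\<^sub>R b) - k z) / h - k' z)) 0 < e"
    proof eventually_elim
      case (elim h)
      have "n2 (\<lambda>z. (k (z + h *\<^sub>R b) - k z) / h - k' z) \<le> (1 - 0)\<^sup>2 * (e / 2)"
      proof (rule average_l2(2)[where G="\<lambda>\<tau> z. k' (z + (\<tau> * h) *\<^sub>R b) - k' z"])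
        show "(\<lambda>(\<tau>, x). indicator {0..1} \<tau> * (k' (x + (\<tau> * h) *\<^sub>R b) - k' x)) \<in> borel_measurable (lborel \<Otimes>\<^sub>M lborel)"
          by measurable
        fix x
        have cx: "continuous_on UNIV (\<lambda>\<tau>. k' (x + (\<tau> * h) *\<^sub>R b) - k' x)"
          by (intro continuous_intros continuous_on_compose2[OF ck']) auto
        thus "continuous_on {0..1} (\<lambda>\<tau>. k' (x + (\<tau> * h) *\<^sub>R b) - k' x)" by (rule continuous_on_subset) simp
        have "(LINT \<tau>|lborel. (k' (x + (\<tau> * h) *\<^sub>R b) - k' x) * indicator {0..1} \<tau>) =
           (k (x + (1 * h) *\<^sub>R b) / h - 1 * k' x) - (k (x + (0 * h) *\<^sub>R b) / h - 0 * k' x)"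
        proof (rule integral_FTC_Icc_real)
          fix \<tau> :: real
          have "((\<lambda>\<tau>. k (x + (\<tau> * h) *\<^sub>R b)) has_real_derivative k' (x + (\<tau> * h) *\<^sub>R b) * h) (at \<tau>)"
            by (rule DERIV_chain2[of "\<lambda>s. k (x + s *\<^sub>R b)", OF dir_derivD[OF k(3)]]) (auto intro!: derivative_eq_intros)
          thus "((\<lambda>\<tau>. k (x + (\<tau> * h) *\<^sub>R b) / h - \<tau> * k' x) has_real_derivative k' (x + (\<tau> * h) *\<^sub>R b) - k' x) (at \<tau>)"
            using elim by (auto intro!: derivative_eq_intros)
          show "isCont (\<lambda>\<tau>. k' (x + (\<tau> * h) *\<^sub>R b) - k' x) \<tau>"
            using cx by (simp add: continuous_on_eq_continuous_at)
        qed simp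
        thus "(k (x + h *\<^sub>R b) - k x) / h - k' x = (LINT \<tau>|lborel. indicator {0..1} \<tau> * (k' (x + (\<tau> * h) *\<^sub>R b) - k' x))"
          by (simp add: mult.commute diff_divide_distrib)
      next
        fix \<tau> :: real assume \<tau>: "\<tau> \<in> {0..1}"
        show "l2 (\<lambda>z. k' (z + (\<tau> * h) *\<^sub>R b) - k' z)" by (intro l2_diff lt lk')
        have "norm ((\<tau> * h) *\<^sub>R b) \<le> 1 * \<bar>h\<bar> * norm b"
          using \<tau> by (simp add: abs_mult) (intro mult_right_mono mult_left_le_one_le; simp)
        hence "norm ((\<tau> * h) *\<^sub>R b) < d" using elim by simp
        from d2[OF this] show "n2 (\<lambda>z. k' (z + (\<tau> * h) *\<^sub>R b) - k' z) \<le> e / 2" by (simp add: add.commute)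
      qed (auto)
      thus ?case using e by simp
    qed
  qed
qed

lemma conv_dir_deriv:
  assumes u: "l2 u" and k: "ckernel k" "ckernel k'" "dir_deriv b k k'"
  shows "dir_deriv b (conv u k) (conv u k')"
proof (rule dir_derivI)
  fix x
  have "((\<lambda>h. (conv u k (x + h *\<^sub>R b) - conv u k x) / h) \<longlongrightarrow> conv u k' x) (at 0)"
  proof -
    have l: "l2lim (\<lambda>h y. (k ((x - y) + h *\<^sub>R b) - k (x - y)) / h) (\<lambda>y. k' (x - y)) (at 0)"
    proof (rule l2limI)
      note q = kernel_quotient[OF k]
      have "\<forall>\<^sub>F h in at 0. l2 (\<lambda>z. (k (z + h *\<^sub>R b) - k z) / h)" using q by (simp add: l2lim_def)
      thus "\<forall>\<^sub>F h in at 0. l2 (\<lambda>y. (k ((x - y) + h *\<^sub>R b) - k (x - y)) / h)"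
        by eventually_elim (rule lpres_l2[OF lpres_reflect])
      show "l2 (\<lambda>y. k' (x - y))" by (rule l2_kernel_shift[OF k(2)])
      have "\<forall>\<^sub>F h in at 0. n2 (\<lambda>z. (k (z + h *\<^sub>R b) - k z) / h - k' z) =
         n2 (\<lambda>y. (k ((x - y) + h *\<^sub>R b) - k (x - y)) / h - k' (x - y))"
        using \<open>\<forall>\<^sub>F h in at 0. l2 (\<lambda>z. (k (z + h *\<^sub>R b) - k z) / h)\<close>
      proof eventually_elim
        case (elim h)
        from lpres_l2(2)[OF lpres_reflect[of x] l2_diff(1)[OF elim kernel_l2[OF k(2)]]] show ?case by simp
      qed
      thus "((\<lambda>h. n2 (\<lambda>y. (k ((x - y) + h *\<^sub>R b) - k (x - y)) / h - k' (x - y))) \<longlongrightarrow> 0) (at 0)"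
        using q by (elim Lim_transform_eventually[rotated]) (simp add: l2lim_def)
    qed
    have "((\<lambda>h. LINT y|lborel. u y * ((k ((x - y) + h *\<^sub>R b) - k (x - y)) / h)) \<longlongrightarrow> conv u k' x) (at 0)"
      unfolding conv_def by (rule l2lim_pair[OF l2lim_const[OF u] l])
    moreover have "(LINT y|lborel. u y * ((k ((x - y) + h *\<^sub>R b) - k (x - y)) / h)) =
       (conv u k (x + h *\<^sub>R b) - conv u k x) / h" for h
    proof -
      have "(LINT y|lborel. u y * ((k ((x - y) + h *\<^sub>R b) - k (x - y)) / h)) =
         (LINT y|lborel. (u y * k ((x + h *\<^sub>R b) - y) - u y * k (x - y)) / h)"
        by (intro Bochner_Integration.integral_cong) (auto simp: algebra_simps)
      also have "\<dots> = (conv u k (x + h *\<^sub>R b) - conv u k x) / h"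
        unfolding conv_def using conv_integrable[OF u k(1)] by simp
      finally show ?thesis .
    qed
    ultimately show ?thesis by (simp only:)
  qed
  thus "((\<lambda>s. conv u k (x + s *\<^sub>R b)) has_real_derivative conv u k' x) (at 0)"
    by (simp add: has_field_derivative_iff)
qed

text \<open>Cauchy-Schwarz bounds the change in t uniformly in x, which leaves continuity in x at a
  fixed time. Joint continuity is what makes the time averages in \<open>l2_increment_bound\<close>
  measurable on the product.\<close>

lemma conv_joint_continuous:
  assumes u: "l2cont u" and k: "ckernel k"
  shows "continuous_on ({0..} \<times> UNIV) (\<lambda>(t, x). conv (u t) k x)"
  unfolding continuous_on_def
proof (clarify)
  fix t :: real and x :: 'a assume t: "0 \<le> t"
  let ?F = "at (t, x) within {0..} \<times> UNIV"
  have e: "\<forall>\<^sub>F p in ?F. 0 \<le> fst p" unfolding eventually_at_filter by (rule always_eventually) auto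
  have f1: "(fst \<longlongrightarrow> t) ?F" and f2: "(snd \<longlongrightarrow> x) ?F"
    using tendsto_fst[OF tendsto_ident_at] tendsto_snd[OF tendsto_ident_at] by fastforce+
  have c1: "((\<lambda>s. n2 (\<lambda>x. u s x - u t x)) \<longlongrightarrow> 0) (at t within {0..})"
    using u t by (auto simp: l2cont_def l2lim_def)
  have c1': "((\<lambda>p. n2 (\<lambda>x. u (fst p) x - u t x)) \<longlongrightarrow> 0) ?F"
  proof (rule tendstoI)
    fix e :: real assume "0 < e"
    with tendstoD[OF c1] have "\<forall>\<^sub>F s in at t within {0..}. dist (n2 (\<lambda>x. u s x - u t x)) 0 < e" by blast
    then obtain d where d: "0 < d" "\<And>s. s \<in> {0..} \<Longrightarrow> s \<noteq> t \<Longrightarrow> dist s t < d \<Longrightarrow> dist (n2 (\<lambda>x. u s x - u t x)) 0 < e"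
      by (auto simp: eventually_at)
    have "\<forall>\<^sub>F p in ?F. dist (fst p) t < d" using tendstoD[OF f1 d(1)] .
    with \<open>\<forall>\<^sub>F p in ?F. 0 \<le> fst p\<close> show "\<forall>\<^sub>F p in ?F. dist (n2 (\<lambda>x. u (fst p) x - u t x)) 0 < e"
    proof eventually_elim
      case (elim p) thus ?case using d(2)[of "fst p"] \<open>0 < e\<close> by (cases "fst p = t") auto
    qed
  qed
  have c2: "((\<lambda>p. conv (u t) k (snd p)) \<longlongrightarrow> conv (u t) k x) ?F"
    using conv_continuous[OF l2cont_l2[OF u t] k]
    by (intro continuous_on_tendsto_compose[OF _ f2]) auto
  have "((\<lambda>p. conv (u (fst p)) k (snd p) - conv (u t) k (snd p)) \<longlongrightarrow> 0) ?F"
  proof (rule Lim_null_comparison)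
    show "\<forall>\<^sub>F p in ?F. norm (conv (u (fst p)) k (snd p) - conv (u t) k (snd p)) \<le> sqrt (n2 (\<lambda>x. u (fst p) x - u t x)) * sqrt (n2 k)"
      using e
    proof eventually_elim
      case (elim p)
      have l: "l2 (u (fst p))" "l2 (u t)" using u t elim by (auto simp: l2cont_def)
      show ?case using conv_bound[OF l2_diff(1)[OF l] k, of "snd p"] by (simp add: conv_diff[OF l k])
    qed
    show "((\<lambda>p. sqrt (n2 (\<lambda>x. u (fst p) x - u t x)) * sqrt (n2 k)) \<longlongrightarrow> 0) ?F"
      using tendsto_real_sqrt[OF c1'] by (intro tendsto_mult_left_zero) simp
  qed
  from tendsto_add[OF this c2]
  show "((\<lambda>p. case p of (t, x) \<Rightarrow> conv (u t) k x) \<longlongrightarrow> conv (u t) k x) ?F"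
    by (simp add: case_prod_beta)
qed

section \<open>Smooth bump kernels\<close>

text \<open>The classical smooth function exp(-1/s), extended by 0 to s \<le> 0. The extra powers of
  s make the family closed under differentiation up to linear combinations, so that every derivative
  is explicit.\<close>

definition ebump :: "nat \<Rightarrow> real \<Rightarrow> real" where
  "ebump m s = (if s \<le> 0 then 0 else exp (- 1 / s) / s ^ m)"

lemma ebump_nonneg: "0 \<le> ebump m s" by (simp add: ebump_def)

lemma ebump_tendsto_0: "(ebump m \<longlongrightarrow> 0) (at 0)"
proof (rule filterlim_split_at)
  show "(ebump m \<longlongrightarrow> 0) (at_left 0)"
    by (rule tendsto_eventually) (auto simp: eventually_at_filter ebump_def)
  have "((\<lambda>s. (inverse s) ^ m / exp (inverse s)) \<longlongrightarrow> (0::real)) (at_right 0)"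
    by (rule filterlim_compose[OF tendsto_power_div_exp_0 filterlim_inverse_at_top_right])
  thus "(ebump m \<longlongrightarrow> 0) (at_right 0)"
  proof (rule Lim_transform_eventually)
    show "\<forall>\<^sub>F s in at_right 0. inverse s ^ m / exp (inverse s) = ebump m s"
      by (auto simp: eventually_at_filter ebump_def exp_minus field_simps)
  qed
qed

lemma ebump_deriv: "(ebump m has_real_derivative ebump (m + 2) s - real m * ebump (m + 1) s) (at s)"
proof (cases s "0::real" rule: linorder_cases)
  case less
  have "((\<lambda>s. 0) has_real_derivative 0) (at s)" by simp
  hence "(ebump m has_real_derivative 0) (at s)"
    by (rule has_field_derivative_transform_within_open[where S="{..<0}"]) (use less in \<open>auto simp: ebump_def\<close>)
  thus ?thesis using less by (simp add: ebump_def)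
next
  case equal
  have "((\<lambda>h. (ebump m h - ebump m 0) / (h - 0)) \<longlongrightarrow> 0) (at 0)"
    by (rule Lim_transform_eventually[OF ebump_tendsto_0[of "Suc m"]])
       (auto simp: eventually_at_filter ebump_def)
  thus ?thesis unfolding has_field_derivative_iff using equal by (simp add: ebump_def)
next
  case greater
  have "((\<lambda>s. exp (- 1 / s) / s ^ m) has_real_derivative ebump (m + 2) s - real m * ebump (m + 1) s) (at s)"
  proof -
    have d1: "((\<lambda>s. exp (- 1 / s)) has_real_derivative exp (- 1 / s) / s\<^sup>2) (at s)"
      using greater by (auto intro!: derivative_eq_intros simp: power2_eq_square)
    have d2: "((\<lambda>s. s ^ m) has_real_derivative real m * s ^ (m - Suc 0)) (at s)" by (rule DERIV_pow)
    have "(exp (- 1 / s) / s\<^sup>2 * s ^ m - exp (- 1 / s) * (real m * s ^ (m - Suc 0))) / (s ^ m * s ^ m)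
       = ebump (m + 2) s - real m * ebump (m + 1) s"
      using greater by (cases m) (auto simp: ebump_def field_simps power2_eq_square)
    thus ?thesis using DERIV_divide[OF d1 d2] greater by simp
  qed
  thus ?thesis
    by (rule has_field_derivative_transform_within_open[where S="{0<..}"]) (use greater in \<open>auto simp: ebump_def\<close>)
qed

lemma ebump_continuous: "continuous_on A (ebump m)"
  by (rule DERIV_continuous_on) (rule has_field_derivative_at_within[OF ebump_deriv])

text \<open>An algebra that is closed under partial derivatives, so that membership yields
  \<open>Ck k\<close> for all k by induction. The difference a - x is the shape that a convolution
  kernel takes as a function of the integration variable.\<close>

inductive_set smooth_alg :: "('a::euclidean_space \<Rightarrow> real) set" where
  const: "(\<lambda>x. c) \<in> smooth_alg"
| coord: "(\<lambda>x. x \<bullet> b) \<in> smooth_alg"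
| ebump: "(\<lambda>x. ebump m (d - (a - x) \<bullet> (a - x))) \<in> smooth_alg"
| add: "f \<in> smooth_alg \<Longrightarrow> g \<in> smooth_alg \<Longrightarrow> (\<lambda>x. f x + g x) \<in> smooth_alg"
| mult: "f \<in> smooth_alg \<Longrightarrow> g \<in> smooth_alg \<Longrightarrow> (\<lambda>x. f x * g x) \<in> smooth_alg"

lemma ebump_has_derivative:
  "((\<lambda>x. ebump m (d - (a - x) \<bullet> (a - x))) has_derivative
     (\<lambda>h. (ebump (m + 2) (d - (a - x) \<bullet> (a - x)) - real m * ebump (m + 1) (d - (a - x) \<bullet> (a - x))) * (2 * ((a - x) \<bullet> h)))) (at x)"
proof -
  have "((\<lambda>x. d - (a - x) \<bullet> (a - x)) has_derivative (\<lambda>h. 2 * ((a - x) \<bullet> h))) (at x)"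
    by (auto intro!: derivative_eq_intros simp: inner_commute)
  from DERIV_compose_FDERIV[OF ebump_deriv this] show ?thesis
    by (simp add: mult.commute)
qed

lemma smooth_alg_derivative:
  assumes "f \<in> smooth_alg"
  shows "\<exists>f'. (\<forall>x. (f has_derivative f' x) (at x)) \<and> (\<forall>b. (\<lambda>x. f' x b) \<in> smooth_alg)"
  using assms
proof induction
  case (const c)
  show ?case by (rule exI[of _ "\<lambda>x h. 0"]) (auto intro: smooth_alg.const)
next
  case (coord b)
  have "((\<lambda>x. x \<bullet> b) has_derivative (\<lambda>h. h \<bullet> b)) (at x)" for x
    by (auto intro!: derivative_eq_intros)
  thus ?case by (intro exI[of _ "\<lambda>x h. h \<bullet> b"]) (auto intro: smooth_alg.const)
next
  case (ebump m d a)
  have "(\<lambda>x. (ebump (m + 2) (d - (a - x) \<bullet> (a - x)) + (- real m) * ebump (m + 1) (d - (a - x) \<bullet> (a - x))) * (2 * (a \<bullet> b + (-1) * (x \<bullet> b)))) \<in> smooth_alg" for b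
    by (intro smooth_alg.intros)
  hence "(\<lambda>x. (ebump (m + 2) (d - (a - x) \<bullet> (a - x)) - real m * ebump (m + 1) (d - (a - x) \<bullet> (a - x))) * (2 * ((a - x) \<bullet> b))) \<in> smooth_alg" for b
    by (simp add: inner_diff_left)
  thus ?case
    by (intro exI[of _ "\<lambda>x h. (ebump (m + 2) (d - (a - x) \<bullet> (a - x)) - real m * ebump (m + 1) (d - (a - x) \<bullet> (a - x))) * (2 * ((a - x) \<bullet> h))"]
        conjI allI ebump_has_derivative)
next
  case (add f g)
  from add.IH obtain f' g' where "\<And>x. (f has_derivative f' x) (at x)" "\<And>b. (\<lambda>x. f' x b) \<in> smooth_alg"
    "\<And>x. (g has_derivative g' x) (at x)" "\<And>b. (\<lambda>x. g' x b) \<in> smooth_alg" by auto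
  thus ?case by (intro exI[of _ "\<lambda>x h. f' x h + g' x h"]) (auto intro!: has_derivative_add smooth_alg.add)
next
  case (mult f g)
  from mult.IH obtain f' g' where "\<And>x. (f has_derivative f' x) (at x)" "\<And>b. (\<lambda>x. f' x b) \<in> smooth_alg"
    "\<And>x. (g has_derivative g' x) (at x)" "\<And>b. (\<lambda>x. g' x b) \<in> smooth_alg" by auto
  thus ?case using mult.hyps
    by (intro exI[of _ "\<lambda>x h. f x * g' x h + f' x h * g x"]) (auto intro!: has_derivative_mult smooth_alg.add smooth_alg.mult)
qed

lemma smooth_alg_partial:
  assumes "f \<in> smooth_alg"
  shows "f differentiable (at x)" "partial b f \<in> smooth_alg"
proof -
  obtain f' where f: "\<And>x. (f has_derivative f' x) (at x)" "\<And>b. (\<lambda>x. f' x b) \<in> smooth_alg"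
    using smooth_alg_derivative[OF assms] by blast
  show "f differentiable (at x)" using f(1) by (auto simp: differentiable_def)
  have "partial b f = (\<lambda>x. f' x b)"
    unfolding partial_def using frechet_derivative_at[OF f(1)] by simp
  thus "partial b f \<in> smooth_alg" using f(2) by simp
qed

lemma smooth_alg_Ck: "f \<in> smooth_alg \<Longrightarrow> Ck k f"
proof (induction k arbitrary: f)
  case 0
  thus ?case using smooth_alg_partial(1)
    by (auto simp: continuous_on_eq_continuous_at intro: differentiable_imp_continuous_within)
next
  case (Suc k)
  have "f differentiable at x" "Ck k (partial b f)" for x b
    by (intro Suc.IH smooth_alg_partial Suc.prems)+
  thus ?case by simp
qed

section \<open>The normalised bump, its first and second derivatives, and its use as a test
  function\<close>

definition bump_mass :: "'a::euclidean_space itself \<Rightarrow> real \<Rightarrow> real" where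
  "bump_mass _ \<delta> = (LINT x|lborel. ebump 0 (\<delta>\<^sup>2 - (x::'a) \<bullet> x))"

definition bump :: "real \<Rightarrow> 'a::euclidean_space \<Rightarrow> real" where
  "bump \<delta> x = ebump 0 (\<delta>\<^sup>2 - x \<bullet> x) / bump_mass TYPE('a) \<delta>"

text \<open>\<open>bump1\<close> and \<open>bump2\<close> are the first and second derivatives of
  \<open>bump\<close> in direction b: \<open>ebump 0\<close> differentiates to
  \<open>ebump 2\<close>, and \<open>ebump 2\<close> to \<open>ebump 4\<close> minus twice
  \<open>ebump 3\<close>, each with the inner factor -2 (x \<bullet> b).\<close>

definition bump1 :: "real \<Rightarrow> 'a \<Rightarrow> 'a::euclidean_space \<Rightarrow> real" where
  "bump1 \<delta> b x = - 2 * (x \<bullet> b) * ebump 2 (\<delta>\<^sup>2 - x \<bullet> x) / bump_mass TYPE('a) \<delta>"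

definition bump2 :: "real \<Rightarrow> 'a \<Rightarrow> 'a::euclidean_space \<Rightarrow> real" where
  "bump2 \<delta> b x = (4 * (x \<bullet> b)\<^sup>2 * (ebump 4 (\<delta>\<^sup>2 - x \<bullet> x) - 2 * ebump 3 (\<delta>\<^sup>2 - x \<bullet> x))
     - 2 * (b \<bullet> b) * ebump 2 (\<delta>\<^sup>2 - x \<bullet> x)) / bump_mass TYPE('a) \<delta>"

lemma sq_outside_ball: "0 < \<delta> \<Longrightarrow> \<delta> \<le> norm x \<Longrightarrow> \<delta>\<^sup>2 - x \<bullet> x \<le> 0"
  by (simp add: dot_square_norm power_mono)

lemma ckernel_cong: "ckernel f \<Longrightarrow> f = g \<Longrightarrow> ckernel g" by simp

lemma ebump_zero_outside: "0 < \<delta> \<Longrightarrow> \<delta> \<le> norm x \<Longrightarrow> ebump m (\<delta>\<^sup>2 - x \<bullet> x) = 0"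
  using sq_outside_ball[of \<delta> x] by (simp add: ebump_def)

lemma ckernel_ebump_mult: 
  assumes "0 < \<delta>" "continuous_on UNIV g" 
  shows "ckernel (\<lambda>x::'a::euclidean_space. g x * ebump m (\<delta>\<^sup>2 - x \<bullet> x))"
  unfolding ckernel_def
proof
  show "continuous_on UNIV (\<lambda>x. g x * ebump m (\<delta>\<^sup>2 - x \<bullet> x))"
    by (intro continuous_intros assms continuous_on_compose2[OF ebump_continuous[of UNIV]]) auto
  show "\<exists>r. \<forall>x. r < norm x \<longrightarrow> g x * ebump m (\<delta>\<^sup>2 - x \<bullet> x) = 0"
    using assms by (intro exI[of _ \<delta>]) (auto simp: ebump_zero_outside)
qed

lemma ckernel_add: "ckernel f \<Longrightarrow> ckernel g \<Longrightarrow> ckernel (\<lambda>x. f x + g x)"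
  unfolding ckernel_def
proof (safe)
  fix r r' assume "\<forall>x. r < norm x \<longrightarrow> f x = 0" "\<forall>x. r' < norm x \<longrightarrow> g x = 0"
  thus "\<exists>r. \<forall>x. r < norm x \<longrightarrow> f x + g x = 0" by (intro exI[of _ "max r r'"]) auto
qed (auto intro!: continuous_intros)

lemma ckernel_bump: assumes "0 < \<delta>"
  shows "ckernel (bump \<delta> :: 'a::euclidean_space \<Rightarrow> real)" "ckernel (bump1 \<delta> (b::'a))" "ckernel (bump2 \<delta> (b::'a))"
proof -
  let ?m = "bump_mass TYPE('a) \<delta>"
  show "ckernel (bump \<delta> :: 'a \<Rightarrow> real)"
    by (rule ckernel_cong[OF ckernel_ebump_mult[OF assms, of "\<lambda>x. 1 / ?m" 0]])
       (auto simp: bump_def intro!: continuous_intros)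
  show "ckernel (bump1 \<delta> b)"
    by (rule ckernel_cong[OF ckernel_ebump_mult[OF assms, of "\<lambda>x. - 2 * (x \<bullet> b) / ?m" 2]])
       (auto simp: fun_eq_iff bump1_def divide_inverse intro!: continuous_intros)
  have "ckernel (\<lambda>x. (4 * (x \<bullet> b)\<^sup>2 / ?m) * ebump 4 (\<delta>\<^sup>2 - x \<bullet> x) + ((- 8 * (x \<bullet> b)\<^sup>2 / ?m) * ebump 3 (\<delta>\<^sup>2 - x \<bullet> x)
     + (- 2 * (b \<bullet> b) / ?m) * ebump 2 (\<delta>\<^sup>2 - x \<bullet> x)))"
    unfolding divide_inverse by (intro ckernel_add ckernel_ebump_mult assms continuous_intros)
  thus "ckernel (bump2 \<delta> b)"
    by (rule ckernel_cong) (auto simp: fun_eq_iff bump2_def divide_inverse algebra_simps)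
qed

lemma ebump_dir_deriv: "dir_deriv b (\<lambda>x. ebump m (d - x \<bullet> x))
   (\<lambda>x. (ebump (m + 2) (d - x \<bullet> x) - real m * ebump (m + 1) (d - x \<bullet> x)) * (- 2 * (x \<bullet> b)))"
  unfolding dir_deriv_def
proof (intro allI)
  fix x s
  show "((\<lambda>s. ebump m (d - (x + s *\<^sub>R b) \<bullet> (x + s *\<^sub>R b))) has_real_derivative
      (ebump (m + 2) (d - (x + s *\<^sub>R b) \<bullet> (x + s *\<^sub>R b)) - real m * ebump (m + 1) (d - (x + s *\<^sub>R b) \<bullet> (x + s *\<^sub>R b)))
        * (- 2 * ((x + s *\<^sub>R b) \<bullet> b))) (at s)"
  proof (rule DERIV_chain2[OF ebump_deriv])
    have "((\<lambda>s. d - (x \<bullet> x + 2 * s * (x \<bullet> b) + s * s * (b \<bullet> b))) has_real_derivative - (2 * (x \<bullet> b) + 2 * s * (b \<bullet> b))) (at s)"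
      by (auto intro!: derivative_eq_intros)
    moreover have "(x + s *\<^sub>R b) \<bullet> (x + s *\<^sub>R b) = x \<bullet> x + 2 * s * (x \<bullet> b) + s * s * (b \<bullet> b)" for s
      by (simp add: inner_add_left inner_add_right inner_commute[of b x] algebra_simps)
    moreover have "- (2 * (x \<bullet> b) + 2 * s * (b \<bullet> b)) = - 2 * ((x + s *\<^sub>R b) \<bullet> b)"
      by (simp add: inner_add_left algebra_simps)
    ultimately show "((\<lambda>s. d - (x + s *\<^sub>R b) \<bullet> (x + s *\<^sub>R b)) has_real_derivative - 2 * ((x + s *\<^sub>R b) \<bullet> b)) (at s)"
      by (simp only:)
  qed
qed

lemma dir_deriv_const_mult: "dir_deriv b f f' \<Longrightarrow> dir_deriv b (\<lambda>x. c * f x) (\<lambda>x. c * f' x)"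
  unfolding dir_deriv_def by (auto intro!: derivative_eq_intros)

lemma dir_deriv_inner: "dir_deriv b (\<lambda>x. x \<bullet> b) (\<lambda>x. b \<bullet> b)"
  unfolding dir_deriv_def by (auto intro!: derivative_eq_intros simp: inner_add_left)

lemma dir_deriv_cong: "dir_deriv b f f' \<Longrightarrow> f = g \<Longrightarrow> f' = g' \<Longrightarrow> dir_deriv b g g'"
  by simp

lemma bump_dir_deriv: "dir_deriv b (bump \<delta>) (bump1 \<delta> b)" "dir_deriv b (bump1 \<delta> b) (bump2 \<delta> b)"
proof -
  let ?c = "inverse (bump_mass TYPE('a) \<delta>)"
  show "dir_deriv b (bump \<delta>) (bump1 \<delta> b)"
    by (rule dir_deriv_cong[OF dir_deriv_const_mult[OF ebump_dir_deriv[of b 0 "\<delta>\<^sup>2"], of ?c]])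
       (auto simp: fun_eq_iff bump_def bump1_def divide_inverse numeral_2_eq_2)
  show "dir_deriv b (bump1 \<delta> b) (bump2 \<delta> b)"
    by (rule dir_deriv_cong[OF dir_deriv_const_mult[OF dir_deriv_mult[OF dir_deriv_inner[of b] ebump_dir_deriv[of b 2 "\<delta>\<^sup>2"]], of "- 2 * ?c"]])
       (auto simp: fun_eq_iff bump1_def bump2_def divide_inverse algebra_simps power2_eq_square eval_nat_numeral)
qed

lemma bump_mass_pos: assumes "0 < \<delta>" shows "0 < bump_mass TYPE('a::euclidean_space) \<delta>"
proof -
  let ?f = "\<lambda>x::'a. ebump 0 (\<delta>\<^sup>2 - x \<bullet> x)"
  have i: "integrable lborel ?f"
    using kernel_integrable[OF ckernel_ebump_mult[OF assms, of "\<lambda>x. 1" 0]] by simp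
  have "integral\<^sup>L lborel ?f \<noteq> 0"
  proof
    assume "integral\<^sup>L lborel ?f = 0"
    hence "AE x in lborel. ?f x = 0" using integral_nonneg_eq_0_iff_AE[OF i] by (simp add: ebump_nonneg)
    moreover have "?f x \<noteq> 0" if "x \<in> ball 0 \<delta>" for x
    proof -
      have "x \<bullet> x < \<delta>\<^sup>2" using that assms by (simp add: dot_square_norm power_strict_mono)
      thus ?thesis by (simp add: ebump_def)
    qed
    ultimately have "AE x in lborel. x \<notin> ball (0::'a) \<delta>" by (auto elim: AE_mp)
    hence "ball (0::'a) \<delta> \<in> null_sets lborel" by (subst AE_iff_null_sets) (simp_all del: mem_ball)
    thus False using content_ball_pos[OF assms, of "0::'a"] by (simp add: null_sets_def measure_def)
  qed
  moreover have "0 \<le> integral\<^sup>L lborel ?f" by (simp add: ebump_nonneg)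
  ultimately show ?thesis unfolding bump_mass_def by simp
qed

lemma bump_nonneg: "0 \<le> bump \<delta> x"
  unfolding bump_def bump_mass_def by (simp add: ebump_nonneg)

lemma bump_integral: "0 < \<delta> \<Longrightarrow> (LINT x|lborel. bump \<delta> (x::'a::euclidean_space)) = 1"
  using bump_mass_pos[where 'a='a, of \<delta>] unfolding bump_def bump_mass_def by simp

lemma bump_zero_outside: "0 < \<delta> \<Longrightarrow> \<delta> \<le> norm x \<Longrightarrow> bump \<delta> x = 0"
  by (simp add: bump_def ebump_zero_outside)

lemma bump_test_function:
  assumes "0 < \<delta>" "cball x \<delta> \<subseteq> \<Omega>"
  shows "(\<lambda>y. bump \<delta> (x - y)) \<in> test_functions \<Omega>"
proof -
  let ?m = "bump_mass TYPE('a) \<delta>"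
  have "(\<lambda>y. (1 / ?m) * ebump 0 (\<delta>\<^sup>2 - (x - y) \<bullet> (x - y))) \<in> smooth_alg"
    by (intro smooth_alg.intros)
  hence "(\<lambda>y. bump \<delta> (x - y)) \<in> smooth_alg" by (simp add: bump_def)
  moreover have "{y. bump \<delta> (x - y) \<noteq> 0} \<subseteq> cball x \<delta>"
  proof
    fix y assume "y \<in> {y. bump \<delta> (x - y) \<noteq> 0}"
    hence "\<not> \<delta> \<le> norm (x - y)" using bump_zero_outside[OF assms(1), of "x - y"] by auto
    thus "y \<in> cball x \<delta>" by (simp add: dist_norm)
  qed
  hence c: "closure {y. bump \<delta> (x - y) \<noteq> 0} \<subseteq> cball x \<delta>" by (rule closure_minimal) simp
  moreover have "compact (closure {y. bump \<delta> (x - y) \<noteq> 0})"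
    using c by (meson bounded_cball bounded_subset closed_closure compact_eq_bounded_closed)
  ultimately show ?thesis using assms(2) smooth_alg_Ck by (auto simp: test_functions_def)
qed

text \<open>The sign comes from differentiating in the integration variable y. It cancels the sign
  in the definition of a weak derivative, so differentiating the kernel in x amounts to mollifying
  the weak derivative.\<close>

lemma partial_bump: "partial b (\<lambda>y. bump \<delta> (x - y)) = (\<lambda>y. - bump1 \<delta> b (x - y))"
proof
  fix y
  let ?m = "bump_mass TYPE('a) \<delta>"
  have "((\<lambda>y. ebump 0 (\<delta>\<^sup>2 - (x - y) \<bullet> (x - y)) * (1 / ?m)) has_derivative
     (\<lambda>h. (ebump (0 + 2) (\<delta>\<^sup>2 - (x - y) \<bullet> (x - y)) - real 0 * ebump (0 + 1) (\<delta>\<^sup>2 - (x - y) \<bullet> (x - y))) * (2 * ((x - y) \<bullet> h)) * (1 / ?m))) (at y)"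
    by (rule has_derivative_mult_left[OF ebump_has_derivative])
  from frechet_derivative_at[OF this]
  have "frechet_derivative (\<lambda>y. ebump 0 (\<delta>\<^sup>2 - (x - y) \<bullet> (x - y)) * (1 / ?m)) (at y) b =
     (ebump (0 + 2) (\<delta>\<^sup>2 - (x - y) \<bullet> (x - y)) - real 0 * ebump (0 + 1) (\<delta>\<^sup>2 - (x - y) \<bullet> (x - y))) * (2 * ((x - y) \<bullet> b)) * (1 / ?m)"
    by (metis (no_types, lifting))
  thus "partial b (\<lambda>y. bump \<delta> (x - y)) y = - bump1 \<delta> b (x - y)"
    unfolding partial_def bump_def bump1_def by (simp add: numeral_2_eq_2 mult.commute)
qed

lemma partial_bump1: "partial b (\<lambda>y. - bump1 \<delta> b (x - y)) = (\<lambda>y. bump2 \<delta> b (x - y))"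
proof
  fix y
  let ?m = "bump_mass TYPE('a) \<delta>" and ?e = "\<lambda>m. ebump m (\<delta>\<^sup>2 - (x - y) \<bullet> (x - y))"
  have i: "((\<lambda>y. (x - y) \<bullet> b) has_derivative (\<lambda>h. - (h \<bullet> b))) (at y)"
    by (auto intro!: derivative_eq_intros)
  have "((\<lambda>y. ((x - y) \<bullet> b) * ebump 2 (\<delta>\<^sup>2 - (x - y) \<bullet> (x - y)) * (2 / ?m)) has_derivative
     (\<lambda>h. (((x - y) \<bullet> b) * ((?e (2 + 2) - real 2 * ?e (2 + 1)) * (2 * ((x - y) \<bullet> h))) + (- (h \<bullet> b)) * ?e 2) * (2 / ?m))) (at y)"
    by (rule has_derivative_mult_left[OF has_derivative_mult[OF i ebump_has_derivative]])
  from frechet_derivative_at[OF this] 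
  have "frechet_derivative (\<lambda>y. ((x - y) \<bullet> b) * ebump 2 (\<delta>\<^sup>2 - (x - y) \<bullet> (x - y)) * (2 / ?m)) (at y) b =
     (((x - y) \<bullet> b) * ((?e (2 + 2) - real 2 * ?e (2 + 1)) * (2 * ((x - y) \<bullet> b))) + (- (b \<bullet> b)) * ?e 2) * (2 / ?m)"
    by (metis (no_types, lifting))
  moreover have "(\<lambda>y. - bump1 \<delta> b (x - y)) = (\<lambda>y. ((x - y) \<bullet> b) * ebump 2 (\<delta>\<^sup>2 - (x - y) \<bullet> (x - y)) * (2 / ?m))"
    by (auto simp: bump1_def)
  ultimately have "partial b (\<lambda>y. - bump1 \<delta> b (x - y)) y =
     (((x - y) \<bullet> b) * ((?e (2 + 2) - real 2 * ?e (2 + 1)) * (2 * ((x - y) \<bullet> b))) + (- (b \<bullet> b)) * ?e 2) * (2 / ?m)"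
    unfolding partial_def by (simp only:)
  also have "\<dots> = bump2 \<delta> b (x - y)"
  proof -
    have alg: "(p * ((e4 - 2 * e3) * (2 * p)) + (- bb) * e2) * (2 / m) = (4 * p\<^sup>2 * (e4 - 2 * e3) - 2 * bb * e2) / m"
      for p e4 e3 e2 bb m :: real by (simp add: field_simps power2_eq_square)
    show ?thesis unfolding bump2_def alg[symmetric] by simp
  qed
  finally show "partial b (\<lambda>y. - bump1 \<delta> b (x - y)) y = bump2 \<delta> b (x - y)" .
qed

lemma laplacian_bump: "laplacian (\<lambda>y. bump \<delta> (x - y)) = (\<lambda>y. \<Sum>b\<in>Basis. bump2 \<delta> b (x - y))"
  unfolding laplacian_def partial_bump partial_bump1 ..

text \<open>The bump is a probability density supported in the ball of radius \<delta>. By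
  Cauchy-Schwarz the squared error at x is at most the bump average of |u(x - y) - u(x)|^2;
  integrating first over x leaves translations by vectors shorter than \<delta>.\<close>

lemma conv_bump_approx:
  assumes u: "l2 u" and \<delta>: "0 < \<delta>" and t: "\<And>y. norm y < \<delta> \<Longrightarrow> n2 (\<lambda>x. u (- y + x) - u x) \<le> e" and e: "0 \<le> e"
  shows "n2 (\<lambda>x. conv u (bump \<delta>) x - u x) \<le> e"
proof -
  note k = ckernel_bump(1)[OF \<delta>]
  note K = lpres_reflect
  have m[measurable]: "u \<in> borel_measurable borel" "(bump \<delta> :: 'a \<Rightarrow> real) \<in> borel_measurable borel"
    using u kernel_meas[OF k] by (auto simp: l2_def)
  obtain B where B: "\<And>x::'a. \<bar>bump \<delta> x\<bar> \<le> B" using kernel_bound[OF k] by blast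
  have B0: "0 \<le> B" using B[of 0] by linarith
  have ib: "integrable lborel (bump \<delta> :: 'a \<Rightarrow> real)" by (rule kernel_integrable[OF k])
  have sq: "\<bar>sqrt (bump \<delta> y)\<bar> \<le> sqrt B" for y :: 'a
    using B[of y] bump_nonneg[of \<delta> y] by simp
  have ls: "l2 (\<lambda>y::'a. sqrt (bump \<delta> y))" "n2 (\<lambda>y::'a. sqrt (bump \<delta> y)) = 1"
    using ib bump_integral[OF \<delta>, where 'a='a] measurable_compose[OF m(2)] by (auto simp: l2_def n2_def bump_nonneg)
  have lu: "l2 (\<lambda>y. u (x - y))" for x by (rule lpres_l2[OF K u])
  have ld: "l2 (\<lambda>y. (u (x - y) - u x) * sqrt (bump \<delta> y))" for x
  proof -
    have "l2 (\<lambda>y. sqrt (bump \<delta> y) * u (x - y))" by (rule l2_weight(1)[OF lu _ sq]) simp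
    from l2_diff(1)[OF this l2_cmult[OF ls(1), of "u x"]] show ?thesis by (simp add: algebra_simps)
  qed
  have pt: "(conv u (bump \<delta>) x - u x)\<^sup>2 \<le> n2 (\<lambda>y. (u (x - y) - u x) * sqrt (bump \<delta> y))" for x
  proof -
    have "conv u (bump \<delta>) x = (LINT y|lborel. u (x - y) * bump \<delta> y)"
      unfolding conv_def using lpres_integral[OF K[of x], of "\<lambda>y. u y * bump \<delta> (x - y)"] by simp
    moreover have "integrable lborel (\<lambda>y. u (x - y) * bump \<delta> y)"
      by (rule l2_mult_integrable[OF lu kernel_l2[OF k]])
    ultimately have "conv u (bump \<delta>) x - u x = (LINT y|lborel. u (x - y) * bump \<delta> y - u x * bump \<delta> y)"
      using ib bump_integral[OF \<delta>, where 'a='a] by simp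
    also have "\<dots> = (LINT y|lborel. ((u (x - y) - u x) * sqrt (bump \<delta> y)) * sqrt (bump \<delta> y))"
      by (intro Bochner_Integration.integral_cong) (auto simp: algebra_simps bump_nonneg)
    finally show ?thesis using cauchy_schwarz_sq[OF ld[of x] ls(1)] by (simp add: ls(2))
  qed
  have "(\<integral>\<^sup>+x. ennreal ((conv u (bump \<delta>) x - u x)\<^sup>2) \<partial>lborel) \<le>
      (\<integral>\<^sup>+x. (\<integral>\<^sup>+y. ennreal (((u (x - y) - u x) * sqrt (bump \<delta> y))\<^sup>2) \<partial>lborel) \<partial>lborel)"
    by (intro nn_integral_mono) (simp only: nn_n2[OF ld] ennreal_leI[OF pt])
  also have "\<dots> = (\<integral>\<^sup>+y. (\<integral>\<^sup>+x. ennreal (((u (x - y) - u x) * sqrt (bump \<delta> y))\<^sup>2) \<partial>lborel) \<partial>lborel)"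
    by (rule lborel_pair.Fubini') measurable
  also have "\<dots> \<le> (\<integral>\<^sup>+y. ennreal (bump \<delta> (y::'a)) * ennreal e \<partial>lborel)"
  proof (rule nn_integral_mono)
    fix y :: 'a
    have l: "l2 (\<lambda>x. u (- y + x) - u x)" by (intro l2_diff u lpres_l2(1)[OF lpres_translate u])
    have "(\<integral>\<^sup>+x. ennreal (((u (x - y) - u x) * sqrt (bump \<delta> y))\<^sup>2) \<partial>lborel) =
       (\<integral>\<^sup>+x. ennreal (bump \<delta> y) * ennreal ((u (- y + x) - u x)\<^sup>2) \<partial>lborel)"
      by (intro nn_integral_cong) (simp add: power_mult_distrib bump_nonneg ennreal_mult[symmetric] mult.commute)
    also have "\<dots> = ennreal (bump \<delta> y) * ennreal (n2 (\<lambda>x. u (- y + x) - u x))"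
      by (subst nn_integral_cmult, measurable) (simp only: nn_n2[OF l])
    also have "\<dots> \<le> ennreal (bump \<delta> y) * ennreal e"
      using t[of y] bump_zero_outside[OF \<delta>, of y] by (cases "norm y < \<delta>") (auto intro!: mult_left_mono ennreal_leI)
    finally show "(\<integral>\<^sup>+x. ennreal (((u (x - y) - u x) * sqrt (bump \<delta> y))\<^sup>2) \<partial>lborel) \<le> \<dots>" .
  qed
  also have "\<dots> = ennreal 1 * ennreal e"
    using nn_integral_eq_integral[OF ib] bump_integral[OF \<delta>, where 'a='a]
    by (subst nn_integral_multc) (auto simp: bump_nonneg)
  finally have f: "(\<integral>\<^sup>+x. ennreal ((conv u (bump \<delta>) x - u x)\<^sup>2) \<partial>lborel) \<le> ennreal e" by simp
  show ?thesis by (rule l2I_nn(2)[OF _ f e]) (use conv_meas[OF u k] in simp)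
qed

section \<open>Mollification with radii tending to zero\<close>

definition eps :: "nat \<Rightarrow> real" where "eps n = 1 / real (Suc n)"

lemma eps_pos[simp]: "0 < eps n" by (simp add: eps_def)
lemma eps_lim: "eps \<longlonglongrightarrow> 0" unfolding eps_def by (rule LIMSEQ_Suc[OF lim_1_over_n])
lemma eps_mono: "m \<le> n \<Longrightarrow> eps n \<le> eps m" by (simp add: eps_def field_simps)

lemma conv_bump_lim: assumes u: "l2 u" shows "l2lim (\<lambda>n. conv u (bump (eps n))) u sequentially"
proof (rule l2limI)
  show "(\<lambda>n. n2 (\<lambda>x. conv u (bump (eps n)) x - u x)) \<longlonglongrightarrow> 0"
  proof (rule LIMSEQ_I)
    fix e :: real assume e: "0 < e"
    from tendstoD[OF l2_translation_at[OF u], of "e/2"] e obtain d where d: "0 < d"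
      "\<And>y. y \<noteq> 0 \<Longrightarrow> norm y < d \<Longrightarrow> n2 (\<lambda>x. u (y + x) - u x) < e / 2"
      by (auto simp: eventually_at)
    have d2: "n2 (\<lambda>x. u (y + x) - u x) \<le> e / 2" if "norm y < d" for y
      using d(2)[OF _ that] e by (cases "y = 0") auto
    from LIMSEQ_D[OF eps_lim d(1)] obtain N where N: "\<And>n. n \<ge> N \<Longrightarrow> norm (eps n - 0) < d" by auto
    show "\<exists>N. \<forall>n\<ge>N. norm (n2 (\<lambda>x. conv u (bump (eps n)) x - u x) - 0) < e"
    proof (intro exI allI impI)
      fix n assume "n \<ge> N"
      hence "eps n < d" using N[of n] by simp
      hence "n2 (\<lambda>x. conv u (bump (eps n)) x - u x) \<le> e / 2"
        using e by (intro conv_bump_approx u d2) auto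
      thus "norm (n2 (\<lambda>x. conv u (bump (eps n)) x - u x) - 0) < e" using e by simp
    qed
  qed
qed (use u conv_l2(1)[OF u ckernel_bump(1)] in auto)

lemma conv_bump_n2_le: "l2 u \<Longrightarrow> 0 < \<delta> \<Longrightarrow> n2 (conv u (bump \<delta>)) \<le> n2 u"
  for u :: "'a::euclidean_space \<Rightarrow> real"
  using conv_l2(2)[of u "bump \<delta>"] ckernel_bump(1)[of \<delta>] bump_integral[of \<delta>, where 'a='a]
  by (simp add: bump_nonneg)

lemma conv_bump_bounded:
  fixes u :: "'a::euclidean_space \<Rightarrow> real"
  assumes u: "l2 u" and \<delta>: "0 < \<delta>" and b: "AE x in lborel. \<bar>u x\<bar> \<le> e"
  shows "\<bar>conv u (bump \<delta>) x\<bar> \<le> e"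
proof -
  note k = ckernel_bump(1)[OF \<delta>, where 'a='a]
  have i: "integrable lborel (\<lambda>y. bump \<delta> (x - y))" by (rule lpres_integrable[OF lpres_reflect kernel_integrable[OF k]])
  have "\<bar>conv u (bump \<delta>) x\<bar> \<le> (LINT y|lborel. \<bar>u y * bump \<delta> (x - y)\<bar>)"
    unfolding conv_def by (rule integral_abs_bound)
  also have "\<dots> \<le> (LINT y|lborel. e * bump \<delta> (x - y))"
  proof (rule integral_mono_AE)
    show "AE y in lborel. \<bar>u y * bump \<delta> (x - y)\<bar> \<le> e * bump \<delta> (x - y)"
      using b by eventually_elim (simp add: abs_mult bump_nonneg mult_right_mono)
  qed (use i conv_integrable[OF u k, of x] in auto)
  also have "\<dots> = e"
    using lpres_integral[OF lpres_reflect[of x], of "bump \<delta>"] bump_integral[OF \<delta>, where 'a='a] kernel_meas[OF k] by simp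
  finally show ?thesis .
qed

section \<open>Square integrable functions on an open set and the fundamental lemma of the calculus
  of variations\<close>

lemma L2_iff: "g \<in> L2 \<Omega> \<longleftrightarrow> l2 (\<lambda>x. indicator \<Omega> x * g x)"
proof -
  have "(indicator \<Omega> x * g x)\<^sup>2 = indicator \<Omega> x * (g x)\<^sup>2" for x by (simp add: indicator_def)
  thus ?thesis by (simp add: L2_def l2_def set_borel_measurable_def set_integrable_def)
qed

lemmas L2_l2 = L2_iff[THEN iffD1]

lemma L2_UNIV: "g \<in> L2 UNIV \<longleftrightarrow> l2 g"
  by (simp add: L2_iff)

text \<open>\<open>g\<close> is extended by 0 and mollified. At points farther than
  \<open>eps N\<close> from the complement, the translated bumps of index n \<ge> N are test
  functions on the set, so the mollification vanishes there, while it converges to the extension in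
  L^2.\<close>

lemma test_function_orthogonal_zero:
  assumes \<Omega>: "open \<Omega>" and g: "g \<in> L2 \<Omega>"
    and o: "\<And>\<eta>. \<eta> \<in> test_functions \<Omega> \<Longrightarrow> (LINT x:\<Omega>|lborel. g x * \<eta> x) = 0"
  shows "AE x in lborel. x \<in> \<Omega> \<longrightarrow> g x = 0"
proof -
  define u where "u x = indicator \<Omega> x * g x" for x
  have u: "l2 u" unfolding u_def by (rule L2_l2[OF g])
  \<comment> \<open>The whole space is treated apart because \<open>infdist\<close> to the empty set
    is 0 by convention, which would make every \<open>W N\<close> empty.\<close>
  define W where "W N = (if \<Omega> = UNIV then UNIV else {x. eps N < infdist x (- \<Omega>)})" for N
  have Wo: "open (W N)" for N
  proof -
    have "open {x. eps N < infdist x (- \<Omega>)}"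
      by (intro open_Collect_less continuous_intros)
    thus ?thesis by (simp add: W_def)
  qed
  have [measurable]: "W N \<in> sets borel" for N using Wo by simp
  have W: "cball x (eps n) \<subseteq> \<Omega>" if "x \<in> W N" "N \<le> n" for x n N
  proof
    fix y assume y: "y \<in> cball x (eps n)"
    show "y \<in> \<Omega>"
    proof (rule ccontr)
      assume n: "y \<notin> \<Omega>"
      hence "infdist x (- \<Omega>) \<le> dist x y" by (intro infdist_le) auto
      also have "\<dots> \<le> eps N" using y eps_mono[OF that(2)] by auto
      finally show False using that(1) n by (auto simp: W_def split: if_splits)
    qed
  qed
  have z: "conv u (bump (eps n)) x = 0" if "x \<in> W N" "N \<le> n" for x n N
  proof -
    have "(\<lambda>y. bump (eps n) (x - y)) \<in> test_functions \<Omega>"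
      by (rule bump_test_function[OF eps_pos W[OF that]])
    from o[OF this] show ?thesis
      by (simp add: conv_def u_def set_lebesgue_integral_def mult.assoc)
  qed
  have "AE x in lborel. indicator (W N) x * u x = 0" for N
  proof -
    have l: "l2 (\<lambda>x. indicator (W N) x * u x)" by (rule l2_weight(1)[OF u, where B=1]) auto
    have "n2 (\<lambda>x. indicator (W N) x * u x) \<le> 0"
    proof (rule LIMSEQ_le_const)
      show "(\<lambda>n. n2 (\<lambda>x. conv u (bump (eps n)) x - u x)) \<longlonglongrightarrow> 0"
        using conv_bump_lim[OF u] by (simp add: l2lim_def)
      show "\<exists>M. \<forall>n\<ge>M. n2 (\<lambda>x. indicator (W N) x * u x) \<le> n2 (\<lambda>x. conv u (bump (eps n)) x - u x)"
      proof (intro exI[of _ N] allI impI)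
        fix n assume n: "N \<le> n"
        have "n2 (\<lambda>x. indicator (W N) x * u x) \<le> 1\<^sup>2 * n2 (\<lambda>x. conv u (bump (eps n)) x - u x)"
        proof (rule l2_bound(2))
          show "l2 (\<lambda>x. conv u (bump (eps n)) x - u x)" by (intro l2_diff conv_l2 u ckernel_bump) simp
          show "AE x in lborel. \<bar>indicator (W N) x * u x\<bar> \<le> 1 * \<bar>conv u (bump (eps n)) x - u x\<bar>"
            using z[OF _ n] by (intro AE_I2) (auto simp: indicator_def)
        qed (use l in \<open>auto simp: l2_def\<close>)
        thus "n2 (\<lambda>x. indicator (W N) x * u x) \<le> n2 (\<lambda>x. conv u (bump (eps n)) x - u x)" by simp
      qed
    qed
    thus ?thesis using n2_eq_0_iff[OF l] n2_nonneg[of "\<lambda>x. indicator (W N) x * u x"] by linarith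
  qed
  hence "AE x in lborel. \<forall>N. indicator (W N) x * u x = 0" by (subst AE_all_countable) blast
  thus ?thesis
  proof eventually_elim
    case (elim x)
    show ?case
    proof
      assume x: "x \<in> \<Omega>"
      have "\<exists>N. x \<in> W N"
      proof (cases "\<Omega> = UNIV")
        case False
        hence "0 < infdist x (- \<Omega>)" using x \<Omega> by (intro infdist_pos_not_in_closed) auto
        from LIMSEQ_D[OF eps_lim this] obtain N where "norm (eps N - 0) < infdist x (- \<Omega>)" by blast
        thus ?thesis using False by (intro exI[of _ N]) (simp add: W_def)
      qed (simp add: W_def)
      then obtain N where "x \<in> W N" ..
      thus "g x = 0" using elim x by (auto simp: u_def dest: spec[of _ N])
    qed
  qed
qed

section \<open>From derivatives in time at each point to derivatives in L^2\<close>

lemma l2_increment_bound: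
  fixes U U' :: "real \<Rightarrow> 'a::euclidean_space \<Rightarrow> real"
  assumes ab: "0 \<le> a" "a \<le> b" "0 \<le> t"
    and cj: "continuous_on ({0..} \<times> UNIV) (\<lambda>(\<tau>, x). U' \<tau> x)"
    and l: "\<And>\<tau>. 0 \<le> \<tau> \<Longrightarrow> l2 (U' \<tau>)" "\<And>\<tau>. 0 \<le> \<tau> \<Longrightarrow> l2 (U \<tau>)"
    and d: "\<And>x \<tau>. 0 \<le> \<tau> \<Longrightarrow> ((\<lambda>s. U s x) has_real_derivative U' \<tau> x) (at \<tau> within {0..})"
    and B: "\<And>\<tau>. \<tau> \<in> {a..b} \<Longrightarrow> n2 (\<lambda>x. U' \<tau> x - U' t x) \<le> B"
  shows "n2 (\<lambda>x. U b x - U a x - (b - a) * U' t x) \<le> (b - a)\<^sup>2 * B"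
proof (rule average_l2(2)[where G="\<lambda>\<tau> x. U' \<tau> x - U' t x"])
  have cx: "continuous_on {a..b} (\<lambda>\<tau>. U' \<tau> x)" for x
  proof -
    have "continuous_on {a..b} (\<lambda>\<tau>. (\<lambda>(\<tau>, x). U' \<tau> x) (\<tau>, x))"
      by (rule continuous_on_compose2[OF cj]) (use ab in \<open>auto intro!: continuous_intros\<close>)
    thus ?thesis by simp
  qed
  have ct: "continuous_on ({a..b} \<times> UNIV) (\<lambda>p. U' t (snd p))"
  proof -
    have "continuous_on ({a..b} \<times> UNIV) (\<lambda>p::real \<times> 'a. (\<lambda>(\<tau>, x). U' \<tau> x) (t, snd p))"
      by (rule continuous_on_compose2[OF cj]) (use ab in \<open>auto intro!: continuous_intros\<close>)
    thus ?thesis by simp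
  qed
  have "continuous_on ({a..b} \<times> UNIV) (\<lambda>p. U' (fst p) (snd p) - U' t (snd p))"
    using ab by (intro continuous_on_diff ct continuous_on_subset[OF cj[unfolded case_prod_beta]]) auto
  hence "(\<lambda>p. indicator ({a..b} \<times> UNIV) p *\<^sub>R (U' (fst p) (snd p) - U' t (snd p))) \<in> borel_measurable borel"
    by (intro borel_measurable_continuous_on_indicator) (auto intro!: borel_closed closed_Times)
  moreover have "(\<lambda>(\<tau>, x). indicator {a..b} \<tau> * (U' \<tau> x - U' t x)) =
    (\<lambda>p. indicator ({a..b} \<times> UNIV) p *\<^sub>R (U' (fst p) (snd p) - U' t (snd p)))"
    by (auto simp: fun_eq_iff indicator_def)
  ultimately show "(\<lambda>(\<tau>, x). indicator {a..b} \<tau> * (U' \<tau> x - U' t x)) \<in> borel_measurable (lborel \<Otimes>\<^sub>M lborel)"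
    by (simp add: lborel_prod)
  fix x
  show "continuous_on {a..b} (\<lambda>\<tau>. U' \<tau> x - U' t x)" by (intro continuous_intros cx)
  have "(LINT \<tau>|lborel. indicator {a..b} \<tau> *\<^sub>R (U' \<tau> x - U' t x)) = (U b x - b * U' t x) - (U a x - a * U' t x)"
  proof (rule integral_FTC_Icc)
    fix \<tau> assume \<tau>: "a \<le> \<tau>" "\<tau> \<le> b"
    have "((\<lambda>s. U s x) has_real_derivative U' \<tau> x) (at \<tau> within {0..})"
      using \<tau> ab by (intro d) auto
    hence "((\<lambda>s. U s x) has_real_derivative U' \<tau> x) (at \<tau> within {a..b})"
      by (rule DERIV_subset) (use ab in auto)
    hence "((\<lambda>s. U s x - s * U' t x) has_real_derivative U' \<tau> x - U' t x) (at \<tau> within {a..b})"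
      by (auto intro!: derivative_eq_intros)
    thus "((\<lambda>s. U s x - s * U' t x) has_vector_derivative U' \<tau> x - U' t x) (at \<tau> within {a..b})"
      by (simp add: has_real_derivative_iff_has_vector_derivative)
  qed (use ab in \<open>auto intro!: continuous_intros cx\<close>)
  thus "U b x - U a x - (b - a) * U' t x = (LINT \<tau>|lborel. indicator {a..b} \<tau> * (U' \<tau> x - U' t x))"
    by (simp add: algebra_simps)
next
  fix \<tau> assume \<tau>: "\<tau> \<in> {a..b}"
  show "l2 (\<lambda>x. U' \<tau> x - U' t x)" using \<tau> ab by (intro l2_diff l) auto
  show "n2 (\<lambda>x. U' \<tau> x - U' t x) \<le> B" by (rule B[OF \<tau>])
next
  have "l2 (\<lambda>x. U b x - U a x - (b - a) * U' t x)" using ab by (intro l2_diff l2_cmult l) auto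
  thus "(\<lambda>x. U b x - U a x - (b - a) * U' t x) \<in> borel_measurable borel" by (simp add: l2_def)
qed (rule ab)

text \<open>Continuity of \<open>\<psi>\<close> makes \<open>B\<close> small on short intervals
  around t, and dividing by (b - a)^2 bounds the error of the difference quotient.\<close>

lemma l2deriv_of_increment_bound:
  fixes \<phi> \<psi> :: "real \<Rightarrow> 'a::euclidean_space \<Rightarrow> real"
  assumes c: "l2cont \<phi>" "l2cont \<psi>"
    and main: "\<And>a b t B. 0 \<le> a \<Longrightarrow> a \<le> b \<Longrightarrow> 0 \<le> t \<Longrightarrow> (\<And>\<tau>. \<tau> \<in> {a..b} \<Longrightarrow> n2 (\<lambda>x. \<psi> \<tau> x - \<psi> t x) \<le> B) \<Longrightarrow>
      n2 (\<lambda>x. \<phi> b x - \<phi> a x - (b - a) * \<psi> t x) \<le> (b - a)\<^sup>2 * B"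
  shows "l2deriv \<phi> \<psi>"
  unfolding l2deriv_def
proof (intro allI impI l2limI)
  fix t :: real assume t: "0 \<le> t"
  let ?F = "at t within {0..}"
  show "l2 (\<psi> t)" using c t by (simp add: l2cont_def)
  show "\<forall>\<^sub>F s in ?F. l2 (\<lambda>x. (\<phi> s x - \<phi> t x) / (s - t))"
    using eventually_nonneg_within
  proof eventually_elim
    case (elim s)
    have "l2 (\<lambda>x. (1 / (s - t)) * (\<phi> s x - \<phi> t x))" using c elim t by (intro l2_cmult l2_diff) (auto simp: l2cont_def)
    thus ?case by simp
  qed
  show "((\<lambda>s. n2 (\<lambda>x. (\<phi> s x - \<phi> t x) / (s - t) - \<psi> t x)) \<longlongrightarrow> 0) ?F"
  proof (rule tendstoI)
    fix e :: real assume e: "0 < e"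
    have "((\<lambda>s. n2 (\<lambda>x. \<psi> s x - \<psi> t x)) \<longlongrightarrow> 0) ?F" using c t by (auto simp: l2cont_def l2lim_def)
    from tendstoD[OF this, of "e/2"] e obtain r where r: "0 < r"
      "\<And>s. 0 \<le> s \<Longrightarrow> s \<noteq> t \<Longrightarrow> dist s t < r \<Longrightarrow> n2 (\<lambda>x. \<psi> s x - \<psi> t x) < e / 2"
      by (auto simp: eventually_at)
    have r2: "n2 (\<lambda>x. \<psi> s x - \<psi> t x) \<le> e / 2" if "0 \<le> s" "dist s t < r" for s
      using r(2)[OF that(1) _ that(2)] e by (cases "s = t") auto
    show "\<forall>\<^sub>F s in ?F. dist (n2 (\<lambda>x. (\<phi> s x - \<phi> t x) / (s - t) - \<psi> t x)) 0 < e"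
      unfolding eventually_at
    proof (intro exI[of _ r] conjI ballI impI r(1))
      fix s assume s: "s \<in> {0..}" "s \<noteq> t \<and> dist s t < r"
      \<comment> \<open>The quotient is symmetric in s and t, so ordering the endpoints treats both
        sides of t at once.\<close>
      define a b where "a = min s t" and "b = max s t"
      have ab: "0 \<le> a" "a \<le> b" "0 < b - a" using s t by (auto simp: a_def b_def)
      have "n2 (\<lambda>x. \<phi> b x - \<phi> a x - (b - a) * \<psi> t x) \<le> (b - a)\<^sup>2 * (e / 2)"
        using s t by (intro main ab r2) (auto simp: a_def b_def dist_real_def split: if_splits)
      moreover have "(\<lambda>x. (\<phi> s x - \<phi> t x) / (s - t) - \<psi> t x) = (\<lambda>x. (1 / (b - a)) * (\<phi> b x - \<phi> a x - (b - a) * \<psi> t x))"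
        using s by (cases "s < t") (auto simp: a_def b_def fun_eq_iff min_def max_def field_simps)
      ultimately have "n2 (\<lambda>x. (\<phi> s x - \<phi> t x) / (s - t) - \<psi> t x) \<le> (1 / (b - a))\<^sup>2 * ((b - a)\<^sup>2 * (e / 2))"
        by (simp only: n2_cmult) (intro mult_left_mono; simp)
      also have "\<dots> = e / 2" using ab by (simp add: power_divide)
      finally show "dist (n2 (\<lambda>x. (\<phi> s x - \<phi> t x) / (s - t) - \<psi> t x)) 0 < e"
        using e by simp
    qed
  qed
qed

lemma l2deriv_pointwise:
  fixes U U' :: "real \<Rightarrow> 'a::euclidean_space \<Rightarrow> real"
  assumes "l2cont U" "l2cont U'" "continuous_on ({0..} \<times> UNIV) (\<lambda>(\<tau>, x). U' \<tau> x)"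
    and "\<And>x \<tau>. 0 \<le> \<tau> \<Longrightarrow> ((\<lambda>s. U s x) has_real_derivative U' \<tau> x) (at \<tau> within {0..})"
  shows "l2deriv U U'"
  by (rule l2deriv_of_increment_bound[OF assms(1,2)], rule l2_increment_bound)
     (use assms in \<open>auto simp: l2cont_l2\<close>)

text \<open>Mollification does not increase \<open>n2\<close>, so the increment bound holds with a
  constant independent of the radius and survives its limit. In this way the weak time derivative of
  \<open>\<phi>\<close> becomes a strong derivative in L^2, with no mollification left.\<close>

lemma l2deriv_of_mollified:
  fixes \<phi> \<psi> :: "real \<Rightarrow> 'a::euclidean_space \<Rightarrow> real"
  assumes c: "l2cont \<phi>" "l2cont \<psi>"
    and d: "\<And>\<delta> x t. 0 < \<delta> \<Longrightarrow> 0 \<le> t \<Longrightarrow>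
      ((\<lambda>s. conv (\<phi> s) (bump \<delta>) x) has_real_derivative conv (\<psi> t) (bump \<delta>) x) (at t within {0..})"
  shows "l2deriv \<phi> \<psi>"
proof (rule l2deriv_of_increment_bound[OF c])
  fix a b t B :: real
  assume ab: "0 \<le> a" "a \<le> b" "0 \<le> t" and B: "\<And>\<tau>. \<tau> \<in> {a..b} \<Longrightarrow> n2 (\<lambda>x. \<psi> \<tau> x - \<psi> t x) \<le> B"
  define v where "v x = \<phi> b x - \<phi> a x - (b - a) * \<psi> t x" for x
  have l: "l2 (\<phi> b)" "l2 (\<phi> a)" "l2 (\<psi> t)" using c ab by (auto simp: l2cont_def)
  have lt: "l2 (\<psi> \<tau>)" if "\<tau> \<in> {a..b}" for \<tau> using c ab that by (auto simp: l2cont_def)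
  have lv: "l2 v" unfolding v_def by (intro l2_diff l2_cmult l)
  have "n2 (conv v (bump (eps n))) \<le> (b - a)\<^sup>2 * B" for n
  proof -
    let ?k = "bump (eps n) :: 'a \<Rightarrow> real"
    have k: "ckernel ?k" by (rule ckernel_bump) simp
    have "n2 (\<lambda>x. conv (\<phi> b) ?k x - conv (\<phi> a) ?k x - (b - a) * conv (\<psi> t) ?k x) \<le> (b - a)\<^sup>2 * B"
    proof (rule l2_increment_bound[where U="\<lambda>t. conv (\<phi> t) ?k" and U'="\<lambda>t. conv (\<psi> t) ?k", OF ab])
      show "continuous_on ({0..} \<times> UNIV) (\<lambda>(\<tau>, x). conv (\<psi> \<tau>) ?k x)"
        by (rule conv_joint_continuous[OF c(2) k])
      fix \<tau> assume \<tau>: "\<tau> \<in> {a..b}"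
      have e: "(\<lambda>x. conv (\<psi> \<tau>) ?k x - conv (\<psi> t) ?k x) = conv (\<lambda>x. \<psi> \<tau> x - \<psi> t x) ?k"
        using conv_diff[OF lt[OF \<tau>] l(3) k] by auto
      have "n2 (conv (\<lambda>x. \<psi> \<tau> x - \<psi> t x) ?k) \<le> n2 (\<lambda>x. \<psi> \<tau> x - \<psi> t x)"
        by (intro conv_bump_n2_le l2_diff lt \<tau> l) simp
      also have "\<dots> \<le> B" by (rule B[OF \<tau>])
      finally show "n2 (\<lambda>x. conv (\<psi> \<tau>) ?k x - conv (\<psi> t) ?k x) \<le> B" unfolding e .
    qed (use c d k in \<open>auto intro!: conv_l2 simp: l2cont_l2\<close>)
    moreover have "conv v ?k = (\<lambda>x. conv (\<phi> b) ?k x - conv (\<phi> a) ?k x - (b - a) * conv (\<psi> t) ?k x)"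
      unfolding v_def by (auto simp: conv_diff conv_cmult l k l2_diff l2_cmult)
    ultimately show ?thesis by simp
  qed
  moreover have "(\<lambda>n. n2 (conv v (bump (eps n)))) \<longlonglongrightarrow> n2 v"
    by (rule l2lim_n2[OF conv_bump_lim[OF lv]])
  ultimately show "n2 (\<lambda>x. \<phi> b x - \<phi> a x - (b - a) * \<psi> t x) \<le> (b - a)\<^sup>2 * B"
    unfolding v_def[symmetric] by (intro LIMSEQ_le_const2) auto
qed

section \<open>Weighted virial and energy identities\<close>

definition ip :: "('a::euclidean_space \<Rightarrow> real) \<Rightarrow> ('a \<Rightarrow> real) \<Rightarrow> ('a \<Rightarrow> real) \<Rightarrow> real" where
  "ip w a b = (LINT x|lborel. w x * a x * b x)"

definition bdd_meas :: "('a::euclidean_space \<Rightarrow> real) \<Rightarrow> bool" where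
  "bdd_meas w \<longleftrightarrow> w \<in> borel_measurable borel \<and> (\<exists>B. \<forall>x. \<bar>w x\<bar> \<le> B)"

lemma bdd_meas_l2: "bdd_meas w \<Longrightarrow> l2 u \<Longrightarrow> l2 (\<lambda>x. w x * u x)"
  unfolding bdd_meas_def by (auto intro: l2_weight(1))

lemma ip_integrable: "bdd_meas w \<Longrightarrow> l2 a \<Longrightarrow> l2 b \<Longrightarrow> integrable lborel (\<lambda>x. w x * a x * b x)"
  by (intro l2_mult_integrable bdd_meas_l2)

lemma ip_commute: "ip w a b = ip w b a"
  unfolding ip_def by (simp add: mult.commute mult.left_commute)

lemma ip_bound:
  assumes "l2 a" "l2 b" "w \<in> borel_measurable borel" "\<And>x. \<bar>w x\<bar> \<le> B"
  shows "\<bar>ip w a b\<bar> \<le> B * (n2 a + n2 b)"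
proof -
  have B: "0 \<le> B" using assms(4)[of 0] by linarith
  have i: "integrable lborel (\<lambda>x. w x * a x * b x)" using assms by (intro ip_integrable) (auto simp: bdd_meas_def)
  have "\<bar>ip w a b\<bar> \<le> (LINT x|lborel. \<bar>w x * a x * b x\<bar>)" unfolding ip_def by (rule integral_abs_bound)
  also have "\<dots> \<le> (LINT x|lborel. B * ((a x)\<^sup>2 + (b x)\<^sup>2))"
  proof (rule integral_mono)
    show "integrable lborel (\<lambda>x. B * ((a x)\<^sup>2 + (b x)\<^sup>2))" using assms by (simp add: l2_def)
    fix x
    have "2 * (\<bar>a x\<bar> * \<bar>b x\<bar>) \<le> (a x)\<^sup>2 + (b x)\<^sup>2" using sum_squares_bound[of "\<bar>a x\<bar>" "\<bar>b x\<bar>"] by simp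
    moreover have "0 \<le> \<bar>a x\<bar> * \<bar>b x\<bar>" by simp
    ultimately have "\<bar>a x\<bar> * \<bar>b x\<bar> \<le> (a x)\<^sup>2 + (b x)\<^sup>2" by linarith
    hence "\<bar>w x\<bar> * (\<bar>a x\<bar> * \<bar>b x\<bar>) \<le> B * ((a x)\<^sup>2 + (b x)\<^sup>2)"
      using assms(4) B by (intro mult_mono) auto
    thus "\<bar>w x * a x * b x\<bar> \<le> B * ((a x)\<^sup>2 + (b x)\<^sup>2)" by (simp add: abs_mult mult.assoc)
  qed (use i in simp)
  also have "\<dots> = B * (n2 a + n2 b)" using assms by (simp add: n2_def l2_def)
  finally show ?thesis .
qed

lemma l2lim_ip: assumes "l2lim f u F" "l2lim g v F" "bdd_meas w"
  shows "((\<lambda>i. ip w (f i) (g i)) \<longlongrightarrow> ip w u v) F"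
proof -
  obtain B where "w \<in> borel_measurable borel" "\<And>x. \<bar>w x\<bar> \<le> B" using assms(3) by (auto simp: bdd_meas_def)
  thus ?thesis unfolding ip_def using assms by (intro l2lim_pair l2lim_weight[where B=B]) auto
qed

lemma ip_diff_right: "bdd_meas w \<Longrightarrow> l2 a \<Longrightarrow> l2 b \<Longrightarrow> l2 c \<Longrightarrow> ip w a (\<lambda>x. b x - c x) = ip w a b - ip w a c"
  unfolding ip_def by (simp add: right_diff_distrib ip_integrable)

lemma ip_sum_right: "finite I \<Longrightarrow> bdd_meas w \<Longrightarrow> l2 a \<Longrightarrow> (\<And>i. i \<in> I \<Longrightarrow> l2 (b i)) \<Longrightarrow>
    ip w a (\<lambda>x. \<Sum>i\<in>I. b i x) = (\<Sum>i\<in>I. ip w a (b i))"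
  unfolding ip_def by (simp add: sum_distrib_left ip_integrable)

lemma l2cont_ip: "l2cont u \<Longrightarrow> l2cont v \<Longrightarrow> bdd_meas w \<Longrightarrow> continuous_on {0..} (\<lambda>t. ip w (u t) (v t))"
  unfolding continuous_on_def l2cont_def by (auto intro: l2lim_ip)

lemma ip_ftc:
  assumes "l2cont u" "l2cont v" "l2deriv u u'" "l2deriv v v'" "0 \<le> s" "s \<le> t" "bdd_meas w"
  shows "((\<lambda>\<tau>. ip w (u' \<tau>) (v \<tau>) + ip w (u \<tau>) (v' \<tau>)) has_integral ip w (u t) (v t) - ip w (u s) (v s)) {s..t}"
proof -
  obtain B where "w \<in> borel_measurable borel" "\<And>x. \<bar>w x\<bar> \<le> B" using assms(7) by (auto simp: bdd_meas_def)
  thus ?thesis unfolding ip_def using assms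
    by (intro l2cont_ftc l2cont_weight[where B=B] l2deriv_weight[where B=B]) auto
qed

locale smooth_weight =
  fixes w :: "'a::euclidean_space \<Rightarrow> real" and dw :: "'a \<Rightarrow> 'a \<Rightarrow> real" and B :: real
  assumes w_cont: "continuous_on UNIV w" and w_bound: "\<And>x. \<bar>w x\<bar> \<le> B"
    and dw_cont: "\<And>b. b \<in> Basis \<Longrightarrow> continuous_on UNIV (dw b)" and dw_bound: "\<And>b x. b \<in> Basis \<Longrightarrow> \<bar>dw b x\<bar> \<le> B"
    and w_deriv: "\<And>b. b \<in> Basis \<Longrightarrow> dir_deriv b w (dw b)"
begin

lemma w_bdd: "bdd_meas w" using w_cont w_bound by (auto simp: bdd_meas_def borel_measurable_continuous_onI)
lemma dw_bdd: "b \<in> Basis \<Longrightarrow> bdd_meas (dw b)"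
  using dw_cont dw_bound by (auto simp: bdd_meas_def borel_measurable_continuous_onI)

text \<open>The product w f g and its derivative in direction b are both integrable, so the integral
  of the derivative vanishes and there is no boundary term at infinity.\<close>

lemma ibp:
  assumes b: "b \<in> Basis" and l: "l2 f" "l2 f'" "l2 g" "l2 g'"
    and c: "continuous_on UNIV f" "continuous_on UNIV f'" "continuous_on UNIV g" "continuous_on UNIV g'"
    and d: "dir_deriv b f f'" "dir_deriv b g g'"
  shows "ip w f g' = - ip (dw b) f g - ip w f' g"
proof -
  have i: "integrable lborel (\<lambda>x. w x * f x * g x)" "integrable lborel (\<lambda>x. dw b x * f x * g x)"
    "integrable lborel (\<lambda>x. w x * f' x * g x)" "integrable lborel (\<lambda>x. w x * f x * g' x)"
    using l w_bdd dw_bdd[OF b] by (auto intro!: ip_integrable)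
  have "(LINT x|lborel. dw b x * f x * g x + w x * f' x * g x + w x * f x * g' x) = 0"
  proof (rule integral_directional_derivative_zero[where g="\<lambda>x. w x * f x * g x" and b=b])
    show "continuous_on UNIV (\<lambda>x. dw b x * f x * g x + w x * f' x * g x + w x * f x * g' x)"
      by (intro continuous_intros w_cont dw_cont c b)
    have "dir_deriv b (\<lambda>x. w x * f x * g x) (\<lambda>x. (dw b x * f x + w x * f' x) * g x + (w x * f x) * g' x)"
      by (intro dir_deriv_mult w_deriv b d)
    thus "((\<lambda>s. w (x + s *\<^sub>R b) * f (x + s *\<^sub>R b) * g (x + s *\<^sub>R b)) has_real_derivative
       dw b (x + s *\<^sub>R b) * f (x + s *\<^sub>R b) * g (x + s *\<^sub>R b) + w (x + s *\<^sub>R b) * f' (x + s *\<^sub>R b) * g (x + s *\<^sub>R b) +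
         w (x + s *\<^sub>R b) * f (x + s *\<^sub>R b) * g' (x + s *\<^sub>R b)) (at s)" for x s
      by (simp add: dir_deriv_def algebra_simps)
  qed (use i in auto)
  thus ?thesis using i by (simp add: ip_def)
qed

end

text \<open>The equation enters only through its mollifications; \<open>G b\<close> is the weak derivative of \<open>\<phi>\<close> in direction \<open>b\<close>.\<close>

locale wave =
  fixes \<phi> \<psi> k :: "real \<Rightarrow> 'a::euclidean_space \<Rightarrow> real" and G :: "'a \<Rightarrow> real \<Rightarrow> 'a \<Rightarrow> real"
  assumes cont: "l2cont \<phi>" "l2cont \<psi>" "l2cont k" "\<And>b. b \<in> Basis \<Longrightarrow> l2cont (G b)"
    and deriv_phi: "\<And>\<delta> x t. 0 < \<delta> \<Longrightarrow> 0 \<le> t \<Longrightarrow>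
      ((\<lambda>s. conv (\<phi> s) (bump \<delta>) x) has_real_derivative conv (\<psi> t) (bump \<delta>) x) (at t within {0..})"
    and deriv_psi: "\<And>\<delta> x t. 0 < \<delta> \<Longrightarrow> 0 \<le> t \<Longrightarrow>
      ((\<lambda>s. conv (\<psi> s) (bump \<delta>) x) has_real_derivative
         (\<Sum>b\<in>Basis. conv (\<phi> t) (bump2 \<delta> b) x) - conv (k t) (bump \<delta>) x) (at t within {0..})"
    and gradient: "\<And>\<delta> x t b. 0 < \<delta> \<Longrightarrow> 0 \<le> t \<Longrightarrow> b \<in> Basis \<Longrightarrow>
      conv (\<phi> t) (bump1 \<delta> b) x = conv (G b t) (bump \<delta>) x"
begin

lemma l2deriv_phi: "l2deriv \<phi> \<psi>"
  by (rule l2deriv_of_mollified[OF cont(1,2) deriv_phi])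

lemma moll_cont: assumes "0 < \<delta>"
  shows "l2cont (\<lambda>t. conv (\<phi> t) (bump \<delta>))" "l2cont (\<lambda>t. conv (\<psi> t) (bump \<delta>))" "l2cont (\<lambda>t. conv (k t) (bump \<delta>))"
    "l2cont (\<lambda>t. conv (\<phi> t) (bump1 \<delta> b))" "l2cont (\<lambda>t. conv (\<psi> t) (bump1 \<delta> b))" "l2cont (\<lambda>t. conv (\<phi> t) (bump2 \<delta> b))"
  using cont ckernel_bump[OF assms] by (auto intro!: l2cont_conv)

lemma moll_deriv: assumes "0 < \<delta>"
  shows "l2deriv (\<lambda>t. conv (\<phi> t) (bump \<delta>)) (\<lambda>t. conv (\<psi> t) (bump \<delta>))"
    "l2deriv (\<lambda>t. conv (\<phi> t) (bump1 \<delta> b)) (\<lambda>t. conv (\<psi> t) (bump1 \<delta> b))"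
    "l2deriv (\<lambda>t. conv (\<psi> t) (bump \<delta>)) (\<lambda>t x. (\<Sum>b\<in>Basis. conv (\<phi> t) (bump2 \<delta> b) x) - conv (k t) (bump \<delta>) x)"
proof -
  show "l2deriv (\<lambda>t. conv (\<phi> t) (bump \<delta>)) (\<lambda>t. conv (\<psi> t) (bump \<delta>))"
    "l2deriv (\<lambda>t. conv (\<phi> t) (bump1 \<delta> b)) (\<lambda>t. conv (\<psi> t) (bump1 \<delta> b))"
    using l2deriv_phi cont ckernel_bump[OF assms] by (auto intro!: l2deriv_conv)
  show "l2deriv (\<lambda>t. conv (\<psi> t) (bump \<delta>)) (\<lambda>t x. (\<Sum>b\<in>Basis. conv (\<phi> t) (bump2 \<delta> b) x) - conv (k t) (bump \<delta>) x)"
  proof (rule l2deriv_pointwise)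
    show "l2cont (\<lambda>t x. (\<Sum>b\<in>Basis. conv (\<phi> t) (bump2 \<delta> b) x) - conv (k t) (bump \<delta>) x)"
      by (intro l2cont_diff l2cont_sum moll_cont assms) simp
    show "continuous_on ({0..} \<times> UNIV) (\<lambda>(\<tau>, x). (\<Sum>b\<in>Basis. conv (\<phi> \<tau>) (bump2 \<delta> b) x) - conv (k \<tau>) (bump \<delta>) x)"
      unfolding case_prod_beta
      by (intro continuous_on_diff continuous_on_sum conv_joint_continuous[unfolded case_prod_beta] cont ckernel_bump assms)
  qed (use deriv_psi[OF assms] moll_cont(2)[OF assms] in auto)
qed

lemma moll_dir_deriv: assumes "0 < \<delta>" "0 \<le> t"
  shows "dir_deriv b (conv (\<phi> t) (bump \<delta>)) (conv (\<phi> t) (bump1 \<delta> b))"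
    "dir_deriv b (conv (\<psi> t) (bump \<delta>)) (conv (\<psi> t) (bump1 \<delta> b))"
    "dir_deriv b (conv (\<phi> t) (bump1 \<delta> b)) (conv (\<phi> t) (bump2 \<delta> b))"
  using cont assms by (auto intro!: conv_dir_deriv bump_dir_deriv ckernel_bump l2cont_l2)

lemma moll_space_cont: assumes "0 < \<delta>" "0 \<le> t"
  shows "continuous_on UNIV (conv (\<phi> t) (bump \<delta>))" "continuous_on UNIV (conv (\<psi> t) (bump \<delta>))"
    "continuous_on UNIV (conv (\<phi> t) (bump1 \<delta> b))" "continuous_on UNIV (conv (\<psi> t) (bump1 \<delta> b))"
    "continuous_on UNIV (conv (\<phi> t) (bump2 \<delta> b))"
  using cont assms by (auto intro!: conv_continuous ckernel_bump l2cont_l2)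

lemma gradient_fun: "0 < \<delta> \<Longrightarrow> 0 \<le> t \<Longrightarrow> b \<in> Basis \<Longrightarrow> conv (\<phi> t) (bump1 \<delta> b) = conv (G b t) (bump \<delta>)"
  by (rule ext) (rule gradient)

end

lemma moll_ip_lim: "l2 a \<Longrightarrow> l2 b \<Longrightarrow> bdd_meas w \<Longrightarrow>
   (\<lambda>n. ip w (conv a (bump (eps n))) (conv b (bump (eps n)))) \<longlonglongrightarrow> ip w a b"
  by (intro l2lim_ip conv_bump_lim)

lemma moll_ip_bound:
  assumes "l2 a" "l2 b" "w \<in> borel_measurable borel" "\<And>x. \<bar>w x\<bar> \<le> B" "0 < \<delta>"
  shows "\<bar>ip w (conv a (bump \<delta>)) (conv b (bump \<delta>))\<bar> \<le> B * (n2 a + n2 b)"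
proof -
  have B: "0 \<le> B" using assms(4)[of 0] by linarith
  have "\<bar>ip w (conv a (bump \<delta>)) (conv b (bump \<delta>))\<bar> \<le> B * (n2 (conv a (bump \<delta>)) + n2 (conv b (bump \<delta>)))"
    by (rule ip_bound) (use assms in \<open>auto intro!: conv_l2 ckernel_bump\<close>)
  also have "\<dots> \<le> B * (n2 a + n2 b)"
    using assms B by (intro mult_left_mono add_mono conv_bump_n2_le) auto
  finally show ?thesis .
qed

definition tip :: "('a::euclidean_space \<Rightarrow> real) \<Rightarrow> (real \<Rightarrow> 'a \<Rightarrow> real) \<Rightarrow> (real \<Rightarrow> 'a \<Rightarrow> real) \<Rightarrow> real \<Rightarrow> real \<Rightarrow> real" where
  "tip w a b s t = integral {s..t} (\<lambda>\<tau>. ip w (a \<tau>) (b \<tau>))"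

lemma tip_integrable: "l2cont a \<Longrightarrow> l2cont b \<Longrightarrow> bdd_meas w \<Longrightarrow> 0 \<le> s \<Longrightarrow> (\<lambda>\<tau>. ip w (a \<tau>) (b \<tau>)) integrable_on {s..t}"
  by (intro integrable_continuous_real continuous_on_subset[OF l2cont_ip]) auto

lemma moll_l2cont: "l2cont a \<Longrightarrow> 0 < \<delta> \<Longrightarrow> l2cont (\<lambda>\<tau>. conv (a \<tau>) (bump \<delta>))"
  by (intro l2cont_conv ckernel_bump)

text \<open>At each time the pairing converges. Since mollification does not increase
  \<open>n2\<close>, the continuous function B (n2 a + n2 b) dominates on the time interval for
  every n.\<close>

lemma moll_tip_lim:
  assumes "l2cont a" "l2cont b" "bdd_meas w" "0 \<le> s"
  shows "(\<lambda>n. tip w (\<lambda>\<tau>. conv (a \<tau>) (bump (eps n))) (\<lambda>\<tau>. conv (b \<tau>) (bump (eps n))) s t) \<longlonglongrightarrow> tip w a b s t"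
proof -
  obtain B where B: "w \<in> borel_measurable borel" "\<And>x. \<bar>w x\<bar> \<le> B" using assms(3) by (auto simp: bdd_meas_def)
  show ?thesis unfolding tip_def
  proof (rule dominated_convergence)
  show "(\<lambda>\<tau>. ip w (conv (a \<tau>) (bump (eps n))) (conv (b \<tau>) (bump (eps n)))) integrable_on {s..t}" for n
    using assms by (intro tip_integrable moll_l2cont) auto
  show "(\<lambda>\<tau>. B * (n2 (a \<tau>) + n2 (b \<tau>))) integrable_on {s..t}"
    using assms by (intro integrable_continuous_real continuous_intros continuous_on_subset[OF l2cont_n2]) auto
  fix \<tau> assume "\<tau> \<in> {s..t}"
  hence l: "l2 (a \<tau>)" "l2 (b \<tau>)" using assms by (auto simp: l2cont_def)
  show "norm (ip w (conv (a \<tau>) (bump (eps n))) (conv (b \<tau>) (bump (eps n)))) \<le> B * (n2 (a \<tau>) + n2 (b \<tau>))" for n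
    using moll_ip_bound[OF l B, of "eps n"] by simp
  show "(\<lambda>n. ip w (conv (a \<tau>) (bump (eps n))) (conv (b \<tau>) (bump (eps n)))) \<longlonglongrightarrow> ip w (a \<tau>) (b \<tau>)"
    by (intro moll_ip_lim l assms)
  qed
qed

locale weighted_wave = wave \<phi> \<psi> k G + smooth_weight w dw B
  for \<phi> \<psi> k :: "real \<Rightarrow> 'a::euclidean_space \<Rightarrow> real" and G :: "'a \<Rightarrow> real \<Rightarrow> 'a \<Rightarrow> real"
    and w :: "'a \<Rightarrow> real" and dw :: "'a \<Rightarrow> 'a \<Rightarrow> real" and B :: real
begin

text \<open>The time derivative of <w \<open>\<phi>\<close>, \<open>\<psi>\<close>>. For the
  mollified solution the Laplacian is integrated by parts against w \<open>\<phi>\<close>; the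
  result contains first derivatives only, and these are mollifications of \<open>G b\<close>, so the
  radius can tend to zero.\<close>

theorem virial_identity:
  assumes st: "0 \<le> s" "s \<le> t"
  shows "tip w \<psi> \<psi> s t - (\<Sum>b\<in>Basis. tip (dw b) \<phi> (G b) s t) - (\<Sum>b\<in>Basis. tip w (G b) (G b) s t) - tip w \<phi> k s t
    = ip w (\<phi> t) (\<psi> t) - ip w (\<phi> s) (\<psi> s)"
proof (rule LIMSEQ_unique)
  let ?m = "\<lambda>n u \<tau>. conv (u \<tau>) (bump (eps n))"
  show "(\<lambda>n. tip w (?m n \<psi>) (?m n \<psi>) s t - (\<Sum>b\<in>Basis. tip (dw b) (?m n \<phi>) (?m n (G b)) s t)
     - (\<Sum>b\<in>Basis. tip w (?m n (G b)) (?m n (G b)) s t) - tip w (?m n \<phi>) (?m n k) s t) \<longlonglongrightarrow>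
     tip w \<psi> \<psi> s t - (\<Sum>b\<in>Basis. tip (dw b) \<phi> (G b) s t) - (\<Sum>b\<in>Basis. tip w (G b) (G b) s t) - tip w \<phi> k s t"
    using st by (auto intro!: tendsto_intros moll_tip_lim cont w_bdd dw_bdd)
  have "tip w (?m n \<psi>) (?m n \<psi>) s t - (\<Sum>b\<in>Basis. tip (dw b) (?m n \<phi>) (?m n (G b)) s t)
     - (\<Sum>b\<in>Basis. tip w (?m n (G b)) (?m n (G b)) s t) - tip w (?m n \<phi>) (?m n k) s t
     = ip w (?m n \<phi> t) (?m n \<psi> t) - ip w (?m n \<phi> s) (?m n \<psi> s)" for n
  proof -
    have e: "(0::real) < eps n" by simp
    note c = cont(1-3)[THEN moll_l2cont, OF e] cont(4)[THEN moll_l2cont, OF _ e]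
    have "((\<lambda>\<tau>. ip w (?m n \<psi> \<tau>) (?m n \<psi> \<tau>) + ip w (?m n \<phi> \<tau>) (\<lambda>x. (\<Sum>b\<in>Basis. conv (\<phi> \<tau>) (bump2 (eps n) b) x) - ?m n k \<tau> x))
      has_integral ip w (?m n \<phi> t) (?m n \<psi> t) - ip w (?m n \<phi> s) (?m n \<psi> s)) {s..t}"
      by (intro ip_ftc moll_cont moll_deriv w_bdd st) simp_all
    moreover have "ip w (?m n \<psi> \<tau>) (?m n \<psi> \<tau>) + ip w (?m n \<phi> \<tau>) (\<lambda>x. (\<Sum>b\<in>Basis. conv (\<phi> \<tau>) (bump2 (eps n) b) x) - ?m n k \<tau> x)
       = ip w (?m n \<psi> \<tau>) (?m n \<psi> \<tau>) - (\<Sum>b\<in>Basis. ip (dw b) (?m n \<phi> \<tau>) (?m n (G b) \<tau>))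
         - (\<Sum>b\<in>Basis. ip w (?m n (G b) \<tau>) (?m n (G b) \<tau>)) - ip w (?m n \<phi> \<tau>) (?m n k \<tau>)" if "\<tau> \<in> {s..t}" for \<tau>
    proof -
      have \<tau>: "0 \<le> \<tau>" using that st by simp
      note l = moll_cont[OF e, THEN l2cont_l2, OF \<tau>]
      have "ip w (?m n \<phi> \<tau>) (\<lambda>x. (\<Sum>b\<in>Basis. conv (\<phi> \<tau>) (bump2 (eps n) b) x) - ?m n k \<tau> x)
         = (\<Sum>b\<in>Basis. ip w (?m n \<phi> \<tau>) (conv (\<phi> \<tau>) (bump2 (eps n) b))) - ip w (?m n \<phi> \<tau>) (?m n k \<tau>)"
        by (simp add: ip_diff_right ip_sum_right l2_sum w_bdd l)
      also have "(\<Sum>b\<in>Basis. ip w (?m n \<phi> \<tau>) (conv (\<phi> \<tau>) (bump2 (eps n) b))) =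
         (\<Sum>b\<in>Basis. - ip (dw b) (?m n \<phi> \<tau>) (?m n (G b) \<tau>) - ip w (?m n (G b) \<tau>) (?m n (G b) \<tau>))"
      proof (rule sum.cong[OF refl])
        fix b :: 'a assume b: "b \<in> Basis"
        have "ip w (?m n \<phi> \<tau>) (conv (\<phi> \<tau>) (bump2 (eps n) b)) = - ip (dw b) (?m n \<phi> \<tau>) (conv (\<phi> \<tau>) (bump1 (eps n) b))
            - ip w (conv (\<phi> \<tau>) (bump1 (eps n) b)) (conv (\<phi> \<tau>) (bump1 (eps n) b))"
          by (rule ibp[OF b]) (intro l moll_space_cont moll_dir_deriv e \<tau>)+
        thus "ip w (?m n \<phi> \<tau>) (conv (\<phi> \<tau>) (bump2 (eps n) b)) = - ip (dw b) (?m n \<phi> \<tau>) (?m n (G b) \<tau>) - ip w (?m n (G b) \<tau>) (?m n (G b) \<tau>)"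
          by (simp add: gradient_fun[OF e \<tau> b])
      qed
      finally show ?thesis by (simp add: sum_subtractf sum_negf)
    qed
    ultimately have "((\<lambda>\<tau>. ip w (?m n \<psi> \<tau>) (?m n \<psi> \<tau>) - (\<Sum>b\<in>Basis. ip (dw b) (?m n \<phi> \<tau>) (?m n (G b) \<tau>))
         - (\<Sum>b\<in>Basis. ip w (?m n (G b) \<tau>) (?m n (G b) \<tau>)) - ip w (?m n \<phi> \<tau>) (?m n k \<tau>)) has_integral
         ip w (?m n \<phi> t) (?m n \<psi> t) - ip w (?m n \<phi> s) (?m n \<psi> s)) {s..t}"
      by (rule has_integral_eq[rotated])
    moreover have "((\<lambda>\<tau>. ip w (?m n \<psi> \<tau>) (?m n \<psi> \<tau>) - (\<Sum>b\<in>Basis. ip (dw b) (?m n \<phi> \<tau>) (?m n (G b) \<tau>))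
         - (\<Sum>b\<in>Basis. ip w (?m n (G b) \<tau>) (?m n (G b) \<tau>)) - ip w (?m n \<phi> \<tau>) (?m n k \<tau>)) has_integral
         tip w (?m n \<psi>) (?m n \<psi>) s t - (\<Sum>b\<in>Basis. tip (dw b) (?m n \<phi>) (?m n (G b)) s t)
          - (\<Sum>b\<in>Basis. tip w (?m n (G b)) (?m n (G b)) s t) - tip w (?m n \<phi>) (?m n k) s t) {s..t}"
      unfolding tip_def
      by (intro has_integral_diff has_integral_sum integrable_integral tip_integrable c w_bdd dw_bdd st) auto
    ultimately show ?thesis by (rule has_integral_unique[rotated])
  qed
  moreover have "(\<lambda>n. ip w (?m n \<phi> t) (?m n \<psi> t) - ip w (?m n \<phi> s) (?m n \<psi> s)) \<longlonglongrightarrow> ip w (\<phi> t) (\<psi> t) - ip w (\<phi> s) (\<psi> s)"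
    using st by (auto intro!: tendsto_intros moll_ip_lim cont[THEN l2cont_l2] w_bdd)
  ultimately show "(\<lambda>n. tip w (?m n \<psi>) (?m n \<psi>) s t - (\<Sum>b\<in>Basis. tip (dw b) (?m n \<phi>) (?m n (G b)) s t)
     - (\<Sum>b\<in>Basis. tip w (?m n (G b)) (?m n (G b)) s t) - tip w (?m n \<phi>) (?m n k) s t) \<longlonglongrightarrow>
     ip w (\<phi> t) (\<psi> t) - ip w (\<phi> s) (\<psi> s)" by simp
qed

text \<open>The free energy density with mass one. The potential is left out: the source is
  estimated as an error, and the positivity of the energy is independent of the sign of
  \<open>F\<close>.\<close>

definition energy :: "real \<Rightarrow> real" where
  "energy \<tau> = ip w (\<psi> \<tau>) (\<psi> \<tau>) + (\<Sum>b\<in>Basis. ip w (G b \<tau>) (G b \<tau>)) + ip w (\<phi> \<tau>) (\<phi> \<tau>)"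

text \<open>After integration by parts the terms of the form <w \<open>?h b\<close>,
  \<open>?g b\<close>> from the gradient and from the Laplacian cancel. There remain the flux
  through the derivative of the weight and the work of the mass term and of the source.\<close>

theorem energy_identity:
  assumes st: "0 \<le> s" "s \<le> t"
  shows "2 * (tip w \<psi> \<phi> s t - tip w \<psi> k s t - (\<Sum>b\<in>Basis. tip (dw b) \<psi> (G b) s t)) = energy t - energy s"
proof (rule LIMSEQ_unique)
  let ?m = "\<lambda>n u \<tau>. conv (u \<tau>) (bump (eps n))"
  let ?E = "\<lambda>n \<tau>. ip w (?m n \<psi> \<tau>) (?m n \<psi> \<tau>) + (\<Sum>b\<in>Basis. ip w (?m n (G b) \<tau>) (?m n (G b) \<tau>)) + ip w (?m n \<phi> \<tau>) (?m n \<phi> \<tau>)"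
  show "(\<lambda>n. 2 * (tip w (?m n \<psi>) (?m n \<phi>) s t - tip w (?m n \<psi>) (?m n k) s t - (\<Sum>b\<in>Basis. tip (dw b) (?m n \<psi>) (?m n (G b)) s t)))
     \<longlonglongrightarrow> 2 * (tip w \<psi> \<phi> s t - tip w \<psi> k s t - (\<Sum>b\<in>Basis. tip (dw b) \<psi> (G b) s t))"
    using st by (auto intro!: tendsto_intros moll_tip_lim cont w_bdd dw_bdd)
  have "2 * (tip w (?m n \<psi>) (?m n \<phi>) s t - tip w (?m n \<psi>) (?m n k) s t - (\<Sum>b\<in>Basis. tip (dw b) (?m n \<psi>) (?m n (G b)) s t))
     = ?E n t - ?E n s" for n
  proof -
    have e: "(0::real) < eps n" by simp
    note c = cont(1-3)[THEN moll_l2cont, OF e] cont(4)[THEN moll_l2cont, OF _ e]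
    let ?p' = "\<lambda>\<tau> x. (\<Sum>b\<in>Basis. conv (\<phi> \<tau>) (bump2 (eps n) b) x) - ?m n k \<tau> x"
    let ?g = "\<lambda>b \<tau>. conv (\<phi> \<tau>) (bump1 (eps n) b)" and ?h = "\<lambda>b \<tau>. conv (\<psi> \<tau>) (bump1 (eps n) b)"
    have f1: "((\<lambda>\<tau>. ip w (?p' \<tau>) (?m n \<psi> \<tau>) + ip w (?m n \<psi> \<tau>) (?p' \<tau>))
      has_integral ip w (?m n \<psi> t) (?m n \<psi> t) - ip w (?m n \<psi> s) (?m n \<psi> s)) {s..t}"
      by (intro ip_ftc moll_cont moll_deriv w_bdd st) simp_all
    have f2: "((\<lambda>\<tau>. ip w (?m n \<psi> \<tau>) (?m n \<phi> \<tau>) + ip w (?m n \<phi> \<tau>) (?m n \<psi> \<tau>))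
      has_integral ip w (?m n \<phi> t) (?m n \<phi> t) - ip w (?m n \<phi> s) (?m n \<phi> s)) {s..t}"
      by (intro ip_ftc moll_cont moll_deriv w_bdd st) simp_all
    \<comment> \<open>\<open>?h b\<close> is the time derivative of \<open>?g b\<close>: the
      derivative is put on the kernel, so no regularity of \<open>\<psi>\<close> in space is
      needed.\<close>
    have f3: "((\<lambda>\<tau>. \<Sum>b\<in>Basis. ip w (?h b \<tau>) (?g b \<tau>) + ip w (?g b \<tau>) (?h b \<tau>))
      has_integral (\<Sum>b\<in>Basis. ip w (?g b t) (?g b t) - ip w (?g b s) (?g b s))) {s..t}"
      by (intro has_integral_sum ip_ftc moll_cont moll_deriv w_bdd st) simp_all
    have "(\<Sum>b\<in>Basis. ip w (?g b t) (?g b t) - ip w (?g b s) (?g b s)) =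
        (\<Sum>b\<in>Basis. ip w (?m n (G b) t) (?m n (G b) t) - ip w (?m n (G b) s) (?m n (G b) s))"
      using st by (intro sum.cong) (auto simp: gradient_fun[OF e])
    hence v: "ip w (?m n \<psi> t) (?m n \<psi> t) - ip w (?m n \<psi> s) (?m n \<psi> s) + (\<Sum>b\<in>Basis. ip w (?g b t) (?g b t) - ip w (?g b s) (?g b s))
       + (ip w (?m n \<phi> t) (?m n \<phi> t) - ip w (?m n \<phi> s) (?m n \<phi> s)) = ?E n t - ?E n s" by (simp add: sum_subtractf)
    have "((\<lambda>\<tau>. (ip w (?p' \<tau>) (?m n \<psi> \<tau>) + ip w (?m n \<psi> \<tau>) (?p' \<tau>)) + (\<Sum>b\<in>Basis. ip w (?h b \<tau>) (?g b \<tau>) + ip w (?g b \<tau>) (?h b \<tau>))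
       + (ip w (?m n \<psi> \<tau>) (?m n \<phi> \<tau>) + ip w (?m n \<phi> \<tau>) (?m n \<psi> \<tau>))) has_integral ?E n t - ?E n s) {s..t}"
      using has_integral_add[OF has_integral_add[OF f1 f3] f2] unfolding v .
    moreover have "(ip w (?p' \<tau>) (?m n \<psi> \<tau>) + ip w (?m n \<psi> \<tau>) (?p' \<tau>)) + (\<Sum>b\<in>Basis. ip w (?h b \<tau>) (?g b \<tau>) + ip w (?g b \<tau>) (?h b \<tau>))
       + (ip w (?m n \<psi> \<tau>) (?m n \<phi> \<tau>) + ip w (?m n \<phi> \<tau>) (?m n \<psi> \<tau>))
       = 2 * (ip w (?m n \<psi> \<tau>) (?m n \<phi> \<tau>) - ip w (?m n \<psi> \<tau>) (?m n k \<tau>) - (\<Sum>b\<in>Basis. ip (dw b) (?m n \<psi> \<tau>) (?m n (G b) \<tau>)))"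
      if "\<tau> \<in> {s..t}" for \<tau>
    proof -
      have \<tau>: "0 \<le> \<tau>" using that st by simp
      note l = moll_cont[OF e, THEN l2cont_l2, OF \<tau>]
      have "ip w (?m n \<psi> \<tau>) (?p' \<tau>)
         = (\<Sum>b\<in>Basis. ip w (?m n \<psi> \<tau>) (conv (\<phi> \<tau>) (bump2 (eps n) b))) - ip w (?m n \<psi> \<tau>) (?m n k \<tau>)"
        by (simp add: ip_diff_right ip_sum_right l2_sum w_bdd l)
      also have "(\<Sum>b\<in>Basis. ip w (?m n \<psi> \<tau>) (conv (\<phi> \<tau>) (bump2 (eps n) b))) =
         (\<Sum>b\<in>Basis. - ip (dw b) (?m n \<psi> \<tau>) (?m n (G b) \<tau>) - ip w (?h b \<tau>) (?g b \<tau>))"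
      proof (rule sum.cong[OF refl])
        fix b :: 'a assume b: "b \<in> Basis"
        have "ip w (?m n \<psi> \<tau>) (conv (\<phi> \<tau>) (bump2 (eps n) b)) = - ip (dw b) (?m n \<psi> \<tau>) (?g b \<tau>) - ip w (?h b \<tau>) (?g b \<tau>)"
          by (rule ibp[OF b]) (intro l moll_space_cont moll_dir_deriv e \<tau>)+
        thus "ip w (?m n \<psi> \<tau>) (conv (\<phi> \<tau>) (bump2 (eps n) b)) = - ip (dw b) (?m n \<psi> \<tau>) (?m n (G b) \<tau>) - ip w (?h b \<tau>) (?g b \<tau>)"
          using gradient_fun[OF e \<tau> b] by simp
      qed
      finally have p: "ip w (?m n \<psi> \<tau>) (?p' \<tau>) = - (\<Sum>b\<in>Basis. ip (dw b) (?m n \<psi> \<tau>) (?m n (G b) \<tau>)) - (\<Sum>b\<in>Basis. ip w (?h b \<tau>) (?g b \<tau>))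
        - ip w (?m n \<psi> \<tau>) (?m n k \<tau>)" by (simp add: sum_subtractf sum_negf)
      have "ip w (?p' \<tau>) (?m n \<psi> \<tau>) = ip w (?m n \<psi> \<tau>) (?p' \<tau>)" "ip w (?m n \<phi> \<tau>) (?m n \<psi> \<tau>) = ip w (?m n \<psi> \<tau>) (?m n \<phi> \<tau>)"
        "(\<Sum>b\<in>Basis. ip w (?g b \<tau>) (?h b \<tau>)) = (\<Sum>b\<in>Basis. ip w (?h b \<tau>) (?g b \<tau>))"
        by (auto intro: ip_commute sum.cong)
      thus ?thesis unfolding p sum.distrib by (simp only:) (simp add: p algebra_simps)
    qed
    ultimately have "((\<lambda>\<tau>. 2 * (ip w (?m n \<psi> \<tau>) (?m n \<phi> \<tau>) - ip w (?m n \<psi> \<tau>) (?m n k \<tau>) - (\<Sum>b\<in>Basis. ip (dw b) (?m n \<psi> \<tau>) (?m n (G b) \<tau>))))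
       has_integral ?E n t - ?E n s) {s..t}"
      by (rule has_integral_eq[rotated])
    moreover have "((\<lambda>\<tau>. 2 * (ip w (?m n \<psi> \<tau>) (?m n \<phi> \<tau>) - ip w (?m n \<psi> \<tau>) (?m n k \<tau>) - (\<Sum>b\<in>Basis. ip (dw b) (?m n \<psi> \<tau>) (?m n (G b) \<tau>))))
       has_integral 2 * (tip w (?m n \<psi>) (?m n \<phi>) s t - tip w (?m n \<psi>) (?m n k) s t - (\<Sum>b\<in>Basis. tip (dw b) (?m n \<psi>) (?m n (G b)) s t))) {s..t}"
      unfolding tip_def
      by (intro has_integral_mult_right has_integral_diff has_integral_sum integrable_integral tip_integrable c w_bdd dw_bdd st) auto
    ultimately show ?thesis by (rule has_integral_unique[rotated])
  qed
  moreover have "(\<lambda>n. ?E n t - ?E n s) \<longlonglongrightarrow> energy t - energy s"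
    using st unfolding energy_def by (auto intro!: tendsto_intros moll_ip_lim cont[THEN l2cont_l2] w_bdd)
  ultimately show "(\<lambda>n. 2 * (tip w (?m n \<psi>) (?m n \<phi>) s t - tip w (?m n \<psi>) (?m n k) s t - (\<Sum>b\<in>Basis. tip (dw b) (?m n \<psi>) (?m n (G b)) s t)))
     \<longlonglongrightarrow> energy t - energy s" by simp
qed

end

section \<open>Uniqueness and bounds on the velocity\<close>

text \<open>The maximum M of exp(-2 C t) E(t) on [0,T] is taken at some m. Inserting E(t) \<le> M
  exp(2 C t) into the integral inequality at m gives M \<le> M/2; the exponent 2 C is what produces
  the factor 1/2.\<close>

lemma gronwall_zero:
  fixes E :: "real \<Rightarrow> real"
  assumes c: "continuous_on {0..} E" and nn: "\<And>t. 0 \<le> t \<Longrightarrow> 0 \<le> E t" and C: "0 < C"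
    and le: "\<And>t. 0 \<le> t \<Longrightarrow> E t \<le> C * integral {0..t} E" and T: "0 \<le> T"
  shows "E T = 0"
proof -
  have "continuous_on {0..T} (\<lambda>t. exp (- 2 * C * t) * E t)"
    by (intro continuous_intros continuous_on_subset[OF c]) auto
  hence "\<exists>m\<in>{0..T}. \<forall>t\<in>{0..T}. exp (- 2 * C * t) * E t \<le> exp (- 2 * C * m) * E m"
    using T by (intro continuous_attains_sup) auto
  then obtain m where m: "m \<in> {0..T}" "\<And>t. t \<in> {0..T} \<Longrightarrow> exp (- 2 * C * t) * E t \<le> exp (- 2 * C * m) * E m"
    by blast
  define M where "M = exp (- 2 * C * m) * E m"
  have M0: "0 \<le> M" using nn[of m] m(1) by (simp add: M_def)
  have b: "E t \<le> M * exp (2 * C * t)" if t: "t \<in> {0..T}" for t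
  proof -
    have "E t = exp (2 * C * t) * (exp (- 2 * C * t) * E t)"
      by (simp add: mult.assoc[symmetric] exp_add[symmetric])
    also have "\<dots> \<le> exp (2 * C * t) * M"
      unfolding M_def by (rule mult_left_mono[OF m(2)[OF t]]) simp
    finally show ?thesis by (simp only: mult.commute)
  qed
  have I: "((\<lambda>t. M * exp (2 * C * t)) has_integral M * exp (2 * C * m) / (2 * C) - M * exp (2 * C * 0) / (2 * C)) {0..m}"
    using m(1) C by (intro fundamental_theorem_of_calculus)
      (auto simp: has_real_derivative_iff_has_vector_derivative[symmetric] intro!: derivative_eq_intros)
  have "E m \<le> C * integral {0..m} E" using le m(1) by simp
  also have "\<dots> \<le> C * integral {0..m} (\<lambda>t. M * exp (2 * C * t))"
    using C m(1) b by (intro mult_left_mono integral_le integrable_continuous_real continuous_on_subset[OF c] continuous_intros) auto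
  also have "\<dots> = M / 2 * exp (2 * C * m) - M / 2"
    using C integral_unique[OF I] by (simp add: field_simps)
  also have "\<dots> \<le> M / 2 * exp (2 * C * m)" using M0 by simp
  finally have "exp (- 2 * C * m) * E m \<le> exp (- 2 * C * m) * (M / 2 * exp (2 * C * m))"
    by (intro mult_left_mono) auto
  moreover have "exp (- 2 * C * m) * (M / 2 * exp (2 * C * m)) = M / 2" by (simp add: exp_minus field_simps)
  ultimately have "M \<le> M / 2" unfolding M_def by (simp only:)
  hence "M = 0" using M0 by simp
  thus ?thesis using b[of T] nn[of T] T by simp
qed

lemma unit_weight: "smooth_weight (\<lambda>_. 1) (\<lambda>_ _. 0) 1"
  by unfold_locales (auto simp: dir_deriv_def)

lemma ip_one: "ip (\<lambda>_. 1) a a = n2 a"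
  by (simp add: ip_def n2_def power2_eq_square)

lemma ip_zero: "ip (\<lambda>_. 0) a b = 0" by (simp add: ip_def)

lemma tip_zero: "tip (\<lambda>_. 0) a b s t = 0" by (simp add: tip_def ip_zero)

lemma ip_one_young: "l2 a \<Longrightarrow> l2 b \<Longrightarrow> 0 < c \<Longrightarrow> 2 * \<bar>ip (\<lambda>_. 1) a b\<bar> \<le> c * n2 a + n2 b / c"
  using young_pair[of a b c] by (simp add: ip_def)

lemma ip_one_am: "l2 a \<Longrightarrow> l2 b \<Longrightarrow> 2 * \<bar>ip (\<lambda>_. 1) a b\<bar> \<le> n2 a + n2 b"
  using ip_one_young[of a b 1] by simp

lemma ip_one_diff_bound:
  assumes "l2 a" "l2 b" "l2 c"
  shows "\<bar>2 * (ip (\<lambda>_. 1) a b - ip (\<lambda>_. 1) a c)\<bar> \<le> 2 * n2 a + n2 b + n2 c"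
proof -
  let ?p = "ip (\<lambda>_. 1) a b" and ?q = "ip (\<lambda>_. 1) a c"
  have "\<bar>2 * (?p - ?q)\<bar> \<le> 2 * \<bar>?p\<bar> + 2 * \<bar>?q\<bar>"
    using abs_triangle_ineq4[of ?p ?q] by (simp add: abs_mult)
  also have "\<dots> \<le> (n2 a + n2 b) + (n2 a + n2 c)"
    by (intro add_mono ip_one_am assms)
  finally show ?thesis by simp
qed

section \<open>Energy estimates with constant weight: uniqueness, and a uniform bound on the
  velocity\<close>

context wave
begin

lemma unit_weighted: "weighted_wave \<phi> \<psi> k G (\<lambda>_. 1) (\<lambda>_ _. 0) 1"
  by (intro weighted_wave.intro wave_axioms unit_weight)

definition total_energy :: "real \<Rightarrow> real" where
  "total_energy t = n2 (\<psi> t) + (\<Sum>b\<in>Basis. n2 (G b t)) + n2 (\<phi> t)"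

lemma total_energy_ge: "n2 (\<phi> t) \<le> total_energy t" "n2 (\<psi> t) \<le> total_energy t"
proof -
  have "0 \<le> (\<Sum>b\<in>Basis. n2 (G b t))" by (intro sum_nonneg) simp
  thus "n2 (\<phi> t) \<le> total_energy t" "n2 (\<psi> t) \<le> total_energy t"
    unfolding total_energy_def using n2_nonneg[of "\<phi> t"] n2_nonneg[of "\<psi> t"] by linarith+
qed

lemma total_energy_nonneg: "0 \<le> total_energy t"
  by (rule order_trans[OF n2_nonneg total_energy_ge(1)])

lemma total_energy_cont: "continuous_on {0..} total_energy"
  unfolding total_energy_def by (intro continuous_intros l2cont_n2 cont)

lemma total_energy_identity:
  assumes "0 \<le> s" "s \<le> t"
  shows "((\<lambda>\<tau>. 2 * (ip (\<lambda>_. 1) (\<psi> \<tau>) (\<phi> \<tau>) - ip (\<lambda>_. 1) (\<psi> \<tau>) (k \<tau>))) has_integral total_energy t - total_energy s) {s..t}"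
proof -
  interpret weighted_wave \<phi> \<psi> k G "\<lambda>_. 1" "\<lambda>_ _. 0" 1 by (rule unit_weighted)
  have i: "(\<lambda>\<tau>. ip (\<lambda>_. 1) (\<psi> \<tau>) (\<phi> \<tau>)) integrable_on {s..t}" "(\<lambda>\<tau>. ip (\<lambda>_. 1) (\<psi> \<tau>) (k \<tau>)) integrable_on {s..t}"
    using assms cont w_bdd by (auto intro!: tip_integrable)
  have e: "integral {s..t} (\<lambda>\<tau>. 2 * (ip (\<lambda>_. 1) (\<psi> \<tau>) (\<phi> \<tau>) - ip (\<lambda>_. 1) (\<psi> \<tau>) (k \<tau>))) = total_energy t - total_energy s"
    using energy_identity[OF assms] i by (simp add: tip_zero tip_def energy_def total_energy_def ip_one integral_diff ip_zero)
  have "(\<lambda>\<tau>. 2 * (ip (\<lambda>_. 1) (\<psi> \<tau>) (\<phi> \<tau>) - ip (\<lambda>_. 1) (\<psi> \<tau>) (k \<tau>))) integrable_on {s..t}"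
    by (intro integrable_on_mult_right integrable_diff i)
  from integrable_integral[OF this] show ?thesis unfolding e .
qed

text \<open>The source is at most a multiple of \<open>\<phi>\<close> in L^2, so Gronwall applies to
  the total energy. The rate 3 + L collects 2 from \<open>\<psi>\<close>, 1 from
  \<open>\<phi>\<close> and L from the source.\<close>

lemma zero_solution:
  assumes L: "0 \<le> L" "\<And>t. 0 \<le> t \<Longrightarrow> n2 (k t) \<le> L * n2 (\<phi> t)"
    and z: "n2 (\<phi> 0) = 0" "n2 (\<psi> 0) = 0" and T: "0 \<le> T"
  shows "n2 (\<phi> T) = 0" "n2 (\<psi> T) = 0"
proof -
  \<comment> \<open>The initial gradient is zero as well: its mollifications are convolutions of
    \<open>\<phi> 0\<close> with derivatives of the bump.\<close>
  have G0: "n2 (G b 0) = 0" if b: "b \<in> Basis" for b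
  proof -
    have l: "l2 (\<phi> 0)" "l2 (G b 0)" using cont b by (auto simp: l2cont_def)
    have "conv (G b 0) (bump (eps n)) x = 0" for n x
    proof -
      have "conv (G b 0) (bump (eps n)) x = conv (\<phi> 0) (bump1 (eps n) b) x"
        using b by (intro gradient[symmetric]) auto
      also have "\<dots> = conv (\<lambda>x. 0) (bump1 (eps n) b) x"
        using n2_eq_0_iff[OF l(1)] z(1) l(1) by (intro conv_cong_AE ckernel_bump) (auto simp: l2_def)
      finally show ?thesis by (simp add: conv_def)
    qed
    hence "n2 (conv (G b 0) (bump (eps n))) = 0" for n by (simp add: n2_def)
    with l2lim_n2[OF conv_bump_lim[OF l(2)]] show ?thesis by (simp add: LIMSEQ_const_iff)
  qed
  note nn = total_energy_nonneg total_energy_ge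
  have e0: "total_energy 0 = 0" by (simp add: total_energy_def z G0)
  have "total_energy t \<le> (3 + L) * integral {0..t} total_energy" if t: "0 \<le> t" for t
  proof -
    have i: "total_energy integrable_on {0..t}"
      by (intro integrable_continuous_real continuous_on_subset[OF total_energy_cont]) auto
    have "total_energy t - total_energy 0 \<le> integral {0..t} (\<lambda>\<tau>. (3 + L) * total_energy \<tau>)"
    proof (rule has_integral_le[OF total_energy_identity[OF order_refl t]])
      show "((\<lambda>\<tau>. (3 + L) * total_energy \<tau>) has_integral integral {0..t} (\<lambda>\<tau>. (3 + L) * total_energy \<tau>)) {0..t}"
        using i by (intro integrable_integral integrable_on_mult_right)
      fix \<tau> assume "\<tau> \<in> {0..t}"
      hence \<tau>: "0 \<le> \<tau>" by simp
      have l: "l2 (\<phi> \<tau>)" "l2 (\<psi> \<tau>)" "l2 (k \<tau>)" using cont \<tau> by (auto simp: l2cont_def)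
      have "2 * (ip (\<lambda>_. 1) (\<psi> \<tau>) (\<phi> \<tau>) - ip (\<lambda>_. 1) (\<psi> \<tau>) (k \<tau>)) \<le> 2 * n2 (\<psi> \<tau>) + n2 (\<phi> \<tau>) + n2 (k \<tau>)"
        by (rule order_trans[OF abs_ge_self ip_one_diff_bound[OF l(2,1,3)]])
      also have "\<dots> \<le> 2 * total_energy \<tau> + total_energy \<tau> + L * total_energy \<tau>"
        using nn[of \<tau>] L(2)[OF \<tau>] mult_left_mono[OF nn(2)[of \<tau>] L(1)] by linarith
      also have "\<dots> = (3 + L) * total_energy \<tau>" by (simp add: algebra_simps)
      finally show "2 * (ip (\<lambda>_. 1) (\<psi> \<tau>) (\<phi> \<tau>) - ip (\<lambda>_. 1) (\<psi> \<tau>) (k \<tau>)) \<le> (3 + L) * total_energy \<tau>" .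
    qed
    thus ?thesis by (simp add: e0)
  qed
  hence "total_energy T = 0" using L(1) nn T by (intro gronwall_zero[OF total_energy_cont, where C="3 + L"]) auto
  thus "n2 (\<phi> T) = 0" "n2 (\<psi> T) = 0"
    using nn(2,3)[of T] n2_nonneg[of "\<phi> T"] n2_nonneg[of "\<psi> T"] by linarith+
qed

text \<open>With m the integral of \<open>n2 (\<psi> \<tau>)\<close> over a unit interval, the
  energy varies there by at most 2 m + 1 + L and hence stays below 3 m + 3 + L. The virial identity
  bounds m by its boundary terms, in which the energy enters with a small factor. The loop closes at
  m \<le> 20 + 3 L, and 3 m + 3 + L \<le> 63 + 10 L.\<close>

lemma velocity_bounded:
  assumes b: "\<And>t. 0 \<le> t \<Longrightarrow> n2 (\<phi> t) \<le> 1" "\<And>t. 0 \<le> t \<Longrightarrow> (\<Sum>b\<in>Basis. n2 (G b t)) \<le> 1" "\<And>t. 0 \<le> t \<Longrightarrow> n2 (k t) \<le> L"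
    and T: "0 \<le> T"
  shows "n2 (\<psi> T) \<le> 63 + 10 * L"
proof -
  interpret weighted_wave \<phi> \<psi> k G "\<lambda>_. 1" "\<lambda>_ _. 0" 1 by (rule unit_weighted)
  define m where "m = integral {T..T+1} (\<lambda>\<tau>. n2 (\<psi> \<tau>))"
  have ipsi: "(\<lambda>\<tau>. n2 (\<psi> \<tau>)) integrable_on S" if "S = {s..t}" "0 \<le> s" for s t S
    unfolding that(1) using that(2) by (intro integrable_continuous_real continuous_on_subset[OF l2cont_n2[OF cont(2)]]) auto
  have mi: "((\<lambda>\<tau>. n2 (\<psi> \<tau>)) has_integral m) {T..T+1}"
    unfolding m_def by (rule integrable_integral[OF ipsi[OF refl T]])
  have l: "l2 (\<phi> \<tau>)" "l2 (\<psi> \<tau>)" "l2 (k \<tau>)" if "0 \<le> \<tau>" for \<tau> using cont that by (auto simp: l2cont_def)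
  have diff: "\<bar>total_energy t - total_energy s\<bar> \<le> 2 * m + 1 + L" if "T \<le> s" "s \<le> t" "t \<le> T + 1" for s t
  proof -
    have i: "(\<lambda>\<tau>. 2 * n2 (\<psi> \<tau>) + (1 + L)) integrable_on {a..b}" if "0 \<le> a" for a b
      using ipsi[OF refl that] by (intro integrable_add integrable_on_mult_right) auto
    have "norm (integral {s..t} (\<lambda>\<tau>. 2 * (ip (\<lambda>_. 1) (\<psi> \<tau>) (\<phi> \<tau>) - ip (\<lambda>_. 1) (\<psi> \<tau>) (k \<tau>)))) \<le>
       integral {s..t} (\<lambda>\<tau>. 2 * n2 (\<psi> \<tau>) + (1 + L))"
    proof (rule integral_norm_bound_integral)
      show "(\<lambda>\<tau>. 2 * (ip (\<lambda>_. 1) (\<psi> \<tau>) (\<phi> \<tau>) - ip (\<lambda>_. 1) (\<psi> \<tau>) (k \<tau>))) integrable_on {s..t}"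
        using total_energy_identity[of s t] that T by (auto simp: integrable_on_def)
      show "(\<lambda>\<tau>. 2 * n2 (\<psi> \<tau>) + (1 + L)) integrable_on {s..t}" using i that T by simp
      fix \<tau> assume "\<tau> \<in> {s..t}"
      hence \<tau>: "0 \<le> \<tau>" using that T by simp
      show "norm (2 * (ip (\<lambda>_. 1) (\<psi> \<tau>) (\<phi> \<tau>) - ip (\<lambda>_. 1) (\<psi> \<tau>) (k \<tau>))) \<le> 2 * n2 (\<psi> \<tau>) + (1 + L)"
        using ip_one_diff_bound[OF l(2)[OF \<tau>] l(1)[OF \<tau>] l(3)[OF \<tau>]] b(1)[OF \<tau>] b(3)[OF \<tau>]
        unfolding real_norm_def by linarith
    qed
    also have "\<dots> \<le> integral {T..T+1} (\<lambda>\<tau>. 2 * n2 (\<psi> \<tau>) + (1 + L))"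
    proof (rule integral_subset_le)
      show "\<forall>\<tau>\<in>{T..T+1}. 0 \<le> 2 * n2 (\<psi> \<tau>) + (1 + L)"
      proof
        fix \<tau> assume "\<tau> \<in> {T..T+1}"
        hence "0 \<le> \<tau>" using T by simp
        from b(3)[OF this] show "0 \<le> 2 * n2 (\<psi> \<tau>) + (1 + L)" using n2_nonneg[of "k \<tau>"] n2_nonneg[of "\<psi> \<tau>"] by linarith
      qed
    qed (use i that T in auto)
    also have "\<dots> = 2 * m + (1 + L)"
      using has_integral_add[OF has_integral_mult_right[OF mi, of 2] has_integral_const_real[of "1 + L" T "T + 1"]]
      by (intro integral_unique) simp
    finally show ?thesis using integral_unique[OF total_energy_identity[of s t]] that T by simp
  qed
  \<comment> \<open>The energy at t is compared with the energy at every s of the interval, and the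
    comparison is averaged over s, since only the mean of \<open>n2 (\<psi> s)\<close> is at
    hand.\<close>
  have en: "total_energy t \<le> 3 * m + 3 + L" if t: "t \<in> {T..T+1}" for t
  proof -
    have "integral {T..T+1} (\<lambda>s. total_energy t) \<le> integral {T..T+1} (\<lambda>s. n2 (\<psi> s) + (2 * m + 3 + L))"
    proof (rule integral_le)
      show "(\<lambda>s. n2 (\<psi> s) + (2 * m + 3 + L)) integrable_on {T..T + 1}"
        using ipsi[OF refl T] by (intro integrable_add) auto
      fix s assume s: "s \<in> {T..T+1}"
      have "total_energy t \<le> total_energy s + 2 * m + 1 + L"
        using diff[of s t] diff[of t s] s t by (cases "s \<le> t") auto
      moreover have "total_energy s \<le> n2 (\<psi> s) + 2"
        unfolding total_energy_def using b(1)[of s] b(2)[of s] s T by simp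
      ultimately show "total_energy t \<le> n2 (\<psi> s) + (2 * m + 3 + L)" by simp
    qed auto
    also have "\<dots> = m + (2 * m + 3 + L)"
      using has_integral_add[OF mi has_integral_const_real[of "2 * m + 3 + L" T "T + 1"]]
      by (intro integral_unique) simp
    finally show ?thesis by simp
  qed
  have psi: "n2 (\<psi> t) \<le> 3 * m + 3 + L" if t: "t \<in> {T..T+1}" for t
    using total_energy_ge(2)[of t] en[OF t] by linarith
  \<comment> \<open>Young's weight 12 puts 1/24 in front of the velocity bound. The two boundary
    terms together then contain 2 * 3 m / 24 = m/4, which is absorbed by m.\<close>
  have pair: "\<bar>ip (\<lambda>_. 1) (\<phi> t) (\<psi> t)\<bar> \<le> 6 + (3 * m + 3 + L) / 24" if t: "t \<in> {T..T+1}" for t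
  proof -
    have "0 \<le> t" using t T by simp
    define X where "X = \<bar>ip (\<lambda>_. 1) (\<phi> t) (\<psi> t)\<bar>"
    have "2 * X \<le> 12 * n2 (\<phi> t) + n2 (\<psi> t) / 12"
      unfolding X_def using \<open>0 \<le> t\<close> by (intro ip_one_young l) auto
    hence "X \<le> 6 + (3 * m + 3 + L) / 24" using b(1)[OF \<open>0 \<le> t\<close>] psi[OF t] by argo
    thus ?thesis by (simp only: X_def)
  qed
  have "m = tip (\<lambda>_. 1) \<psi> \<psi> T (T+1)" by (simp add: m_def tip_def ip_one)
  also have "\<dots> = (\<Sum>b\<in>Basis. tip (\<lambda>_. 1) (G b) (G b) T (T+1)) + tip (\<lambda>_. 1) \<phi> k T (T+1)
     + (ip (\<lambda>_. 1) (\<phi> (T+1)) (\<psi> (T+1)) - ip (\<lambda>_. 1) (\<phi> T) (\<psi> T))"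
    using virial_identity[OF T, of "T+1"] by (simp add: tip_zero)
  also have "(\<Sum>b\<in>Basis. tip (\<lambda>_. 1) (G b) (G b) T (T+1)) = integral {T..T+1} (\<lambda>t. \<Sum>b\<in>Basis. n2 (G b t))"
    unfolding tip_def ip_one using T
    by (intro integral_sum[symmetric] integrable_continuous_real continuous_on_subset[OF l2cont_n2[OF cont(4)]]) auto
  also have "\<dots> \<le> integral {T..T+1} (\<lambda>t. 1)"
    using T b(2) by (intro integral_le integrable_continuous_real continuous_intros continuous_on_subset[OF l2cont_n2[OF cont(4)]]) auto
  also have "tip (\<lambda>_. 1) \<phi> k T (T+1) \<le> integral {T..T+1} (\<lambda>t. (1 + L) / 2)"
    unfolding tip_def
  proof (rule integral_le)
    fix t assume "t \<in> {T..T+1}"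
    hence t: "0 \<le> t" using T by simp
    show "ip (\<lambda>_. 1) (\<phi> t) (k t) \<le> (1 + L) / 2"
      using ip_one_am[OF l(1)[OF t] l(3)[OF t]] b(1)[OF t] b(3)[OF t] abs_ge_self[of "ip (\<lambda>_. 1) (\<phi> t) (k t)"] by argo
  qed (use T cont w_bdd in \<open>auto intro!: tip_integrable\<close>)
  finally have "m \<le> 1 + (1 + L) / 2 + 2 * (6 + (3 * m + 3 + L) / 24)"
    using pair[of T, unfolded abs_le_iff] pair[of "T+1", unfolded abs_le_iff] by (auto simp: add_divide_distrib)
  moreover have "0 \<le> L" using b(3)[OF T] n2_nonneg[of "k T"] by linarith
  ultimately have "m \<le> 20 + 3 * L" by argo
  thus ?thesis using psi[of T] by simp
qed

end

section \<open>Weighted inequalities on the half line\<close>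

text \<open>The half line is encoded by an indicator factor on the whole line, so that the L^2
  results for \<open>lborel\<close> apply directly.\<close>

definition pos :: "real \<Rightarrow> real" where "pos r = indicator {0<..} r"

definition hl_integrable :: "(real \<Rightarrow> real) \<Rightarrow> bool" where
  "hl_integrable f \<longleftrightarrow> integrable lborel (\<lambda>r. pos r * f r)"

definition hl_integral :: "(real \<Rightarrow> real) \<Rightarrow> real" where
  "hl_integral f = (LINT r|lborel. pos r * f r)"

definition hl2 :: "(real \<Rightarrow> real) \<Rightarrow> bool" where
  "hl2 f \<longleftrightarrow> l2 (\<lambda>r. pos r * f r)"

lemma pos_meas[measurable]: "pos \<in> borel_measurable borel" unfolding pos_def by simp
lemma pos_simps[simp]: "0 < r \<Longrightarrow> pos r = 1" "r \<le> 0 \<Longrightarrow> pos r = 0" "pos r * (pos r * a) = pos r * a" "0 \<le> pos r" "pos r * pos r = pos r"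
  by (auto simp: pos_def indicator_def)

lemma pos_cases: "(0 < r \<Longrightarrow> pos r = 1 \<Longrightarrow> P) \<Longrightarrow> (r \<le> 0 \<Longrightarrow> pos r = 0 \<Longrightarrow> P) \<Longrightarrow> P"
  by (cases "0 < r") auto

lemma hl_integral_cong: "(\<And>r. 0 < r \<Longrightarrow> f r = g r) \<Longrightarrow> hl_integral f = hl_integral g"
  unfolding hl_integral_def by (intro Bochner_Integration.integral_cong refl) (metis mult_zero_left not_le pos_simps(2))

lemma hl_integrable_cong: "(\<And>r. 0 < r \<Longrightarrow> f r = g r) \<Longrightarrow> hl_integrable f = hl_integrable g"
  unfolding hl_integrable_def by (intro Bochner_Integration.integrable_cong refl) (metis mult_zero_left not_le pos_simps(2))

lemma hl_integral_add: "hl_integrable f \<Longrightarrow> hl_integrable g \<Longrightarrow> hl_integral (\<lambda>r. f r + g r) = hl_integral f + hl_integral g"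
  and hl_integral_diff: "hl_integrable f \<Longrightarrow> hl_integrable g \<Longrightarrow> hl_integral (\<lambda>r. f r - g r) = hl_integral f - hl_integral g"
  and hl_integrable_add: "hl_integrable f \<Longrightarrow> hl_integrable g \<Longrightarrow> hl_integrable (\<lambda>r. f r + g r)"
  and hl_integrable_diff: "hl_integrable f \<Longrightarrow> hl_integrable g \<Longrightarrow> hl_integrable (\<lambda>r. f r - g r)"
  by (simp_all add: hl_integrable_def hl_integral_def distrib_left right_diff_distrib)

lemma hl_integral_cmult: "hl_integral (\<lambda>r. c * f r) = c * hl_integral f"
  by (simp add: hl_integral_def mult.left_commute)
lemma hl_integrable_cmult: "hl_integrable f \<Longrightarrow> hl_integrable (\<lambda>r. c * f r)"
  by (simp add: hl_integrable_def mult.left_commute)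

lemma hl_integral_mono: "hl_integrable f \<Longrightarrow> hl_integrable g \<Longrightarrow> (\<And>r. 0 < r \<Longrightarrow> f r \<le> g r) \<Longrightarrow> hl_integral f \<le> hl_integral g"
  unfolding hl_integrable_def hl_integral_def
  by (rule integral_mono) (auto intro: pos_cases simp: pos_def indicator_def)

lemma hl_integral_nonneg: "(\<And>r. 0 < r \<Longrightarrow> 0 \<le> f r) \<Longrightarrow> 0 \<le> hl_integral f"
  unfolding hl_integral_def by (rule Bochner_Integration.integral_nonneg) (auto simp: pos_def indicator_def)

lemma hl_integrable_bound:
  assumes "hl_integrable g" "f \<in> borel_measurable borel" "\<And>r. 0 < r \<Longrightarrow> \<bar>f r\<bar> \<le> g r"
  shows "hl_integrable f"
  unfolding hl_integrable_def
proof (rule Bochner_Integration.integrable_bound)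
  show "integrable lborel (\<lambda>r. pos r * g r)" using assms by (simp add: hl_integrable_def)
  show "(\<lambda>r. pos r * f r) \<in> borel_measurable lborel" using assms(2) by simp
  show "AE r in lborel. norm (pos r * f r) \<le> norm (pos r * g r)"
  proof (rule AE_I2)
    fix r show "norm (pos r * f r) \<le> norm (pos r * g r)"
      by (rule pos_cases[of r]) (use assms(3)[of r] in auto)
  qed
qed

lemma hl2_mult:
  assumes "w \<in> borel_measurable borel" "\<And>r. 0 < r \<Longrightarrow> \<bar>w r\<bar> \<le> B" "hl2 f" "hl2 g"
  shows "hl_integrable (\<lambda>r. w r * f r * g r)"
proof -
  have b: "\<bar>pos r * w r\<bar> \<le> max B 0" for r by (rule pos_cases[of r]) (use assms(2)[of r] in auto)
  have "integrable lborel (\<lambda>r. (pos r * w r) * (pos r * f r) * (pos r * g r))"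
    by (rule l2_mult_integrable[OF l2_weight(1)[where w="\<lambda>r. pos r * w r" and u="\<lambda>r. pos r * f r", OF _ _ b]])
       (use assms in \<open>auto simp: hl2_def\<close>)
  moreover have "(pos r * w r) * (pos r * f r) * (pos r * g r) = pos r * (w r * f r * g r)" for r
    by (rule pos_cases[of r]) auto
  ultimately show ?thesis by (simp add: hl_integrable_def)
qed

lemma hl_cauchy_schwarz:
  assumes "hl2 f" "hl2 g"
  shows "(hl_integral (\<lambda>r. f r * g r))\<^sup>2 \<le> hl_integral (\<lambda>r. (f r)\<^sup>2) * hl_integral (\<lambda>r. (g r)\<^sup>2)"
proof -
  have e: "pos r * f r * (pos r * g r) = pos r * (f r * g r)" "(pos r * f r)\<^sup>2 = pos r * (f r)\<^sup>2" "(pos r * g r)\<^sup>2 = pos r * (g r)\<^sup>2" for r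
    by (rule pos_cases[of r]; simp)+
  show ?thesis using cauchy_schwarz_sq[OF assms[unfolded hl2_def]] by (simp add: hl_integral_def n2_def e)
qed

lemma hl2_sq: "hl2 f \<Longrightarrow> hl_integrable (\<lambda>r. (f r)\<^sup>2)"
  using hl2_mult[of "\<lambda>_. 1" 1 f f] by (simp add: power2_eq_square)

lemma hl2_weight:
  assumes "w \<in> borel_measurable borel" "\<And>r. 0 < r \<Longrightarrow> \<bar>w r\<bar> \<le> B" "hl2 f" shows "hl2 (\<lambda>r. w r * f r)"
proof -
  have b: "\<bar>pos r * w r\<bar> \<le> max B 0" for r by (rule pos_cases[of r]) (use assms(2)[of r] in auto)
  have "l2 (\<lambda>r. (pos r * w r) * (pos r * f r))"
    by (rule l2_weight(1)[where w="\<lambda>r. pos r * w r" and u="\<lambda>r. pos r * f r", OF _ _ b])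
       (use assms in \<open>auto simp: hl2_def\<close>)
  thus ?thesis by (simp add: hl2_def mult.assoc mult.left_commute)
qed

lemma hl2_bound:
  assumes "f \<in> borel_measurable borel" "hl2 g" "\<And>r. 0 < r \<Longrightarrow> \<bar>f r\<bar> \<le> \<bar>g r\<bar>" shows "hl2 f"
  unfolding hl2_def
proof (rule l2_bound(1)[where C=1])
  show "l2 (\<lambda>r. pos r * g r)" using assms by (simp add: hl2_def)
  show "AE r in lborel. \<bar>pos r * f r\<bar> \<le> 1 * \<bar>pos r * g r\<bar>"
  proof (rule AE_I2)
    fix r show "\<bar>pos r * f r\<bar> \<le> 1 * \<bar>pos r * g r\<bar>" by (rule pos_cases[of r]) (use assms(3)[of r] in auto)
  qed
qed (use assms(1) in simp)

lemma hl2_add: "hl2 f \<Longrightarrow> hl2 g \<Longrightarrow> hl2 (\<lambda>r. f r + g r)"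
  unfolding hl2_def using l2_add(1)[of "\<lambda>r. pos r * f r" "\<lambda>r. pos r * g r"] by (simp add: distrib_left)

lemma hl_ftc:
  assumes d: "\<And>r. 0 \<le> r \<Longrightarrow> (h has_real_derivative h' r) (at r)" and c: "continuous_on {0..} h'"
    and i: "hl_integrable h'" and y: "0 \<le> y"
  shows "(LINT r|lborel. (pos r * h' r) * indicator {..y} r) = h y - h 0"
proof -
  have "(LINT r|lborel. (pos r * h' r) * indicator {..y} r) = (LINT r|lborel. indicator {0..y} r *\<^sub>R h' r)"
  proof (rule integral_cong_AE)
    have m: "(\<lambda>r. pos r * h' r) \<in> borel_measurable borel" using i by (simp add: hl_integrable_def)
    thus "(\<lambda>r. (pos r * h' r) * indicator {..y} r) \<in> borel_measurable lborel" by simp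
    show "(\<lambda>r. indicator {0..y} r *\<^sub>R h' r) \<in> borel_measurable lborel"
      using borel_measurable_continuous_on_indicator[of "{0..y}" h'] continuous_on_subset[OF c, of "{0..y}"] by auto
    have "AE r in lborel. r \<noteq> (0::real)" by (rule AE_lborel_singleton)
    thus "AE r in lborel. (pos r * h' r) * indicator {..y} r = indicator {0..y} r *\<^sub>R h' r"
      by eventually_elim (auto simp: pos_def indicator_def)
  qed
  also have "\<dots> = h y - h 0"
  proof (rule integral_FTC_Icc[OF y])
    show "continuous_on {0..y} h'" by (rule continuous_on_subset[OF c]) auto
    fix r assume "0 \<le> r" "r \<le> y"
    thus "(h has_vector_derivative h' r) (at r within {0..y})"
      using d[of r] by (auto simp: has_real_derivative_iff_has_vector_derivative intro: has_vector_derivative_at_within)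
  qed
  finally show ?thesis .
qed

text \<open>Integrability of \<open>h'\<close> gives \<open>h\<close> a limit at infinity, and
  integrability of \<open>h\<close> forces this limit to be 0. Only the boundary term at the origin
  remains.\<close>

lemma hl_integral_derivative:
  assumes d: "\<And>r. 0 \<le> r \<Longrightarrow> (h has_real_derivative h' r) (at r)" and c: "continuous_on {0..} h'"
    and i: "hl_integrable h" "hl_integrable h'"
  shows "hl_integral h' = - h 0"
proof -
  have "((\<lambda>y. LINT r|lborel. (pos r * h' r) * indicator {..y} r) \<longlongrightarrow> (LINT r|lborel. pos r * h' r)) at_top"
  proof (rule integral_dominated_convergence_at_top)
    show "integrable lborel (\<lambda>r. \<bar>pos r * h' r\<bar>)" using i by (simp add: hl_integrable_def)
    show "(\<lambda>r. (pos r * h' r)) \<in> borel_measurable lborel" using i by (auto simp: hl_integrable_def)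
    thus "(\<lambda>r. (pos r * h' r) * indicator {..y} r) \<in> borel_measurable lborel" for y by simp
    show "\<forall>\<^sub>F y in at_top. AE r in lborel. norm ((pos r * h' r) * indicator {..y} r) \<le> \<bar>pos r * h' r\<bar>"
      by (auto simp: indicator_def)
    show "AE r in lborel. ((\<lambda>y. (pos r * h' r) * indicator {..y} r) \<longlongrightarrow> pos r * h' r) at_top"
    proof (rule AE_I2)
      fix r :: real
      have "\<forall>\<^sub>F y in at_top. (pos r * h' r) * indicator {..y} r = pos r * h' r"
        using eventually_ge_at_top[of r] by eventually_elim (simp add: indicator_def)
      thus "((\<lambda>y. (pos r * h' r) * indicator {..y} r) \<longlongrightarrow> pos r * h' r) at_top" by (rule tendsto_eventually)
    qed
  qed
  hence "((\<lambda>y. h y - h 0) \<longlongrightarrow> hl_integral h') at_top"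
    unfolding hl_integral_def
  proof (rule Lim_transform_eventually)
    show "\<forall>\<^sub>F y in at_top. (LINT r|lborel. (pos r * h' r) * indicator {..y} r) = h y - h 0"
      using eventually_ge_at_top[of 0] by eventually_elim (rule hl_ftc[OF d c i(2)])
  qed
  from tendsto_add[OF this tendsto_const[of "h 0"]] have L: "(h \<longlongrightarrow> hl_integral h' + h 0) at_top" by simp
  \<comment> \<open>A nonzero limit would keep |h| above a positive constant on a ray, and rays have
    infinite measure.\<close>
  have "hl_integral h' + h 0 = 0"
  proof (rule ccontr)
    define L where "L = hl_integral h' + h 0"
    assume "hl_integral h' + h 0 \<noteq> 0"
    hence Lp: "0 < \<bar>L\<bar> / 2" by (simp add: L_def)
    from tendstoD[OF L Lp] have "\<forall>\<^sub>F y in at_top. dist (h y) L < \<bar>L\<bar> / 2" by (simp add: L_def)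
    then obtain N where N: "\<And>y. y \<ge> N \<Longrightarrow> dist (h y) L < \<bar>L\<bar> / 2" by (auto simp: eventually_at_top_linorder)
    have b: "\<bar>L\<bar> / 2 \<le> \<bar>h y\<bar>" if "y \<ge> N" for y using N[OF that] by (auto simp: dist_real_def abs_if split: if_splits)
    have "integrable lborel (\<lambda>y. indicator {max N 1..} y * (\<bar>L\<bar> / 2))"
    proof (rule Bochner_Integration.integrable_bound[OF i(1)[unfolded hl_integrable_def]])
      show "AE y in lborel. norm (indicator {max N 1..} y * (\<bar>L\<bar> / 2)) \<le> norm (pos y * h y)"
        using b by (auto simp: indicator_def pos_def)
    qed simp
    hence "integrable lborel (\<lambda>y. indicator {max N 1..} y * (\<bar>L\<bar> / 2) * (2 / \<bar>L\<bar>))" by (rule integrable_mult_left)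
    hence "integrable lborel (indicator {max N 1..} :: real \<Rightarrow> real)" using Lp by simp
    hence "emeasure lborel {max N 1..} < \<infinity>" by (simp add: integrable_indicator_iff)
    moreover have "ennreal (real n) \<le> emeasure lborel {max N 1..}" for n
    proof -
      have "emeasure lborel {max N 1..max N 1 + real n} \<le> emeasure lborel {max N 1..}"
        by (intro emeasure_mono) auto
      thus ?thesis by simp
    qed
    ultimately show False
      by (metis ennreal_Ex_less_of_nat ennreal_of_nat_eq_real_of_nat infinity_ennreal_def leD)
  qed
  thus ?thesis by simp
qed

lemma hl_pointwise_bound:
  assumes d: "\<And>r. 0 \<le> r \<Longrightarrow> (h has_real_derivative h' r) (at r)" and c: "continuous_on {0..} h'"
    and i: "hl_integrable h'" and h0: "h 0 = 0" and y: "0 \<le> y"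
  shows "\<bar>h y\<bar> \<le> hl_integral (\<lambda>r. \<bar>h' r\<bar>)"
proof -
  have j: "integrable lborel (\<lambda>r. pos r * h' r)" using i by (simp add: hl_integrable_def)
  have k: "integrable lborel (\<lambda>r. (pos r * h' r) * indicator {..y} r)"
    by (rule Bochner_Integration.integrable_bound[OF j]) (use j in \<open>auto simp: indicator_def\<close>)
  have "\<bar>h y\<bar> = \<bar>LINT r|lborel. (pos r * h' r) * indicator {..y} r\<bar>" using hl_ftc[OF d c i y] h0 by simp
  also have "\<dots> \<le> (LINT r|lborel. \<bar>(pos r * h' r) * indicator {..y} r\<bar>)" by (rule integral_abs_bound)
  also have "\<dots> \<le> (LINT r|lborel. \<bar>pos r * h' r\<bar>)"
    using j k by (intro integral_mono) (auto simp: indicator_def)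
  finally show ?thesis by (simp add: hl_integral_def abs_mult)
qed

text \<open>With u = \<open>inv1p\<close>, the function h(r) = r/(1+r) is 1 - u, and u' = - u^2.
  Hence h' = u^2, h'' = -2 u^3 and h''' = 6 u^4, and all weights below are powers of u.\<close>

definition inv1p :: "real \<Rightarrow> real" where "inv1p r = 1 / (1 + r)"

lemma inv1p_deriv: "0 \<le> r \<Longrightarrow> (inv1p has_real_derivative - (inv1p r)\<^sup>2) (at r)"
  unfolding inv1p_def by (auto intro!: derivative_eq_intros simp: power2_eq_square)
lemma inv1p_cont: "continuous_on {0..} inv1p"
  unfolding inv1p_def by (intro continuous_intros) auto
lemma inv1p_meas[measurable]: "inv1p \<in> borel_measurable borel" unfolding inv1p_def by simp
lemma inv1p_pos: "0 \<le> r \<Longrightarrow> 0 < inv1p r" by (simp add: inv1p_def)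
lemma inv1p_le1: "0 \<le> r \<Longrightarrow> inv1p r \<le> 1" by (simp add: inv1p_def)
lemma inv1p_abs_power: "0 \<le> r \<Longrightarrow> \<bar>inv1p r ^ n\<bar> \<le> 1"
  using inv1p_pos[of r] inv1p_le1[of r] by (simp add: power_le_one)

section \<open>Transport, Hardy and sup bounds for a function on the half line that vanishes at
  0\<close>

locale half_line_fun =
  fixes v v1 :: "real \<Rightarrow> real"
  assumes v_deriv: "\<And>r. (v has_real_derivative v1 r) (at r)" and v1_cont: "continuous_on UNIV v1"
    and v_hl2: "hl2 v" and v1_hl2: "hl2 v1" and v0: "v 0 = 0"
begin

lemma v_cont: "continuous_on UNIV v"
  using v_deriv by (meson DERIV_continuous_on has_field_derivative_at_within)

lemma v_meas[measurable]: "v \<in> borel_measurable borel" "v1 \<in> borel_measurable borel"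
  using v_cont v1_cont by (auto intro: borel_measurable_continuous_onI)

lemma wint: "hl_integrable (\<lambda>r. inv1p r ^ n * v r * v r)" "hl_integrable (\<lambda>r. inv1p r ^ n * v r * v1 r)"
  "hl_integrable (\<lambda>r. inv1p r ^ n * v1 r * v1 r)"
  by (intro hl2_mult[where B=1] v_hl2 v1_hl2; simp add: inv1p_abs_power)+

text \<open>\<open>A\<close> is the integral of h' v1^2 and \<open>B\<close> that of (h'''/6) v^2,
  the two quadratic forms of the Morawetz identity.\<close>

definition A where "A = hl_integral (\<lambda>r. inv1p r ^ 2 * v1 r * v1 r)"
definition B where "B = hl_integral (\<lambda>r. inv1p r ^ 4 * v r * v r)"

lemma B_nonneg: "0 \<le> B" and A_nonneg: "0 \<le> A" unfolding A_def B_def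
  by (auto intro!: hl_integral_nonneg simp: mult.assoc)

text \<open>The integrand is the derivative of (1/2) h v^2. This is the skewness of h d/dr +
  h'/2.\<close>

lemma transport_zero: "hl_integral (\<lambda>r. v r * ((1 - inv1p r) * v1 r + 1/2 * (inv1p r)\<^sup>2 * v r)) = 0"
proof -
  let ?h = "\<lambda>r. 1/2 * (v r * v r) - 1/2 * (inv1p r * v r * v r)"
  let ?h' = "\<lambda>r. v r * v1 r - (inv1p r * v r * v1 r) + 1/2 * (inv1p r ^ 2 * v r * v r)"
  have "hl_integral ?h' = - ?h 0"
  proof (rule hl_integral_derivative)
    show "(?h has_real_derivative ?h' r) (at r)" if "0 \<le> r" for r
      by (rule derivative_eq_intros v_deriv inv1p_deriv that refl)+ (simp add: power2_eq_square algebra_simps)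
    show "continuous_on {0..} ?h'"
      by (intro continuous_intros continuous_on_subset[OF v_cont] continuous_on_subset[OF v1_cont] inv1p_cont) auto
    show "hl_integrable ?h" "hl_integrable ?h'"
      using wint(1)[of 0] wint(1)[of 1] wint(2)[of 0] wint(2)[of 1] wint(1)[of 2]
      by (auto intro!: hl_integrable_add hl_integrable_diff hl_integrable_cmult simp del: times_divide_eq_left)
  qed
  thus ?thesis by (simp add: v0 algebra_simps power2_eq_square)
qed

text \<open>The square of u v1 - a u^2 v is integrated. Since the integral of u^3 v v1 equals (3/2)
  \<open>B\<close>, the outcome is A - (3 a - a^2) B \<ge> 0, and a = 3/2 is the best
  choice.\<close>

lemma hardy: "9/4 * B \<le> A"
proof -
  let ?h = "\<lambda>r. inv1p r ^ 3 * v r * v r"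
  let ?h' = "\<lambda>r. 2 * (inv1p r ^ 3 * v r * v1 r) - 3 * (inv1p r ^ 4 * v r * v r)"
  have "hl_integral ?h' = - ?h 0"
  proof (rule hl_integral_derivative)
    show "(?h has_real_derivative ?h' r) (at r)" if "0 \<le> r" for r
      by (rule derivative_eq_intros v_deriv inv1p_deriv that refl)+ (simp add: power2_eq_square eval_nat_numeral algebra_simps)
    show "continuous_on {0..} ?h'"
      by (intro continuous_intros continuous_on_subset[OF v_cont] continuous_on_subset[OF v1_cont] inv1p_cont) auto
    show "hl_integrable ?h" "hl_integrable ?h'"
      by (intro hl_integrable_diff hl_integrable_cmult wint)+
  qed
  hence c: "2 * hl_integral (\<lambda>r. inv1p r ^ 3 * v r * v1 r) = 3 * B"
    by (simp add: v0 hl_integral_diff hl_integral_cmult hl_integrable_cmult wint B_def)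
  have "0 \<le> hl_integral (\<lambda>r. (inv1p r * v1 r - 3/2 * (inv1p r ^ 2 * v r))\<^sup>2)"
    by (rule hl_integral_nonneg) simp
  also have "\<dots> = hl_integral (\<lambda>r. (inv1p r ^ 2 * v1 r * v1 r) - 3 * (inv1p r ^ 3 * v r * v1 r) + 9/4 * (inv1p r ^ 4 * v r * v r))"
    by (intro hl_integral_cong) (simp add: power2_eq_square eval_nat_numeral algebra_simps)
  also have "\<dots> = A - 3 * hl_integral (\<lambda>r. inv1p r ^ 3 * v r * v1 r) + 9/4 * B"
    unfolding A_def B_def
    by (simp only: hl_integral_add hl_integral_diff hl_integral_cmult hl_integrable_add hl_integrable_diff hl_integrable_cmult wint)
  finally show ?thesis using c by linarith
qed

text \<open>A one-dimensional Sobolev inequality: u v^2 vanishes at 0 and is bounded by the integral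
  of the absolute value of its derivative 2 u v v1 - u^2 v^2. Cauchy-Schwarz keeps one unweighted
  factor v and places all weights on the other; 3 = 2 + 1.\<close>

lemma sup_bound:
  assumes y: "0 \<le> y"
  shows "inv1p y * (v y)\<^sup>2 \<le> 3 * sqrt (hl_integral (\<lambda>r. (v r)\<^sup>2)) * sqrt (A + B)"
proof -
  let ?h = "\<lambda>r. inv1p r * v r * v r"
  let ?h' = "\<lambda>r. 2 * (inv1p r ^ 1 * v r * v1 r) - (inv1p r ^ 2 * v r * v r)"
  let ?N = "hl_integral (\<lambda>r. (v r)\<^sup>2)"
  have N: "0 \<le> ?N" by (rule hl_integral_nonneg) simp
  have ih: "hl_integrable ?h'" by (intro hl_integrable_diff hl_integrable_cmult wint)
  have "\<bar>?h y\<bar> \<le> hl_integral (\<lambda>r. \<bar>?h' r\<bar>)"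
  proof (rule hl_pointwise_bound[OF _ _ ih _ y])
    show "(?h has_real_derivative ?h' r) (at r)" if "0 \<le> r" for r
      by (rule derivative_eq_intros v_deriv inv1p_deriv that refl)+ (simp add: power2_eq_square algebra_simps)
    show "continuous_on {0..} ?h'"
      by (intro continuous_intros continuous_on_subset[OF v_cont] continuous_on_subset[OF v1_cont] inv1p_cont) auto
  qed (simp add: v0)
  have va: "hl2 (\<lambda>r. \<bar>v r\<bar>)" by (rule hl2_bound[OF _ v_hl2]) auto
  have l1: "hl2 (\<lambda>r. inv1p r ^ 1 * \<bar>v1 r\<bar>)"
    by (rule hl2_weight[where B=1]) (auto intro: hl2_bound[OF _ v1_hl2] simp: inv1p_pos inv1p_le1 less_imp_le)
  have l2: "hl2 (\<lambda>r. inv1p r ^ 2 * \<bar>v r\<bar>)"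
    by (rule hl2_weight[where B=1]) (auto intro: va simp: power_le_one inv1p_pos inv1p_le1 less_imp_le)
  have c1: "hl_integral (\<lambda>r. \<bar>v r\<bar> * (inv1p r ^ 1 * \<bar>v1 r\<bar>)) \<le> sqrt ?N * sqrt A"
  proof -
    have "(hl_integral (\<lambda>r. \<bar>v r\<bar> * (inv1p r ^ 1 * \<bar>v1 r\<bar>)))\<^sup>2 \<le> ?N * A"
      using hl_cauchy_schwarz[OF va l1] unfolding A_def by (simp add: power_mult_distrib mult.assoc power2_eq_square[of "v1 _"] power2_abs)
    thus ?thesis by (metis real_le_rsqrt real_sqrt_mult)
  qed
  have c2: "hl_integral (\<lambda>r. \<bar>v r\<bar> * (inv1p r ^ 2 * \<bar>v r\<bar>)) \<le> sqrt ?N * sqrt B"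
  proof -
    have "(hl_integral (\<lambda>r. \<bar>v r\<bar> * (inv1p r ^ 2 * \<bar>v r\<bar>)))\<^sup>2 \<le> ?N * B"
      using hl_cauchy_schwarz[OF va l2] unfolding B_def by (simp add: power_mult_distrib mult.assoc power2_eq_square[of "v _"] power_mult[symmetric])
    thus ?thesis by (metis real_le_rsqrt real_sqrt_mult)
  qed
  have i1: "hl_integrable (\<lambda>r. \<bar>v r\<bar> * (inv1p r ^ 1 * \<bar>v1 r\<bar>))" "hl_integrable (\<lambda>r. \<bar>v r\<bar> * (inv1p r ^ 2 * \<bar>v r\<bar>))"
    using hl2_mult[of "\<lambda>_. 1" 1, OF _ _ va l1] hl2_mult[of "\<lambda>_. 1" 1, OF _ _ va l2] by auto
  have "hl_integral (\<lambda>r. \<bar>?h' r\<bar>) \<le> hl_integral (\<lambda>r. 2 * (\<bar>v r\<bar> * (inv1p r ^ 1 * \<bar>v1 r\<bar>)) + \<bar>v r\<bar> * (inv1p r ^ 2 * \<bar>v r\<bar>))"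
  proof (rule hl_integral_mono)
    show "hl_integrable (\<lambda>r. \<bar>?h' r\<bar>)" using ih unfolding hl_integrable_def by (auto dest: integrable_abs simp: abs_mult)
    show "hl_integrable (\<lambda>r. 2 * (\<bar>v r\<bar> * (inv1p r ^ 1 * \<bar>v1 r\<bar>)) + \<bar>v r\<bar> * (inv1p r ^ 2 * \<bar>v r\<bar>))"
      by (intro hl_integrable_add hl_integrable_cmult i1)
    fix r :: real assume "0 < r"
    hence "0 < inv1p r" by (intro inv1p_pos) simp
    thus "\<bar>?h' r\<bar> \<le> 2 * (\<bar>v r\<bar> * (inv1p r ^ 1 * \<bar>v1 r\<bar>)) + \<bar>v r\<bar> * (inv1p r ^ 2 * \<bar>v r\<bar>)"
      by (intro order_trans[OF abs_triangle_ineq4]) (simp add: abs_mult mult_ac)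
  qed
  also have "\<dots> = 2 * hl_integral (\<lambda>r. \<bar>v r\<bar> * (inv1p r ^ 1 * \<bar>v1 r\<bar>)) + hl_integral (\<lambda>r. \<bar>v r\<bar> * (inv1p r ^ 2 * \<bar>v r\<bar>))"
    using i1 by (simp only: hl_integral_add hl_integrable_cmult hl_integral_cmult)
  also have "\<dots> \<le> 2 * (sqrt ?N * sqrt A) + sqrt ?N * sqrt B" using c1 c2 by linarith
  also have "\<dots> \<le> 2 * (sqrt ?N * sqrt (A + B)) + sqrt ?N * sqrt (A + B)"
    using A_nonneg B_nonneg N by (intro add_mono mult_left_mono real_sqrt_le_mono) auto
  also have "\<dots> = 3 * sqrt ?N * sqrt (A + B)" by simp
  finally have "hl_integral (\<lambda>r. \<bar>?h' r\<bar>) \<le> 3 * sqrt ?N * sqrt (A + B)" .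
  moreover have "inv1p y * (v y)\<^sup>2 = ?h y" by (simp add: power2_eq_square)
  ultimately show ?thesis using \<open>\<bar>?h y\<bar> \<le> hl_integral (\<lambda>r. \<bar>?h' r\<bar>)\<close> abs_ge_self[of "?h y"] by linarith
qed

text \<open>Interpolates the weight u^2, too heavy at infinity for \<open>B\<close>, between the
  unweighted norm and \<open>B\<close>. It serves the part of the multiplier with h'.\<close>

lemma weighted_cs: "hl_integral (\<lambda>r. inv1p r ^ 2 * v r * v r) \<le> sqrt (hl_integral (\<lambda>r. (v r)\<^sup>2)) * sqrt B"
proof -
  have l: "hl2 (\<lambda>r. inv1p r ^ 2 * v r)"
    by (rule hl2_weight[where B=1]) (auto intro: v_hl2 simp: power_le_one inv1p_pos inv1p_le1 less_imp_le)
  have "hl_integral (\<lambda>r. v r * (inv1p r ^ 2 * v r)) = hl_integral (\<lambda>r. inv1p r ^ 2 * v r * v r)"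
    "hl_integral (\<lambda>r. (inv1p r ^ 2 * v r)\<^sup>2) = B"
    unfolding B_def by (auto intro!: hl_integral_cong simp: power2_eq_square eval_nat_numeral)
  hence "(hl_integral (\<lambda>r. inv1p r ^ 2 * v r * v r))\<^sup>2 \<le> hl_integral (\<lambda>r. (v r)\<^sup>2) * B"
    using hl_cauchy_schwarz[OF v_hl2 l] by simp
  thus ?thesis by (metis real_le_rsqrt real_sqrt_mult)
qed

text \<open>The cubic term needs two small factors and the weights of \<open>A\<close> and
  \<open>B\<close>. Far from the origin one p = v/r is traded for the weight u, and
  \<open>sup_bound\<close> controls u v^2; near the origin the weights are bounded below and |p|
  \<le> e suffices. \<open>S\<close> is the right side of \<open>sup_bound\<close>.\<close>

lemma nonlinear_bound:
  assumes p: "\<And>r. 0 < r \<Longrightarrow> v r = r * p r" "\<And>r. 0 < r \<Longrightarrow> \<bar>p r\<bar> \<le> e" and e: "0 \<le> e"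
    and N: "hl_integral (\<lambda>r. (v r)\<^sup>2) \<le> c * e\<^sup>2" and c: "0 \<le> c"
    and m[measurable]: "n \<in> borel_measurable borel" "p \<in> borel_measurable borel"
    and n: "\<And>r. 0 < r \<Longrightarrow> \<bar>n r\<bar> \<le> C * \<bar>p r\<bar> ^ 3" and C: "0 \<le> C"
  shows "hl_integrable (\<lambda>r. r * n r * ((1 - inv1p r) * v1 r + 1/2 * (inv1p r)\<^sup>2 * v r))"
    "\<bar>hl_integral (\<lambda>r. r * n r * ((1 - inv1p r) * v1 r + 1/2 * (inv1p r)\<^sup>2 * v r))\<bar> \<le> C * e\<^sup>2 * (18 * c + 12) * (A + B)"
proof -
  define Q where "Q = A + B"
  define NN where "NN = hl_integral (\<lambda>r. (v r)\<^sup>2)"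
  define S where "S = 3 * sqrt NN * sqrt Q"
  have Q0: "0 \<le> Q" using A_nonneg B_nonneg by (simp add: Q_def)
  have N0: "0 \<le> NN" unfolding NN_def by (rule hl_integral_nonneg) simp
  have S0: "0 \<le> S" using Q0 N0 by (simp add: S_def)
  have S: "inv1p r * (v r)\<^sup>2 \<le> S" if "0 < r" for r using sup_bound[of r] that by (simp add: S_def Q_def NN_def)
  have iu2: "1 / r \<le> 2 * inv1p r" if "1 \<le> r" for r using that by (simp add: inv1p_def field_simps)
  have iu1: "1 \<le> 2 * inv1p r" if "0 < r" "r < 1" for r using that by (simp add: inv1p_def field_simps)
  \<comment> \<open>For r \<ge> 1 the division by r in p = v/r is comparable with multiplication by
    u.\<close>
  have pv_large: "(p r)\<^sup>2 \<le> 4 * (inv1p r)\<^sup>2 * (v r)\<^sup>2" if "1 \<le> r" for r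
  proof -
    have "p r = (1 / r) * v r" using p(1)[of r] that by simp
    hence "(p r)\<^sup>2 = (1 / r)\<^sup>2 * (v r)\<^sup>2" by (simp add: power_mult_distrib power_divide)
    also have "\<dots> \<le> (2 * inv1p r)\<^sup>2 * (v r)\<^sup>2"
      using iu2[OF that] that by (intro mult_right_mono power_mono) auto
    finally show ?thesis by (simp add: power_mult_distrib)
  qed
  have p_sq: "(p r)\<^sup>2 \<le> e\<^sup>2" if "0 < r" for r
    using power_mono[OF p(2)[OF that] abs_ge_zero, of 2] by simp
  \<comment> \<open>Since h = r u, the part of the multiplier with v1 is at most C g u |v1|, where u
    v1 is the function measured by \<open>A\<close>; hence \<open>g\<close> only has to be bounded
    in L^2.\<close>
  define g where "g r = r\<^sup>2 * \<bar>p r\<bar> ^ 3" for r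
  have gm[measurable]: "g \<in> borel_measurable borel" unfolding g_def by simp
  have pv: "(p r)\<^sup>2 * (v r)\<^sup>2 \<le> 4 * S\<^sup>2 + 16 * e ^ 4 * inv1p r ^ 4" if r: "0 < r" for r
  proof (cases "1 \<le> r")
    case True
    have "(p r)\<^sup>2 * (v r)\<^sup>2 \<le> 4 * (inv1p r)\<^sup>2 * (v r)\<^sup>2 * (v r)\<^sup>2" by (intro mult_right_mono pv_large True) simp
    also have "\<dots> = 4 * (inv1p r * (v r)\<^sup>2)\<^sup>2" by (simp add: power2_eq_square)
    also have "\<dots> \<le> 4 * S\<^sup>2" using S[OF r] inv1p_pos[of r] r by (intro mult_left_mono power_mono) auto
    finally show ?thesis by (rule order_trans) simp
  next
    case False
    have "(p r)\<^sup>2 * (v r)\<^sup>2 = (p r)\<^sup>2 * (p r)\<^sup>2 * r\<^sup>2" using p(1)[OF r] by (simp add: power_mult_distrib)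
    also have "\<dots> \<le> e\<^sup>2 * e\<^sup>2 * 1"
      using p_sq[OF r] r False by (intro mult_mono) (auto simp: power_le_one)
    also have "\<dots> \<le> e ^ 4 * (2 * inv1p r) ^ 4"
      using mult_left_mono[OF one_le_power[OF iu1[OF r], of 4], of "e ^ 4"] False by (simp add: power_add[symmetric])
    also have "\<dots> = 16 * e ^ 4 * inv1p r ^ 4" by (simp add: power_mult_distrib)
    finally show ?thesis by (simp add: add_increasing)
  qed
  have g2: "(g r)\<^sup>2 \<le> 4 * S\<^sup>2 * (v r)\<^sup>2 + 16 * e ^ 4 * (inv1p r ^ 4 * v r * v r)" if r: "0 < r" for r
  proof -
    have "(g r)\<^sup>2 = (v r)\<^sup>2 * ((p r)\<^sup>2 * (v r)\<^sup>2)"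
      unfolding g_def using p(1)[OF r] by (simp add: power_mult_distrib eval_nat_numeral power2_abs[unfolded power2_eq_square])
    also have "\<dots> \<le> (v r)\<^sup>2 * (4 * S\<^sup>2 + 16 * e ^ 4 * inv1p r ^ 4)" by (intro mult_left_mono pv r) simp
    finally show ?thesis by (simp add: algebra_simps power2_eq_square)
  qed
  have ig2: "hl_integrable (\<lambda>r. 4 * S\<^sup>2 * (v r)\<^sup>2 + 16 * e ^ 4 * (inv1p r ^ 4 * v r * v r))"
    by (intro hl_integrable_add hl_integrable_cmult wint hl2_sq v_hl2)
  have ig: "hl_integrable (\<lambda>r. (g r)\<^sup>2)"
    by (rule hl_integrable_bound[OF ig2]) (use g2 in auto)
  have gl: "hl2 g"
  proof -
    have "(pos r * g r)\<^sup>2 = pos r * (g r)\<^sup>2" for r by (rule pos_cases[of r]) auto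
    thus ?thesis using ig by (simp add: hl2_def l2_def hl_integrable_def)
  qed
  have gN: "hl_integral (\<lambda>r. (g r)\<^sup>2) \<le> (e\<^sup>2 * (6 * c + 4))\<^sup>2 * Q"
  proof -
    have "hl_integral (\<lambda>r. (g r)\<^sup>2) \<le> 4 * S\<^sup>2 * NN + 16 * e ^ 4 * B"
      using hl_integral_mono[OF ig ig2 g2]
      by (simp only: hl_integral_add hl_integral_cmult hl_integrable_cmult wint hl2_sq v_hl2 NN_def B_def)
    also have "\<dots> = 36 * NN\<^sup>2 * Q + 16 * e ^ 4 * B" 
    proof -
      have "S\<^sup>2 = 9 * NN * Q" using N0 Q0 by (simp add: S_def power_mult_distrib)
      thus ?thesis by (simp add: power2_eq_square)
    qed
    also have "\<dots> \<le> 36 * (c * e\<^sup>2)\<^sup>2 * Q + 16 * e ^ 4 * Q"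
      using N N0 Q0 A_nonneg B_nonneg c e by (intro add_mono mult_mono power_mono) (auto simp: NN_def Q_def)
    \<comment> \<open>The added term completes 36 c^2 + 16 to the square of 6 c + 4.\<close>
    also have "\<dots> \<le> 36 * (c * e\<^sup>2)\<^sup>2 * Q + 16 * e ^ 4 * Q + 48 * c * e ^ 4 * Q"
      using c Q0 by simp
    also have "\<dots> = (e\<^sup>2 * (6 * c + 4))\<^sup>2 * Q" by (simp add: power2_eq_square eval_nat_numeral algebra_simps)
    finally show ?thesis .
  qed
  have l1: "hl2 (\<lambda>r. inv1p r * \<bar>v1 r\<bar>)"
    by (rule hl2_weight[where B=1]) (auto intro: hl2_bound[OF _ v1_hl2] simp: inv1p_pos inv1p_le1 less_imp_le)
  have i1: "hl_integrable (\<lambda>r. g r * (inv1p r * \<bar>v1 r\<bar>))"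
    using hl2_mult[of "\<lambda>_. 1" 1, OF _ _ gl l1] by simp
  have t1: "hl_integral (\<lambda>r. g r * (inv1p r * \<bar>v1 r\<bar>)) \<le> e\<^sup>2 * (6 * c + 4) * Q"
  proof -
    have "hl_integral (\<lambda>r. (inv1p r * \<bar>v1 r\<bar>)\<^sup>2) = A"
      unfolding A_def by (intro hl_integral_cong) (simp add: power_mult_distrib power2_eq_square[of "v1 _"] mult.assoc)
    hence "(hl_integral (\<lambda>r. g r * (inv1p r * \<bar>v1 r\<bar>)))\<^sup>2 \<le> (e\<^sup>2 * (6 * c + 4))\<^sup>2 * Q * Q"
      using hl_cauchy_schwarz[OF gl l1] gN A_nonneg B_nonneg Q0
      by (elim order_trans, simp only:, intro mult_mono) (auto simp: Q_def)
    also have "\<dots> = (e\<^sup>2 * (6 * c + 4) * Q)\<^sup>2" by (simp add: power2_eq_square)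
    finally show ?thesis by (rule power2_le_imp_le) (use c Q0 in simp)
  qed
  have i2: "hl_integrable (\<lambda>r. 4 * S * (inv1p r ^ 2 * v r * v r) + 4 * e\<^sup>2 * (inv1p r ^ 4 * v r * v r))"
    by (intro hl_integrable_add hl_integrable_cmult wint)
  have t2: "hl_integral (\<lambda>r. 4 * S * (inv1p r ^ 2 * v r * v r) + 4 * e\<^sup>2 * (inv1p r ^ 4 * v r * v r)) \<le> e\<^sup>2 * (12 * c + 4) * Q"
  proof -
    have "hl_integral (\<lambda>r. 4 * S * (inv1p r ^ 2 * v r * v r) + 4 * e\<^sup>2 * (inv1p r ^ 4 * v r * v r))
       = 4 * S * hl_integral (\<lambda>r. inv1p r ^ 2 * v r * v r) + 4 * e\<^sup>2 * B"
      by (simp only: hl_integral_add hl_integral_cmult hl_integrable_cmult wint B_def)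
    also have "\<dots> \<le> 4 * S * (sqrt NN * sqrt Q) + 4 * e\<^sup>2 * Q"
    proof (intro add_mono mult_left_mono)
      have "hl_integral (\<lambda>r. inv1p r ^ 2 * v r * v r) \<le> sqrt NN * sqrt B" using weighted_cs by (simp add: NN_def)
      also have "\<dots> \<le> sqrt NN * sqrt Q" using A_nonneg N0 by (intro mult_left_mono real_sqrt_le_mono) (auto simp: Q_def)
      finally show "hl_integral (\<lambda>r. inv1p r ^ 2 * v r * v r) \<le> sqrt NN * sqrt Q" .
    qed (use S0 A_nonneg in \<open>auto simp: Q_def\<close>)
    also have "\<dots> = 12 * NN * Q + 4 * e\<^sup>2 * Q"
    proof -
      have "(sqrt NN * sqrt Q) * (sqrt NN * sqrt Q) = (sqrt NN * sqrt NN) * (sqrt Q * sqrt Q)" by (simp only: mult_ac)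
      also have "\<dots> = NN * Q" using N0 Q0 by simp
      finally have z: "(sqrt NN * sqrt Q) * (sqrt NN * sqrt Q) = NN * Q" .
      have "4 * S * (sqrt NN * sqrt Q) = 12 * ((sqrt NN * sqrt Q) * (sqrt NN * sqrt Q))" by (simp add: S_def)
      thus ?thesis unfolding z by simp
    qed
    also have "\<dots> \<le> 12 * (c * e\<^sup>2) * Q + 4 * e\<^sup>2 * Q"
      using N Q0 by (intro add_mono mult_right_mono mult_left_mono) (auto simp: NN_def)
    finally show ?thesis by (simp add: algebra_simps)
  qed
  let ?f = "\<lambda>r. r * n r * ((1 - inv1p r) * v1 r + 1/2 * (inv1p r)\<^sup>2 * v r)"
  let ?G = "\<lambda>r. C * (g r * (inv1p r * \<bar>v1 r\<bar>)) + C * (4 * S * (inv1p r ^ 2 * v r * v r) + 4 * e\<^sup>2 * (inv1p r ^ 4 * v r * v r))"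
  have iG: "hl_integrable ?G" by (intro hl_integrable_add[OF hl_integrable_cmult[OF i1] hl_integrable_cmult[OF i2]])
  have fG: "\<bar>?f r\<bar> \<le> ?G r" if r: "0 < r" for r
  proof -
    have u: "0 < inv1p r" "1 - inv1p r = r * inv1p r" using r by (auto simp: inv1p_def field_simps)
    have a: "\<bar>r * n r * ((1 - inv1p r) * v1 r)\<bar> \<le> C * (g r * (inv1p r * \<bar>v1 r\<bar>))"
    proof -
      have "\<bar>r * n r * ((1 - inv1p r) * v1 r)\<bar> = \<bar>n r\<bar> * (r\<^sup>2 * (inv1p r * \<bar>v1 r\<bar>))"
        unfolding u(2) using r u(1) by (simp add: abs_mult power2_eq_square mult_ac)
      also have "\<dots> \<le> C * \<bar>p r\<bar> ^ 3 * (r\<^sup>2 * (inv1p r * \<bar>v1 r\<bar>))" using u(1) by (intro mult_right_mono n r) auto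
      finally show ?thesis by (simp add: g_def mult_ac)
    qed
    have b: "inv1p r ^ 2 * (p r)\<^sup>2 * (v r)\<^sup>2 \<le> 4 * S * (inv1p r ^ 2 * v r * v r) + 4 * e\<^sup>2 * (inv1p r ^ 4 * v r * v r)"
    proof (cases "1 \<le> r")
      case True
      have "inv1p r ^ 2 * (p r)\<^sup>2 * (v r)\<^sup>2 \<le> inv1p r ^ 2 * (4 * (inv1p r)\<^sup>2 * (v r)\<^sup>2) * (v r)\<^sup>2"
        by (intro mult_right_mono mult_left_mono pv_large True) auto
      also have "\<dots> = (4 * (inv1p r ^ 2 * v r * v r)) * (inv1p r * (inv1p r * (v r)\<^sup>2))" by (simp add: power2_eq_square mult_ac)
      also have "\<dots> \<le> (4 * (inv1p r ^ 2 * v r * v r)) * (1 * S)"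
        using S[OF r] u(1) inv1p_le1[of r] r S0 by (intro mult_left_mono mult_mono) (auto simp: mult.assoc)
      also have "\<dots> \<le> 4 * S * (inv1p r ^ 2 * v r * v r) + 4 * e\<^sup>2 * (inv1p r ^ 4 * v r * v r)"
        by (simp add: mult.assoc)
      finally show ?thesis .
    next
      case False
      have "inv1p r ^ 2 * (p r)\<^sup>2 * (v r)\<^sup>2 \<le> inv1p r ^ 2 * e\<^sup>2 * (v r)\<^sup>2"
        by (intro mult_right_mono mult_left_mono p_sq r) auto
      also have "\<dots> \<le> (2 * inv1p r) ^ 2 * (inv1p r ^ 2 * e\<^sup>2 * (v r)\<^sup>2)"
        using mult_right_mono[OF one_le_power[OF iu1[OF r], of 2], of "inv1p r ^ 2 * e\<^sup>2 * (v r)\<^sup>2"] False by simp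
      also have "\<dots> = 4 * e\<^sup>2 * (inv1p r ^ 4 * v r * v r)" by (simp add: power2_eq_square eval_nat_numeral mult_ac)
      also have "\<dots> \<le> 4 * S * (inv1p r ^ 2 * v r * v r) + 4 * e\<^sup>2 * (inv1p r ^ 4 * v r * v r)"
        using S0 by (simp add: mult.assoc)
      finally show ?thesis .
    qed
    have "\<bar>r * n r * (1/2 * (inv1p r)\<^sup>2 * v r)\<bar> = \<bar>n r\<bar> * (1/2 * r * (inv1p r)\<^sup>2 * \<bar>v r\<bar>)"
      using r by (simp add: abs_mult mult_ac)
    also have "\<dots> \<le> C * \<bar>p r\<bar> ^ 3 * (1/2 * r * (inv1p r)\<^sup>2 * \<bar>v r\<bar>)" using r by (intro mult_right_mono n) auto
    also have "\<dots> = 1/2 * (C * (inv1p r ^ 2 * (p r)\<^sup>2 * (v r)\<^sup>2))"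
      using p(1)[OF r] r by (simp add: abs_mult power_mult_distrib eval_nat_numeral power2_abs[unfolded power2_eq_square])
    also have "\<dots> \<le> C * (inv1p r ^ 2 * (p r)\<^sup>2 * (v r)\<^sup>2)" using C by simp
    also have "\<dots> \<le> C * (4 * S * (inv1p r ^ 2 * v r * v r) + 4 * e\<^sup>2 * (inv1p r ^ 4 * v r * v r))" by (rule mult_left_mono[OF b C])
    finally have b': "\<bar>r * n r * (1/2 * (inv1p r)\<^sup>2 * v r)\<bar> \<le> C * (4 * S * (inv1p r ^ 2 * v r * v r) + 4 * e\<^sup>2 * (inv1p r ^ 4 * v r * v r))" .
    have "\<bar>?f r\<bar> \<le> \<bar>r * n r * ((1 - inv1p r) * v1 r)\<bar> + \<bar>r * n r * (1/2 * (inv1p r)\<^sup>2 * v r)\<bar>"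
      using abs_triangle_ineq by (simp only: distrib_left)
    thus ?thesis using a b' by linarith
  qed
  show if': "hl_integrable ?f" by (rule hl_integrable_bound[OF iG]) (use fG in auto)
  have "\<bar>hl_integral ?f\<bar> \<le> hl_integral ?G"
  proof (rule abs_leI)
    show "hl_integral ?f \<le> hl_integral ?G"
      by (rule hl_integral_mono[OF if' iG]) (rule order_trans[OF abs_ge_self fG])
    have "hl_integral (\<lambda>r. (-1) * ?f r) \<le> hl_integral ?G"
    proof (rule hl_integral_mono[OF hl_integrable_cmult[OF if'] iG])
      fix r :: real assume "0 < r"
      have "(-1) * x \<le> \<bar>x\<bar>" for x :: real by simp
      thus "(-1) * ?f r \<le> ?G r" using fG[OF \<open>0 < r\<close>] by (rule order_trans)
    qed
    thus "- hl_integral ?f \<le> hl_integral ?G" by (simp only: hl_integral_cmult)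
  qed
  also have "\<dots> \<le> C * (e\<^sup>2 * (6 * c + 4) * Q) + C * (e\<^sup>2 * (12 * c + 4) * Q)"
    using t1 t2 C by (simp only: hl_integral_add[OF hl_integrable_cmult[OF i1] hl_integrable_cmult[OF i2]] hl_integral_cmult) (intro add_mono mult_left_mono)
  also have "\<dots> \<le> C * e\<^sup>2 * (18 * c + 12) * Q" using C Q0 c by (simp add: algebra_simps)
  finally show "\<bar>hl_integral ?f\<bar> \<le> C * e\<^sup>2 * (18 * c + 12) * (A + B)" by (simp add: Q_def)
qed

end

locale half_line_fun2 = half_line_fun +
  fixes v2 :: "real \<Rightarrow> real"
  assumes v1_deriv: "\<And>r. (v1 has_real_derivative v2 r) (at r)" and v2_cont: "continuous_on UNIV v2" and v2_hl2: "hl2 v2"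
begin

lemma wint2: "hl_integrable (\<lambda>r. inv1p r ^ n * v r * v2 r)" "hl_integrable (\<lambda>r. inv1p r ^ n * v1 r * v2 r)"
  by (intro hl2_mult[where B=1] v_hl2 v1_hl2 v2_hl2; simp add: inv1p_abs_power)+

text \<open>Two integrations by parts turn v2 (h v1 + h' v / 2) into - h' v1^2 + (1/4) h''' v^2, and
  h''' = 6 u^4 gives the factor 3/2. The function \<open>?h\<close> is (1/2) h v1^2 + (1/2) h' v v1
  - (1/4) h'' v^2, which vanishes at 0 because h and v do.\<close>

lemma morawetz: "hl_integral (\<lambda>r. v2 r * ((1 - inv1p r) * v1 r + 1/2 * (inv1p r)\<^sup>2 * v r)) = - A + 3/2 * B"
proof -
  let ?h = "\<lambda>r. 1/2 * (inv1p r ^ 0 * v1 r * v1 r) - 1/2 * (inv1p r ^ 1 * v1 r * v1 r) + 1/2 * (inv1p r ^ 2 * v r * v1 r) + 1/2 * (inv1p r ^ 3 * v r * v r)"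
  let ?m = "\<lambda>r. inv1p r ^ 0 * v1 r * v2 r - inv1p r ^ 1 * v1 r * v2 r + 1/2 * (inv1p r ^ 2 * v r * v2 r)"
  let ?h' = "\<lambda>r. ?m r + (inv1p r ^ 2 * v1 r * v1 r) - 3/2 * (inv1p r ^ 4 * v r * v r)"
  have "hl_integral ?h' = - ?h 0"
  proof (rule hl_integral_derivative)
    show "(?h has_real_derivative ?h' r) (at r)" if "0 \<le> r" for r
      by (rule derivative_eq_intros v_deriv v1_deriv inv1p_deriv that refl)+ (simp add: power2_eq_square eval_nat_numeral algebra_simps)
    show "continuous_on {0..} ?h'"
      by (intro continuous_intros continuous_on_subset[OF v_cont] continuous_on_subset[OF v1_cont] continuous_on_subset[OF v2_cont] inv1p_cont) auto
    show "hl_integrable ?h" "hl_integrable ?h'"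
      by (intro hl_integrable_diff hl_integrable_add hl_integrable_cmult wint wint2)+
  qed
  also have "?h 0 = 0" by (simp add: v0 inv1p_def)
  also have "hl_integral ?h' = hl_integral ?m + A - 3/2 * B"
    unfolding A_def B_def
    by (simp only: hl_integral_add hl_integral_diff hl_integral_cmult hl_integrable_add hl_integrable_diff hl_integrable_cmult wint wint2)
  also have "hl_integral ?m = hl_integral (\<lambda>r. v2 r * ((1 - inv1p r) * v1 r + 1/2 * (inv1p r)\<^sup>2 * v r))"
    by (intro hl_integral_cong) (simp add: algebra_simps)
  finally show ?thesis by simp
qed

end

section \<open>The Morawetz estimate for radial functions\<close>

text \<open>The area of the unit sphere in three dimensions, as 3 times the volume of the unit
  ball.\<close>

definition sph :: real where "sph = 3 * unit_ball_vol 3"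

lemma sph_pos: "0 < sph" unfolding sph_def by (simp add: unit_ball_vol_pos)

text \<open>Both measures are compared on the half lines up to a, where the left one is the volume
  of a ball and the right one the integral of \<open>sph\<close> r^2. Polar coordinates are needed
  for functions of the norm only.\<close>

lemma distr_norm:
  assumes dim: "DIM('a::euclidean_space) = 3"
  shows "distr lborel borel (norm :: 'a \<Rightarrow> real) = density lborel (\<lambda>r. ennreal (sph * r\<^sup>2 * pos r))"
proof (rule measure_eqI_generator_eq[where E="range (\<lambda>a. {..a})" and \<Omega>=UNIV and A="\<lambda>n. {..real n}"])
  have s: "sets (borel :: real measure) = sigma_sets UNIV (range (\<lambda>a. {..a}))"
    unfolding borel_eq_atMost by simp
  show "sets (distr lborel borel (norm :: 'a \<Rightarrow> real)) = sigma_sets UNIV (range (\<lambda>a. {..a}))"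
    "sets (density lborel (\<lambda>r. ennreal (sph * r\<^sup>2 * pos r))) = sigma_sets UNIV (range (\<lambda>a. {..a}))"
    using s by simp_all
  show "Int_stable (range (\<lambda>a::real. {..a}))"
    by (auto simp: Int_stable_def)
  have cb: "{x::'a. norm x \<le> a} = cball 0 a" for a by auto
  have D: "emeasure (distr lborel borel (norm :: 'a \<Rightarrow> real)) {..a} = emeasure lborel (cball (0::'a) a)" for a
    by (subst emeasure_distr) (auto simp: vimage_def cb)
  show "emeasure (distr lborel borel (norm :: 'a \<Rightarrow> real)) {..real n} \<noteq> \<infinity>" for n
    unfolding D using emeasure_cball[of "real n" "0::'a"] by simp
  show "(\<Union>i. {..real i}) = UNIV" by (auto simp: real_arch_simple)
  fix X assume "X \<in> range (\<lambda>a::real. {..a})"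
  then obtain a where X: "X = {..a}" by auto
  have "emeasure (density lborel (\<lambda>r. ennreal (sph * r\<^sup>2 * pos r))) X = (\<integral>\<^sup>+r. ennreal (sph * r\<^sup>2 * pos r) * indicator {..a} r \<partial>lborel)"
    unfolding X by (rule emeasure_density) auto
  also have "\<dots> = emeasure lborel (cball (0::'a) a)"
  proof (cases "0 \<le> a")
    case True
    have "(\<integral>\<^sup>+r. ennreal (sph * r\<^sup>2 * pos r) * indicator {..a} r \<partial>lborel) = (\<integral>\<^sup>+r. ennreal (sph * r\<^sup>2) * indicator {0..a} r \<partial>lborel)"
      by (intro nn_integral_cong) (auto simp: pos_def indicator_def)
    also have "\<dots> = ennreal (unit_ball_vol 3 * a ^ 3 - unit_ball_vol 3 * 0 ^ 3)"
      using True by (intro nn_integral_FTC_Icc) (auto intro!: derivative_eq_intros simp: sph_def)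
    also have "\<dots> = emeasure lborel (cball (0::'a) a)" using emeasure_cball[OF True, of "0::'a"] by (simp add: dim)
    finally show ?thesis .
  next
    case False
    have z: "ennreal (sph * r\<^sup>2 * pos r) * indicator {..a} r = 0" for r
      using False by (simp add: pos_def indicator_def)
    show ?thesis unfolding z using False by simp
  qed
  finally show "emeasure (distr lborel borel (norm :: 'a \<Rightarrow> real)) X = emeasure (density lborel (\<lambda>r. ennreal (sph * r\<^sup>2 * pos r))) X"
    by (simp add: D X)
qed auto

lemma polar:
  fixes f :: "real \<Rightarrow> real"
  assumes dim: "DIM('a::euclidean_space) = 3" and f[measurable]: "f \<in> borel_measurable borel"
  shows "integrable lborel (\<lambda>x::'a. f (norm x)) \<longleftrightarrow> hl_integrable (\<lambda>r. r\<^sup>2 * f r)"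
    "(LINT x|lborel. f (norm (x::'a))) = sph * hl_integral (\<lambda>r. r\<^sup>2 * f r)"
proof -
  have nn: "AE r in lborel. 0 \<le> sph * r\<^sup>2 * pos r" using sph_pos by simp
  have e: "(sph * r\<^sup>2 * pos r) *\<^sub>R f r = sph * (pos r * (r\<^sup>2 * f r))" for r by simp
  have "integrable lborel (\<lambda>x::'a. f (norm x)) \<longleftrightarrow> integrable (distr lborel borel (norm :: 'a \<Rightarrow> real)) f"
    by (subst integrable_distr_eq) auto
  also have "\<dots> \<longleftrightarrow> integrable lborel (\<lambda>r. (sph * r\<^sup>2 * pos r) *\<^sub>R f r)"
    unfolding distr_norm[OF dim] using nn by (intro integrable_density) auto
  also have "\<dots> \<longleftrightarrow> hl_integrable (\<lambda>r. r\<^sup>2 * f r)"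
    unfolding e hl_integrable_def using sph_pos by simp
  finally show "integrable lborel (\<lambda>x::'a. f (norm x)) \<longleftrightarrow> hl_integrable (\<lambda>r. r\<^sup>2 * f r)" .
  have "(LINT x|lborel. f (norm (x::'a))) = integral\<^sup>L (distr lborel borel (norm :: 'a \<Rightarrow> real)) f"
    by (subst integral_distr) auto
  also have "\<dots> = (LINT r|lborel. (sph * r\<^sup>2 * pos r) *\<^sub>R f r)"
    unfolding distr_norm[OF dim] using nn by (intro integral_density) auto
  also have "\<dots> = sph * hl_integral (\<lambda>r. r\<^sup>2 * f r)"
    unfolding e hl_integral_def by simp
  finally show "(LINT x|lborel. f (norm (x::'a))) = sph * hl_integral (\<lambda>r. r\<^sup>2 * f r)" .
qed

lemma norm_line_deriv:
  fixes x b :: "'a::euclidean_space"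
  assumes "x + s *\<^sub>R b \<noteq> 0"
  shows "((\<lambda>s. norm (x + s *\<^sub>R b)) has_real_derivative ((x + s *\<^sub>R b) \<bullet> b) / norm (x + s *\<^sub>R b)) (at s)"
proof -
  have e: "(x + s *\<^sub>R b) \<bullet> (x + s *\<^sub>R b) = x \<bullet> x + 2 * s * (x \<bullet> b) + s * s * (b \<bullet> b)" for s
    by (simp add: inner_add_left inner_add_right inner_commute[of b x] algebra_simps)
  have p: "0 < x \<bullet> x + 2 * s * (x \<bullet> b) + s * s * (b \<bullet> b)" unfolding e[symmetric] using assms by simp
  have "((\<lambda>s. x \<bullet> x + 2 * s * (x \<bullet> b) + s * s * (b \<bullet> b)) has_real_derivative 2 * (x \<bullet> b) + 2 * s * (b \<bullet> b)) (at s)"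
    by (auto intro!: derivative_eq_intros)
  from DERIV_chain2[OF DERIV_real_sqrt[OF p] this]
  have "((\<lambda>s. sqrt ((x + s *\<^sub>R b) \<bullet> (x + s *\<^sub>R b))) has_real_derivative
     (inverse (sqrt ((x + s *\<^sub>R b) \<bullet> (x + s *\<^sub>R b))) / 2) * (2 * (x \<bullet> b) + 2 * s * (b \<bullet> b))) (at s)"
    unfolding e .
  hence "((\<lambda>s. norm (x + s *\<^sub>R b)) has_real_derivative
     (inverse (norm (x + s *\<^sub>R b)) / 2) * (2 * (x \<bullet> b) + 2 * s * (b \<bullet> b))) (at s)"
    unfolding norm_eq_sqrt_inner .
  moreover have "(inverse (norm (x + s *\<^sub>R b)) / 2) * (2 * (x \<bullet> b) + 2 * s * (b \<bullet> b)) = ((x + s *\<^sub>R b) \<bullet> b) / norm (x + s *\<^sub>R b)"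
  proof -
    have alg: "(inverse N / 2) * (2 * y + 2 * s * z) = (y + s * z) / N" for N y z :: real
    proof -
      have "2 * y + 2 * s * z = 2 * (y + s * z)" by simp
      thus ?thesis by (simp add: divide_inverse[of _ N])
    qed
    show ?thesis unfolding alg inner_add_left inner_scaleR_left ..
  qed
  ultimately show ?thesis by (simp only:)
qed

text \<open>The components of the field h(r) x/r, while \<open>mor_pot\<close> is h/r + h'/2. For
  h(r) = r/(1+r) the division by r cancels, so both coefficients are bounded on the whole
  space.\<close>

definition mor_vec :: "'a \<Rightarrow> 'a::euclidean_space \<Rightarrow> real" where
  "mor_vec b x = (x \<bullet> b) * inv1p (norm x)"
definition mor_pot :: "'a::euclidean_space \<Rightarrow> real" where
  "mor_pot x = inv1p (norm x) + 1/2 * (inv1p (norm x))\<^sup>2"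

text \<open>The first order operator \<open>h \<partial>\<^sub>r + h/r + h'/2\<close> with \<open>h(r) = r/(1+r)\<close>, which conjugation
  with \<open>r\<close> turns into \<open>h \<partial>\<^sub>r + h'/2\<close> on the half line.\<close>
definition mor_op :: "('a::euclidean_space \<Rightarrow> real) \<Rightarrow> ('a \<Rightarrow> 'a \<Rightarrow> real) \<Rightarrow> 'a \<Rightarrow> real" where
  "mor_op \<Phi> D x = (\<Sum>b\<in>Basis. mor_vec b x * D b x) + mor_pot x * \<Phi> x"

text \<open>Comparable with \<open>inv1p (norm x) ^ 4\<close> but a function of the squared norm,
  hence smooth at the origin as a \<open>smooth_weight\<close> must be.\<close>

definition dec_weight :: "'a::real_normed_vector \<Rightarrow> real" where "dec_weight x = 1 / (1 + (norm x)\<^sup>2)\<^sup>2"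

text \<open>Radial symmetry is expressed along the line through the fixed unit vector e. The profile
  r -> \<Phi>(r e) is thus defined on all reals, and its derivative is \<open>D e\<close> on that
  line.\<close>

locale radial_fun =
  fixes \<Phi> :: "'a::euclidean_space \<Rightarrow> real" and D :: "'a \<Rightarrow> 'a \<Rightarrow> real" and e :: 'a
  assumes dim: "DIM('a) = 3" and e: "e \<in> Basis"
    and radial: "\<And>x. \<Phi> x = \<Phi> (norm x *\<^sub>R e)"
    and deriv: "\<And>b. b \<in> Basis \<Longrightarrow> dir_deriv b \<Phi> (D b)"
    and D_cont: "\<And>b. b \<in> Basis \<Longrightarrow> continuous_on UNIV (D b)"
    and \<Phi>_l2: "l2 \<Phi>" and D_l2: "\<And>b. b \<in> Basis \<Longrightarrow> l2 (D b)"
begin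

definition p :: "real \<Rightarrow> real" where "p r = \<Phi> (r *\<^sub>R e)"
definition p1 :: "real \<Rightarrow> real" where "p1 r = D e (r *\<^sub>R e)"
definition v :: "real \<Rightarrow> real" where "v r = r * p r"
definition v1 :: "real \<Rightarrow> real" where "v1 r = p r + r * p1 r"

lemma p_deriv: "(p has_real_derivative p1 r) (at r)"
proof -
  have "p = (\<lambda>s. \<Phi> (s *\<^sub>R e))" by (auto simp: p_def)
  thus ?thesis using dir_derivD[OF deriv[OF e], of 0 r] by (simp add: p1_def)
qed

lemma p_cont: "continuous_on UNIV p"
  using p_deriv by (meson DERIV_continuous_on has_field_derivative_at_within)
lemma p1_cont: "continuous_on UNIV p1"
  unfolding p1_def by (intro continuous_on_compose2[OF D_cont[OF e]] continuous_intros) auto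

lemma p_meas[measurable]: "p \<in> borel_measurable borel" "p1 \<in> borel_measurable borel"
  using p_cont p1_cont by (auto intro: borel_measurable_continuous_onI)

lemma v_meas[measurable]: "v \<in> borel_measurable borel" "v1 \<in> borel_measurable borel"
  unfolding v_def v1_def by simp_all

lemma \<Phi>_norm: "\<Phi> x = p (norm x)" using radial[of x] by (simp add: p_def)

lemma D_eq: assumes "x \<noteq> 0" "b \<in> Basis" shows "D b x = p1 (norm x) * ((x \<bullet> b) / norm x)"
proof -
  have "((\<lambda>s. p (norm (x + s *\<^sub>R b))) has_real_derivative p1 (norm (x + 0 *\<^sub>R b)) * (((x + 0 *\<^sub>R b) \<bullet> b) / norm (x + 0 *\<^sub>R b))) (at 0)"
    by (rule DERIV_chain2[of p, OF p_deriv norm_line_deriv]) (use assms in simp)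
  moreover have "((\<lambda>s. p (norm (x + s *\<^sub>R b))) has_real_derivative D b (x + 0 *\<^sub>R b)) (at 0)"
    using dir_derivD[OF deriv[OF assms(2)], of x 0] by (simp add: \<Phi>_norm)
  ultimately show ?thesis using DERIV_unique by fastforce
qed

lemma sum_D_sq: assumes "x \<noteq> 0" shows "(\<Sum>b\<in>Basis. (D b x)\<^sup>2) = (p1 (norm x))\<^sup>2"
proof -
  have "(\<Sum>b\<in>Basis. (D b x)\<^sup>2) = (\<Sum>b\<in>Basis. (p1 (norm x) / norm x)\<^sup>2 * (x \<bullet> b)\<^sup>2)"
    by (intro sum.cong) (auto simp: D_eq[OF assms] power_mult_distrib power_divide)
  also have "\<dots> = (p1 (norm x) / norm x)\<^sup>2 * (\<Sum>b\<in>Basis. (x \<bullet> b) * (x \<bullet> b))" by (simp add: sum_distrib_left power2_eq_square)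
  also have "(\<Sum>b\<in>Basis. (x \<bullet> b) * (x \<bullet> b)) = (norm x)\<^sup>2" by (simp add: euclidean_inner[symmetric] dot_square_norm)
  finally show ?thesis using assms by (simp add: power_divide)
qed

text \<open>Conjugation with r absorbs the zeroth order part h/r: r (h p' + (h/r) p) equals h (r
  p)', so only h'/2 is left as a potential.\<close>

lemma mor_op_eq: assumes "x \<noteq> 0"
  shows "norm x * mor_op \<Phi> D x = (1 - inv1p (norm x)) * v1 (norm x) + 1/2 * (inv1p (norm x))\<^sup>2 * v (norm x)"
proof -
  let ?r = "norm x"
  have "(\<Sum>b\<in>Basis. mor_vec b x * D b x) = (\<Sum>b\<in>Basis. inv1p ?r * p1 ?r / ?r * ((x \<bullet> b) * (x \<bullet> b)))"
    by (intro sum.cong) (auto simp: D_eq[OF assms] mor_vec_def)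
  also have "\<dots> = inv1p ?r * p1 ?r / ?r * (norm x)\<^sup>2"
    unfolding sum_distrib_left[symmetric] by (simp add: euclidean_inner[symmetric] dot_square_norm)
  also have "\<dots> = inv1p ?r * (?r * p1 ?r)" using assms by (simp add: power2_eq_square)
  finally have "?r * mor_op \<Phi> D x = (?r * inv1p ?r) * (p ?r + ?r * p1 ?r) + 1/2 * (inv1p ?r)\<^sup>2 * (?r * p ?r)"
    by (simp add: mor_op_def mor_pot_def \<Phi>_norm algebra_simps)
  moreover have "?r * inv1p ?r = 1 - inv1p ?r"
    using norm_ge_zero[of x] by (simp add: inv1p_def field_simps add_nonneg_eq_0_iff)
  ultimately show ?thesis by (simp add: v_def v1_def)
qed

lemma v_hl2: "hl2 v" and v_norm: "n2 \<Phi> = sph * hl_integral (\<lambda>r. (v r)\<^sup>2)"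
proof -
  have "integrable lborel (\<lambda>x::'a. (p (norm x))\<^sup>2)" using \<Phi>_l2 by (simp add: l2_def \<Phi>_norm)
  hence i: "hl_integrable (\<lambda>r. (v r)\<^sup>2)"
    using polar(1)[OF dim, of "\<lambda>r. (p r)\<^sup>2"] by (simp add: v_def power_mult_distrib)
  have "(pos r * v r)\<^sup>2 = pos r * (v r)\<^sup>2" for r by (rule pos_cases[of r]) auto
  thus "hl2 v" using i by (simp add: hl2_def l2_def hl_integrable_def)
  show "n2 \<Phi> = sph * hl_integral (\<lambda>r. (v r)\<^sup>2)"
    using polar(2)[OF dim, of "\<lambda>r. (p r)\<^sup>2"] by (simp add: n2_def \<Phi>_norm v_def power_mult_distrib)
qed

lemma rp1_hl2: "hl2 (\<lambda>r. r * p1 r)"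
proof -
  have "integrable lborel (\<lambda>x. \<Sum>b\<in>Basis. (D b x)\<^sup>2)"
    using D_l2 by (intro Bochner_Integration.integrable_sum) (auto simp: l2_def)
  moreover have "AE x in lborel. (\<Sum>b\<in>Basis. (D b x)\<^sup>2) = (p1 (norm x))\<^sup>2"
    using AE_lborel_singleton[of "0::'a"] by eventually_elim (rule sum_D_sq)
  moreover have "(\<lambda>x. \<Sum>b\<in>Basis. (D b x)\<^sup>2) \<in> borel_measurable lborel" using calculation(1) by auto
  ultimately have "integrable lborel (\<lambda>x::'a. (p1 (norm x))\<^sup>2)"
    by (subst (asm) integrable_cong_AE) auto
  hence i: "hl_integrable (\<lambda>r. (r * p1 r)\<^sup>2)"
    using polar(1)[OF dim, of "\<lambda>r. (p1 r)\<^sup>2"] by (simp add: power_mult_distrib)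
  have "(pos r * (r * p1 r))\<^sup>2 = pos r * (r * p1 r)\<^sup>2" for r by (rule pos_cases[of r]) auto
  thus ?thesis using i by (simp add: hl2_def l2_def hl_integrable_def)
qed

text \<open>Square integrability of \<Phi> controls r p only. Near the origin continuity bounds p,
  and beyond 1 one has |p| \<le> |v|; this is needed because v1 = p + r p'.\<close>

lemma p_hl2: "hl2 p"
proof -
  have "compact (p ` {0..1})" by (intro compact_continuous_image continuous_on_subset[OF p_cont]) auto
  then obtain M where "\<forall>y\<in>p ` {0..1}. norm y \<le> M"
    using compact_imp_bounded bounded_iff by metis
  hence M: "\<And>r. 0 \<le> r \<Longrightarrow> r \<le> 1 \<Longrightarrow> \<bar>p r\<bar> \<le> M" by auto
  have M0: "0 \<le> M" using M[of 0] by (simp add: order_trans[OF abs_ge_zero])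
  have "hl2 (\<lambda>r. M * indicator {0..1} r + \<bar>v r\<bar>)"
  proof (rule hl2_add)
    have "l2 (\<lambda>r. M * (pos r * indicator {0..1} r))"
    proof (intro l2_cmult)
      have "(\<lambda>r. pos r * indicator {0..1} r :: real) = indicator {0<..1}" by (auto simp: fun_eq_iff pos_def indicator_def)
      moreover have "integrable lborel (\<lambda>r. (indicator {0<..1::real} r :: real)\<^sup>2)"
        by (simp add: power2_eq_square indicator_inter_arith[symmetric])
      ultimately show "l2 (\<lambda>r. pos r * indicator {0..1} r)" by (simp add: l2_def)
    qed
    thus "hl2 (\<lambda>r. M * indicator {0..1} r)" by (simp add: hl2_def mult.left_commute)
    show "hl2 (\<lambda>r. \<bar>v r\<bar>)" by (rule hl2_bound[OF _ v_hl2]) auto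
  qed
  thus ?thesis
  proof (rule hl2_bound[rotated])
    fix r :: real assume r: "0 < r"
    have "\<bar>p r\<bar> \<le> M * indicator {0..1} r + \<bar>v r\<bar>"
    proof (cases "r \<le> 1")
      case True thus ?thesis using M[of r] r by (simp add: add_increasing2)
    next
      case False thus ?thesis using r by (simp add: v_def abs_mult mult_le_cancel_right1)
    qed
    thus "\<bar>p r\<bar> \<le> \<bar>M * indicator {0..1} r + \<bar>v r\<bar>\<bar>" by simp
  qed simp
qed

sublocale half_line_fun v v1
proof
  show "(v has_real_derivative v1 r) (at r)" for r
    unfolding v_def v1_def by (auto intro!: derivative_eq_intros p_deriv)
  show "continuous_on UNIV v1" unfolding v1_def by (intro continuous_intros p_cont p1_cont)
  show "hl2 v" by (rule v_hl2)
  show "hl2 v1" unfolding v1_def by (rule hl2_add[OF p_hl2 rp1_hl2])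
  show "v 0 = 0" by (simp add: v_def)
qed

lemma mor_op_integral:
  assumes [measurable]: "h \<in> borel_measurable borel" and F: "F \<in> borel_measurable borel" "\<And>x. x \<noteq> 0 \<Longrightarrow> F x = h (norm x)"
    and m: "mor_op \<Phi> D \<in> borel_measurable borel"
  shows "(LINT x|lborel. F x * mor_op \<Phi> D x) = sph * hl_integral (\<lambda>r. r * h r * ((1 - inv1p r) * v1 r + 1/2 * (inv1p r)\<^sup>2 * v r))"
proof -
  let ?k = "\<lambda>r. h r * (((1 - inv1p r) * v1 r + 1/2 * (inv1p r)\<^sup>2 * v r) / r)"
  have "(LINT x|lborel. F x * mor_op \<Phi> D x) = (LINT x|lborel. ?k (norm (x::'a)))"
  proof (rule integral_cong_AE)
    show "(\<lambda>x. F x * mor_op \<Phi> D x) \<in> borel_measurable lborel" using F(1) m by simp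
    show "AE x in lborel. F x * mor_op \<Phi> D x = ?k (norm x)"
      using AE_lborel_singleton[of "0::'a"]
    proof eventually_elim
      case (elim x)
      thus ?case using F(2)[of x] mor_op_eq[of x, symmetric] by simp
    qed
  qed simp
  also have "\<dots> = sph * hl_integral (\<lambda>r. r\<^sup>2 * ?k r)" by (rule polar(2)[OF dim]) simp
  also have "hl_integral (\<lambda>r. r\<^sup>2 * ?k r) = hl_integral (\<lambda>r. r * h r * ((1 - inv1p r) * v1 r + 1/2 * (inv1p r)\<^sup>2 * v r))"
    by (intro hl_integral_cong) (simp add: power2_eq_square)
  finally show ?thesis .
qed

lemma mor_op_meas: "mor_op \<Phi> D \<in> borel_measurable borel"
proof -
  have [measurable]: "\<Phi> \<in> borel_measurable borel" "\<And>b. b \<in> Basis \<Longrightarrow> D b \<in> borel_measurable borel"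
    using \<Phi>_l2 D_l2 by (auto simp: l2_def)
  show ?thesis unfolding mor_op_def mor_vec_def mor_pot_def by measurable
qed

lemma mor_op_skew: "(LINT x|lborel. \<Phi> x * mor_op \<Phi> D x) = 0"
proof -
  have "(LINT x|lborel. \<Phi> x * mor_op \<Phi> D x) = sph * hl_integral (\<lambda>r. r * p r * ((1 - inv1p r) * v1 r + 1/2 * (inv1p r)\<^sup>2 * v r))"
    using \<Phi>_l2 by (intro mor_op_integral mor_op_meas) (auto simp: \<Phi>_norm l2_def)
  also have "\<dots> = 0" using transport_zero by (simp add: v_def)
  finally show ?thesis .
qed

text \<open>\<open>n2 \<Phi>\<close> is \<open>sph\<close> times the integral of v^2, so
  \<open>nonlinear_bound\<close> applies with c = 1/\<open>sph\<close>; multiplying back by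
  \<open>sph\<close> yields 18 + 12 \<open>sph\<close>, the constant in the smallness
  condition.\<close>

lemma mor_op_nonlinear:
  assumes b: "\<And>x. \<bar>\<Phi> x\<bar> \<le> \<epsilon>" "n2 \<Phi> \<le> \<epsilon>\<^sup>2" and N: "N \<in> borel_measurable borel" "\<And>s. \<bar>s\<bar> \<le> \<epsilon> \<Longrightarrow> \<bar>N s\<bar> \<le> C * \<bar>s\<bar> ^ 3"
    and C: "0 \<le> C"
  shows "\<bar>LINT x|lborel. N (\<Phi> x) * mor_op \<Phi> D x\<bar> \<le> C * \<epsilon>\<^sup>2 * (18 + 12 * sph) * (A + B)"
proof -
  have [measurable]: "N \<in> borel_measurable borel" by (rule N)
  have e0: "0 \<le> \<epsilon>" using b(1)[of 0] by linarith
  have pb: "\<bar>p r\<bar> \<le> \<epsilon>" for r using b(1) by (simp add: p_def)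
  have "(LINT x|lborel. N (\<Phi> x) * mor_op \<Phi> D x) = sph * hl_integral (\<lambda>r. r * N (p r) * ((1 - inv1p r) * v1 r + 1/2 * (inv1p r)\<^sup>2 * v r))"
    using \<Phi>_l2 by (intro mor_op_integral mor_op_meas) (auto simp: \<Phi>_norm l2_def)
  moreover have "\<bar>hl_integral (\<lambda>r. r * N (p r) * ((1 - inv1p r) * v1 r + 1/2 * (inv1p r)\<^sup>2 * v r))\<bar> \<le> C * \<epsilon>\<^sup>2 * (18 * (1 / sph) + 12) * (A + B)"
  proof (rule nonlinear_bound(2)[where p=p])
    show "hl_integral (\<lambda>r. (v r)\<^sup>2) \<le> 1 / sph * \<epsilon>\<^sup>2" using b(2) sph_pos by (simp add: v_norm field_simps)
    show "\<bar>N (p r)\<bar> \<le> C * \<bar>p r\<bar> ^ 3" for r by (rule N(2)[OF pb])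
  qed (use pb e0 C sph_pos in \<open>auto simp: v_def\<close>)
  hence "sph * \<bar>hl_integral (\<lambda>r. r * N (p r) * ((1 - inv1p r) * v1 r + 1/2 * (inv1p r)\<^sup>2 * v r))\<bar> \<le> sph * (C * \<epsilon>\<^sup>2 * (18 * (1 / sph) + 12) * (A + B))"
    using sph_pos by (intro mult_left_mono) auto
  moreover have "sph * (C * \<epsilon>\<^sup>2 * (18 * (1 / sph) + 12) * (A + B)) = C * \<epsilon>\<^sup>2 * (18 + 12 * sph) * (A + B)"
    using sph_pos by (simp add: field_simps)
  moreover have "\<bar>sph * a\<bar> = sph * \<bar>a\<bar>" for a using sph_pos by (simp add: abs_mult)
  ultimately show ?thesis by (simp only:)
qed

text \<open>\<open>A\<close> measures (r p)' and not r p'. Expanding its square and subtracting the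
  derivative of u^2 p v, whose integral is 0, leaves u^2 (r p')^2 and 2 u^3 p v, and p v = r p^2 is
  nonnegative for r > 0.\<close>

lemma gradient_le_A: "hl_integral (\<lambda>r. inv1p r ^ 2 * (r * p1 r) * (r * p1 r)) \<le> A"
proof -
  let ?h = "\<lambda>r. inv1p r ^ 2 * p r * v r"
  let ?q = "\<lambda>r. r * p1 r"
  let ?h' = "\<lambda>r. (inv1p r ^ 2 * p r * p r + 2 * (inv1p r ^ 2 * p r * ?q r)) - 2 * (inv1p r ^ 3 * p r * v r)"
  have w: "\<bar>inv1p r ^ n\<bar> \<le> 1" if "0 < r" for r n using that by (intro inv1p_abs_power) simp
  have i: "hl_integrable (\<lambda>r. inv1p r ^ n * p r * v r)" "hl_integrable (\<lambda>r. inv1p r ^ n * p r * p r)"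
    "hl_integrable (\<lambda>r. inv1p r ^ n * p r * ?q r)" "hl_integrable (\<lambda>r. inv1p r ^ n * ?q r * ?q r)" for n
    by (intro hl2_mult[where B=1] p_hl2 v_hl2 rp1_hl2 w; simp)+
  have ih': "hl_integrable ?h'" by (intro hl_integrable_diff hl_integrable_add hl_integrable_cmult i)
  have "hl_integral ?h' = - ?h 0"
  proof (rule hl_integral_derivative)
    show "(?h has_real_derivative ?h' r) (at r)" if "0 \<le> r" for r
    proof -
      have "(?h has_real_derivative (2 * inv1p r * (- (inv1p r)\<^sup>2)) * p r * v r + inv1p r ^ 2 * p1 r * v r + inv1p r ^ 2 * p r * v1 r) (at r)"
        by (rule derivative_eq_intros v_deriv p_deriv inv1p_deriv that refl)+ (simp add: power2_eq_square algebra_simps)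
      thus ?thesis by (rule back_subst[where P="\<lambda>d. (?h has_real_derivative d) (at r)"])
        (simp add: v_def v1_def power2_eq_square eval_nat_numeral algebra_simps)
    qed
    show "continuous_on {0..} ?h'"
      by (intro continuous_intros continuous_on_subset[OF p_cont] continuous_on_subset[OF p1_cont] continuous_on_subset[OF v_cont] inv1p_cont) auto
  qed (intro i ih')+
  hence z: "hl_integral ?h' = 0" by (simp add: v0)
  have "A = hl_integral (\<lambda>r. ?h' r + (2 * (inv1p r ^ 3 * p r * v r) + inv1p r ^ 2 * ?q r * ?q r))"
    unfolding A_def by (intro hl_integral_cong) (simp add: v1_def power2_eq_square algebra_simps)
  also have "\<dots> = hl_integral ?h' + (2 * hl_integral (\<lambda>r. inv1p r ^ 3 * p r * v r) + hl_integral (\<lambda>r. inv1p r ^ 2 * ?q r * ?q r))"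
    using ih' i by (simp only: hl_integral_add hl_integral_cmult hl_integrable_cmult hl_integrable_add)
  finally have "A = 2 * hl_integral (\<lambda>r. inv1p r ^ 3 * p r * v r) + hl_integral (\<lambda>r. inv1p r ^ 2 * ?q r * ?q r)" by (simp only: z add_0)
  moreover have "0 \<le> hl_integral (\<lambda>r. inv1p r ^ 3 * p r * v r)"
  proof (rule hl_integral_nonneg)
    fix r :: real assume r: "0 < r"
    have "0 \<le> inv1p r ^ 3 * r * (p r)\<^sup>2" using inv1p_pos[of r] r by simp
    thus "0 \<le> inv1p r ^ 3 * p r * v r" by (simp add: v_def power2_eq_square mult_ac)
  qed
  ultimately show ?thesis by linarith
qed

text \<open>The factor 4 comes from (1+r)^2 \<le> 2 (1+r^2), squared. The gradient has the weight
  u^2 available in \<open>A\<close>, which dominates u^4.\<close>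

lemma weighted_norm_le: "(\<Sum>b\<in>Basis. ip dec_weight (D b) (D b)) + ip dec_weight \<Phi> \<Phi> \<le> 4 * sph * (A + B)"
proof -
  define om where "om r = 1 / (1 + r\<^sup>2)\<^sup>2" for r :: real
  have om_m[measurable]: "om \<in> borel_measurable borel" unfolding om_def by simp
  have om: "om r \<le> 4 * inv1p r ^ 4" "0 \<le> om r" if "0 \<le> r" for r
  proof -
    have "(1 + r)\<^sup>2 \<le> 2 * (1 + r\<^sup>2)" using zero_le_power2[of "r - 1"] by (simp add: power2_eq_square algebra_simps)
    hence "((1 + r)\<^sup>2)\<^sup>2 \<le> (2 * (1 + r\<^sup>2))\<^sup>2" by (intro power_mono) auto
    hence "(1 + r) ^ 4 \<le> 4 * (1 + r\<^sup>2)\<^sup>2" by (simp only: power_mult_distrib power_mult[symmetric]) simp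
    moreover have "0 < (1 + r) ^ 4" "0 < (1 + r\<^sup>2)\<^sup>2"
      using that by (intro zero_less_power add_pos_nonneg; simp)+
    ultimately show "om r \<le> 4 * inv1p r ^ 4" by (simp add: om_def inv1p_def power_divide divide_simps)
  qed (simp add: om_def)
  have om1: "\<bar>om r\<bar> \<le> 1" for r
  proof -
    have "1 \<le> (1 + r\<^sup>2)\<^sup>2" by (rule one_le_power) simp
    thus ?thesis by (simp add: om_def divide_le_eq)
  qed
  have dw: "dec_weight x = om (norm x)" for x by (simp add: dec_weight_def om_def)
  have bm: "bdd_meas dec_weight" unfolding bdd_meas_def dw using om1 by auto
  have "(\<Sum>b\<in>Basis. ip dec_weight (D b) (D b)) = (LINT x|lborel. (\<Sum>b\<in>Basis. dec_weight x * D b x * D b x))"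
    unfolding ip_def by (intro Bochner_Integration.integral_sum[symmetric] ip_integrable bm D_l2)
  also have "\<dots> = (LINT x|lborel. om (norm (x::'a)) * (p1 (norm x))\<^sup>2)"
  proof (rule integral_cong_AE)
    show "(\<lambda>x. \<Sum>b\<in>Basis. dec_weight x * D b x * D b x) \<in> borel_measurable lborel"
      by (intro borel_measurable_integrable Bochner_Integration.integrable_sum ip_integrable bm D_l2)
    show "AE x in lborel. (\<Sum>b\<in>Basis. dec_weight x * D b x * D b x) = om (norm x) * (p1 (norm x))\<^sup>2"
      using AE_lborel_singleton[of "0::'a"]
    proof eventually_elim
      case (elim x)
      show ?case unfolding sum_D_sq[OF elim, symmetric] by (simp add: dw sum_distrib_left power2_eq_square mult.assoc)
    qed
  qed simp
  also have "\<dots> = sph * hl_integral (\<lambda>r. r\<^sup>2 * (om r * (p1 r)\<^sup>2))" by (rule polar(2)[OF dim]) simp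
  finally have e1: "(\<Sum>b\<in>Basis. ip dec_weight (D b) (D b)) = sph * hl_integral (\<lambda>r. r\<^sup>2 * (om r * (p1 r)\<^sup>2))" .
  have e2: "ip dec_weight \<Phi> \<Phi> = sph * hl_integral (\<lambda>r. r\<^sup>2 * (om r * (p r)\<^sup>2))"
    using polar(2)[OF dim, of "\<lambda>r. om r * (p r)\<^sup>2"] by (simp add: ip_def dw \<Phi>_norm power2_eq_square mult.assoc)
  have w: "\<bar>inv1p r ^ n\<bar> \<le> 1" if "0 < r" for r n using that by (intro inv1p_abs_power) simp
  have i: "hl_integrable (\<lambda>r. om r * (r * p1 r) * (r * p1 r))" "hl_integrable (\<lambda>r. om r * v r * v r)"
    "hl_integrable (\<lambda>r. inv1p r ^ 2 * (r * p1 r) * (r * p1 r))"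
    by (intro hl2_mult[where B=1] rp1_hl2 v_hl2 om1 w; simp)+
  have "hl_integral (\<lambda>r. r\<^sup>2 * (om r * (p1 r)\<^sup>2)) = hl_integral (\<lambda>r. om r * (r * p1 r) * (r * p1 r))"
    by (intro hl_integral_cong) (simp add: power2_eq_square)
  also have "\<dots> \<le> hl_integral (\<lambda>r. 4 * (inv1p r ^ 2 * (r * p1 r) * (r * p1 r)))"
  proof (rule hl_integral_mono[OF i(1) hl_integrable_cmult[OF i(3)]])
    fix r :: real assume r: "0 < r"
    have "inv1p r ^ 4 \<le> inv1p r ^ 2" using inv1p_pos[of r] inv1p_le1[of r] r by (intro power_decreasing) auto
    hence "om r * ((r * p1 r) * (r * p1 r)) \<le> 4 * inv1p r ^ 2 * ((r * p1 r) * (r * p1 r))"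
      using om(1)[of r] r by (intro mult_right_mono) auto
    thus "om r * (r * p1 r) * (r * p1 r) \<le> 4 * (inv1p r ^ 2 * (r * p1 r) * (r * p1 r))" by (simp only: mult.assoc)
  qed
  also have "\<dots> \<le> 4 * A" using gradient_le_A by (simp add: hl_integral_cmult)
  finally have f1: "hl_integral (\<lambda>r. r\<^sup>2 * (om r * (p1 r)\<^sup>2)) \<le> 4 * A" .
  have "hl_integral (\<lambda>r. r\<^sup>2 * (om r * (p r)\<^sup>2)) = hl_integral (\<lambda>r. om r * v r * v r)"
    by (intro hl_integral_cong) (simp add: v_def power2_eq_square)
  also have "\<dots> \<le> hl_integral (\<lambda>r. 4 * (inv1p r ^ 4 * v r * v r))"
  proof (rule hl_integral_mono[OF i(2) hl_integrable_cmult[OF wint(1)]])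
    fix r :: real assume r: "0 < r"
    have "om r * (v r * v r) \<le> 4 * inv1p r ^ 4 * (v r * v r)" using om(1)[of r] r by (intro mult_right_mono) auto
    thus "om r * v r * v r \<le> 4 * (inv1p r ^ 4 * v r * v r)" by (simp only: mult.assoc)
  qed
  also have "\<dots> = 4 * B" by (simp add: hl_integral_cmult B_def)
  finally have f2: "hl_integral (\<lambda>r. r\<^sup>2 * (om r * (p r)\<^sup>2)) \<le> 4 * B" .
  have "sph * (hl_integral (\<lambda>r. r\<^sup>2 * (om r * (p1 r)\<^sup>2)) + hl_integral (\<lambda>r. r\<^sup>2 * (om r * (p r)\<^sup>2))) \<le> sph * (4 * A + 4 * B)"
    using f1 f2 sph_pos by (intro mult_left_mono) auto
  thus ?thesis unfolding e1 e2 by (simp add: algebra_simps)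
qed

end

locale radial_fun2 = radial_fun +
  fixes D2 :: "'a \<Rightarrow> 'a \<Rightarrow> real"
  assumes deriv2: "\<And>b. b \<in> Basis \<Longrightarrow> dir_deriv b (D b) (D2 b)"
    and D2_cont: "\<And>b. b \<in> Basis \<Longrightarrow> continuous_on UNIV (D2 b)"
    and D2_l2: "\<And>b. b \<in> Basis \<Longrightarrow> l2 (D2 b)"
begin

definition p2 :: "real \<Rightarrow> real" where "p2 r = D2 e (r *\<^sub>R e)"
definition v2 :: "real \<Rightarrow> real" where "v2 r = 2 * p1 r + r * p2 r"

lemma p1_deriv: "(p1 has_real_derivative p2 r) (at r)"
  using dir_derivD[OF deriv2[OF e], of 0 r] by (simp add: p1_def[abs_def] p2_def)
lemma p2_cont: "continuous_on UNIV p2"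
  unfolding p2_def by (intro continuous_on_compose2[OF D2_cont[OF e]] continuous_intros) auto

lemma p2_meas[measurable]: "p2 \<in> borel_measurable borel"
  using p2_cont by (auto intro: borel_measurable_continuous_onI)

lemma laplacian_eq: assumes x: "x \<noteq> 0" shows "(\<Sum>b\<in>Basis. D2 b x) = p2 (norm x) + 2 * p1 (norm x) / norm x"
proof -
  let ?r = "norm x"
  have r: "0 < ?r" using x by simp
  have D2: "D2 b x = p2 ?r * ((x \<bullet> b) * (x \<bullet> b) / ?r\<^sup>2) + p1 ?r * (1 / ?r - (x \<bullet> b) * (x \<bullet> b) / ?r ^ 3)" if b: "b \<in> Basis" for b
  proof -
    have nd: "((\<lambda>s. norm (x + s *\<^sub>R b)) has_real_derivative (x \<bullet> b) / ?r) (at 0)"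
      using norm_line_deriv[of x 0 b] x by simp
    have "((\<lambda>s. p1 (norm (x + s *\<^sub>R b))) has_real_derivative p2 (norm (x + 0 *\<^sub>R b)) * ((x \<bullet> b) / ?r)) (at 0)"
      by (rule DERIV_chain2[of p1, OF p1_deriv nd])
    hence pd: "((\<lambda>s. p1 (norm (x + s *\<^sub>R b))) has_real_derivative p2 ?r * ((x \<bullet> b) / ?r)) (at 0)" by simp
    have id: "((\<lambda>s. (x + s *\<^sub>R b) \<bullet> b) has_real_derivative 1) (at 0)"
      using b by (auto intro!: derivative_eq_intros simp: inner_add_left)
    have "((\<lambda>s. p1 (norm (x + s *\<^sub>R b)) * (((x + s *\<^sub>R b) \<bullet> b) / norm (x + s *\<^sub>R b))) has_real_derivative
        p2 ?r * ((x \<bullet> b) / ?r) * (((x + 0 *\<^sub>R b) \<bullet> b) / norm (x + 0 *\<^sub>R b))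
         + (1 * norm (x + 0 *\<^sub>R b) - ((x + 0 *\<^sub>R b) \<bullet> b) * ((x \<bullet> b) / ?r)) / (norm (x + 0 *\<^sub>R b) * norm (x + 0 *\<^sub>R b)) * p1 (norm (x + 0 *\<^sub>R b))) (at 0)"
      by (rule DERIV_mult[OF pd DERIV_divide[OF id nd]]) (use x in simp)
    \<comment> \<open>The formula \<open>D_eq\<close> holds away from the origin only, so the two
      functions of s agree near 0, which suffices for the derivative there.\<close>
    moreover have "\<forall>\<^sub>F s in nhds 0. p1 (norm (x + s *\<^sub>R b)) * (((x + s *\<^sub>R b) \<bullet> b) / norm (x + s *\<^sub>R b)) = D b (x + s *\<^sub>R b)"
    proof -
      have "((\<lambda>s. x + s *\<^sub>R b) \<longlongrightarrow> x + 0 *\<^sub>R b) (nhds 0)" by (intro tendsto_intros filterlim_ident)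
      hence "\<forall>\<^sub>F s in nhds 0. x + s *\<^sub>R b \<in> - {0}" by (rule topological_tendstoD) (use x in auto)
      thus ?thesis by eventually_elim (simp add: D_eq b)
    qed
    ultimately have "((\<lambda>s. D b (x + s *\<^sub>R b)) has_real_derivative
        p2 ?r * ((x \<bullet> b) / ?r) * (((x + 0 *\<^sub>R b) \<bullet> b) / norm (x + 0 *\<^sub>R b))
         + (1 * norm (x + 0 *\<^sub>R b) - ((x + 0 *\<^sub>R b) \<bullet> b) * ((x \<bullet> b) / ?r)) / (norm (x + 0 *\<^sub>R b) * norm (x + 0 *\<^sub>R b)) * p1 (norm (x + 0 *\<^sub>R b))) (at 0)"
      by (rule DERIV_cong_ev[OF refl _ refl, THEN iffD1, rotated])
    moreover have "((\<lambda>s. D b (x + s *\<^sub>R b)) has_real_derivative D2 b (x + 0 *\<^sub>R b)) (at 0)"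
      by (rule dir_derivD[OF deriv2[OF b]])
    ultimately have "D2 b (x + 0 *\<^sub>R b) = p2 ?r * ((x \<bullet> b) / ?r) * (((x + 0 *\<^sub>R b) \<bullet> b) / norm (x + 0 *\<^sub>R b))
         + (1 * norm (x + 0 *\<^sub>R b) - ((x + 0 *\<^sub>R b) \<bullet> b) * ((x \<bullet> b) / ?r)) / (norm (x + 0 *\<^sub>R b) * norm (x + 0 *\<^sub>R b)) * p1 (norm (x + 0 *\<^sub>R b))"
      by (rule DERIV_unique[rotated])
    thus ?thesis using r by (simp add: field_simps power2_eq_square eval_nat_numeral)
  qed
  have S: "(\<Sum>b\<in>Basis. (x \<bullet> b) * (x \<bullet> b)) = ?r\<^sup>2" by (simp add: euclidean_inner[symmetric] dot_square_norm)
  have "(\<Sum>b\<in>Basis. D2 b x) = (\<Sum>b\<in>Basis. p2 ?r / ?r\<^sup>2 * ((x \<bullet> b) * (x \<bullet> b)) + (p1 ?r / ?r - p1 ?r / ?r ^ 3 * ((x \<bullet> b) * (x \<bullet> b))))"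
    by (intro sum.cong) (auto simp: D2 right_diff_distrib)
  also have "\<dots> = p2 ?r / ?r\<^sup>2 * ?r\<^sup>2 + (3 * (p1 ?r / ?r) - p1 ?r / ?r ^ 3 * ?r\<^sup>2)"
    unfolding sum.distrib sum_subtractf sum_distrib_left[symmetric] S by (simp add: dim)
  also have "\<dots> = p2 ?r + 2 * p1 ?r / ?r" using r by (simp add: field_simps power2_eq_square eval_nat_numeral)
  finally show ?thesis .
qed

sublocale half_line_fun2 v v1 v2
proof
  show "(v1 has_real_derivative v2 r) (at r)" for r
    unfolding v1_def v2_def by (auto intro!: derivative_eq_intros p_deriv p1_deriv)
  show "continuous_on UNIV v2" unfolding v2_def by (intro continuous_intros p1_cont p2_cont)
  \<comment> \<open>\<open>v2\<close> is r times the Laplacian, so its square integrability follows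
    from that of the Laplacian, without separate bounds on p'' and p'/r.\<close>
  have "l2 (\<lambda>x. \<Sum>b\<in>Basis. D2 b x)" by (intro l2_sum D2_l2) auto
  hence m: "(\<lambda>x. \<Sum>b\<in>Basis. D2 b x) \<in> borel_measurable borel" "integrable lborel (\<lambda>x. (\<Sum>b\<in>Basis. D2 b x)\<^sup>2)" by (auto simp: l2_def)
  have "AE x in lborel. (\<Sum>b\<in>Basis. D2 b x)\<^sup>2 = (p2 (norm x) + 2 * p1 (norm x) / norm x)\<^sup>2"
    using AE_lborel_singleton[of "0::'a"] by eventually_elim (simp add: laplacian_eq)
  hence "integrable lborel (\<lambda>x::'a. (p2 (norm x) + 2 * p1 (norm x) / norm x)\<^sup>2)"
    using m by (subst (asm) integrable_cong_AE) auto
  hence "hl_integrable (\<lambda>r. r\<^sup>2 * (p2 r + 2 * p1 r / r)\<^sup>2)"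
    using polar(1)[OF dim, of "\<lambda>r. (p2 r + 2 * p1 r / r)\<^sup>2"] by simp
  hence "hl_integrable (\<lambda>r. (v2 r)\<^sup>2)"
    by (rule hl_integrable_cong[THEN iffD1, rotated]) (simp add: v2_def power_mult_distrib[symmetric] algebra_simps)
  moreover have "(pos r * v2 r)\<^sup>2 = pos r * (v2 r)\<^sup>2" for r by (rule pos_cases[of r]) auto
  moreover have "v2 \<in> borel_measurable borel" unfolding v2_def by simp
  ultimately show "hl2 v2" by (simp add: hl2_def l2_def hl_integrable_def)
qed

lemma mor_op_laplacian: "(LINT x|lborel. (\<Sum>b\<in>Basis. D2 b x) * mor_op \<Phi> D x) = sph * (- A + 3/2 * B)"
proof -
  have "(LINT x|lborel. (\<Sum>b\<in>Basis. D2 b x) * mor_op \<Phi> D x) =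
      sph * hl_integral (\<lambda>r. r * (p2 r + 2 * p1 r / r) * ((1 - inv1p r) * v1 r + 1/2 * (inv1p r)\<^sup>2 * v r))"
  proof (rule mor_op_integral)
    have "l2 (\<lambda>x. \<Sum>b\<in>Basis. D2 b x)" by (intro l2_sum D2_l2) auto
    thus "(\<lambda>x. \<Sum>b\<in>Basis. D2 b x) \<in> borel_measurable borel" by (simp add: l2_def)
  qed (auto simp: laplacian_eq mor_op_meas)
  also have "hl_integral (\<lambda>r. r * (p2 r + 2 * p1 r / r) * ((1 - inv1p r) * v1 r + 1/2 * (inv1p r)\<^sup>2 * v r))
     = hl_integral (\<lambda>r. v2 r * ((1 - inv1p r) * v1 r + 1/2 * (inv1p r)\<^sup>2 * v r))"
    by (intro hl_integral_cong) (simp add: v2_def algebra_simps)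
  finally show ?thesis unfolding morawetz .
qed

theorem radial_morawetz:
  assumes b: "\<And>x. \<bar>\<Phi> x\<bar> \<le> \<epsilon>" "n2 \<Phi> \<le> \<epsilon>\<^sup>2" and N: "N \<in> borel_measurable borel" "\<And>s. \<bar>s\<bar> \<le> \<epsilon> \<Longrightarrow> \<bar>N s\<bar> \<le> C * \<bar>s\<bar> ^ 3"
    and C: "0 \<le> C" and small: "C * \<epsilon>\<^sup>2 * (18 + 12 * sph) \<le> sph / 10"
  shows "(LINT x|lborel. (\<Sum>b\<in>Basis. D2 b x) * mor_op \<Phi> D x) - (LINT x|lborel. N (\<Phi> x) * mor_op \<Phi> D x)
     \<le> - (1/40) * ((\<Sum>b\<in>Basis. ip dec_weight (D b) (D b)) + ip dec_weight \<Phi> \<Phi>)"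
proof -
  have "- (LINT x|lborel. N (\<Phi> x) * mor_op \<Phi> D x) \<le> C * \<epsilon>\<^sup>2 * (18 + 12 * sph) * (A + B)"
    using mor_op_nonlinear[OF b N C] by (simp add: abs_le_iff)
  also have "\<dots> \<le> sph / 10 * (A + B)" using A_nonneg B_nonneg by (intro mult_right_mono small) auto
  finally have 1: "- (LINT x|lborel. N (\<Phi> x) * mor_op \<Phi> D x) \<le> sph / 10 * (A + B)" .
  have "sph * (9/4 * B) \<le> sph * A" using sph_pos hardy by (intro mult_left_mono) auto
  moreover have "0 \<le> sph * A" "0 \<le> sph * B" using sph_pos A_nonneg B_nonneg by auto
  \<comment> \<open>The inequality amounts to 17 B \<le> 8 A, and Hardy's inequality gives 18 B
    \<le> 8 A. Of the remaining (A + B)/10, the factor 4 of \<open>weighted_norm_le\<close> leaves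
    1/40.\<close>
  ultimately have "sph * (- A + 3/2 * B) + sph / 10 * (A + B) \<le> - (1/40) * (4 * sph * (A + B))"
    by (simp add: algebra_simps)
  also have "\<dots> \<le> - (1/40) * ((\<Sum>b\<in>Basis. ip dec_weight (D b) (D b)) + ip dec_weight \<Phi> \<Phi>)"
    using weighted_norm_le by simp
  finally show ?thesis unfolding mor_op_laplacian using 1 by linarith
qed

end

section \<open>Reflections and differences of solutions\<close>

text \<open>All conditions are local, for arguments in [-1,1], because solutions are bounded by
  \<epsilon> \<le> 1; the growth of f elsewhere is irrelevant.\<close>

locale nonlinearity =
  fixes f :: "real \<Rightarrow> real" and m C L :: real
  assumes f_meas[measurable]: "f \<in> borel_measurable borel"
    and f_lip: "\<And>s s'. \<bar>s\<bar> \<le> 1 \<Longrightarrow> \<bar>s'\<bar> \<le> 1 \<Longrightarrow> \<bar>f s - f s'\<bar> \<le> L * \<bar>s - s'\<bar>"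
    and f_cubic: "\<And>s. \<bar>s\<bar> \<le> 1 \<Longrightarrow> \<bar>f s - m * s\<bar> \<le> C * \<bar>s\<bar> ^ 3"
    and C_nonneg: "0 \<le> C" and L_nonneg: "0 \<le> L"
begin

lemma f_zero: "f 0 = 0" using f_cubic[of 0] by simp

lemma f_le: "\<bar>s\<bar> \<le> 1 \<Longrightarrow> \<bar>f s\<bar> \<le> L * \<bar>s\<bar>"
  using f_lip[of s 0] by (simp add: f_zero)

lemma comp_l2:
  assumes "l2 u" "AE x in lborel. \<bar>u x\<bar> \<le> 1"
  shows "l2 (\<lambda>x. f (u x))" "n2 (\<lambda>x. f (u x)) \<le> L\<^sup>2 * n2 u"
proof -
  have [measurable]: "u \<in> borel_measurable borel" using assms by (simp add: l2_def)
  have ae: "AE x in lborel. \<bar>f (u x)\<bar> \<le> L * \<bar>u x\<bar>" using assms(2) by eventually_elim (rule f_le)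
  have me: "(\<lambda>x. f (u x)) \<in> borel_measurable borel" by simp
  show "l2 (\<lambda>x. f (u x))" "n2 (\<lambda>x. f (u x)) \<le> L\<^sup>2 * n2 u" by (rule l2_bound[OF me assms(1) ae])+
qed

lemma comp_diff:
  assumes "l2 u" "AE x in lborel. \<bar>u x\<bar> \<le> 1" "l2 v" "AE x in lborel. \<bar>v x\<bar> \<le> 1"
  shows "n2 (\<lambda>x. f (u x) - f (v x)) \<le> L\<^sup>2 * n2 (\<lambda>x. u x - v x)"
proof (rule l2_bound(2))
  have [measurable]: "u \<in> borel_measurable borel" "v \<in> borel_measurable borel" using assms by (auto simp: l2_def)
  show "(\<lambda>x. f (u x) - f (v x)) \<in> borel_measurable borel" by simp
  show "l2 (\<lambda>x. u x - v x)" by (intro l2_diff assms)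
  show "AE x in lborel. \<bar>f (u x) - f (v x)\<bar> \<le> L * \<bar>u x - v x\<bar>"
    using assms(2,4) by eventually_elim (rule f_lip)
qed

lemma comp_l2lim:
  assumes "l2lim g u F" "\<forall>\<^sub>F i in F. AE x in lborel. \<bar>g i x\<bar> \<le> 1" "AE x in lborel. \<bar>u x\<bar> \<le> 1"
  shows "l2lim (\<lambda>i x. f (g i x)) (\<lambda>x. f (u x)) F"
proof (rule l2lim_bound)
  have e: "\<forall>\<^sub>F i in F. l2 (g i)" "l2 u" using assms(1) by (auto simp: l2lim_def)
  show "\<forall>\<^sub>F i in F. l2 (\<lambda>x. f (g i x))" using e(1) assms(2) by eventually_elim (rule comp_l2)
  show "l2 (\<lambda>x. f (u x))" by (rule comp_l2[OF e(2) assms(3)])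
  show "\<forall>\<^sub>F i in F. n2 (\<lambda>x. f (g i x) - f (u x)) \<le> L\<^sup>2 * n2 (\<lambda>x. g i x - u x)"
    using e(1) assms(2) by eventually_elim (rule comp_diff[OF _ _ e(2) assms(3)])
  show "((\<lambda>i. L\<^sup>2 * n2 (\<lambda>x. g i x - u x)) \<longlongrightarrow> 0) F"
    using assms(1) unfolding l2lim_def by (auto intro!: tendsto_mult_right_zero)
qed

lemma comp_l2cont:
  assumes "l2cont u" "\<And>t. 0 \<le> t \<Longrightarrow> AE x in lborel. \<bar>u t x\<bar> \<le> 1"
  shows "l2cont (\<lambda>t x. f (u t x))"
proof (rule l2contI)
  show "l2 (\<lambda>x. f (u t x))" if "0 \<le> t" for t using assms that by (intro comp_l2) (auto simp: l2cont_def)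
  show "l2lim (\<lambda>t x. f (u t x)) (\<lambda>x. f (u t x)) (at t within {0..})" if "0 \<le> t" for t
  proof (rule comp_l2lim)
    show "l2lim u (u t) (at t within {0..})" using assms(1) that by (simp add: l2cont_def)
    show "\<forall>\<^sub>F s in at t within {0..}. AE x in lborel. \<bar>u s x\<bar> \<le> 1"
      using eventually_nonneg_within by eventually_elim (rule assms(2))
  qed (use assms that in auto)
qed

text \<open>Subtracting the linear part gives again a nonlinearity, with vanishing linear
  coefficient, so the composition lemmas apply to the cubic part too.\<close>

lemma remainder: "nonlinearity (\<lambda>s. f s - m * s) 0 C (L + \<bar>m\<bar>)"
proof
  fix s s' :: real assume a: "\<bar>s\<bar> \<le> 1" "\<bar>s'\<bar> \<le> 1"
  have "\<bar>(f s - m * s) - (f s' - m * s')\<bar> = \<bar>(f s - f s') - m * (s - s')\<bar>" by (simp add: algebra_simps)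
  also have "\<dots> \<le> \<bar>f s - f s'\<bar> + \<bar>m\<bar> * \<bar>s - s'\<bar>" by (rule order_trans[OF abs_triangle_ineq4]) (simp add: abs_mult)
  also have "\<dots> \<le> (L + \<bar>m\<bar>) * \<bar>s - s'\<bar>" using f_lip[OF a] by (simp add: distrib_right)
  finally show "\<bar>(f s - m * s) - (f s' - m * s')\<bar> \<le> (L + \<bar>m\<bar>) * \<bar>s - s'\<bar>" .
qed (use f_cubic C_nonneg L_nonneg in auto)

end

section \<open>Reflections in hyperplanes\<close>

definition mirror :: "'a::euclidean_space \<Rightarrow> 'a \<Rightarrow> 'a" where
  "mirror n x = x - (2 * (x \<bullet> n) / (n \<bullet> n)) *\<^sub>R n"

lemma mirror_linear: "linear (mirror n)"
proof (rule linearI)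
  fix x y :: 'a and c :: real
  have "2 * ((x + y) \<bullet> n) / (n \<bullet> n) = 2 * (x \<bullet> n) / (n \<bullet> n) + 2 * (y \<bullet> n) / (n \<bullet> n)"
    by (simp add: inner_add_left distrib_left add_divide_distrib)
  thus "mirror n (x + y) = mirror n x + mirror n y" by (simp add: mirror_def scaleR_add_left)
  show "mirror n (c *\<^sub>R x) = c *\<^sub>R mirror n x" by (simp add: mirror_def scaleR_diff_right mult.left_commute)
qed

lemma mirror_inner: "mirror n x \<bullet> y = x \<bullet> mirror n y"
  by (simp add: mirror_def inner_diff_left inner_diff_right inner_commute[of n y])

lemma mirror_mirror: "mirror n (mirror n x) = x"
proof (cases "n = 0")
  case False
  hence "mirror n x \<bullet> n = - (x \<bullet> n)" by (simp add: mirror_def inner_diff_left)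
  thus ?thesis unfolding mirror_def[of n "mirror n x"] by (simp add: mirror_def)
qed (simp add: mirror_def)

lemma mirror_dot: "mirror n x \<bullet> mirror n y = x \<bullet> y"
  using mirror_inner[of n x "mirror n y"] by (simp add: mirror_mirror)

lemma mirror_norm: "norm (mirror n x) = norm x"
  by (simp add: norm_eq_sqrt_inner mirror_dot)

lemma mirror_diff: "mirror n (x - y) = mirror n x - mirror n y"
  by (rule linear_diff[OF mirror_linear])

text \<open>The reflection in the perpendicular bisector of x and y, which passes through the origin
  when the norms agree. For x = y the normal is 0 and \<open>mirror 0\<close> is the identity, since
  division by 0 gives 0.\<close>

lemma mirror_swap: assumes "norm x = norm y" shows "mirror (x - y) x = y"
proof (cases "x = y")
  case True thus ?thesis by (simp add: mirror_def)
next
  case False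
  have "x \<bullet> x = y \<bullet> y" using assms by (simp add: dot_square_norm)
  hence "(x - y) \<bullet> (x - y) = 2 * (x \<bullet> (x - y))" by (simp add: inner_diff_left inner_diff_right inner_commute)
  moreover have "(x - y) \<bullet> (x - y) \<noteq> 0" using False by simp
  ultimately show ?thesis by (simp add: mirror_def)
qed

text \<open>Boxes determine Lebesgue measure, and the preimage of a box is its image because a
  reflection is its own inverse; orthogonal maps preserve the measure of the image.\<close>

lemma lpres_mirror: fixes n :: "real^'n::{finite,wellorder}" shows "lpres (mirror n)"
proof -
  have ot: "orthogonal_transformation (mirror n)"
    by (simp add: orthogonal_transformation_def mirror_linear mirror_dot)
  have [measurable]: "mirror n \<in> borel_measurable borel"
    by (intro borel_measurable_continuous_onI linear_continuous_on linear_conv_bounded_linear[THEN iffD1] mirror_linear)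
  have "lborel = distr lborel borel (mirror n)"
  proof (rule lborel_eqI)
    fix l u :: "real^'n::{finite,wellorder}" assume lu: "\<And>b. b \<in> Basis \<Longrightarrow> l \<bullet> b \<le> u \<bullet> b"
    have im: "mirror n -` box l u = mirror n ` box l u"
    proof (intro set_eqI iffI)
      fix x assume "x \<in> mirror n -` box l u"
      thus "x \<in> mirror n ` box l u" by (intro image_eqI[of _ _ "mirror n x"]) (auto simp: mirror_mirror)
    qed (auto simp: mirror_mirror)
    have bb: "mirror n -` box l u \<in> sets borel" using measurable_sets[of "mirror n" borel borel "box l u"] by simp
    have "bounded (mirror n -` box l u)"
      unfolding im by (intro bounded_linear_image bounded_box linear_conv_bounded_linear[THEN iffD1] mirror_linear)
    hence fin: "emeasure lborel (mirror n -` box l u) < \<infinity>" by (rule emeasure_bounded_finite)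
    have "emeasure (distr lborel borel (mirror n)) (box l u) = emeasure lborel (mirror n -` box l u)"
      by (subst emeasure_distr) auto
    also have "\<dots> = ennreal (measure lborel (mirror n -` box l u))" using fin by (simp add: emeasure_eq_ennreal_measure)
    also have "measure lborel (mirror n -` box l u) = measure lebesgue (mirror n ` box l u)"
      using bb by (simp add: im[symmetric] measure_completion)
    also have "\<dots> = measure lebesgue (box l u)"
      by (rule measure_orthogonal_image[OF ot]) (simp add: lmeasurable_box)
    also have "\<dots> = measure lborel (box l u)" by (simp add: measure_completion)
    also have "\<dots> = (\<Prod>b\<in>Basis. (u - l) \<bullet> b)" by (rule measure_lborel_box[OF lu])
    finally show "emeasure (distr lborel borel (mirror n)) (box l u) = ennreal (\<Prod>b\<in>Basis. (u - l) \<bullet> b)" .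
  qed simp
  thus ?thesis by (simp add: lpres_def)
qed

lemma bump_mirror: "bump \<delta> (mirror n x) = bump \<delta> x"
  by (simp add: bump_def mirror_dot)

lemma bump1_mirror: "bump1 \<delta> b (mirror n x) = (\<Sum>c\<in>Basis. (mirror n b \<bullet> c) * bump1 \<delta> c x)"
proof -
  have "mirror n x \<bullet> b = (\<Sum>c\<in>Basis. (mirror n b \<bullet> c) * (x \<bullet> c))"
    unfolding mirror_inner[of n x b] by (subst euclidean_inner) (simp add: mult.commute)
  thus ?thesis
    by (simp add: bump1_def mirror_dot sum_distrib_left sum_distrib_right sum_divide_distrib mult_ac sum_negf)
qed

text \<open>The sum is the Laplacian of the bump. Written out, it depends on x through x \<bullet> x
  only.\<close>

lemma sum_bump2_mirror: "(\<Sum>b\<in>Basis. bump2 \<delta> b (mirror n x)) = (\<Sum>b\<in>Basis. bump2 \<delta> b x)"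
proof -
  have s: "(\<Sum>b\<in>Basis. bump2 \<delta> b x) = (4 * (x \<bullet> x) * (ebump 4 (\<delta>\<^sup>2 - x \<bullet> x) - 2 * ebump 3 (\<delta>\<^sup>2 - x \<bullet> x))
     - 2 * real DIM('a) * ebump 2 (\<delta>\<^sup>2 - x \<bullet> x)) / bump_mass TYPE('a) \<delta>" for x :: 'a
  proof -
    have "(\<Sum>b\<in>Basis. bump2 \<delta> b x) = (\<Sum>b\<in>Basis. (x \<bullet> b) * (x \<bullet> b) * (4 * (ebump 4 (\<delta>\<^sup>2 - x \<bullet> x) - 2 * ebump 3 (\<delta>\<^sup>2 - x \<bullet> x)) / bump_mass TYPE('a) \<delta>)
       - 2 * ebump 2 (\<delta>\<^sup>2 - x \<bullet> x) / bump_mass TYPE('a) \<delta>)"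
    proof (rule sum.cong[OF refl])
      fix b :: 'a assume b: "b \<in> Basis"
      have alg: "(4 * q\<^sup>2 * E - 2 * 1 * E2) / M = q * q * (4 * E / M) - 2 * E2 / M" for q E E2 M :: real
        by (simp add: power2_eq_square diff_divide_distrib)
      show "bump2 \<delta> b x = (x \<bullet> b) * (x \<bullet> b) * (4 * (ebump 4 (\<delta>\<^sup>2 - x \<bullet> x) - 2 * ebump 3 (\<delta>\<^sup>2 - x \<bullet> x)) / bump_mass TYPE('a) \<delta>)
       - 2 * ebump 2 (\<delta>\<^sup>2 - x \<bullet> x) / bump_mass TYPE('a) \<delta>"
        unfolding bump2_def inner_same_Basis[OF b] alg ..
    qed
    also have "\<dots> = (x \<bullet> x) * (4 * (ebump 4 (\<delta>\<^sup>2 - x \<bullet> x) - 2 * ebump 3 (\<delta>\<^sup>2 - x \<bullet> x)) / bump_mass TYPE('a) \<delta>)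
       - real DIM('a) * (2 * ebump 2 (\<delta>\<^sup>2 - x \<bullet> x) / bump_mass TYPE('a) \<delta>)"
      unfolding sum_subtractf sum_distrib_right[symmetric] euclidean_inner[of x x, symmetric] by simp
    moreover have "X * (4 * E / M) - D * (2 * E2 / M) = (4 * X * E - 2 * D * E2) / M" for X E M D E2 :: real
      by (cases "M = 0") (simp_all add: field_simps)
    ultimately show ?thesis by (simp only:)
  qed
  show ?thesis unfolding s by (simp add: mirror_dot)
qed

lemma conv_cmult_kernel: "conv u (\<lambda>z. c * k z) x = c * conv u k x"
proof -
  have "u y * (c * k (x - y)) = c * (u y * k (x - y))" for y by simp
  thus ?thesis by (simp only: conv_def integral_mult_right_zero)
qed

lemma conv_mirror:
  fixes u :: "real^'n::{finite,wellorder} \<Rightarrow> real"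
  assumes "u \<in> borel_measurable borel" "ckernel k"
  shows "conv (\<lambda>x. u (mirror n x)) k x = conv u (\<lambda>z. k (mirror n z)) (mirror n x)"
proof -
  have [measurable]: "u \<in> borel_measurable borel" "k \<in> borel_measurable borel" using assms kernel_meas by auto
  have "conv (\<lambda>x. u (mirror n x)) k x = (LINT y|lborel. (\<lambda>z. u z * k (x - mirror n z)) (mirror n y))"
    by (simp add: conv_def mirror_mirror)
  also have "\<dots> = (LINT z|lborel. u z * k (x - mirror n z))"
    by (rule lpres_integral[OF lpres_mirror]) (use lpres_meas[OF lpres_mirror, of n] in measurable)
  also have "\<dots> = conv u (\<lambda>z. k (mirror n z)) (mirror n x)"
    by (simp add: conv_def mirror_diff mirror_mirror)
  finally show ?thesis .
qed

lemma l2cont_mirror: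
  fixes n :: "real^'n::{finite,wellorder}"
  shows "l2cont u \<Longrightarrow> l2cont (\<lambda>t x. u t (mirror n x))"
proof (rule l2contI)
  assume u: "l2cont u"
  show "l2 (\<lambda>x. u t (mirror n x))" if "0 \<le> t" for t using u that by (auto simp: l2cont_def intro: lpres_l2[OF lpres_mirror])
  show "l2lim (\<lambda>t x. u t (mirror n x)) (\<lambda>x. u t (mirror n x)) (at t within {0..})" if t: "0 \<le> t" for t
  proof (rule l2lim_bound)
    show "\<forall>\<^sub>F s in at t within {0..}. l2 (\<lambda>x. u s (mirror n x))"
      using eventually_nonneg_within by eventually_elim (use u in \<open>auto simp: l2cont_def intro: lpres_l2[OF lpres_mirror]\<close>)
    show "l2 (\<lambda>x. u t (mirror n x))" using u t by (auto simp: l2cont_def intro: lpres_l2[OF lpres_mirror])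
    show "((\<lambda>s. n2 (\<lambda>x. u s x - u t x)) \<longlongrightarrow> 0) (at t within {0..})" using u t by (auto simp: l2cont_def l2lim_def)
    show "\<forall>\<^sub>F s in at t within {0..}. n2 (\<lambda>x. u s (mirror n x) - u t (mirror n x)) \<le> n2 (\<lambda>x. u s x - u t x)"
      using eventually_nonneg_within
    proof eventually_elim
      case (elim s)
      have "l2 (\<lambda>x. u s x - u t x)" using u t elim by (intro l2_diff) (auto simp: l2cont_def)
      from lpres_l2(2)[OF lpres_mirror this] show ?case by simp
    qed
  qed
qed

text \<open>The derivative of a reflected function in direction b is the reflected derivative in
  direction \<open>mirror n b\<close>, expanded over the basis; this gives the new gradient. The
  bump and its Laplacian are invariant, so the mollified equation is simply evaluated at the
  reflected point.\<close>

lemma wave_mirror: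
  fixes \<phi> \<psi> k :: "real \<Rightarrow> real^'n::{finite,wellorder} \<Rightarrow> real"
  assumes "wave \<phi> \<psi> k G"
  shows "wave (\<lambda>t x. \<phi> t (mirror n x)) (\<lambda>t x. \<psi> t (mirror n x)) (\<lambda>t x. k t (mirror n x))
     (\<lambda>b t x. \<Sum>c\<in>Basis. (mirror n b \<bullet> c) * G c t (mirror n x))"
proof -
  interpret wave \<phi> \<psi> k G by (rule assms)
  have me: "\<phi> t \<in> borel_measurable borel" "\<psi> t \<in> borel_measurable borel" "k t \<in> borel_measurable borel"
    "\<And>b. b \<in> Basis \<Longrightarrow> G b t \<in> borel_measurable borel" if "0 \<le> t" for t
    using cont that by (auto simp: l2cont_def l2_def)
  have cr: "conv (\<lambda>x. u (mirror n x)) (bump \<delta>) x = conv u (bump \<delta>) (mirror n x)"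
    if "0 < \<delta>" "u \<in> borel_measurable borel" for u \<delta> and x :: "real^'n::{finite,wellorder}"
    using conv_mirror[OF that(2) ckernel_bump(1)[OF that(1)]] by (simp add: bump_mirror)
  show ?thesis
  proof
    show "l2cont (\<lambda>t x. \<phi> t (mirror n x))" "l2cont (\<lambda>t x. \<psi> t (mirror n x))" "l2cont (\<lambda>t x. k t (mirror n x))"
      "l2cont (\<lambda>t x. \<Sum>c\<in>Basis. (mirror n b \<bullet> c) * G c t (mirror n x))" for b
      by (intro l2cont_mirror l2cont_sum l2cont_cmult cont finite_Basis; assumption)+
  next
    fix \<delta> t :: real and x :: "real^'n::{finite,wellorder}" assume d: "0 < \<delta>" and t: "0 \<le> t"
    show "((\<lambda>s. conv (\<lambda>x. \<phi> s (mirror n x)) (bump \<delta>) x) has_real_derivative conv (\<lambda>x. \<psi> t (mirror n x)) (bump \<delta>) x) (at t within {0..})"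
      using deriv_phi[OF d t, of "mirror n x"] unfolding cr[OF d me(2)[OF t]]
      by (rule has_field_derivative_transform_within[where d=1]) (use t in \<open>auto simp: cr[OF d me(1)]\<close>)
    have "(\<Sum>b\<in>Basis. conv (\<lambda>x. \<phi> t (mirror n x)) (bump2 \<delta> b) x) = conv (\<lambda>x. \<phi> t (mirror n x)) (\<lambda>x. \<Sum>b\<in>Basis. bump2 \<delta> b x) x"
      using cont t by (intro conv_sum_kernel[symmetric] ckernel_bump d lpres_l2[OF lpres_mirror]) (auto simp: l2cont_def)
    also have "\<dots> = conv (\<phi> t) (\<lambda>x. \<Sum>b\<in>Basis. bump2 \<delta> b x) (mirror n x)"
    proof (subst conv_mirror[OF me(1)[OF t]])
      have "ckernel (\<lambda>x. \<Sum>b\<in>I. bump2 \<delta> b (x::real^'n::{finite,wellorder}))" if "finite I" for I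
        using that
      proof induction
        case empty show ?case by (simp add: ckernel_def)
      qed (simp add: ckernel_add ckernel_bump d)
      thus "ckernel (\<lambda>x. \<Sum>b\<in>Basis. bump2 \<delta> b (x::real^'n::{finite,wellorder}))" by simp
    qed (simp add: sum_bump2_mirror)
    also have "\<dots> = (\<Sum>b\<in>Basis. conv (\<phi> t) (bump2 \<delta> b) (mirror n x))"
      using cont t by (intro conv_sum_kernel ckernel_bump d) (auto simp: l2cont_def)
    finally have lap: "(\<Sum>b\<in>Basis. conv (\<lambda>x. \<phi> t (mirror n x)) (bump2 \<delta> b) x) = (\<Sum>b\<in>Basis. conv (\<phi> t) (bump2 \<delta> b) (mirror n x))" .
    show "((\<lambda>s. conv (\<lambda>x. \<psi> s (mirror n x)) (bump \<delta>) x) has_real_derivative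
         (\<Sum>b\<in>Basis. conv (\<lambda>x. \<phi> t (mirror n x)) (bump2 \<delta> b) x) - conv (\<lambda>x. k t (mirror n x)) (bump \<delta>) x) (at t within {0..})"
      using deriv_psi[OF d t, of "mirror n x"] unfolding lap cr[OF d me(3)[OF t]]
      by (rule has_field_derivative_transform_within[where d=1]) (use t in \<open>auto simp: cr[OF d me(2)]\<close>)
    fix b :: "real^'n::{finite,wellorder}" assume b: "b \<in> Basis"
    have ck: "ckernel (\<lambda>z. (mirror n b \<bullet> c) * bump1 \<delta> c z)" for c
      using ckernel_bump(2)[OF d, of c] by (auto simp: ckernel_def intro!: continuous_intros)
    have lk: "l2 (\<lambda>x. (mirror n b \<bullet> c) * G c t (mirror n x))" if "c \<in> Basis" for c
      using cont(4)[OF that] t by (intro l2_cmult lpres_l2[OF lpres_mirror]) (auto simp: l2cont_def)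
    have "conv (\<lambda>x. \<phi> t (mirror n x)) (bump1 \<delta> b) x = conv (\<phi> t) (\<lambda>z. \<Sum>c\<in>Basis. (mirror n b \<bullet> c) * bump1 \<delta> c z) (mirror n x)"
      unfolding conv_mirror[OF me(1)[OF t] ckernel_bump(2)[OF d]] by (simp add: bump1_mirror)
    also have "\<dots> = (\<Sum>c\<in>Basis. conv (\<phi> t) (\<lambda>z. (mirror n b \<bullet> c) * bump1 \<delta> c z) (mirror n x))"
      using cont t by (intro conv_sum_kernel ck) (auto simp: l2cont_def)
    also have "\<dots> = (\<Sum>c\<in>Basis. conv (\<lambda>x. (mirror n b \<bullet> c) * G c t (mirror n x)) (bump \<delta>) x)"
    proof (rule sum.cong[OF refl])
      fix c :: "real^'n::{finite,wellorder}" assume c: "c \<in> Basis"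
      have "conv (\<phi> t) (\<lambda>z. (mirror n b \<bullet> c) * bump1 \<delta> c z) (mirror n x) = (mirror n b \<bullet> c) * conv (\<phi> t) (bump1 \<delta> c) (mirror n x)"
        by (rule conv_cmult_kernel)
      also have "\<dots> = (mirror n b \<bullet> c) * conv (\<lambda>x. G c t (mirror n x)) (bump \<delta>) x"
        by (simp add: gradient[OF d t c] cr[OF d me(4)[OF t c]])
      finally show "conv (\<phi> t) (\<lambda>z. (mirror n b \<bullet> c) * bump1 \<delta> c z) (mirror n x) = conv (\<lambda>x. (mirror n b \<bullet> c) * G c t (mirror n x)) (bump \<delta>) x"
        by (simp add: conv_cmult)
    qed
    also have "\<dots> = conv (\<lambda>x. \<Sum>c\<in>Basis. (mirror n b \<bullet> c) * G c t (mirror n x)) (bump \<delta>) x"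
      by (intro conv_sum[symmetric] lk ckernel_bump d) auto
    finally show "conv (\<lambda>x. \<phi> t (mirror n x)) (bump1 \<delta> b) x = conv (\<lambda>x. \<Sum>c\<in>Basis. (mirror n b \<bullet> c) * G c t (mirror n x)) (bump \<delta>) x" .
  qed
qed

text \<open>The locale treats the source as a function of its own, which makes it linear in all four
  arguments although the equation is not.\<close>

lemma wave_diff:
  assumes "wave \<phi> \<psi> k G" "wave \<phi>' \<psi>' k' G'"
  shows "wave (\<lambda>t x. \<phi> t x - \<phi>' t x) (\<lambda>t x. \<psi> t x - \<psi>' t x) (\<lambda>t x. k t x - k' t x) (\<lambda>b t x. G b t x - G' b t x)"
proof -
  interpret a: wave \<phi> \<psi> k G by (rule assms)
  interpret b: wave \<phi>' \<psi>' k' G' by (rule assms)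
  note l = a.cont[THEN l2cont_l2] b.cont[THEN l2cont_l2]
  note cb = ckernel_bump
  show ?thesis
  proof
    show "l2cont (\<lambda>t x. \<phi> t x - \<phi>' t x)" "l2cont (\<lambda>t x. \<psi> t x - \<psi>' t x)" "l2cont (\<lambda>t x. k t x - k' t x)"
      "\<And>b. b \<in> Basis \<Longrightarrow> l2cont (\<lambda>t x. G b t x - G' b t x)"
      by (intro l2cont_diff a.cont b.cont; assumption)+
  next
    fix \<delta> t :: real and x :: 'a assume d: "0 < \<delta>" and t: "0 \<le> t"
    note [simp] = conv_diff[OF _ _ cb(1)[OF d]] conv_diff[OF _ _ cb(2)[OF d]] conv_diff[OF _ _ cb(3)[OF d]]
    show "((\<lambda>s. conv (\<lambda>x. \<phi> s x - \<phi>' s x) (bump \<delta>) x) has_real_derivative conv (\<lambda>x. \<psi> t x - \<psi>' t x) (bump \<delta>) x) (at t within {0..})"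
      using DERIV_diff[OF a.deriv_phi[OF d t, of x] b.deriv_phi[OF d t, of x]]
      by (rule has_field_derivative_transform_within[where d=1, THEN DERIV_cong]) (use t l in auto)
    show "((\<lambda>s. conv (\<lambda>x. \<psi> s x - \<psi>' s x) (bump \<delta>) x) has_real_derivative
       (\<Sum>b\<in>Basis. conv (\<lambda>x. \<phi> t x - \<phi>' t x) (bump2 \<delta> b) x) - conv (\<lambda>x. k t x - k' t x) (bump \<delta>) x) (at t within {0..})"
      using DERIV_diff[OF a.deriv_psi[OF d t, of x] b.deriv_psi[OF d t, of x]]
      by (rule has_field_derivative_transform_within[where d=1, THEN DERIV_cong]) (use t l in \<open>auto simp: sum_subtractf\<close>)
    fix b :: 'a assume b: "b \<in> Basis"
    show "conv (\<lambda>x. \<phi> t x - \<phi>' t x) (bump1 \<delta> b) x = conv (\<lambda>x. G b t x - G' b t x) (bump \<delta>) x"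
      using l t b by (simp add: a.gradient[OF d t b] b.gradient[OF d t b])
  qed
qed

text \<open>Far out, every integral of \<open>e\<close> over a later interval is at most h. Hence
  e(t) \<le> e(s) + K h for s in [t-1,t], and integrating over s gives e(t) \<le> (1 + K) h, which
  is less than \<eta> = (2 + K) h.\<close>

lemma decay_at_top:
  fixes e :: "real \<Rightarrow> real"
  assumes c: "continuous_on {0..} e" and nn: "\<And>t. 0 \<le> t \<Longrightarrow> 0 \<le> e t"
    and bd: "\<And>t. 0 \<le> t \<Longrightarrow> integral {0..t} e \<le> C" and K: "0 \<le> K"
    and le: "\<And>s t. 0 \<le> s \<Longrightarrow> s \<le> t \<Longrightarrow> e t - e s \<le> K * integral {s..t} e"
  shows "(e \<longlongrightarrow> 0) at_top"
proof (rule tendstoI)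
  fix \<eta> :: real assume \<eta>: "0 < \<eta>"
  define h where "h = \<eta> / (2 + K)"
  have h: "0 < h" using \<eta> K by (simp add: h_def)
  have i: "e integrable_on {s..t}" if "0 \<le> s" for s t
    using that by (intro integrable_continuous_real continuous_on_subset[OF c]) auto
  have split: "integral {0..s} e + integral {s..t} e = integral {0..t} e" if "0 \<le> s" "s \<le> t" for s t
    using that by (intro Henstock_Kurzweil_Integration.integral_combine i) auto
  have pos: "0 \<le> integral {s..t} e" if "0 \<le> s" for s t
    using that i nn by (intro integral_nonneg) auto
  define S where "S = (SUP t\<in>{0..}. integral {0..t} e)"
  have bdd: "bdd_above ((\<lambda>t. integral {0..t} e) ` {0..})" using bd by (auto intro!: bdd_aboveI2)
  have "\<exists>T\<in>{0..}. S - h < integral {0..T} e"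
    unfolding S_def using h by (intro less_cSUP_iff[THEN iffD1] bdd) auto
  then obtain T where T: "0 \<le> T" "S - h < integral {0..T} e" by auto
  have tail: "integral {s..t} e \<le> h" if "T \<le> s" "s \<le> t" for s t
  proof -
    have "integral {0..t} e \<le> S" unfolding S_def using that T by (intro cSUP_upper bdd) auto
    moreover have "integral {0..T} e \<le> integral {0..s} e" using split[of T s] pos[of T s] T that by simp
    ultimately show ?thesis using split[of s t] T that by simp
  qed
  show "\<forall>\<^sub>F t in at_top. dist (e t) 0 < \<eta>"
    using eventually_ge_at_top[of "T + 1"]
  proof eventually_elim
    case (elim t)
    have "integral {t-1..t} (\<lambda>s. e t) \<le> integral {t-1..t} (\<lambda>s. e s + K * h)"
    proof (rule integral_le)
      show "(\<lambda>s. e t) integrable_on {t-1..t}" by (rule integrable_continuous_real) simp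
      show "(\<lambda>s. e s + K * h) integrable_on {t-1..t}" using i[of "t-1" t] elim T by (intro integrable_add) auto
      fix s assume s: "s \<in> {t-1..t}"
      have "e t - e s \<le> K * integral {s..t} e" using s elim T by (intro le) auto
      also have "\<dots> \<le> K * h" using K s elim by (intro mult_left_mono tail) auto
      finally show "e t \<le> e s + K * h" by simp
    qed
    also have "\<dots> = integral {t-1..t} e + K * h"
    proof -
      have "0 \<le> t - 1" using elim T by simp
      from has_integral_add[OF integrable_integral[OF i[OF this]] has_integral_const_real[of "K * h" "t-1" t]] show ?thesis
        by (intro integral_unique) simp
    qed
    also have "\<dots> \<le> h + K * h" using tail[of "t-1" t] elim by simp
    also have "\<dots> < (2 + K) * h" using h by (simp add: algebra_simps)
    also have "\<dots> = \<eta>" using K by (simp add: h_def)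
    finally have "e t < \<eta>" by simp
    thus ?case using nn[of t] elim T by simp
  qed
qed

section \<open>Integrated decay of the local energy\<close>

lemma n2_sum_le:
  assumes "finite I" "\<And>i. i \<in> I \<Longrightarrow> l2 (u i)"
  shows "n2 (\<lambda>x. \<Sum>i\<in>I. u i x) \<le> real (card I) * (\<Sum>i\<in>I. n2 (u i))"
proof -
  have "n2 (\<lambda>x. \<Sum>i\<in>I. u i x) \<le> (LINT x|lborel. real (card I) * (\<Sum>i\<in>I. (u i x)\<^sup>2))"
    unfolding n2_def
  proof (rule integral_mono)
    show "integrable lborel (\<lambda>x. (\<Sum>i\<in>I. u i x)\<^sup>2)" using l2_sum[OF assms] by (simp add: l2_def)
    show "integrable lborel (\<lambda>x. real (card I) * (\<Sum>i\<in>I. (u i x)\<^sup>2))"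
      using assms by (intro integrable_mult_right Bochner_Integration.integrable_sum) (auto simp: l2_def)
    show "(\<Sum>i\<in>I. u i x)\<^sup>2 \<le> real (card I) * (\<Sum>i\<in>I. (u i x)\<^sup>2)" for x
      using sum_squared_le_sum_of_squares[of "\<lambda>i. u i x" I] by (simp add: mult.commute)
  qed
  also have "\<dots> = real (card I) * (\<Sum>i\<in>I. n2 (u i))"
    using assms by (simp add: n2_def l2_def Bochner_Integration.integral_sum)
  finally show ?thesis .
qed

lemma mor_vec_bound: assumes "b \<in> Basis" shows "\<bar>mor_vec b x\<bar> \<le> 1"
proof -
  have "\<bar>mor_vec b x\<bar> \<le> norm x * inv1p (norm x)"
    unfolding mor_vec_def abs_mult using Basis_le_norm[OF assms, of x] inv1p_pos[of "norm x"]
    by (intro mult_mono) auto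
  also have "\<dots> \<le> 1"
  proof -
    have "0 < 1 + norm x" using norm_ge_zero[of x] by linarith
    thus ?thesis by (simp add: inv1p_def divide_le_eq)
  qed
  finally show ?thesis .
qed

lemma mor_pot_bound: "\<bar>mor_pot x\<bar> \<le> 2"
proof -
  have "0 < inv1p (norm x)" "inv1p (norm x) \<le> 1" by (auto simp: inv1p_pos inv1p_le1)
  moreover from this have "(inv1p (norm x))\<^sup>2 \<le> 1" by (simp add: power_le_one)
  ultimately show ?thesis unfolding mor_pot_def by (simp add: abs_le_iff)
qed

lemma mor_meas[measurable]: "mor_vec b \<in> borel_measurable borel" "mor_pot \<in> borel_measurable borel"
  unfolding mor_vec_def[abs_def] mor_pot_def[abs_def] by measurable

lemma l2lim_mor:
  assumes "l2lim u u0 F" "\<And>b. b \<in> Basis \<Longrightarrow> l2lim (D b) (D0 b) F"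
  shows "l2lim (\<lambda>i. mor_op (u i) (\<lambda>b. D b i)) (mor_op u0 D0) F"
  unfolding mor_op_def[abs_def]
  by (intro l2lim_add l2lim_sum l2lim_weight[where B=1] l2lim_weight[where B=2] assms mor_meas mor_vec_bound mor_pot_bound finite_Basis)

text \<open>The 8 is 2 times the square of the bound 2 on \<open>mor_pot\<close>. The field has
  components bounded by 1, and the dimension enters through the square of a sum over the
  basis.\<close>

lemma mor_l2: assumes "l2 u" "\<And>b. b \<in> Basis \<Longrightarrow> l2 (D b)"
  shows "l2 (mor_op u D)" "n2 (mor_op (u :: 'a::euclidean_space \<Rightarrow> real) D) \<le> 8 * n2 u + 2 * real DIM('a) * (\<Sum>b\<in>Basis. n2 (D b))"
proof -
  have l: "l2 (\<lambda>x. mor_vec b x * D b x)" "n2 (\<lambda>x. mor_vec b x * D b x) \<le> 1\<^sup>2 * n2 (D b)" if "b \<in> Basis" for b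
    by (rule l2_weight[OF assms(2)[OF that] mor_meas(1) mor_vec_bound[OF that]])+
  have p: "l2 (\<lambda>x. mor_pot x * u x)" "n2 (\<lambda>x. mor_pot x * u x) \<le> 2\<^sup>2 * n2 u"
    by (rule l2_weight[OF assms(1) mor_meas(2) mor_pot_bound])+
  have s: "l2 (\<lambda>x. \<Sum>b\<in>Basis. mor_vec b x * D b x)" by (intro l2_sum l) auto
  show "l2 (mor_op u D)" unfolding mor_op_def[abs_def] by (intro l2_add s p)
  have "n2 (mor_op u D) \<le> 2 * n2 (\<lambda>x. \<Sum>b\<in>Basis. mor_vec b x * D b x) + 2 * n2 (\<lambda>x. mor_pot x * u x)"
    unfolding mor_op_def[abs_def] by (intro l2_add s p)
  also have "n2 (\<lambda>x. \<Sum>b\<in>Basis. mor_vec b x * D b x) \<le> real DIM('a) * (\<Sum>b\<in>Basis. n2 (\<lambda>x. mor_vec b x * D b x))"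
    by (intro n2_sum_le l) auto
  also have "(\<Sum>b\<in>Basis. n2 (\<lambda>x. mor_vec b x * D b x)) \<le> (\<Sum>b\<in>Basis. n2 (D b))"
    using l(2) by (intro sum_mono) auto
  also have "n2 (\<lambda>x. mor_pot x * u x) \<le> 4 * n2 u" using p(2) by simp
  finally show "n2 (mor_op u D) \<le> 8 * n2 u + 2 * real DIM('a) * (\<Sum>b\<in>Basis. n2 (D b))" by simp
qed

lemma l2cont_mor:
  assumes "l2cont u" "\<And>b. b \<in> Basis \<Longrightarrow> l2cont (D b)"
  shows "l2cont (\<lambda>t. mor_op (u t) (\<lambda>b. D b t))"
  by (rule l2contI) (use assms in \<open>auto intro!: mor_l2 l2lim_mor simp: l2cont_def\<close>)

lemma l2deriv_mor:
  assumes "l2deriv u u'" "\<And>b. b \<in> Basis \<Longrightarrow> l2deriv (D b) (D' b)"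
  shows "l2deriv (\<lambda>t. mor_op (u t) (\<lambda>b. D b t)) (\<lambda>t. mor_op (u' t) (\<lambda>b. D' b t))"
  unfolding mor_op_def[abs_def]
  by (intro l2deriv_add l2deriv_sum l2deriv_weight[where B=1] l2deriv_weight[where B=2] assms mor_meas mor_vec_bound mor_pot_bound finite_Basis)

section \<open>The weight of the local energy\<close>

definition dec_weight_deriv :: "'a \<Rightarrow> 'a::euclidean_space \<Rightarrow> real" where
  "dec_weight_deriv b x = - 4 * (x \<bullet> b) / (1 + (norm x)\<^sup>2) ^ 3"

lemma dec_weight_pos: "0 < dec_weight x" "dec_weight x \<le> 1"
proof -
  have 1: "1 \<le> (1 + (norm x)\<^sup>2)\<^sup>2" by (rule one_le_power) simp
  hence 0: "0 < (1 + (norm x)\<^sup>2)\<^sup>2" by linarith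
  show "0 < dec_weight x" unfolding dec_weight_def by (rule divide_pos_pos[OF zero_less_one 0])
  show "dec_weight x \<le> 1" unfolding dec_weight_def by (subst divide_le_eq_1_pos[OF 0]) (rule 1)
qed

text \<open>From 2 |x| \<le> 1 + |x|^2. The derivative of the weight is bounded by the weight
  itself, so the energy flux is controlled by the local energy and the estimates close.\<close>

lemma dec_weight_deriv_bound: assumes "b \<in> Basis" shows "\<bar>dec_weight_deriv b x\<bar> \<le> 2 * dec_weight x"
proof -
  let ?D = "1 + (norm x)\<^sup>2"
  have p: "0 < ?D" by (simp add: add_pos_nonneg)
  have "\<bar>x \<bullet> b\<bar> \<le> norm x" by (rule Basis_le_norm[OF assms])
  also have "2 * norm x \<le> ?D" using zero_le_power2[of "norm x - 1"] by (simp add: power2_diff)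
  finally have "4 * \<bar>x \<bullet> b\<bar> \<le> 2 * ?D" by simp
  hence "4 * \<bar>x \<bullet> b\<bar> / ?D ^ 3 \<le> 2 * ?D / ?D ^ 3" using p by (intro divide_right_mono) auto
  also have "\<dots> = 2 / ?D\<^sup>2"
  proof -
    have "2 * D / D ^ 3 = 2 / D\<^sup>2" if "D \<noteq> 0" for D :: real using that by (simp add: eval_nat_numeral)
    from this[OF less_imp_neq[OF p, symmetric]] show ?thesis .
  qed
  finally have le: "4 * \<bar>x \<bullet> b\<bar> / ?D ^ 3 \<le> 2 / ?D\<^sup>2" .
  have "0 \<le> ?D ^ 3" using p by (intro zero_le_power) auto
  moreover have "\<bar>- 4 * a / d\<bar> = 4 * \<bar>a\<bar> / d" if "0 \<le> d" for a d :: real using that by (simp add: abs_mult)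
  ultimately have "\<bar>- 4 * (x \<bullet> b) / ?D ^ 3\<bar> \<le> 2 / ?D\<^sup>2" using le by metis
  moreover have "2 / ?D\<^sup>2 = 2 * (1 / ?D\<^sup>2)" by simp
  ultimately show ?thesis unfolding dec_weight_deriv_def dec_weight_def by metis
qed

lemma dec_weight_smooth: "smooth_weight (dec_weight :: 'a::euclidean_space \<Rightarrow> real) dec_weight_deriv 2"
proof
  have p: "1 + (norm x)\<^sup>2 \<noteq> 0" for x :: 'a using zero_le_power2[of "norm x"] by linarith
  show "continuous_on UNIV (dec_weight :: 'a \<Rightarrow> real)"
    unfolding dec_weight_def[abs_def] by (intro continuous_intros) (use p in auto)
  show "\<bar>dec_weight x\<bar> \<le> 2" for x :: 'a using dec_weight_pos[of x] by simp
  show "continuous_on UNIV (dec_weight_deriv b)" for b :: 'a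
    unfolding dec_weight_deriv_def[abs_def] by (intro continuous_intros) (use p in auto)
  show "\<bar>dec_weight_deriv b x\<bar> \<le> 2" if "b \<in> Basis" for b x :: 'a
    using dec_weight_deriv_bound[OF that, of x] dec_weight_pos[of x] by simp
  show "dir_deriv b dec_weight (dec_weight_deriv b)" for b :: 'a
    unfolding dir_deriv_def
  proof (intro allI)
    fix x :: 'a and s :: real
    have e: "(norm (x + s *\<^sub>R b))\<^sup>2 = x \<bullet> x + 2 * s * (x \<bullet> b) + s * s * (b \<bullet> b)" for s
      unfolding dot_square_norm[symmetric] by (simp add: inner_add_left inner_add_right inner_commute[of b x] algebra_simps)
    let ?q = "\<lambda>s. 1 + (x \<bullet> x + 2 * s * (x \<bullet> b) + s * s * (b \<bullet> b))"
    have q: "?q s \<noteq> 0" using p[of "x + s *\<^sub>R b"] by (simp only: e not_False_eq_True)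
    have dq: "(?q has_real_derivative 2 * (x \<bullet> b) + 2 * s * (b \<bullet> b)) (at s)" by (auto intro!: derivative_eq_intros)
    have d: "((\<lambda>s. inverse ((?q s)\<^sup>2)) has_real_derivative - (inverse ((?q s)\<^sup>2) * (real 2 * ((2 * (x \<bullet> b) + 2 * s * (b \<bullet> b)) * ?q s ^ (2 - Suc 0))) * inverse ((?q s)\<^sup>2))) (at s)"
      by (rule DERIV_inverse'[OF DERIV_power[OF dq]]) (simp only: power_not_zero[OF q] not_False_eq_True)
    have alg: "- (inverse (Q\<^sup>2) * (real 2 * ((2 * y + 2 * s * z) * Q ^ (2 - Suc 0))) * inverse (Q\<^sup>2)) = - 4 * (y + s * z) / Q ^ 3"
      if "Q \<noteq> 0" for Q y z :: real
      using that by (simp add: field_simps eval_nat_numeral)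
    have "((\<lambda>s. inverse ((?q s)\<^sup>2)) has_real_derivative - 4 * (x \<bullet> b + s * (b \<bullet> b)) / ?q s ^ 3) (at s)"
      by (rule DERIV_cong[OF d alg[OF q]])
    thus "((\<lambda>s. dec_weight (x + s *\<^sub>R b)) has_real_derivative dec_weight_deriv b (x + s *\<^sub>R b)) (at s)"
      unfolding dec_weight_def dec_weight_deriv_def e by (simp add: inner_add_left inverse_eq_divide)
  qed
qed

lemma dec_weight_meas: "(dec_weight :: 'a::euclidean_space \<Rightarrow> real) \<in> borel_measurable borel"
  using smooth_weight.w_bdd[OF dec_weight_smooth] by (auto simp: bdd_meas_def)

lemma dec_weight_deriv_meas: "b \<in> Basis \<Longrightarrow> dec_weight_deriv b \<in> borel_measurable borel"
  using smooth_weight.dw_bdd[OF dec_weight_smooth, of b] by (auto simp: bdd_meas_def)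

lemma ip_dec_mono:
  assumes "l2 a" "l2 b" "w \<in> borel_measurable borel" "\<And>x. \<bar>w x\<bar> \<le> c * dec_weight x" "0 \<le> c"
  shows "2 * \<bar>ip w a b\<bar> \<le> c * (ip dec_weight a a + ip dec_weight b b)"
proof -
  have bm: "bdd_meas dec_weight" using smooth_weight.w_bdd[OF dec_weight_smooth] .
  have "\<bar>w x\<bar> \<le> c" for x
    using assms(4)[of x] mult_left_mono[OF dec_weight_pos(2)[of x] assms(5)] by linarith
  hence "bdd_meas w" unfolding bdd_meas_def using assms(3) by blast
  hence i: "integrable lborel (\<lambda>x. w x * a x * b x)" by (intro ip_integrable assms)
  have j: "integrable lborel (\<lambda>x. dec_weight x * a x * a x)" "integrable lborel (\<lambda>x. dec_weight x * b x * b x)"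
    by (intro ip_integrable bm assms)+
  have "2 * \<bar>ip w a b\<bar> \<le> 2 * (LINT x|lborel. \<bar>w x * a x * b x\<bar>)" unfolding ip_def by (intro mult_left_mono integral_abs_bound) simp
  also have "\<dots> = (LINT x|lborel. 2 * \<bar>w x * a x * b x\<bar>)" by simp
  also have "\<dots> \<le> (LINT x|lborel. c * (dec_weight x * a x * a x + dec_weight x * b x * b x))"
  proof (rule integral_mono)
    fix x
    have "2 * (\<bar>a x\<bar> * \<bar>b x\<bar>) \<le> a x * a x + b x * b x" using sum_squares_bound[of "\<bar>a x\<bar>" "\<bar>b x\<bar>"] by (simp add: power2_eq_square)
    hence "\<bar>w x\<bar> * (2 * (\<bar>a x\<bar> * \<bar>b x\<bar>)) \<le> (c * dec_weight x) * (a x * a x + b x * b x)"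
      using assms dec_weight_pos[of x] by (intro mult_mono) auto
    thus "2 * \<bar>w x * a x * b x\<bar> \<le> c * (dec_weight x * a x * a x + dec_weight x * b x * b x)"
      by (simp add: abs_mult algebra_simps)
  qed (use i j in auto)
  also have "\<dots> = c * (ip dec_weight a a + ip dec_weight b b)" using j by (simp add: ip_def)
  finally show ?thesis .
qed

lemma ip_dec_nonneg: "0 \<le> ip dec_weight a a"
  unfolding ip_def using dec_weight_pos by (intro Bochner_Integration.integral_nonneg) (simp add: mult.assoc mult_nonneg_nonneg[OF less_imp_le[OF dec_weight_pos(1)] zero_le_square])

section \<open>Small radial solutions: symmetry, integrated Morawetz estimate and decay of the local
  energy\<close>

locale radial_wave = wave \<phi> \<psi> "\<lambda>t x. f (\<phi> t x)" G + nonlinearity f m C L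
  for \<phi> \<psi> :: "real \<Rightarrow> real^3 \<Rightarrow> real" and G and f m C L +
  fixes \<epsilon> :: real
  assumes \<epsilon>: "0 \<le> \<epsilon>" "\<epsilon> \<le> 1"
    and bdd: "\<And>t. 0 \<le> t \<Longrightarrow> AE x in lborel. \<bar>\<phi> t x\<bar> \<le> \<epsilon>"
    and n2_phi: "\<And>t. 0 \<le> t \<Longrightarrow> n2 (\<phi> t) \<le> \<epsilon>\<^sup>2"
    and n2_G: "\<And>t. 0 \<le> t \<Longrightarrow> (\<Sum>b\<in>Basis. n2 (G b t)) \<le> \<epsilon>\<^sup>2"
    and radial0: "radially_symmetric (\<phi> 0)" "radially_symmetric (\<psi> 0)"
    and small: "C * \<epsilon>\<^sup>2 * (18 + 12 * sph) \<le> sph / 10"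
begin

lemma sq_le1: "\<epsilon>\<^sup>2 \<le> 1" using \<epsilon> by (simp add: power_le_one)

lemma bdd1: "0 \<le> t \<Longrightarrow> AE x in lborel. \<bar>\<phi> t x\<bar> \<le> 1"
  using bdd[of t] by (auto elim!: eventually_mono intro: order_trans[OF _ \<epsilon>(2)])

lemma phi_l2: "0 \<le> t \<Longrightarrow> l2 (\<phi> t)" and psi_l2: "0 \<le> t \<Longrightarrow> l2 (\<psi> t)" and G_l2: "0 \<le> t \<Longrightarrow> b \<in> Basis \<Longrightarrow> l2 (G b t)"
  using cont by (auto simp: l2cont_def)

lemma k_le: "0 \<le> t \<Longrightarrow> n2 (\<lambda>x. f (\<phi> t x)) \<le> L\<^sup>2 * n2 (\<phi> t)"
  by (intro comp_l2 phi_l2 bdd1)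

lemma radial_symmetric_mirror:
  assumes "radially_symmetric u" "l2 u"
  shows "n2 (\<lambda>x. u x - u (mirror n x :: real^3)) = 0"
proof -
  obtain g where g: "AE x in lborel. u x = g (norm x)" using assms by (auto simp: radially_symmetric_def)
  have "AE x in lborel. u (mirror n x) = g (norm (mirror n x))" by (rule lpres_AE[OF lpres_mirror g])
  with g have "AE x in lborel. u x - u (mirror n x) = 0" by eventually_elim (simp add: mirror_norm)
  moreover have "l2 (\<lambda>x. u x - u (mirror n x))" by (intro l2_diff assms lpres_l2[OF lpres_mirror])
  ultimately show ?thesis by (simp add: n2_eq_0_iff)
qed

lemma symmetric:
  assumes "0 \<le> t"
  shows "n2 (\<lambda>x. \<phi> t x - \<phi> t (mirror n x)) = 0" "n2 (\<lambda>x. \<psi> t x - \<psi> t (mirror n x)) = 0"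
proof -
  interpret d: wave "\<lambda>t x. \<phi> t x - \<phi> t (mirror n x)" "\<lambda>t x. \<psi> t x - \<psi> t (mirror n x)"
    "\<lambda>t x. f (\<phi> t x) - f (\<phi> t (mirror n x))" "\<lambda>b t x. G b t x - (\<Sum>c\<in>Basis. (mirror n b \<bullet> c) * G c t (mirror n x))"
    by (rule wave_diff[OF wave_axioms wave_mirror[OF wave_axioms]])
  have le: "n2 (\<lambda>x. f (\<phi> t x) - f (\<phi> t (mirror n x))) \<le> L\<^sup>2 * n2 (\<lambda>x. \<phi> t x - \<phi> t (mirror n x))" if "0 \<le> t" for t
    using that by (intro comp_diff phi_l2 bdd1 lpres_l2(1)[OF lpres_mirror] lpres_AE[OF lpres_mirror bdd1])
  have z: "n2 (\<lambda>x. \<phi> 0 x - \<phi> 0 (mirror n x)) = 0" "n2 (\<lambda>x. \<psi> 0 x - \<psi> 0 (mirror n x)) = 0"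
    by (intro radial_symmetric_mirror radial0 phi_l2 psi_l2 order_refl)+
  show "n2 (\<lambda>x. \<phi> t x - \<phi> t (mirror n x)) = 0" "n2 (\<lambda>x. \<psi> t x - \<psi> t (mirror n x)) = 0"
    by (rule d.zero_solution[OF _ le z assms]; simp)+
qed

text \<open>Invariance almost everywhere under every reflection becomes an identity at every point
  after mollification. The reflection used depends on x: it sends x to the point of equal norm on
  the axis.\<close>

lemma moll_radial:
  assumes u: "l2 u" "\<And>n. n2 (\<lambda>x. u x - u (mirror n x :: real^3)) = 0" and d: "0 < \<delta>"
  shows "conv u (bump \<delta>) x = conv u (bump \<delta>) (norm x *\<^sub>R axis 1 1)"
proof -
  let ?y = "norm x *\<^sub>R axis 1 1 :: real^3"
  define n where "n = x - ?y"
  have n: "mirror n x = ?y" unfolding n_def by (rule mirror_swap) (simp add: norm_axis_1)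
  have l: "l2 (\<lambda>x. u (mirror n x))" by (rule lpres_l2[OF lpres_mirror u(1)])
  have "AE x in lborel. u x - u (mirror n x) = 0" using u(2)[of n] n2_eq_0_iff[OF l2_diff(1)[OF u(1) l]] by simp
  hence "conv u (bump \<delta>) x = conv (\<lambda>x. u (mirror n x)) (bump \<delta>) x"
    using u l d by (intro conv_cong_AE ckernel_bump) (auto simp: l2_def)
  also have "\<dots> = conv u (bump \<delta>) (mirror n x)"
    using conv_mirror[of u "bump \<delta>" n x] u(1) ckernel_bump(1)[OF d] by (simp add: bump_mirror l2_def)
  finally show ?thesis by (simp add: n)
qed

lemma axis_Basis: "axis 1 1 \<in> (Basis :: (real^3) set)" by (simp add: axis_in_Basis_iff)

lemma radial_phi:
  assumes "0 < \<delta>" "0 \<le> t"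
  shows "radial_fun2 (conv (\<phi> t) (bump \<delta>)) (\<lambda>b. conv (\<phi> t) (bump1 \<delta> b)) (axis 1 1) (\<lambda>b. conv (\<phi> t) (bump2 \<delta> b))"
proof
  show "conv (\<phi> t) (bump \<delta>) x = conv (\<phi> t) (bump \<delta>) (norm x *\<^sub>R axis 1 1)" for x
    by (rule moll_radial[OF phi_l2[OF assms(2)] symmetric(1)[OF assms(2)] assms(1)])
qed (use assms axis_Basis in \<open>auto intro!: moll_dir_deriv moll_space_cont conv_l2 phi_l2 ckernel_bump\<close>)

lemma radial_psi:
  assumes "0 < \<delta>" "0 \<le> t"
  shows "radial_fun (conv (\<psi> t) (bump \<delta>)) (\<lambda>b. conv (\<psi> t) (bump1 \<delta> b)) (axis 1 1)"
proof
  show "conv (\<psi> t) (bump \<delta>) x = conv (\<psi> t) (bump \<delta>) (norm x *\<^sub>R axis 1 1)" for x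
    by (rule moll_radial[OF psi_l2[OF assms(2)] symmetric(2)[OF assms(2)] assms(1)])
qed (use assms axis_Basis in \<open>auto intro!: moll_dir_deriv moll_space_cont conv_l2 psi_l2 ckernel_bump\<close>)

definition N :: "real \<Rightarrow> real" where "N s = f s - m * s"

sublocale rem: nonlinearity N 0 C "L + \<bar>m\<bar>"
  unfolding N_def[abs_def] by (rule remainder)

definition mor_phi :: "nat \<Rightarrow> real \<Rightarrow> real^3 \<Rightarrow> real" where
  "mor_phi n t = mor_op (conv (\<phi> t) (bump (eps n))) (\<lambda>b. conv (\<phi> t) (bump1 (eps n) b))"
definition mor_psi :: "nat \<Rightarrow> real \<Rightarrow> real^3 \<Rightarrow> real" where
  "mor_psi n t = mor_op (conv (\<psi> t) (bump (eps n))) (\<lambda>b. conv (\<psi> t) (bump1 (eps n) b))"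
text \<open>The commutator of \<open>N\<close> with mollification, the one term of the mollified
  equation that the estimate for radial functions does not cover.\<close>

definition moll_error :: "nat \<Rightarrow> real \<Rightarrow> real^3 \<Rightarrow> real" where
  "moll_error n t x = conv (\<lambda>x. N (\<phi> t x)) (bump (eps n)) x - N (conv (\<phi> t) (bump (eps n)) x)"

lemma moll_bdd: "0 \<le> t \<Longrightarrow> \<bar>conv (\<phi> t) (bump (eps n)) x\<bar> \<le> \<epsilon>"
  by (intro conv_bump_bounded phi_l2 bdd) auto

lemma moll_bdd1: "0 \<le> t \<Longrightarrow> AE x in lborel. \<bar>conv (\<phi> t) (bump (eps n)) x\<bar> \<le> 1"
  by (rule AE_I2) (rule order_trans[OF moll_bdd \<epsilon>(2)])

lemma mor_phi_cont: "l2cont (mor_phi n)" unfolding mor_phi_def[abs_def] by (intro l2cont_mor moll_cont) auto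

lemma moll_error_cont: "l2cont (moll_error n)"
  unfolding moll_error_def[abs_def]
  by (intro l2cont_diff moll_l2cont rem.comp_l2cont cont moll_cont moll_bdd1 bdd1) auto

lemma mor_phi_n2: assumes "0 \<le> t" shows "n2 (mor_phi n t) \<le> 14"
proof -
  have "n2 (mor_phi n t) \<le> 8 * n2 (conv (\<phi> t) (bump (eps n))) + 2 * real DIM(real^3) * (\<Sum>b\<in>Basis. n2 (conv (\<phi> t) (bump1 (eps n) b)))"
    unfolding mor_phi_def using assms by (intro mor_l2 conv_l2 phi_l2 ckernel_bump) auto
  also have "\<dots> \<le> 8 * 1 + 2 * real DIM(real^3) * 1"
  proof (intro add_mono mult_left_mono)
    show "n2 (conv (\<phi> t) (bump (eps n))) \<le> 1"
      using conv_bump_n2_le[OF phi_l2[OF assms], of "eps n"] n2_phi[OF assms] sq_le1 by simp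
    have "(\<Sum>b\<in>Basis. n2 (conv (\<phi> t) (bump1 (eps n) b))) \<le> (\<Sum>b\<in>Basis. n2 (G b t))"
      using assms by (intro sum_mono) (simp add: gradient_fun conv_bump_n2_le G_l2)
    thus "(\<Sum>b\<in>Basis. n2 (conv (\<phi> t) (bump1 (eps n) b))) \<le> 1" using n2_G[OF assms] sq_le1 by simp
  qed auto
  finally show ?thesis by simp
qed

lemma moll_error_n2: assumes "0 \<le> t" shows "n2 (moll_error n t) \<le> 4 * (L + \<bar>m\<bar>)\<^sup>2"
proof -
  have l: "l2 (\<lambda>x. N (\<phi> t x))" "n2 (\<lambda>x. N (\<phi> t x)) \<le> (L + \<bar>m\<bar>)\<^sup>2 * n2 (\<phi> t)"
    by (rule rem.comp_l2[OF phi_l2[OF assms] bdd1[OF assms]])+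
  have c: "l2 (conv (\<phi> t) (bump (eps n)))" "n2 (conv (\<phi> t) (bump (eps n))) \<le> n2 (\<phi> t)"
    using phi_l2[OF assms] by (auto intro!: conv_l2 ckernel_bump conv_bump_n2_le)
  have l': "l2 (\<lambda>x. N (conv (\<phi> t) (bump (eps n)) x))" "n2 (\<lambda>x. N (conv (\<phi> t) (bump (eps n)) x)) \<le> (L + \<bar>m\<bar>)\<^sup>2 * n2 (conv (\<phi> t) (bump (eps n)))"
    by (rule rem.comp_l2[OF c(1) moll_bdd1[OF assms]])+
  have p1: "n2 (\<phi> t) \<le> 1" using n2_phi[OF assms] sq_le1 by simp
  have "n2 (moll_error n t) \<le> 2 * n2 (conv (\<lambda>x. N (\<phi> t x)) (bump (eps n))) + 2 * n2 (\<lambda>x. N (conv (\<phi> t) (bump (eps n)) x))"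
    unfolding moll_error_def[abs_def] by (intro l2_diff conv_l2 ckernel_bump l l') simp
  also have "\<dots> \<le> 2 * ((L + \<bar>m\<bar>)\<^sup>2 * 1) + 2 * ((L + \<bar>m\<bar>)\<^sup>2 * 1)"
  proof (intro add_mono mult_left_mono)
    have "n2 (conv (\<lambda>x. N (\<phi> t x)) (bump (eps n))) \<le> n2 (\<lambda>x. N (\<phi> t x))" by (rule conv_bump_n2_le[OF l(1)]) simp
    also have "\<dots> \<le> (L + \<bar>m\<bar>)\<^sup>2 * n2 (\<phi> t)" by (rule l(2))
    also have "\<dots> \<le> (L + \<bar>m\<bar>)\<^sup>2 * 1" using p1 by (intro mult_left_mono) auto
    finally show "n2 (conv (\<lambda>x. N (\<phi> t x)) (bump (eps n))) \<le> (L + \<bar>m\<bar>)\<^sup>2 * 1" .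
    have "n2 (\<lambda>x. N (conv (\<phi> t) (bump (eps n)) x)) \<le> (L + \<bar>m\<bar>)\<^sup>2 * n2 (conv (\<phi> t) (bump (eps n)))" by (rule l'(2))
    also have "\<dots> \<le> (L + \<bar>m\<bar>)\<^sup>2 * 1" using p1 c(2) by (intro mult_left_mono) auto
    finally show "n2 (\<lambda>x. N (conv (\<phi> t) (bump (eps n)) x)) \<le> (L + \<bar>m\<bar>)\<^sup>2 * 1" .
  qed auto
  finally show ?thesis by simp
qed

lemma er_lim: assumes "0 \<le> t" shows "(\<lambda>n. LINT x|lborel. moll_error n t x * mor_phi n t x) \<longlonglongrightarrow> 0"
proof -
  have l: "l2 (\<lambda>x. N (\<phi> t x))" by (rule rem.comp_l2[OF phi_l2[OF assms] bdd1[OF assms]])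
  have "l2lim (\<lambda>n x. conv (\<lambda>x. N (\<phi> t x)) (bump (eps n)) x - N (conv (\<phi> t) (bump (eps n)) x)) (\<lambda>x. N (\<phi> t x) - N (\<phi> t x)) sequentially"
    using assms by (intro l2lim_diff conv_bump_lim l rem.comp_l2lim phi_l2 bdd1 always_eventually allI moll_bdd1)
  hence e: "l2lim (\<lambda>n. moll_error n t) (\<lambda>x. 0) sequentially" by (simp add: moll_error_def[abs_def])
  have "l2lim (\<lambda>n. mor_op (conv (\<phi> t) (bump (eps n))) (\<lambda>b. conv (G b t) (bump (eps n)))) (mor_op (\<phi> t) (\<lambda>b. G b t)) sequentially"
    using assms by (intro l2lim_mor conv_bump_lim phi_l2 G_l2)
  moreover have "mor_op (conv (\<phi> t) (bump (eps n))) (\<lambda>b. conv (G b t) (bump (eps n))) = mor_phi n t" for n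
    unfolding mor_phi_def mor_op_def[abs_def] using assms by (simp add: gradient_fun)
  ultimately have "l2lim (\<lambda>n. mor_phi n t) (mor_op (\<phi> t) (\<lambda>b. G b t)) sequentially" by simp
  from l2lim_pair[OF e this] show ?thesis by simp
qed

text \<open>\<open>radial_morawetz\<close> is applied at each time to the mollified solution and
  integrated. The constant is independent of t because the left side is the difference of the
  pairing <\<open>\<psi>\<close>, M \<open>\<phi>\<close>> at the two ends, each at most P + 14; 40
  inverts the factor 1/40.\<close>

lemma local_density_bound:
  obtains K where "\<And>t. 0 \<le> t \<Longrightarrow> (\<Sum>b\<in>Basis. tip dec_weight (G b) (G b) 0 t) + tip dec_weight \<phi> \<phi> 0 t \<le> K"
proof -
  interpret sw: smooth_weight "dec_weight :: real^3 \<Rightarrow> real" dec_weight_deriv 2 by (rule dec_weight_smooth)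
  have kb: "n2 (\<lambda>x. f (\<phi> t x)) \<le> L\<^sup>2" if "0 \<le> t" for t
    using k_le[OF that] mult_left_mono[OF order_trans[OF n2_phi[OF that] sq_le1], of "L\<^sup>2"] by simp
  define P where "P = 63 + 10 * L\<^sup>2"
  have P: "n2 (\<psi> t) \<le> P" if "0 \<le> t" for t
    unfolding P_def using n2_phi n2_G sq_le1 kb by (intro velocity_bounded that) (auto intro: order_trans)
  have main: "(\<Sum>b\<in>Basis. tip dec_weight (G b) (G b) 0 t) + tip dec_weight \<phi> \<phi> 0 t \<le> 40 * (2 * (P + 14))" if t: "0 \<le> t" for t
  proof (rule LIMSEQ_le)
    let ?m = "\<lambda>n u \<tau>. conv (u \<tau>) (bump (eps n))"
    let ?q = "\<lambda>n \<tau>. (\<Sum>b\<in>Basis. ip dec_weight (?m n (G b) \<tau>) (?m n (G b) \<tau>)) + ip dec_weight (?m n \<phi> \<tau>) (?m n \<phi> \<tau>)"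
    let ?Y = "\<lambda>n \<tau>. LINT x|lborel. moll_error n \<tau> x * mor_phi n \<tau> x"
    show "(\<lambda>n. (\<Sum>b\<in>Basis. tip dec_weight (?m n (G b)) (?m n (G b)) 0 t) + tip dec_weight (?m n \<phi>) (?m n \<phi>) 0 t) \<longlonglongrightarrow>
      (\<Sum>b\<in>Basis. tip dec_weight (G b) (G b) 0 t) + tip dec_weight \<phi> \<phi> 0 t"
      by (intro tendsto_intros moll_tip_lim cont sw.w_bdd order_refl)
    have Yint: "?Y n integrable_on {0..t}" for n
      by (intro integrable_continuous_real continuous_on_subset[OF l2cont_pair[OF moll_error_cont mor_phi_cont]]) auto
    \<comment> \<open>For fixed t a constant dominates the commutator term uniformly in n, so
      pointwise convergence in time is enough.\<close>
    have "(\<lambda>n. integral {0..t} (?Y n)) \<longlonglongrightarrow> integral {0..t} (\<lambda>\<tau>. 0::real)"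
    proof (rule dominated_convergence)
      show "?Y n integrable_on {0..t}" for n by (rule Yint)
      show "(\<lambda>\<tau>. 4 * (L + \<bar>m\<bar>)\<^sup>2 + 14) integrable_on {0..t}" by (rule integrable_continuous_real) simp
      fix \<tau> assume "\<tau> \<in> {0..t}"
      hence \<tau>: "0 \<le> \<tau>" by simp
      show "norm (?Y n \<tau>) \<le> 4 * (L + \<bar>m\<bar>)\<^sup>2 + 14" for n
        using young_pair[OF l2cont_l2[OF moll_error_cont \<tau>] l2cont_l2[OF mor_phi_cont \<tau>], of 1 n n] moll_error_n2[OF \<tau>, of n] mor_phi_n2[OF \<tau>, of n] by simp
      show "(\<lambda>n. ?Y n \<tau>) \<longlonglongrightarrow> 0" by (rule er_lim[OF \<tau>])
    qed
    hence Ylim: "(\<lambda>n. integral {0..t} (?Y n)) \<longlonglongrightarrow> 0" by simp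
    show "(\<lambda>n. 40 * (2 * (P + 14) - integral {0..t} (?Y n))) \<longlonglongrightarrow> 40 * (2 * (P + 14))"
      using Ylim by (auto intro!: tendsto_eq_intros)
    show "\<exists>N. \<forall>n\<ge>N. (\<Sum>b\<in>Basis. tip dec_weight (?m n (G b)) (?m n (G b)) 0 t) + tip dec_weight (?m n \<phi>) (?m n \<phi>) 0 t
        \<le> 40 * (2 * (P + 14) - integral {0..t} (?Y n))"
    proof (intro exI[of _ 0] allI impI)
      fix n
      have e: "(0::real) < eps n" by simp
      let ?p' = "\<lambda>\<tau> x. (\<Sum>b\<in>Basis. conv (\<phi> \<tau>) (bump2 (eps n) b) x) - conv (\<lambda>x. f (\<phi> \<tau> x)) (bump (eps n)) x"
      \<comment> \<open>The multiplier does not depend on time, so the derivative of M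
        \<open>\<phi>\<close> is M \<open>\<psi>\<close>, and <\<open>\<psi>\<close>, M
        \<open>\<psi>\<close>> vanishes by skewness.\<close>
      have J: "((\<lambda>\<tau>. (LINT x|lborel. ?p' \<tau> x * mor_phi n \<tau> x) + (LINT x|lborel. ?m n \<psi> \<tau> x * mor_psi n \<tau> x)) has_integral
         (LINT x|lborel. ?m n \<psi> t x * mor_phi n t x) - (LINT x|lborel. ?m n \<psi> 0 x * mor_phi n 0 x)) {0..t}"
        by (intro l2cont_ftc moll_cont moll_deriv mor_phi_cont e order_refl t)
           (simp add: mor_phi_def[abs_def] mor_psi_def[abs_def] l2deriv_mor moll_deriv)
      have qint: "?q n integrable_on {0..t}"
        by (intro integrable_add integrable_sum tip_integrable moll_l2cont cont sw.w_bdd) auto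
      have R: "((\<lambda>\<tau>. - (1/40) * ?q n \<tau> - ?Y n \<tau>) has_integral - (1/40) * integral {0..t} (?q n) - integral {0..t} (?Y n)) {0..t}"
        by (intro has_integral_diff has_integral_mult_right integrable_integral qint Yint)
      have le: "(LINT x|lborel. ?m n \<psi> t x * mor_phi n t x) - (LINT x|lborel. ?m n \<psi> 0 x * mor_phi n 0 x) \<le>
         - (1/40) * integral {0..t} (?q n) - integral {0..t} (?Y n)"
      proof (rule has_integral_le[OF J R])
        fix \<tau> assume "\<tau> \<in> {0..t}"
        hence \<tau>: "0 \<le> \<tau>" by simp
        interpret r: radial_fun2 "?m n \<phi> \<tau>" "\<lambda>b. conv (\<phi> \<tau>) (bump1 (eps n) b)" "axis 1 1" "\<lambda>b. conv (\<phi> \<tau>) (bump2 (eps n) b)"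
          by (rule radial_phi[OF e \<tau>])
        interpret s: radial_fun "?m n \<psi> \<tau>" "\<lambda>b. conv (\<psi> \<tau>) (bump1 (eps n) b)" "axis 1 1"
          by (rule radial_psi[OF e \<tau>])
        have z1: "(LINT x|lborel. ?m n \<psi> \<tau> x * mor_psi n \<tau> x) = 0" unfolding mor_psi_def by (rule s.mor_op_skew)
        have z2: "(LINT x|lborel. ?m n \<phi> \<tau> x * mor_phi n \<tau> x) = 0" unfolding mor_phi_def by (rule r.mor_op_skew)
        have lM: "l2 (mor_phi n \<tau>)" by (rule l2cont_l2[OF mor_phi_cont \<tau>])
        have lN: "l2 (\<lambda>x. N (\<phi> \<tau> x))" by (rule rem.comp_l2[OF phi_l2[OF \<tau>] bdd1[OF \<tau>]])
        have lN': "l2 (\<lambda>x. N (?m n \<phi> \<tau> x))" by (rule rem.comp_l2[OF r.\<Phi>_l2 moll_bdd1[OF \<tau>]])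
        have lD: "l2 (\<lambda>x. \<Sum>b\<in>Basis. conv (\<phi> \<tau>) (bump2 (eps n) b) x)" by (intro l2_sum r.D2_l2) auto
        \<comment> \<open>The mollified source splits into the commutator, the cubic part of the
          mollified solution, and the mass term, whose pairing with M \<open>\<phi>\<close> is zero
          by skewness.\<close>
        have "(\<lambda>x. f (\<phi> \<tau> x)) = (\<lambda>x. N (\<phi> \<tau> x) + m * \<phi> \<tau> x)" by (simp add: N_def)
        hence cf: "conv (\<lambda>x. f (\<phi> \<tau> x)) (bump (eps n)) x = moll_error n \<tau> x + N (?m n \<phi> \<tau> x) + m * ?m n \<phi> \<tau> x" for x
          by (simp only: conv_add[OF lN l2_cmult[OF phi_l2[OF \<tau>]] ckernel_bump(1)[OF e]] conv_cmult moll_error_def)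
        have "(LINT x|lborel. ?p' \<tau> x * mor_phi n \<tau> x) = (LINT x|lborel. (\<Sum>b\<in>Basis. conv (\<phi> \<tau>) (bump2 (eps n) b) x) * mor_phi n \<tau> x
           - moll_error n \<tau> x * mor_phi n \<tau> x - N (?m n \<phi> \<tau> x) * mor_phi n \<tau> x - m * (?m n \<phi> \<tau> x * mor_phi n \<tau> x))"
          unfolding cf by (intro Bochner_Integration.integral_cong) (auto simp: algebra_simps)
        also have "\<dots> = (LINT x|lborel. (\<Sum>b\<in>Basis. conv (\<phi> \<tau>) (bump2 (eps n) b) x) * mor_phi n \<tau> x)
           - ?Y n \<tau> - (LINT x|lborel. N (?m n \<phi> \<tau> x) * mor_phi n \<tau> x) - m * (LINT x|lborel. ?m n \<phi> \<tau> x * mor_phi n \<tau> x)"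
          using l2_mult_integrable[OF lD lM] l2_mult_integrable[OF l2cont_l2[OF moll_error_cont \<tau>] lM, of n] l2_mult_integrable[OF lN' lM]
            l2_mult_integrable[OF r.\<Phi>_l2 lM]
          by (simp only: Bochner_Integration.integral_diff Bochner_Integration.integrable_diff integrable_mult_right integral_mult_right_zero)
        also have "\<dots> = ((LINT x|lborel. (\<Sum>b\<in>Basis. conv (\<phi> \<tau>) (bump2 (eps n) b) x) * mor_phi n \<tau> x)
           - (LINT x|lborel. N (?m n \<phi> \<tau> x) * mor_phi n \<tau> x)) - ?Y n \<tau>" by (simp add: z2)
        also have "\<dots> \<le> - (1/40) * ((\<Sum>b\<in>Basis. ip dec_weight (conv (\<phi> \<tau>) (bump1 (eps n) b)) (conv (\<phi> \<tau>) (bump1 (eps n) b)))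
            + ip dec_weight (?m n \<phi> \<tau>) (?m n \<phi> \<tau>)) - ?Y n \<tau>"
          unfolding mor_phi_def
        proof (intro diff_right_mono r.radial_morawetz[where \<epsilon>=\<epsilon> and C=C])
          show "n2 (?m n \<phi> \<tau>) \<le> \<epsilon>\<^sup>2" using conv_bump_n2_le[OF phi_l2[OF \<tau>] e] n2_phi[OF \<tau>] by simp
          show "\<bar>N s\<bar> \<le> C * \<bar>s\<bar> ^ 3" if "\<bar>s\<bar> \<le> \<epsilon>" for s using rem.f_cubic[of s] that \<epsilon>(2) by simp
        qed (use moll_bdd[OF \<tau>] rem.f_meas C_nonneg small in auto)
        also have "(\<Sum>b\<in>Basis. ip dec_weight (conv (\<phi> \<tau>) (bump1 (eps n) b)) (conv (\<phi> \<tau>) (bump1 (eps n) b)))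
          = (\<Sum>b\<in>Basis. ip dec_weight (?m n (G b) \<tau>) (?m n (G b) \<tau>))"
          by (intro sum.cong refl) (simp add: gradient_fun[OF e \<tau>])
        finally show "(LINT x|lborel. ?p' \<tau> x * mor_phi n \<tau> x) + (LINT x|lborel. ?m n \<psi> \<tau> x * mor_psi n \<tau> x) \<le> - (1/40) * ?q n \<tau> - ?Y n \<tau>"
          unfolding z1 by simp
      qed
      \<comment> \<open>The 14 is 8 + 2 * 3, from \<open>mor_l2\<close> in dimension three with
        \<open>n2\<close> of \<open>\<phi>\<close> and of its gradient at most 1.\<close>
      have Jb: "\<bar>LINT x|lborel. ?m n \<psi> s x * mor_phi n s x\<bar> \<le> P + 14" if s: "0 \<le> s" for s
      proof -
        have l: "l2 (?m n \<psi> s)" by (intro conv_l2 psi_l2 ckernel_bump e s)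
        have "n2 (?m n \<psi> s) \<le> P" using conv_bump_n2_le[OF psi_l2[OF s] e] P[OF s] by simp
        thus ?thesis using young_pair[OF l l2cont_l2[OF mor_phi_cont s], of 1 n] mor_phi_n2[OF s, of n] by simp
      qed
      have "integral {0..t} (?q n) = (\<Sum>b\<in>Basis. tip dec_weight (?m n (G b)) (?m n (G b)) 0 t) + tip dec_weight (?m n \<phi>) (?m n \<phi>) 0 t"
        unfolding tip_def
        by (intro integral_unique has_integral_add has_integral_sum integrable_integral tip_integrable moll_l2cont cont sw.w_bdd) auto
      thus "(\<Sum>b\<in>Basis. tip dec_weight (?m n (G b)) (?m n (G b)) 0 t) + tip dec_weight (?m n \<phi>) (?m n \<phi>) 0 t
        \<le> 40 * (2 * (P + 14) - integral {0..t} (?Y n))"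
        using le Jb[OF t, unfolded abs_le_iff] Jb[OF order_refl, unfolded abs_le_iff] by argo
    qed
  qed
  show thesis by (rule that[OF main])
qed

definition local_energy :: "real \<Rightarrow> real" where
  "local_energy t = ip dec_weight (\<psi> t) (\<psi> t) + (\<Sum>b\<in>Basis. ip dec_weight (G b t) (G b t)) + ip dec_weight (\<phi> t) (\<phi> t)"

theorem local_energy_decay: "(local_energy \<longlongrightarrow> 0) at_top"
proof -
  interpret ww: weighted_wave \<phi> \<psi> "\<lambda>t x. f (\<phi> t x)" G "dec_weight :: real^3 \<Rightarrow> real" dec_weight_deriv 2
    by (intro weighted_wave.intro wave_axioms dec_weight_smooth)
  have en: "ww.energy = local_energy" by (auto simp: fun_eq_iff ww.energy_def local_energy_def)
  let ?g = "\<lambda>t. \<Sum>b\<in>Basis. ip dec_weight (G b t) (G b t)"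
  let ?a = "\<lambda>t. ip dec_weight (\<phi> t) (\<phi> t)" and ?p = "\<lambda>t. ip dec_weight (\<psi> t) (\<psi> t)"
  let ?k = "\<lambda>t x. f (\<phi> t x)"
  have g0: "0 \<le> ?g t" "0 \<le> ?a t" "0 \<le> ?p t" for t by (auto intro!: sum_nonneg ip_dec_nonneg)
  have gc: "continuous_on {0..} ?g" "continuous_on {0..} ?a" "continuous_on {0..} ?p"
    by (intro continuous_on_sum l2cont_ip cont ww.w_bdd; assumption)+
  have lc: "continuous_on {0..} local_energy" unfolding local_energy_def[abs_def] by (intro continuous_intros gc)
  have int: "h integrable_on {s..t}" if "continuous_on {0..} h" "0 \<le> s" for h :: "real \<Rightarrow> real" and s t
    using that by (intro integrable_continuous_real continuous_on_subset[OF that(1)]) auto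
  have L2: "n2w t \<le> L\<^sup>2 * ?a t" if "0 \<le> t" "n2w t = ip dec_weight (?k t) (?k t)" for t and n2w :: "real \<Rightarrow> real"
  proof -
    have "ip dec_weight (?k t) (?k t) \<le> (LINT x|lborel. L\<^sup>2 * (dec_weight x * \<phi> t x * \<phi> t x))"
      unfolding ip_def
    proof (rule integral_mono_AE)
      show "AE x in lborel. dec_weight x * f (\<phi> t x) * f (\<phi> t x) \<le> L\<^sup>2 * (dec_weight x * \<phi> t x * \<phi> t x)"
        using bdd1[OF that(1)]
      proof eventually_elim
        case (elim x)
        have "\<bar>f (\<phi> t x)\<bar>\<^sup>2 \<le> (L * \<bar>\<phi> t x\<bar>)\<^sup>2" by (intro power_mono f_le elim) simp
        hence "dec_weight x * (f (\<phi> t x))\<^sup>2 \<le> dec_weight x * (L\<^sup>2 * (\<phi> t x)\<^sup>2)"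
          using dec_weight_pos[of x] by (intro mult_left_mono) (auto simp: power_mult_distrib)
        thus ?case by (simp add: power2_eq_square mult_ac)
      qed
    qed (use that cont ww.w_bdd in \<open>auto intro!: ip_integrable simp: l2cont_def\<close>)
    thus ?thesis using that by (simp add: ip_def)
  qed
  have k2: "ip dec_weight (?k t) (?k t) \<le> L\<^sup>2 * ?a t" if "0 \<le> t" for t
    by (rule L2[OF that, of "\<lambda>t. ip dec_weight (?k t) (?k t)"]) simp
  have l: "l2 (\<phi> t)" "l2 (\<psi> t)" "l2 (?k t)" "\<And>b. b \<in> Basis \<Longrightarrow> l2 (G b t)" if "0 \<le> t" for t
    using cont that by (auto simp: l2cont_def)
  have dwb: "\<bar>dec_weight x\<bar> \<le> 1 * dec_weight x" for x :: "real^3" using dec_weight_pos[of x] by simp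
  have sumle: "(\<Sum>b\<in>Basis. 2 * \<bar>ip (dec_weight_deriv b) u (G b t)\<bar>) \<le> 6 * ip dec_weight u u + 2 * ?g t"
    if "0 \<le> t" "l2 u" for t u
  proof -
    have "(\<Sum>b\<in>Basis. 2 * \<bar>ip (dec_weight_deriv b) u (G b t)\<bar>) \<le> (\<Sum>b\<in>(Basis::(real^3) set). 2 * (ip dec_weight u u + ip dec_weight (G b t) (G b t)))"
      using that by (intro sum_mono ip_dec_mono l dec_weight_deriv_meas dec_weight_deriv_bound) auto
    also have "\<dots> = 6 * ip dec_weight u u + 2 * ?g t"
      by (simp add: sum.distrib sum_distrib_left[symmetric])
    finally show ?thesis .
  qed
  obtain K where K: "\<And>t. 0 \<le> t \<Longrightarrow> (\<Sum>b\<in>Basis. tip dec_weight (G b) (G b) 0 t) + tip dec_weight \<phi> \<phi> 0 t \<le> K"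
    using local_density_bound by blast
  have gint: "integral {0..t} ?g = (\<Sum>b\<in>Basis. tip dec_weight (G b) (G b) 0 t)" if "0 \<le> t" for t
    unfolding tip_def by (intro integral_sum tip_integrable cont ww.w_bdd) auto
  have aint: "integral {0..t} ?a = tip dec_weight \<phi> \<phi> 0 t" for t by (simp add: tip_def)
  have ga: "integral {0..t} ?g + integral {0..t} ?a \<le> K" if "0 \<le> t" for t using K[OF that] gint[OF that] aint by simp
  have ip0: "0 \<le> integral {0..t} ?g" "0 \<le> integral {0..t} ?a" for t
    using int gc g0 by (auto intro!: integral_nonneg)
  \<comment> \<open>Twice the bound on <w \<open>\<phi>\<close>, \<open>\<psi>\<close>>, once for
    each end of the time interval; 64 is 1 for \<open>\<phi>\<close> plus the 63 of
    \<open>velocity_bounded\<close>.\<close>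
  define V where "V = 2 * (64 + 10 * L\<^sup>2)"
  have Vb: "\<bar>ip dec_weight (\<phi> t) (\<psi> t)\<bar> \<le> 64 + 10 * L\<^sup>2" if t: "0 \<le> t" for t
  proof -
    have "n2 (?k t) \<le> L\<^sup>2" if "0 \<le> t" for t
      using k_le[OF that] mult_left_mono[OF order_trans[OF n2_phi[OF that] sq_le1], of "L\<^sup>2"] by simp
    hence "n2 (\<psi> t) \<le> 63 + 10 * L\<^sup>2"
      using n2_phi n2_G sq_le1 by (intro velocity_bounded t) (auto intro: order_trans)
    moreover have "n2 (\<phi> t) \<le> 1" using n2_phi[OF t] sq_le1 by simp
    moreover have "\<bar>ip dec_weight (\<phi> t) (\<psi> t)\<bar> \<le> 1 * (n2 (\<phi> t) + n2 (\<psi> t))"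
      by (rule ip_bound[OF l(1)[OF t] l(2)[OF t] dec_weight_meas]) (rule order_trans[OF dwb], simp add: dec_weight_pos)
    ultimately show ?thesis by simp
  qed
  \<comment> \<open>The virial identity with the decaying weight is solved for the velocity term;
    everything else is bounded by the densities of \<open>\<phi>\<close> and its gradient. They
    occur with the factors 4 + L^2 and 2, both at most 5 + L^2.\<close>
  have pint: "integral {0..t} ?p \<le> (5 + L\<^sup>2) * K + V" if t: "0 \<le> t" for t
  proof -
    have "integral {0..t} ?p = (\<Sum>b\<in>Basis. tip (dec_weight_deriv b) \<phi> (G b) 0 t) + (\<Sum>b\<in>Basis. tip dec_weight (G b) (G b) 0 t)
        + tip dec_weight \<phi> ?k 0 t + (ip dec_weight (\<phi> t) (\<psi> t) - ip dec_weight (\<phi> 0) (\<psi> 0))"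
      using ww.virial_identity[OF order_refl t] by (simp add: tip_def)
    also have "(\<Sum>b\<in>Basis. tip (dec_weight_deriv b) \<phi> (G b) 0 t) = integral {0..t} (\<lambda>\<tau>. \<Sum>b\<in>Basis. ip (dec_weight_deriv b) (\<phi> \<tau>) (G b \<tau>))"
      unfolding tip_def by (intro integral_sum[symmetric] tip_integrable cont ww.dw_bdd) auto
    also have "\<dots> \<le> integral {0..t} (\<lambda>\<tau>. 3 * ?a \<tau> + ?g \<tau>)"
    proof (rule integral_le)
      show "(\<lambda>\<tau>. \<Sum>b\<in>Basis. ip (dec_weight_deriv b) (\<phi> \<tau>) (G b \<tau>)) integrable_on {0..t}"
        by (intro integrable_sum tip_integrable cont ww.dw_bdd) auto
      show "(\<lambda>\<tau>. 3 * ?a \<tau> + ?g \<tau>) integrable_on {0..t}" by (intro int continuous_intros gc) simp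
      fix \<tau> assume "\<tau> \<in> {0..t}"
      hence \<tau>: "0 \<le> \<tau>" by simp
      have "2 * (\<Sum>b\<in>Basis. ip (dec_weight_deriv b) (\<phi> \<tau>) (G b \<tau>)) \<le> (\<Sum>b\<in>Basis. 2 * \<bar>ip (dec_weight_deriv b) (\<phi> \<tau>) (G b \<tau>)\<bar>)"
        unfolding sum_distrib_left by (intro sum_mono) auto
      thus "(\<Sum>b\<in>Basis. ip (dec_weight_deriv b) (\<phi> \<tau>) (G b \<tau>)) \<le> 3 * ?a \<tau> + ?g \<tau>"
        using sumle[OF \<tau> l(1)[OF \<tau>]] by linarith
    qed
    also have "\<dots> = 3 * integral {0..t} ?a + integral {0..t} ?g"
      by (intro integral_unique has_integral_add has_integral_mult_right integrable_integral int gc order_refl)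
    also have "tip dec_weight \<phi> ?k 0 t \<le> integral {0..t} (\<lambda>\<tau>. (1 + L\<^sup>2) * ?a \<tau>)"
      unfolding tip_def
    proof (rule integral_le)
      show "(\<lambda>\<tau>. ip dec_weight (\<phi> \<tau>) (?k \<tau>)) integrable_on {0..t}" by (intro tip_integrable cont ww.w_bdd) auto
      show "(\<lambda>\<tau>. (1 + L\<^sup>2) * ?a \<tau>) integrable_on {0..t}" by (intro int continuous_intros gc) simp
      fix \<tau> assume "\<tau> \<in> {0..t}"
      hence \<tau>: "0 \<le> \<tau>" by simp
      have *: "2 * \<bar>ip dec_weight (\<phi> \<tau>) (?k \<tau>)\<bar> \<le> 1 * (?a \<tau> + ip dec_weight (?k \<tau>) (?k \<tau>))"
        by (rule ip_dec_mono[OF l(1)[OF \<tau>] l(3)[OF \<tau>] dec_weight_meas dwb]) simp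
      show "ip dec_weight (\<phi> \<tau>) (?k \<tau>) \<le> (1 + L\<^sup>2) * ?a \<tau>"
      proof -
        have "X \<le> (1 + c) * a" if "2 * \<bar>X\<bar> \<le> 1 * (a + b)" "b \<le> c * a" for X a b c :: real
        proof -
          have "X \<le> a + b" using that(1) by (simp add: abs_if split: if_splits)
          thus ?thesis using that(2) by (simp add: distrib_right)
        qed
        from this[OF _ k2[OF \<tau>]] *  show ?thesis by blast
      qed
    qed
    also have "\<dots> = (1 + L\<^sup>2) * integral {0..t} ?a" by simp
    finally have "integral {0..t} ?p \<le> 3 * integral {0..t} ?a + integral {0..t} ?g + integral {0..t} ?g + (1 + L\<^sup>2) * integral {0..t} ?a
       + (ip dec_weight (\<phi> t) (\<psi> t) - ip dec_weight (\<phi> 0) (\<psi> 0))" using gint[OF t] by simp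
    also have "ip dec_weight (\<phi> t) (\<psi> t) - ip dec_weight (\<phi> 0) (\<psi> 0) \<le> V"
      using Vb[OF t] Vb[OF order_refl] unfolding V_def by (simp add: abs_le_iff)
    also have "3 * integral {0..t} ?a + integral {0..t} ?g + integral {0..t} ?g + (1 + L\<^sup>2) * integral {0..t} ?a + V
      \<le> (5 + L\<^sup>2) * (integral {0..t} ?g + integral {0..t} ?a) + V"
      using ip0[of t] by (simp add: algebra_simps add_increasing)
    also have "\<dots> \<le> (5 + L\<^sup>2) * K + V" using ga[OF t] by (intro add_mono mult_left_mono) auto
    finally show ?thesis by simp
  qed
  show ?thesis
  \<comment> \<open>The growth rate: mass term, source and flux add up to 8, 1 + L^2 and 2 times the
    densities of \<open>\<psi>\<close>, \<open>\<phi>\<close> and the gradient, at most 9 + L^2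
    times the local energy.\<close>
  proof (rule decay_at_top[OF lc, where C="(5 + L\<^sup>2) * K + V + K" and K="9 + L\<^sup>2"])
    show "0 \<le> local_energy t" for t unfolding local_energy_def using g0[of t] by linarith
    show "0 \<le> 9 + L\<^sup>2" by (simp add: add_nonneg_nonneg)
    show "integral {0..t} local_energy \<le> (5 + L\<^sup>2) * K + V + K" if t: "0 \<le> t" for t
    proof -
      have "integral {0..t} local_energy = integral {0..t} ?p + integral {0..t} ?g + integral {0..t} ?a"
        unfolding local_energy_def[abs_def]
        by (intro integral_unique has_integral_add integrable_integral int gc order_refl)
      thus ?thesis using pint[OF t] ga[OF t] by linarith
    qed
    fix s t :: real assume st: "0 \<le> s" "s \<le> t"
    have i: "(\<lambda>\<tau>. 2 * (ip dec_weight (\<psi> \<tau>) (\<phi> \<tau>) - ip dec_weight (\<psi> \<tau>) (?k \<tau>) - (\<Sum>b\<in>Basis. ip (dec_weight_deriv b) (\<psi> \<tau>) (G b \<tau>)))) integrable_on {s..t}"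
      by (intro integrable_on_mult_right integrable_diff integrable_sum tip_integrable cont ww.w_bdd ww.dw_bdd st) auto
    have "local_energy t - local_energy s = integral {s..t} (\<lambda>\<tau>. 2 * (ip dec_weight (\<psi> \<tau>) (\<phi> \<tau>) - ip dec_weight (\<psi> \<tau>) (?k \<tau>) - (\<Sum>b\<in>Basis. ip (dec_weight_deriv b) (\<psi> \<tau>) (G b \<tau>))))"
      unfolding en[symmetric] ww.energy_identity[OF st, symmetric] tip_def
      by (rule integral_unique[symmetric]) (intro has_integral_mult_right has_integral_diff has_integral_sum integrable_integral tip_integrable cont ww.w_bdd ww.dw_bdd st finite_Basis; assumption)
    also have "\<dots> \<le> integral {s..t} (\<lambda>\<tau>. (9 + L\<^sup>2) * local_energy \<tau>)"
    proof (rule integral_le[OF i])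
      show "(\<lambda>\<tau>. (9 + L\<^sup>2) * local_energy \<tau>) integrable_on {s..t}" by (intro int continuous_intros lc st)
      fix \<tau> assume "\<tau> \<in> {s..t}"
      hence \<tau>: "0 \<le> \<tau>" using st by simp
      have 1: "2 * \<bar>ip dec_weight (\<psi> \<tau>) (\<phi> \<tau>)\<bar> \<le> 1 * (?p \<tau> + ?a \<tau>)"
        by (rule ip_dec_mono[OF l(2)[OF \<tau>] l(1)[OF \<tau>] dec_weight_meas dwb]) simp
      have 2: "2 * \<bar>ip dec_weight (\<psi> \<tau>) (?k \<tau>)\<bar> \<le> 1 * (?p \<tau> + ip dec_weight (?k \<tau>) (?k \<tau>))"
        by (rule ip_dec_mono[OF l(2)[OF \<tau>] l(3)[OF \<tau>] dec_weight_meas dwb]) simp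
      have 3: "- (2 * (\<Sum>b\<in>Basis. ip (dec_weight_deriv b) (\<psi> \<tau>) (G b \<tau>))) \<le> (\<Sum>b\<in>Basis. 2 * \<bar>ip (dec_weight_deriv b) (\<psi> \<tau>) (G b \<tau>)\<bar>)"
        unfolding sum_distrib_left sum_negf[symmetric] by (intro sum_mono) auto
      note 4 = sumle[OF \<tau> l(2)[OF \<tau>]]
      have "2 * (ip dec_weight (\<psi> \<tau>) (\<phi> \<tau>) - ip dec_weight (\<psi> \<tau>) (?k \<tau>) - (\<Sum>b\<in>Basis. ip (dec_weight_deriv b) (\<psi> \<tau>) (G b \<tau>)))
         = 2 * ip dec_weight (\<psi> \<tau>) (\<phi> \<tau>) + 2 * (- ip dec_weight (\<psi> \<tau>) (?k \<tau>)) + - (2 * (\<Sum>b\<in>Basis. ip (dec_weight_deriv b) (\<psi> \<tau>) (G b \<tau>)))"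
        by simp
      also have "\<dots> \<le> (?p \<tau> + ?a \<tau>) + (?p \<tau> + L\<^sup>2 * ?a \<tau>) + (6 * ?p \<tau> + 2 * ?g \<tau>)"
      proof -
        have "2 * X + 2 * (- Y) + Z \<le> (p + a) + (p + l) + W"
          if "2 * \<bar>X\<bar> \<le> 1 * (p + a)" "2 * \<bar>Y\<bar> \<le> 1 * (p + kk)" "Z \<le> S" "S \<le> W" "kk \<le> l" for X Y Z p a l W kk S :: real
          using that by (simp add: abs_if split: if_splits)
        from this[OF 1 2 3 4 k2[OF \<tau>]] show ?thesis .
      qed
      also have "\<dots> \<le> 9 * local_energy \<tau> + L\<^sup>2 * local_energy \<tau>"
      proof (rule order_trans[of _ "(8 * ?p \<tau> + ?a \<tau> + 2 * ?g \<tau>) + L\<^sup>2 * ?a \<tau>"])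
        have "?a \<tau> \<le> local_energy \<tau>" unfolding local_energy_def using g0[of \<tau>] by linarith
        hence "L\<^sup>2 * ?a \<tau> \<le> L\<^sup>2 * local_energy \<tau>" by (intro mult_left_mono) auto
        moreover have "8 * ?p \<tau> + ?a \<tau> + 2 * ?g \<tau> \<le> 9 * local_energy \<tau>"
        proof -
          have "8 * p + a + 2 * g \<le> 9 * (p + g + a)" if "0 \<le> g" "0 \<le> a" "0 \<le> p" for p g a :: real using that by simp
          from this[OF g0] show ?thesis unfolding local_energy_def .
        qed
        ultimately show "(8 * ?p \<tau> + ?a \<tau> + 2 * ?g \<tau>) + L\<^sup>2 * ?a \<tau> \<le> 9 * local_energy \<tau> + L\<^sup>2 * local_energy \<tau>" by linarith
      qed linarith
      also have "\<dots> = (9 + L\<^sup>2) * local_energy \<tau>" by (simp add: distrib_right)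
      finally show "2 * (ip dec_weight (\<psi> \<tau>) (\<phi> \<tau>) - ip dec_weight (\<psi> \<tau>) (?k \<tau>) - (\<Sum>b\<in>Basis. ip (dec_weight_deriv b) (\<psi> \<tau>) (G b \<tau>))) \<le> (9 + L\<^sup>2) * local_energy \<tau>" .
    qed
    also have "\<dots> = (9 + L\<^sup>2) * integral {s..t} local_energy" by simp
    finally show "local_energy t - local_energy s \<le> (9 + L\<^sup>2) * integral {s..t} local_energy" .
  qed
qed

end

section \<open>Weak derivatives and the potentials\<close>

lemma L2_norm_sq: "(L2_norm \<Omega> u)\<^sup>2 = n2 (\<lambda>x. indicator \<Omega> x * u x)"
proof -
  have "indicator \<Omega> x *\<^sub>R (u x)\<^sup>2 = (indicator \<Omega> x * u x)\<^sup>2" for x by (simp add: indicator_def)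
  hence "(LINT x:\<Omega>|lborel. (u x)\<^sup>2) = n2 (\<lambda>x. indicator \<Omega> x * u x)"
    by (simp only: set_lebesgue_integral_def n2_def)
  thus ?thesis by (simp add: L2_norm_def)
qed

lemma H1_norm_sq:
  "(H1_norm \<Omega> u)\<^sup>2 = n2 (\<lambda>x. indicator \<Omega> x * u x) + (\<Sum>b\<in>Basis. n2 (\<lambda>x. indicator \<Omega> x * weak_partial \<Omega> b u x))"
  unfolding H1_norm_def L2_norm_sq by (rule real_sqrt_pow2) (simp add: sum_nonneg add_nonneg_nonneg)

lemma H1L2_norm_sq: "(H1L2_norm \<Omega> u v)\<^sup>2 = n2 (\<lambda>x. indicator \<Omega> x * u x)
    + (\<Sum>b\<in>Basis. n2 (\<lambda>x. indicator \<Omega> x * weak_partial \<Omega> b u x)) + n2 (\<lambda>x. indicator \<Omega> x * v x)"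
  unfolding H1L2_norm_def L2_norm_sq H1_norm_sq by (rule real_sqrt_pow2) (simp add: sum_nonneg add_nonneg_nonneg)

section \<open>Test functions and weak derivatives on an open set\<close>

lemma test_function_outside_support:
  assumes "x \<notin> closure {x. \<eta> x \<noteq> 0}"
  shows "\<eta> x = 0" "partial b \<eta> x = 0"
proof -
  show "\<eta> x = 0" using assms closure_subset[of "{x. \<eta> x \<noteq> 0}"] by blast
  have "(\<eta> has_derivative (\<lambda>h. 0)) (at x)"
  proof (rule has_derivative_transform_within_open[OF has_derivative_const])
    show "open (- closure {x. \<eta> x \<noteq> 0})" by (rule open_Compl[OF closed_closure])
    show "x \<in> - closure {x. \<eta> x \<noteq> 0}" using assms by simp
    show "0 = \<eta> y" if "y \<in> - closure {x. \<eta> x \<noteq> 0}" for y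
      using that closure_subset[of "{x. \<eta> x \<noteq> 0}"] by auto
  qed
  from frechet_derivative_at[OF this] show "partial b \<eta> x = 0" by (simp add: partial_def fun_eq_iff)
qed

lemma test_function_kernel:
  assumes "\<eta> \<in> test_functions \<Omega>"
  shows "ckernel \<eta>" "b \<in> Basis \<Longrightarrow> ckernel (partial b \<eta>)"
proof -
  have k: "\<And>k. Ck k \<eta>" and c: "compact (closure {x. \<eta> x \<noteq> 0})" using assms by (auto simp: test_functions_def)
  obtain r where r: "\<And>x. x \<in> closure {x. \<eta> x \<noteq> 0} \<Longrightarrow> norm x \<le> r"
    using compact_imp_bounded[OF c] by (auto simp: bounded_iff)
  have out: "x \<notin> closure {x. \<eta> x \<noteq> 0}" if "r < norm x" for x using r[of x] that by auto
  show "ckernel \<eta>" unfolding ckernel_def using k[of 0] test_function_outside_support(1)[OF out] by auto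
  show "ckernel (partial b \<eta>)" if "b \<in> Basis"
    unfolding ckernel_def using k[of "Suc 0"] that test_function_outside_support(2)[OF out] by auto
qed

lemma test_functions_UNIV: "\<eta> \<in> test_functions \<Omega> \<Longrightarrow> \<eta> \<in> test_functions UNIV"
  by (simp add: test_functions_def)

lemma test_function_outside: 
  assumes "\<eta> \<in> test_functions \<Omega>" "x \<notin> \<Omega>" shows "\<eta> x = 0" "partial b \<eta> x = 0"
proof -
  have "closure {x. \<eta> x \<noteq> 0} \<subseteq> \<Omega>" using assms(1) by (simp add: test_functions_def)
  hence "x \<notin> closure {x. \<eta> x \<noteq> 0}" using assms(2) by blast
  thus "\<eta> x = 0" "partial b \<eta> x = 0" by (rule test_function_outside_support)+
qed

lemma L2_test_integrable:
  assumes "u \<in> L2 \<Omega>" "ckernel k" shows "set_integrable lborel \<Omega> (\<lambda>x. u x * k x)"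
  using l2_mult_integrable[OF L2_l2[OF assms(1)] kernel_l2[OF assms(2)]] by (simp add: set_integrable_def mult.assoc)

lemma L2_diff: assumes "u \<in> L2 \<Omega>" "v \<in> L2 \<Omega>" shows "(\<lambda>x. u x - v x) \<in> L2 \<Omega>"
  using l2_diff(1)[OF L2_l2[OF assms(1)] L2_l2[OF assms(2)]] by (simp add: L2_iff right_diff_distrib)

lemma has_weak_partial_restrict:
  assumes "has_weak_partial UNIV b u g" shows "has_weak_partial \<Omega> b u g"
  unfolding has_weak_partial_def
proof
  fix \<eta> assume e: "\<eta> \<in> test_functions \<Omega>"
  have eq: "indicator \<Omega> x *\<^sub>R (u x * partial b \<eta> x) = u x * partial b \<eta> x" "indicator \<Omega> x *\<^sub>R (g x * \<eta> x) = g x * \<eta> x" for x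
    using test_function_outside[OF e, of x] by (auto simp: indicator_def)
  show "(LINT x:\<Omega>|lborel. u x * partial b \<eta> x) = - (LINT x:\<Omega>|lborel. g x * \<eta> x)"
    using bspec[OF assms[unfolded has_weak_partial_def] test_functions_UNIV[OF e]]
    by (simp only: set_lebesgue_integral_def eq indicator_UNIV scaleR_one)
qed

lemma has_weak_partial_diff:
  assumes "u \<in> L2 \<Omega>" "v \<in> L2 \<Omega>" "g \<in> L2 \<Omega>" "h \<in> L2 \<Omega>" "b \<in> Basis" "has_weak_partial \<Omega> b u g" "has_weak_partial \<Omega> b v h"
  shows "has_weak_partial \<Omega> b (\<lambda>x. u x - v x) (\<lambda>x. g x - h x)"
  unfolding has_weak_partial_def
proof
  fix \<eta> assume e: "\<eta> \<in> test_functions \<Omega>"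
  note i = L2_test_integrable[OF _ test_function_kernel(1)[OF e]] L2_test_integrable[OF _ test_function_kernel(2)[OF e assms(5)]]
  show "(LINT x:\<Omega>|lborel. (u x - v x) * partial b \<eta> x) = - (LINT x:\<Omega>|lborel. (g x - h x) * \<eta> x)"
    using assms e unfolding left_diff_distrib
    by (simp add: set_integral_diff(2) i has_weak_partial_def)
qed

lemma has_weak_partial_unique:
  assumes "open \<Omega>" "g \<in> L2 \<Omega>" "h \<in> L2 \<Omega>" "has_weak_partial \<Omega> b u g" "has_weak_partial \<Omega> b u h"
  shows "AE x in lborel. x \<in> \<Omega> \<longrightarrow> g x = h x"
proof -
  have "AE x in lborel. x \<in> \<Omega> \<longrightarrow> g x - h x = 0"
  proof (rule test_function_orthogonal_zero[OF assms(1) L2_diff[OF assms(2,3)]])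
    fix \<eta> assume e: "\<eta> \<in> test_functions \<Omega>"
    note i = L2_test_integrable[OF _ test_function_kernel(1)[OF e]]
    show "(LINT x:\<Omega>|lborel. (g x - h x) * \<eta> x) = 0"
      using assms e unfolding left_diff_distrib by (simp add: set_integral_diff(2) i has_weak_partial_def)
  qed
  thus ?thesis by simp
qed

text \<open>\<open>weak_partial\<close> is a choice, fixed only up to null sets by the fundamental
  lemma; its norm does not depend on the choice. This identifies the derivative on a ball with the
  restriction of the derivative on the whole space.\<close>

lemma weak_partial_eq:
  assumes "open \<Omega>" "g \<in> L2 \<Omega>" "has_weak_partial \<Omega> b u g"
  shows "n2 (\<lambda>x. indicator \<Omega> x * weak_partial \<Omega> b u x) = n2 (\<lambda>x. indicator \<Omega> x * g x)"
proof -
  have w: "weak_partial \<Omega> b u \<in> L2 \<Omega> \<and> has_weak_partial \<Omega> b u (weak_partial \<Omega> b u)"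
    unfolding weak_partial_def by (rule someI[of _ g]) (use assms in auto)
  hence "AE x in lborel. x \<in> \<Omega> \<longrightarrow> weak_partial \<Omega> b u x = g x" 
    using has_weak_partial_unique[OF assms(1) _ assms(2) _ assms(3)] by blast
  hence "AE x in lborel. (indicator \<Omega> x * weak_partial \<Omega> b u x)\<^sup>2 = (indicator \<Omega> x * g x)\<^sup>2"
    by eventually_elim (auto simp: indicator_def)
  moreover have "l2 (\<lambda>x. indicator \<Omega> x * weak_partial \<Omega> b u x)" "l2 (\<lambda>x. indicator \<Omega> x * g x)"
    using w assms by (auto simp: L2_iff)
  ultimately show ?thesis unfolding n2_def
    by (intro integral_cong_AE) (auto simp: l2_def)
qed

lemma weak_partial_H1:
  assumes "u \<in> H1 UNIV" "b \<in> Basis"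
  shows "l2 (weak_partial UNIV b u)" "has_weak_partial UNIV b u (weak_partial UNIV b u)"
proof -
  have "\<exists>g. g \<in> L2 UNIV \<and> has_weak_partial UNIV b u g" using assms by (auto simp: H1_def)
  from someI_ex[OF this] show "l2 (weak_partial UNIV b u)" "has_weak_partial UNIV b u (weak_partial UNIV b u)"
    by (simp_all add: weak_partial_def L2_UNIV)
qed

lemma l2_indicator_ball: "l2 u \<Longrightarrow> l2 (\<lambda>x. indicator (ball 0 R) x * u x)"
  by (rule l2_weight(1)[where B=1]) (auto simp: indicator_def)

text \<open>On the ball \<open>dec_weight\<close> is at least its value at radius R, and the
  constant is the inverse of that value.\<close>

lemma n2_ball_le:
  assumes "l2 (u :: 'a::euclidean_space \<Rightarrow> real)"
  shows "n2 (\<lambda>x. indicator (ball 0 R) x * u x) \<le> (1 + R\<^sup>2)\<^sup>2 * ip dec_weight u u"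
proof -
  let ?c = "(1 + R\<^sup>2)\<^sup>2"
  have bm: "bdd_meas (dec_weight :: 'a \<Rightarrow> real)" by (rule smooth_weight.w_bdd[OF dec_weight_smooth])
  have "n2 (\<lambda>x. indicator (ball 0 R) x * u x) \<le> (LINT x|lborel. ?c * (dec_weight x * u x * u x))"
    unfolding n2_def
  proof (rule integral_mono)
    show "integrable lborel (\<lambda>x. (indicator (ball 0 R) x * u x)\<^sup>2)" using l2_indicator_ball[OF assms] by (simp add: l2_def)
    show "integrable lborel (\<lambda>x. ?c * (dec_weight x * u x * u x))" by (intro integrable_mult_right ip_integrable assms bm)
    fix x :: 'a
    show "(indicator (ball 0 R) x * u x)\<^sup>2 \<le> ?c * (dec_weight x * u x * u x)"
    proof (cases "x \<in> ball 0 R")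
      case True
      have 1: "1 \<le> (1 + (norm x)\<^sup>2)\<^sup>2" by (rule one_le_power) simp
      have "(norm x)\<^sup>2 \<le> R\<^sup>2" using True by (intro power_mono) auto
      hence "(1 + (norm x)\<^sup>2)\<^sup>2 \<le> ?c" by (intro power_mono) auto
      moreover have "0 < (1 + (norm x)\<^sup>2)\<^sup>2" using 1 by linarith
      ultimately have "1 \<le> ?c / (1 + (norm x)\<^sup>2)\<^sup>2" by (simp only: pos_le_divide_eq mult_1)
      hence "1 \<le> ?c * dec_weight x" by (simp add: dec_weight_def)
      hence "1 * (u x)\<^sup>2 \<le> ?c * dec_weight x * (u x)\<^sup>2" by (intro mult_right_mono) auto
      thus ?thesis using True by (simp add: power2_eq_square mult.assoc)
    next
      case False
      have "0 \<le> dec_weight x * (u x * u x)" by (intro mult_nonneg_nonneg less_imp_le[OF dec_weight_pos(1)] zero_le_square)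
      thus ?thesis using False by (simp add: mult.assoc)
    qed
  qed
  thus ?thesis by (simp add: ip_def)
qed

section \<open>Distributional solutions of small norm as instances of the mollified setting\<close>

locale small_solution = nonlinearity f m C L for f m C L +
  fixes \<phi> \<psi> :: "real \<Rightarrow> real^3 \<Rightarrow> real" and \<epsilon> :: real
  assumes sol: "global_solution f \<phi> \<psi>"
    and rad: "radially_symmetric (\<phi> 0)" "radially_symmetric (\<psi> 0)"
    and sup: "(SUP t\<in>{0..}. H1_Linf_norm (\<phi> t)) \<le> ereal \<epsilon>"
    and eps: "0 < \<epsilon>" "\<epsilon> \<le> 1" "C * \<epsilon>\<^sup>2 * (18 + 12 * sph) \<le> sph / 10"
begin

definition G :: "real^3 \<Rightarrow> real \<Rightarrow> real^3 \<Rightarrow> real" where "G b t = weak_partial UNIV b (\<phi> t)"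

lemma H1_phi: "0 \<le> t \<Longrightarrow> \<phi> t \<in> H1 UNIV" and l2_psi: "0 \<le> t \<Longrightarrow> l2 (\<psi> t)"
  using sol by (auto simp: global_solution_def L2_UNIV)

lemma l2_phi: "0 \<le> t \<Longrightarrow> l2 (\<phi> t)"
  using H1_phi[of t] by (simp add: H1_def L2_UNIV)

lemma G: assumes "0 \<le> t" "b \<in> Basis" shows "l2 (G b t)" "has_weak_partial UNIV b (\<phi> t) (G b t)"
  unfolding G_def by (intro weak_partial_H1 H1_phi assms)+

lemma norm_le: assumes t: "0 \<le> t"
  shows "AE x in lborel. \<bar>\<phi> t x\<bar> \<le> \<epsilon>" "n2 (\<phi> t) + (\<Sum>b\<in>Basis. n2 (G b t)) \<le> \<epsilon>\<^sup>2"
proof -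
  have "H1_Linf_norm (\<phi> t) \<le> (SUP t\<in>{0..}. H1_Linf_norm (\<phi> t))" using t by (intro SUP_upper) auto
  hence le: "ereal (H1_norm UNIV (\<phi> t)) + esssup lborel (\<lambda>x. ereal \<bar>\<phi> t x\<bar>) \<le> ereal \<epsilon>"
    using sup by (auto simp: H1_Linf_norm_def intro: order_trans)
  let ?e = "esssup lborel (\<lambda>x. ereal \<bar>\<phi> t x\<bar>)"
  have ae: "AE x in lborel. ereal \<bar>\<phi> t x\<bar> \<le> ?e" by (rule esssup_AE)
  \<comment> \<open>To bound each summand by \<epsilon> both must be nonnegative. For the essential
    supremum this holds because Lebesgue measure is not the zero measure.\<close>
  have e0: "0 \<le> ?e"
  proof (rule ccontr)
    assume n: "\<not> 0 \<le> ?e"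
    have "AE x in lborel::(real^3) measure. False"
      using ae
    proof eventually_elim
      case (elim x)
      have "0 \<le> ereal \<bar>\<phi> t x\<bar>" by simp
      thus ?case using elim n order_trans by blast
    qed
    thus False using ae_filter_eq_bot_iff[of "lborel :: (real^3) measure"] by (simp add: trivial_limit_def)
  qed
  have h0: "0 \<le> H1_norm UNIV (\<phi> t)" by (simp add: H1_norm_def sum_nonneg)
  have "?e \<le> ereal (H1_norm UNIV (\<phi> t)) + ?e" using h0 by (intro add_increasing) auto
  hence "?e \<le> ereal \<epsilon>" using le by (rule order_trans)
  thus "AE x in lborel. \<bar>\<phi> t x\<bar> \<le> \<epsilon>" using ae by (auto elim!: eventually_mono dest: order_trans)
  have "ereal (H1_norm UNIV (\<phi> t)) \<le> ereal (H1_norm UNIV (\<phi> t)) + ?e" using e0 by (intro add_increasing2) auto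
  hence "ereal (H1_norm UNIV (\<phi> t)) \<le> ereal \<epsilon>" using le by (rule order_trans)
  hence "(H1_norm UNIV (\<phi> t))\<^sup>2 \<le> \<epsilon>\<^sup>2" using h0 by (intro power_mono) auto
  thus "n2 (\<phi> t) + (\<Sum>b\<in>Basis. n2 (G b t)) \<le> \<epsilon>\<^sup>2" by (simp add: H1_norm_sq G_def)
qed

text \<open>The norm of the difference contains a weak derivative chosen for the difference, whereas
  \<open>G\<close> subtracts derivatives chosen separately; by uniqueness they have the same norm,
  so continuity of the curve carries over to the gradient.\<close>

lemma curve_lim:
  assumes t: "0 \<le> t"
  defines "h \<equiv> \<lambda>s. (H1L2_norm UNIV (\<lambda>x. \<phi> s x - \<phi> t x) (\<lambda>x. \<psi> s x - \<psi> t x))\<^sup>2"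
  shows "(h \<longlongrightarrow> 0) (at t within {0..})" "n2 (\<lambda>x. \<phi> s x - \<phi> t x) \<le> h s" "n2 (\<lambda>x. \<psi> s x - \<psi> t x) \<le> h s"
    "\<lbrakk>0 \<le> s; b \<in> Basis\<rbrakk> \<Longrightarrow> n2 (\<lambda>x. G b s x - G b t x) \<le> h s"
proof -
  have "((\<lambda>s. H1L2_norm UNIV (\<lambda>x. \<phi> s x - \<phi> t x) (\<lambda>x. \<psi> s x - \<psi> t x)) \<longlongrightarrow> 0) (at t within {0..})"
    using sol t by (auto simp: global_solution_def)
  from tendsto_power[OF this, of 2] show "(h \<longlongrightarrow> 0) (at t within {0..})" by (simp add: h_def)
  have hs: "h s = n2 (\<lambda>x. \<phi> s x - \<phi> t x) + (\<Sum>b\<in>Basis. n2 (weak_partial UNIV b (\<lambda>x. \<phi> s x - \<phi> t x))) + n2 (\<lambda>x. \<psi> s x - \<psi> t x)"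
    by (simp add: h_def H1L2_norm_sq)
  have 0: "0 \<le> (\<Sum>b\<in>Basis. n2 (weak_partial UNIV b (\<lambda>x. \<phi> s x - \<phi> t x)))" by (simp add: sum_nonneg)
  show "n2 (\<lambda>x. \<phi> s x - \<phi> t x) \<le> h s" "n2 (\<lambda>x. \<psi> s x - \<psi> t x) \<le> h s" unfolding hs using 0 by auto
  assume s: "0 \<le> s" and b: "b \<in> Basis"
  have "has_weak_partial UNIV b (\<lambda>x. \<phi> s x - \<phi> t x) (\<lambda>x. G b s x - G b t x)"
    using G s t b l2_phi by (intro has_weak_partial_diff) (auto simp: L2_UNIV)
  moreover have "(\<lambda>x. G b s x - G b t x) \<in> L2 UNIV" using G s t b by (intro L2_diff) (auto simp: L2_UNIV)
  ultimately have "n2 (\<lambda>x. G b s x - G b t x) = n2 (weak_partial UNIV b (\<lambda>x. \<phi> s x - \<phi> t x))"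
    using weak_partial_eq[of UNIV "\<lambda>x. G b s x - G b t x" b "\<lambda>x. \<phi> s x - \<phi> t x"] by simp
  also have "\<dots> \<le> (\<Sum>b\<in>Basis. n2 (weak_partial UNIV b (\<lambda>x. \<phi> s x - \<phi> t x)))"
    using b by (intro member_le_sum) auto
  also have "\<dots> \<le> h s" unfolding hs by simp
  finally show "n2 (\<lambda>x. G b s x - G b t x) \<le> h s" .
qed

lemma curve_cont: "l2cont \<phi>" "l2cont \<psi>" "b \<in> Basis \<Longrightarrow> l2cont (G b)"
proof -
  have ev: "\<forall>\<^sub>F s in at t within {0..}. P s" if "\<And>s. 0 \<le> s \<Longrightarrow> P s" for P and t :: real
    using eventually_nonneg_within by eventually_elim (rule that)
  show "l2cont \<phi>"
    by (intro l2contI l2lim_bound[OF _ _ _ curve_lim(1)] ev l2_phi curve_lim)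
  show "l2cont \<psi>"
    by (intro l2contI l2lim_bound[OF _ _ _ curve_lim(1)] ev l2_psi curve_lim)
  show "l2cont (G b)" if "b \<in> Basis"
    by (intro l2contI l2lim_bound[OF _ _ _ curve_lim(1)] ev G(1) curve_lim that)
qed

lemma bdd1: "0 \<le> t \<Longrightarrow> AE x in lborel. \<bar>\<phi> t x\<bar> \<le> 1"
  by (rule eventually_mono[OF norm_le(1)]) (use eps in auto)

text \<open>The test function y -> bump(x - y) turns each pairing in \<open>global_solution\<close>
  into the value at x of a convolution, and its Laplacian into the sum of the kernels
  \<open>bump2\<close>.\<close>

lemma wave: "wave \<phi> \<psi> (\<lambda>t x. f (\<phi> t x)) G"
proof
  show "l2cont \<phi>" "l2cont \<psi>" "\<And>b. b \<in> Basis \<Longrightarrow> l2cont (G b)" by (intro curve_cont; assumption)+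
  show "l2cont (\<lambda>t x. f (\<phi> t x))" by (intro comp_l2cont curve_cont bdd1)
next
  fix \<delta> t :: real and x :: "real^3" assume d: "0 < \<delta>" and t: "0 \<le> t"
  let ?\<eta> = "\<lambda>y. bump \<delta> (x - y)"
  have e: "?\<eta> \<in> test_functions UNIV" by (rule bump_test_function[OF d]) simp
  note eqs = sol[unfolded global_solution_def, THEN conjunct2, THEN conjunct2, rule_format, OF e t]
  show "((\<lambda>s. conv (\<phi> s) (bump \<delta>) x) has_real_derivative conv (\<psi> t) (bump \<delta>) x) (at t within {0..})"
    unfolding conv_def by (rule eqs[THEN conjunct1])
  have "(LINT y|lborel. \<phi> t y * laplacian ?\<eta> y) = conv (\<phi> t) (\<lambda>z. \<Sum>b\<in>Basis. bump2 \<delta> b z) x"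
    by (simp add: laplacian_bump conv_def)
  also have "\<dots> = (\<Sum>b\<in>Basis. conv (\<phi> t) (bump2 \<delta> b) x)"
    by (intro conv_sum_kernel ckernel_bump d l2_phi t) auto
  finally have lap: "(LINT y|lborel. \<phi> t y * laplacian ?\<eta> y) = (\<Sum>b\<in>Basis. conv (\<phi> t) (bump2 \<delta> b) x)" .
  have "((\<lambda>s. LINT x|lborel. \<psi> s x * ?\<eta> x) has_real_derivative
           (LINT x|lborel. \<phi> t x * laplacian ?\<eta> x) - (LINT x|lborel. f (\<phi> t x) * ?\<eta> x)) (at t within {0..})"
    by (rule eqs[THEN conjunct2, THEN conjunct2])
  thus "((\<lambda>s. conv (\<psi> s) (bump \<delta>) x) has_real_derivative
         (\<Sum>b\<in>Basis. conv (\<phi> t) (bump2 \<delta> b) x) - conv (\<lambda>x. f (\<phi> t x)) (bump \<delta>) x) (at t within {0..})"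
    unfolding lap unfolding conv_def .
  fix b :: "real^3" assume b: "b \<in> Basis"
  have "(LINT y:UNIV|lborel. \<phi> t y * partial b ?\<eta> y) = - (LINT y:UNIV|lborel. G b t y * ?\<eta> y)"
    using G(2)[OF t b] e unfolding has_weak_partial_def by blast
  thus "conv (\<phi> t) (bump1 \<delta> b) x = conv (G b t) (bump \<delta>) x"
    by (simp add: partial_bump conv_def set_lebesgue_integral_def)
qed

sublocale radial_wave \<phi> \<psi> G f m C L \<epsilon>
proof (intro radial_wave.intro wave nonlinearity_axioms radial_wave_axioms.intro norm_le rad)
  fix t :: real assume "0 \<le> t"
  note le = norm_le(2)[OF this]
  show "n2 (\<phi> t) \<le> \<epsilon>\<^sup>2" using le sum_nonneg[of Basis "\<lambda>b. n2 (G b t)"] by simp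
  show "(\<Sum>b\<in>Basis. n2 (G b t)) \<le> \<epsilon>\<^sup>2" using le n2_nonneg[of "\<phi> t"] by linarith
qed (use eps in auto)

lemma ball_norm_le: assumes t: "0 \<le> t"
  shows "(H1L2_norm (ball 0 R) (\<phi> t) (\<psi> t))\<^sup>2 \<le> (1 + R\<^sup>2)\<^sup>2 * local_energy t"
proof -
  have "n2 (\<lambda>x. indicator (ball 0 R) x * weak_partial (ball 0 R) b (\<phi> t) x) \<le> (1 + R\<^sup>2)\<^sup>2 * ip dec_weight (G b t) (G b t)"
    if b: "b \<in> Basis" for b
  proof -
    have "n2 (\<lambda>x. indicator (ball 0 R) x * weak_partial (ball 0 R) b (\<phi> t) x) = n2 (\<lambda>x. indicator (ball 0 R) x * G b t x)"
      by (rule weak_partial_eq[OF open_ball _ has_weak_partial_restrict[OF G(2)[OF t b]]])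
         (simp add: L2_iff l2_indicator_ball[OF G(1)[OF t b]])
    also have "\<dots> \<le> (1 + R\<^sup>2)\<^sup>2 * ip dec_weight (G b t) (G b t)" by (intro n2_ball_le G t b)
    finally show ?thesis .
  qed
  hence "(H1L2_norm (ball 0 R) (\<phi> t) (\<psi> t))\<^sup>2 \<le> (1 + R\<^sup>2)\<^sup>2 * ip dec_weight (\<phi> t) (\<phi> t)
     + (\<Sum>b\<in>Basis. (1 + R\<^sup>2)\<^sup>2 * ip dec_weight (G b t) (G b t)) + (1 + R\<^sup>2)\<^sup>2 * ip dec_weight (\<psi> t) (\<psi> t)"
    unfolding H1L2_norm_sq by (intro add_mono sum_mono n2_ball_le l2_phi l2_psi t)
  also have "\<dots> = (1 + R\<^sup>2)\<^sup>2 * local_energy t"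
  proof -
    have "c * x + c * y + c * z = c * (z + y + x)" for c x y z :: real by (simp add: algebra_simps)
    thus ?thesis unfolding local_energy_def sum_distrib_left[symmetric] .
  qed
  finally show ?thesis .
qed

lemma ball_norm_decay: "((\<lambda>t. H1L2_norm (ball 0 R) (\<phi> t) (\<psi> t)) \<longlongrightarrow> 0) at_top"
proof (rule tendsto_sandwich[OF _ _ tendsto_const])
  show "\<forall>\<^sub>F t in at_top. 0 \<le> H1L2_norm (ball 0 R) (\<phi> t) (\<psi> t)" by (simp add: H1L2_norm_def)
  show "\<forall>\<^sub>F t in at_top. H1L2_norm (ball 0 R) (\<phi> t) (\<psi> t) \<le> sqrt ((1 + R\<^sup>2)\<^sup>2 * local_energy t)"
    using eventually_ge_at_top[of 0] by eventually_elim (intro real_le_rsqrt ball_norm_le)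
  have "((\<lambda>t. (1 + R\<^sup>2)\<^sup>2 * local_energy t) \<longlongrightarrow> (1 + R\<^sup>2)\<^sup>2 * 0) at_top" by (intro tendsto_intros local_energy_decay)
  from tendsto_real_sqrt[OF this] show "((\<lambda>t. sqrt ((1 + R\<^sup>2)\<^sup>2 * local_energy t)) \<longlongrightarrow> 0) at_top" by simp
qed

end

section \<open>Lipschitz and cubic bounds for the derivatives of the potentials near zero\<close>

lemma bounded_near_zero: assumes "continuous_on UNIV (g :: real \<Rightarrow> real)" obtains B where "0 \<le> B" "\<And>s. \<bar>s\<bar> \<le> 1 \<Longrightarrow> \<bar>g s\<bar> \<le> B"
proof -
  have "compact (g ` {-1..1})" using assms by (intro compact_continuous_image continuous_on_subset[OF assms]) auto
  then obtain B where "\<And>y. y \<in> g ` {-1..1} \<Longrightarrow> norm y \<le> B" using compact_imp_bounded bounded_iff by metis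
  hence B: "\<bar>g s\<bar> \<le> B" if "\<bar>s\<bar> \<le> 1" for s using that imageI[of s "{-1..1}" g] by (force simp: abs_le_iff)
  moreover have "0 \<le> B" using B[of 0] by simp
  ultimately show ?thesis using that by blast
qed

lemma lipschitz_near_zero:
  assumes "\<And>s. (g has_real_derivative g' s) (at s)" "continuous_on UNIV g'"
  obtains K where "0 \<le> K" "\<And>s s'. \<bar>s\<bar> \<le> 1 \<Longrightarrow> \<bar>s'\<bar> \<le> 1 \<Longrightarrow> \<bar>g s - g s'\<bar> \<le> K * \<bar>s - s'\<bar>"
proof -
  obtain K where K: "0 \<le> K" "\<And>s. \<bar>s\<bar> \<le> 1 \<Longrightarrow> \<bar>g' s\<bar> \<le> K" using bounded_near_zero[OF assms(2)] by blast
  have "norm (g s - g s') \<le> K * norm (s - s')" if "\<bar>s\<bar> \<le> 1" "\<bar>s'\<bar> \<le> 1" for s s'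
    by (rule field_differentiable_bound[of "{-1..1}" g g'])
       (use that K assms(1) in \<open>auto intro: has_field_derivative_at_within\<close>)
  thus ?thesis using that K(1) by auto
qed

text \<open>For F = c h^k with h(0) = 0, the derivative contains h^(k-1); as k - 1 \<ge> 3 and
  |h(s)| \<le> K |s| near 0, it is O(s^3), with linear coefficient 0. Here h is 1 - exp(-s), tanh or
  the identity.\<close>

lemma nonlinearity_power:
  assumes h: "\<And>s. (h has_real_derivative h' s) (at s)" "\<And>s. (h' has_real_derivative h'' s) (at s)" "continuous_on UNIV h''" "h 0 = 0"
    and k: "4 \<le> k"
  shows "\<exists>m C L. nonlinearity (deriv (\<lambda>s. c * h s ^ k)) m C L"
proof -
  define f where "f s = c * (real k * (h s ^ (k - 1) * h' s))" for s
  have "((\<lambda>s. c * h s ^ k) has_real_derivative f s) (at s)" for s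
    unfolding f_def using DERIV_cmult[OF DERIV_power[OF h(1)], of c k s] by (simp add: mult_ac)
  hence f: "deriv (\<lambda>s. c * h s ^ k) = f" by (auto simp: fun_eq_iff intro: DERIV_imp_deriv)
  have ch: "continuous_on UNIV h" "continuous_on UNIV h'" 
    by (rule DERIV_continuous_on[OF has_field_derivative_at_within[OF h(1)]])
       (rule DERIV_continuous_on[OF has_field_derivative_at_within[OF h(2)]])
  define f' where "f' s = c * (real k * (real (k - 1) * (h' s * h s ^ (k - 1 - Suc 0)) * h' s + h'' s * h s ^ (k - 1)))" for s
  have df: "(f has_real_derivative f' s) (at s)" for s
    unfolding f_def f'_def by (rule DERIV_cmult DERIV_mult DERIV_power h)+
  have cf': "continuous_on UNIV f'" unfolding f'_def by (intro continuous_intros ch h)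
  obtain L where L: "0 \<le> L" "\<And>s s'. \<bar>s\<bar> \<le> 1 \<Longrightarrow> \<bar>s'\<bar> \<le> 1 \<Longrightarrow> \<bar>f s - f s'\<bar> \<le> L * \<bar>s - s'\<bar>"
    by (rule lipschitz_near_zero[OF df cf']) blast
  obtain K where K: "0 \<le> K" "\<And>s s'. \<bar>s\<bar> \<le> 1 \<Longrightarrow> \<bar>s'\<bar> \<le> 1 \<Longrightarrow> \<bar>h s - h s'\<bar> \<le> K * \<bar>s - s'\<bar>"
    by (rule lipschitz_near_zero[OF h(1) ch(2)]) blast
  have "continuous_on UNIV (\<lambda>s. c * (real k * (h s ^ (k - 4) * h' s)))" by (intro continuous_intros ch)
  then obtain B where B: "0 \<le> B" "\<And>s. \<bar>s\<bar> \<le> 1 \<Longrightarrow> \<bar>c * (real k * (h s ^ (k - 4) * h' s))\<bar> \<le> B" using bounded_near_zero by blast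
  have "nonlinearity f 0 (B * K ^ 3) L"
  proof
    show "f \<in> borel_measurable borel"
      by (rule borel_measurable_continuous_onI[OF DERIV_continuous_on[OF has_field_derivative_at_within[OF df]]])
    show "\<bar>f s - 0 * s\<bar> \<le> B * K ^ 3 * \<bar>s\<bar> ^ 3" if s: "\<bar>s\<bar> \<le> 1" for s
    proof -
      have e: "k - 1 = (k - 4) + 3" using k by simp
      have "h s ^ (k - 1) = h s ^ (k - 4) * h s ^ 3" by (subst e) (rule power_add)
      hence "f s = (c * (real k * (h s ^ (k - 4) * h' s))) * h s ^ 3" by (simp add: f_def)
      hence "\<bar>f s\<bar> = \<bar>c * (real k * (h s ^ (k - 4) * h' s))\<bar> * \<bar>h s\<bar> ^ 3" by (simp only: abs_mult power_abs)
      also have "\<dots> \<le> B * (K * \<bar>s\<bar>) ^ 3"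
        using B K(2)[of s 0] s h(4) by (intro mult_mono power_mono) auto
      finally show ?thesis by (simp add: power_mult_distrib mult.assoc)
    qed
  qed (use L B K in auto)
  thus ?thesis unfolding f by blast
qed

text \<open>The one potential of the list with a mass: sin s = s + O(s^3), so the linear coefficient
  is 1.\<close>

lemma nonlinearity_sin: "nonlinearity sin 1 1 1"
proof
  show "\<bar>sin s - sin s'\<bar> \<le> 1 * \<bar>s - s'\<bar>" for s s' :: real
    using field_differentiable_bound[of UNIV sin cos 1 s s'] by (auto simp: DERIV_sin abs_cos_le_one)
  show "\<bar>sin s - 1 * s\<bar> \<le> 1 * \<bar>s\<bar> ^ 3" for s :: real
  proof -
    have "(\<Sum>m<3. sin_coeff m * s ^ m) = s" by (simp add: eval_nat_numeral sin_coeff_def)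
    hence "\<bar>sin s - s\<bar> \<le> inverse (fact 3) * \<bar>s\<bar> ^ 3" using Maclaurin_sin_bound[of s 3] by simp
    also have "\<dots> \<le> 1 * \<bar>s\<bar> ^ 3" by (intro mult_right_mono) (auto simp: fact_numeral)
    finally show ?thesis by simp
  qed
qed auto

lemma potential_nonlinearity: assumes "F \<in> potentials" shows "\<exists>m C L. nonlinearity (deriv F) m C L"
proof -
  consider (F1) n where "F = F1 n" "2 \<le> n" | (F2) n where "F = F2 n" "2 \<le> n" | (F3) "F = F3_minus" | (F5) "F = F5_2"
    using assms by (auto simp: potentials_def)
  thus ?thesis
  proof cases
    case F1
    have "\<exists>m C L. nonlinearity (deriv (\<lambda>s. 1 * (1 - exp (- s)) ^ (2 * n))) m C L"
    proof (rule nonlinearity_power)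
      show "((\<lambda>s. 1 - exp (- s)) has_real_derivative exp (- s)) (at s)" for s by (auto intro!: derivative_eq_intros)
      show "((\<lambda>s. exp (- s)) has_real_derivative - exp (- s)) (at s)" for s :: real by (auto intro!: derivative_eq_intros)
    qed (use F1 in \<open>auto intro!: continuous_intros\<close>)
    thus ?thesis by (simp add: F1 F1_def[abs_def])
  next
    case F2
    have "\<exists>m C L. nonlinearity (deriv (\<lambda>s. 1 * tanh s ^ (2 * n))) m C L"
    proof (rule nonlinearity_power)
      show "(tanh has_real_derivative 1 - tanh s ^ 2) (at s)" for s :: real by (auto intro!: derivative_eq_intros)
      show "((\<lambda>s. 1 - tanh s ^ 2) has_real_derivative - (2 * tanh s * (1 - tanh s ^ 2))) (at s)" for s :: real
        by (auto intro!: derivative_eq_intros)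
      show "continuous_on UNIV (\<lambda>s::real. - (2 * tanh s * (1 - tanh s ^ 2)))" by (auto intro!: continuous_intros)
    qed (use F2 in auto)
    thus ?thesis by (simp add: F2 F2_def[abs_def])
  next
    case F3
    have "deriv F = sin"
      unfolding F3 F3_minus_def[abs_def] by (auto simp: fun_eq_iff intro!: DERIV_imp_deriv derivative_eq_intros)
    thus ?thesis using nonlinearity_sin by auto
  next
    case F5
    have "\<exists>m C L. nonlinearity (deriv (\<lambda>s. -1 * s ^ 4)) m C L"
      by (rule nonlinearity_power[where h'="\<lambda>_. 1" and h''="\<lambda>_. 0"]) auto
    thus ?thesis by (simp add: F5 F5_2_def[abs_def])
  qed
qed

theorem corollary3p5:
  fixes F :: "real \<Rightarrow> real"
  assumes "F \<in> potentials"
  shows "\<exists>\<epsilon>\<^sub>0>0. \<forall>\<epsilon>::real. 0 < \<epsilon> \<and> \<epsilon> \<le> \<epsilon>\<^sub>0 \<longrightarrow>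
           (\<forall>\<phi> \<psi> :: real \<Rightarrow> real^3 \<Rightarrow> real.
              global_solution (deriv F) \<phi> \<psi> \<and>
              radially_symmetric (\<phi> 0) \<and> radially_symmetric (\<psi> 0) \<and>
              (SUP t\<in>{0..}. H1_Linf_norm (\<phi> t)) \<le> ereal \<epsilon> \<longrightarrow>
              (\<forall>R>0. ((\<lambda>t. H1L2_norm (ball 0 R) (\<phi> t) (\<psi> t)) \<longlongrightarrow> 0) at_top))"
proof -
  obtain m C L where n: "nonlinearity (deriv F) m C L" using potential_nonlinearity[OF assms] by blast
  \<comment> \<open>For \<epsilon> \<le> 1 one has A \<epsilon>^2 \<le> (A + 1) \<epsilon>, so
    \<epsilon> \<le> sph / (10 (A + 1)) gives the smallness condition; A + 1 keeps the denominator
    positive when C = 0.\<close>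
  define A where "A = C * (18 + 12 * sph)"
  have A: "0 \<le> A" using nonlinearity.C_nonneg[OF n] sph_pos by (simp add: A_def)
  define \<epsilon>\<^sub>0 where "\<epsilon>\<^sub>0 = min 1 (sph / (10 * (A + 1)))"
  show ?thesis
  proof (intro exI[of _ \<epsilon>\<^sub>0] conjI allI impI)
    show "0 < \<epsilon>\<^sub>0" using A sph_pos by (simp add: \<epsilon>\<^sub>0_def)
    fix \<epsilon> R :: real and \<phi> \<psi> :: "real \<Rightarrow> real^3 \<Rightarrow> real"
    assume e: "0 < \<epsilon> \<and> \<epsilon> \<le> \<epsilon>\<^sub>0" and s: "global_solution (deriv F) \<phi> \<psi> \<and> radially_symmetric (\<phi> 0) \<and> radially_symmetric (\<psi> 0) \<and>
              (SUP t\<in>{0..}. H1_Linf_norm (\<phi> t)) \<le> ereal \<epsilon>"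
    have e1: "\<epsilon> \<le> 1" and e2: "\<epsilon> \<le> sph / (10 * (A + 1))" using e by (auto simp: \<epsilon>\<^sub>0_def)
    have "\<epsilon>\<^sup>2 \<le> \<epsilon>" using e e1 by (simp add: power2_eq_square mult_left_le)
    hence "A * \<epsilon>\<^sup>2 \<le> (A + 1) * \<epsilon>" using A e by (intro mult_mono) auto
    also have "\<dots> \<le> (A + 1) * (sph / (10 * (A + 1)))" using A e2 by (intro mult_left_mono) auto
    also have "\<dots> = sph / 10"
    proof -
      have "a * (s / (10 * a)) = s / 10" if "a \<noteq> 0" for a s :: real using that by simp
      from this[of "A + 1" sph] A show ?thesis by simp
    qed
    finally have "C * \<epsilon>\<^sup>2 * (18 + 12 * sph) \<le> sph / 10" by (simp add: A_def mult_ac)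
    then interpret small_solution "deriv F" m C L \<phi> \<psi> \<epsilon>
      using n s e e1 by (intro small_solution.intro small_solution_axioms.intro) auto
    show "((\<lambda>t. H1L2_norm (ball 0 R) (\<phi> t) (\<psi> t)) \<longlongrightarrow> 0) at_top" by (rule ball_norm_decay)
  qed
qed

end
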